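(* Let $u$ be an entire analytic function on $SG$. Then for every word $w$ and every $\ell\in\{0,1,2\}$, $u$ has on the cell $F_w(SG)$ a local power series expansion about $F_wq_\ell$, $$u(x)=\sum_{j=0}^\infty\Big(5^{-mj}c_{j1}P^{(\ell)}_{j1}(F_w^{-1}x)+\big(\tfrac35 5^{-j}\big)^mc_{j2}P^{(\ell)}_{j2}(F_w^{-1}x)+5^{-(j+1)m}c_{j3}P^{(\ell)}_{j3}(F_w^{-1}x)\Big),\qquad m=|w|,$$ with coefficients satisfying $|c_{jk}|=O(R^j)$ for some $R<\lambda_2$, $k=1,2,3$. Conversely, suppose $u$ is a function defined on $F_w(SG)$ given by a local power series expansion of this form (for some $\ell$) with coefficients satisfying $|c_{jk}|=O(R^j)$ for some $R<\lambda_2$, $k=1,2,3$. Then $u$ has a unique extension to an entire analytic function on $SG$.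
   Context: Let $q_0,q_1,q_2$ be the vertices of an equilateral triangle in the plane (indices mod 3), $F_i(x)=\frac12(x+q_i)$, and let $SG$ (Sierpinski gasket) be the unique nonempty compact set with $SG=\bigcup_{i=0}^2F_i(SG)$. For a word $w=(w_1,\dots,w_m)\in\{0,1,2\}^m$, $|w|=m$, put $F_w=F_{w_1}\circ\cdots\circ F_{w_m}$; $F_w(SG)$ is a cell of level $m$. $V_0=\{q_0,q_1,q_2\}$, $V_m=\bigcup_iF_i(V_{m-1})$, $V_*=\bigcup_mV_m$; for distinct $x,y\in V_m$, $x\sim_my$ means $x,y$ lie in a common cell of level $m$. Laplacian: $u\in\mathrm{dom}\,\Delta$ with $\Delta u=f$ means that $u,f$ are continuous on $SG$ and $\frac32 5^m\sum_{y\sim_mx}(u(y)-u(x))\to f(x)$ as $m\to\infty$, uniformly for $x\in V_*\setminus V_0$. Powers $\Delta^n$ are defined iteratively. Normal derivative: $\partial_nu(q_j)=\lim_{m\to\infty}(5/3)^m\big(2u(q_j)-u(F_j^mq_{j+1})-u(F_j^mq_{j-1})\big)$. Tangential derivative: $\partial_Tu(q_j)=\lim_{m\to\infty}5^m\big(u(F_j^mq_{j+1})-u(F_j^mq_{j-1})\big)$. $\mathcal H_j$ is the $(3j+3)$-dimensional space of solutions of $\Delta^{j+1}u=0$ on $SG$. The monomial $P^{(\ell)}_{jk}$ ($k=1,2,3$, $j\ge0$) is the unique function in $\mathcal H_j$ such that for all $0\le m\le j$: $\Delta^mP^{(\ell)}_{jk}(q_\ell)=\delta_{mj}\delta_{k1}$,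 $\partial_n\Delta^mP^{(\ell)}_{jk}(q_\ell)=\delta_{mj}\delta_{k2}$, $\partial_T\Delta^mP^{(\ell)}_{jk}(q_\ell)=\delta_{mj}\delta_{k3}$. A Neumann eigenvalue is a $\lambda$ for which there is a nonzero $u\in\mathrm{dom}\,\Delta$ with $-\Delta u=\lambda u$ and $\partial_nu(q_i)=0$ for $i=0,1,2$. $\lambda_2\approx135.572126995788$ denotes the second nonzero Neumann eigenvalue (distinct eigenvalues in increasing order, not counting multiplicity). An entire analytic function is a function on $SG$ given by a power series $\sum_{k=1}^3\sum_{j=0}^\infty c_{jk}P^{(\ell)}_{jk}(x)$ about a boundary point $q_\ell$ with $|c_{jk}|=O(R^j)$ for some $R<\lambda_2$, $k=1,2,3$. *)

theory Defs
  imports "HOL-Analysis.Analysis" "HOL-Library.Landau_Symbols" "HOL-Library.Numeral_Type"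
begin

text \<open>
  Vertices are indexed by the three-element type \<open>3\<close>, whose arithmetic is modulo 3.
  A real function on \<open>SG\<close> is represented by a function on the plane of which only the values
  on \<open>SG\<close> matter; where a function has to be determined uniquely it is taken in
  \<open>extensional SG\<close>.
\<close>

definition equilateral :: "(3 \<Rightarrow> real^2) \<Rightarrow> bool" where
  "equilateral q \<longleftrightarrow> (\<exists>s>0. \<forall>i j. i \<noteq> j \<longrightarrow> dist (q i) (q j) = s)"

definition F :: "(3 \<Rightarrow> real^2) \<Rightarrow> 3 \<Rightarrow> real^2 \<Rightarrow> real^2" where
  "F q i x = (1/2) *\<^sub>R (x + q i)"

primrec Fw :: "(3 \<Rightarrow> real^2) \<Rightarrow> 3 list \<Rightarrow> real^2 \<Rightarrow> real^2" where
  "Fw q [] = id"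
| "Fw q (i # w) = F q i \<circ> Fw q w"

definition SG :: "(3 \<Rightarrow> real^2) \<Rightarrow> (real^2) set" where
  "SG q = (THE K. K \<noteq> {} \<and> compact K \<and> K = (\<Union>i. F q i ` K))"

definition cell :: "(3 \<Rightarrow> real^2) \<Rightarrow> 3 list \<Rightarrow> (real^2) set" where
  "cell q w = Fw q w ` SG q"

primrec V :: "(3 \<Rightarrow> real^2) \<Rightarrow> nat \<Rightarrow> (real^2) set" where
  "V q 0 = range q"
| "V q (Suc m) = (\<Union>i. F q i ` V q m)"

definition adj :: "(3 \<Rightarrow> real^2) \<Rightarrow> nat \<Rightarrow> real^2 \<Rightarrow> real^2 \<Rightarrow> bool" where
  "adj q m x y \<longleftrightarrow> x \<in> V q m \<and> y \<in> V q m \<and> x \<noteq> y \<and>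
     (\<exists>w. length w = m \<and> x \<in> cell q w \<and> y \<in> cell q w)"

text \<open>
  The discrete Laplacian of level \<open>m\<close> makes sense at \<open>x\<close> only if \<open>x \<in> V q m\<close>, so uniform
  convergence on \<open>V\<^sub>* - V\<^sub>0\<close> means that the error on \<open>V q m - V q 0\<close> is eventually
  below any given bound. As the \<open>V q m\<close> increase with \<open>m\<close>, every point of \<open>V\<^sub>* - V\<^sub>0\<close>
  is covered for all large \<open>m\<close>.
\<close>
definition has_laplacian ::
    "(3 \<Rightarrow> real^2) \<Rightarrow> (real^2 \<Rightarrow> real) \<Rightarrow> (real^2 \<Rightarrow> real) \<Rightarrow> bool" where
  "has_laplacian q u f \<longleftrightarrow> continuous_on (SG q) u \<and> continuous_on (SG q) f \<and>
     (\<forall>\<epsilon>>0. \<forall>\<^sub>F m in sequentially. \<forall>x \<in> V q m - V q 0.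
        \<bar>3/2 * 5^m * (\<Sum>y | adj q m x y. u y - u x) - f x\<bar> < \<epsilon>)"

primrec has_laplacian_pow ::
    "(3 \<Rightarrow> real^2) \<Rightarrow> nat \<Rightarrow> (real^2 \<Rightarrow> real) \<Rightarrow> (real^2 \<Rightarrow> real) \<Rightarrow> bool" where
  "has_laplacian_pow q 0 u f \<longleftrightarrow> (\<forall>x\<in>SG q. f x = u x)"
| "has_laplacian_pow q (Suc n) u f \<longleftrightarrow>
     (\<exists>g. has_laplacian_pow q n u g \<and> has_laplacian q g f)"

definition has_normal_deriv ::
    "(3 \<Rightarrow> real^2) \<Rightarrow> (real^2 \<Rightarrow> real) \<Rightarrow> 3 \<Rightarrow> real \<Rightarrow> bool" where
  "has_normal_deriv q u j d \<longleftrightarrow>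
     (\<lambda>m. (5/3)^m * (2 * u (q j) - u ((F q j ^^ m) (q (j + 1))) - u ((F q j ^^ m) (q (j - 1)))))
       \<longlonglongrightarrow> d"

definition has_tangential_deriv ::
    "(3 \<Rightarrow> real^2) \<Rightarrow> (real^2 \<Rightarrow> real) \<Rightarrow> 3 \<Rightarrow> real \<Rightarrow> bool" where
  "has_tangential_deriv q u j d \<longleftrightarrow>
     (\<lambda>m. 5^m * (u ((F q j ^^ m) (q (j + 1))) - u ((F q j ^^ m) (q (j - 1))))) \<longlonglongrightarrow> d"

definition polyharmonic :: "(3 \<Rightarrow> real^2) \<Rightarrow> nat \<Rightarrow> (real^2 \<Rightarrow> real) set" where
  "polyharmonic q j = {u. has_laplacian_pow q (Suc j) u (\<lambda>_. 0)}"

definition monomial :: "(3 \<Rightarrow> real^2) \<Rightarrow> 3 \<Rightarrow> nat \<Rightarrow> nat \<Rightarrow> real^2 \<Rightarrow> real" where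
  "monomial q l j k = (THE P. P \<in> extensional (SG q) \<and> P \<in> polyharmonic q j \<and>
     (\<forall>m\<le>j. \<exists>g. has_laplacian_pow q m P g \<and>
        g (q l) = of_bool (m = j \<and> k = 1) \<and>
        has_normal_deriv q g l (of_bool (m = j \<and> k = 2)) \<and>
        has_tangential_deriv q g l (of_bool (m = j \<and> k = 3))))"

definition neumann_eigenvalue :: "(3 \<Rightarrow> real^2) \<Rightarrow> real \<Rightarrow> bool" where
  "neumann_eigenvalue q \<mu> \<longleftrightarrow>
     (\<exists>u. (\<exists>x\<in>SG q. u x \<noteq> 0) \<and> has_laplacian q u (\<lambda>x. - \<mu> * u x) \<and>
          (\<forall>i. has_normal_deriv q u i 0))"

definition lambda2 :: "(3 \<Rightarrow> real^2) \<Rightarrow> real" where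
  "lambda2 q = (THE \<mu>. neumann_eigenvalue q \<mu> \<and> \<mu> \<noteq> 0 \<and>
     card {\<nu>. neumann_eigenvalue q \<nu> \<and> \<nu> \<noteq> 0 \<and> \<nu> < \<mu>} = 1)"

text \<open>
  Positivity of \<open>R\<close> is implicit in a geometric bound; it has to be explicit here because
  \<open>O(\<lambda>j. R ^ j)\<close> only sees \<open>\<bar>R\<bar>\<close>.
\<close>
definition coeff_growth :: "(3 \<Rightarrow> real^2) \<Rightarrow> (nat \<Rightarrow> nat \<Rightarrow> real) \<Rightarrow> bool" where
  "coeff_growth q c \<longleftrightarrow>
     (\<exists>R. 0 < R \<and> R < lambda2 q \<and> (\<forall>k\<in>{1..3}. (\<lambda>j. c j k) \<in> O(\<lambda>j. R ^ j)))"

definition entire_analytic :: "(3 \<Rightarrow> real^2) \<Rightarrow> (real^2 \<Rightarrow> real) \<Rightarrow> bool" where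
  "entire_analytic q u \<longleftrightarrow> (\<exists>l c. coeff_growth q c \<and>
     (\<forall>x\<in>SG q. (\<forall>k\<in>{1..3}. summable (\<lambda>j. c j k * monomial q l j k x)) \<and>
        u x = (\<Sum>k=1..3. \<Sum>j. c j k * monomial q l j k x)))"

definition local_expansion ::
    "(3 \<Rightarrow> real^2) \<Rightarrow> 3 list \<Rightarrow> 3 \<Rightarrow> (nat \<Rightarrow> nat \<Rightarrow> real) \<Rightarrow> (real^2 \<Rightarrow> real) \<Rightarrow> bool" where
  "local_expansion q w l c u \<longleftrightarrow> (let m = length w in
     \<forall>x\<in>cell q w.
       (\<lambda>j. (1/5)^(m * j) * c j 1 * monomial q l j 1 (inv (Fw q w) x)
          + (3/5 * (1/5)^j)^m * c j 2 * monomial q l j 2 (inv (Fw q w) x)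
          + (1/5)^((j + 1) * m) * c j 3 * monomial q l j 3 (inv (Fw q w) x)) sums u x)"

end

theory Submission
  imports Defs "HOL-Complex_Analysis.Complex_Analysis"
begin

text \<open>
  The entire function \<open>psi\<close> with \<open>psi (5x) = psi x (5 + psi x)\<close> and \<open>psi' 0 = 2/3\<close> linearises spectral
  decimation: an eigenfunction \<open>\<Delta>u = \<mu>u\<close> restricts to an eigenfunction of the level-\<open>m\<close> graph Laplacian
  with eigenvalue \<open>psi (\<mu>/5\<^sup>m)\<close>, so it is obtained from its boundary values by explicit subdivision.
  For small \<open>\<mu>\<close> let \<open>f\<^sub>k\<close> be the eigenfunction with value, normal derivative or tangential derivative \<open>1\<close>
  at \<open>q\<^sub>l\<close> and the other two data \<open>0\<close>. Its Taylor coefficients in \<open>\<mu>\<close> are the monomials \<open>P\<^sub>j\<^sub>k\<close>. At every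
  point \<open>f\<^sub>k\<close> continues holomorphically to \<open>\<bar>\<mu>\<bar> < \<lambda>\<^sub>2\<close>, because the
  apparent poles of the subdivision rule cancel, and Cauchy's estimate gives \<open>\<bar>P\<^sub>j\<^sub>k\<bar> = O(r\<^sup>-\<^sup>j)\<close> for every \<open>r < \<lambda>\<^sub>2\<close>.
  Changing the centre \<open>l\<close> multiplies the \<open>f\<^sub>k\<close> by a matrix holomorphic in the same disc, hence the series with
  coefficients \<open>O(R\<^sup>j)\<close>, \<open>R < \<lambda>\<^sub>2\<close>, do not depend on the centre. Since \<open>P\<^sub>j\<^sub>k \<circ> F\<^sub>l\<close> is a multiple of
  \<open>P\<^sub>j\<^sub>k\<close>, restriction to a cell \<open>F\<^sub>l(SG)\<close> divides \<open>R\<close> by \<open>5\<close> and extension from it multiplies \<open>R\<close> by \<open>5\<close>,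
  and both claims follow by induction on the word, recentring at each step. Uniqueness holds because the
  coefficients are read off from the values near the centre.
\<close>

section \<open>The decimation functions\<close>

text \<open>Eigenvalues of -\<Delta> correspond to negative \<mu>. One subdivision step divides by
  \<open>(2 + p) * (5 + p)\<close> with \<open>p = psi (\<mu>/5)\<close>, and this vanishes at
  points well inside the disc of radius \<open>Lam\<close>. The cancellation is therefore exhibited
  by closed formulas for two levels; of the denominators that survive, only
  \<open>3 + tt \<mu>\<close> matters, and its zero at -\<open>Lam\<close> fixes the radius. From
  the third letter on the parameter is at most 150/125 = 6/5 in modulus, where \<bar>psi\<bar> \<le>
  21/25 keeps every denominator away from 0 and the estimates are uniform in the word. The radius 6,
  five times 6/5, exceeds \<open>z0\<close>. A second obstacle is that \<open>lambda2\<close> is a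
  description over all Neumann eigenvalues. Eigenfunctions for \<open>5 * z0\<close> and
  \<open>25 * z0\<close> have to be produced, and everything else below \<open>25 * z0\<close>
  excluded. An arbitrary eigenfunction is known only through limits; on sufficiently fine levels it
  is shown to be an exact graph eigenfunction, from where one can descend level by level.\<close>

text \<open>The recursions encode \<open>psi (5x) = psi x (5 + psi x)\<close> for \<open>psi x = 2/3 x hat x\<close>, and \<open>gam (5x) = gam x (1 + psi x / 3)\<close>.\<close>

fun hcoef :: "nat \<Rightarrow> real" where
  "hcoef 0 = 1"
| "hcoef (Suc n) = 2/15 / (5 ^ Suc n - 1) * (\<Sum>i\<in>{..n}. hcoef i * hcoef (n - i))"

fun gcoef :: "nat \<Rightarrow> real" where
  "gcoef 0 = 1"
| "gcoef (Suc n) = 2/9 / (5 ^ Suc n - 1) * (\<Sum>i\<in>{..n}. hcoef i * gcoef (n - i))"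

declare hcoef.simps(2) [simp del] gcoef.simps(2) [simp del]

definition powser :: "(nat \<Rightarrow> real) \<Rightarrow> 'a \<Rightarrow> 'a::{real_normed_field,banach}" where
  "powser a x = (\<Sum>n. of_real (a n) * x ^ n)"

lemma four_mult_Suc_le: "4 * (real n + 1) \<le> 5 ^ Suc n - 1"
  by (induction n) auto

text \<open>The convolution has k + 1 terms, each at most r^-k, while 5^(k+1) - 1 is at least 4(k +
  1); so the geometric bound is inherited as soon as c * r \<le> 4. For c = 2/15 and c = 2/9
  equality holds at r = 30 and r = 18.\<close>

lemma qdiff_coeff_step:
  fixes a b :: "nat \<Rightarrow> real"
  assumes rec: "a (Suc k) = c / (5 ^ Suc k - 1) * (\<Sum>i\<in>{..k}. b i * a (k - i))"
    and a: "\<And>i. i \<le> k \<Longrightarrow> \<bar>a i\<bar> \<le> 1 / r ^ i" and b: "\<And>i. i \<le> k \<Longrightarrow> \<bar>b i\<bar> \<le> 1 / r ^ i"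
    and r: "r > 0" and c: "c \<ge> 0" "c * r \<le> 4"
  shows "\<bar>a (Suc k)\<bar> \<le> 1 / r ^ Suc k"
proof -
  have "\<bar>\<Sum>i\<in>{..k}. b i * a (k - i)\<bar> \<le> (\<Sum>i\<in>{..k}. 1 / r ^ i * (1 / r ^ (k - i)))"
    unfolding abs_mult[symmetric]
  proof (intro order_trans[OF sum_abs] sum_mono)
    fix i assume "i \<in> {..k}"
    then show "\<bar>b i * a (k - i)\<bar> \<le> 1 / r ^ i * (1 / r ^ (k - i))"
      using mult_mono[OF b[of i] a[of "k - i"]] r by (simp only: abs_mult) simp
  qed
  also have "\<dots> = (\<Sum>i\<in>{..k}. 1 / r ^ k)"
    by (intro sum.cong) (auto simp flip: power_add)
  finally have S: "\<bar>\<Sum>i\<in>{..k}. b i * a (k - i)\<bar> \<le> (real k + 1) / r ^ k" by (simp add: add.commute)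
  have pos: "(5::real) ^ Suc k - 1 > 0" using one_less_power[of "5::real" "Suc k"] by simp
  have "\<bar>a (Suc k)\<bar> = c / (5 ^ Suc k - 1) * \<bar>\<Sum>i\<in>{..k}. b i * a (k - i)\<bar>"
    using rec pos c by (simp add: abs_mult)
  also have "\<dots> \<le> c / (5 ^ Suc k - 1) * ((real k + 1) / r ^ k)"
    using S pos c by (intro mult_left_mono) auto
  also have "\<dots> = (c * r) * (real k + 1) / (5 ^ Suc k - 1) * (1 / r ^ Suc k)"
    using r by (simp add: mult_ac)
  also have "\<dots> \<le> 1 * (1 / r ^ Suc k)"
  proof (intro mult_right_mono)
    have "(c * r) * (real k + 1) \<le> 4 * (real k + 1)" using c by (intro mult_right_mono) auto
    then show "(c * r) * (real k + 1) / (5 ^ Suc k - 1) \<le> 1"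
      using four_mult_Suc_le[of k] pos by (simp add: divide_le_eq)
  qed (use r in auto)
  finally show ?thesis by simp
qed

lemma hcoef_bound: "\<bar>hcoef n\<bar> \<le> 1 / 30 ^ n"
proof (induction n rule: less_induct)
  case (less n)
  show ?case
  proof (cases n)
    case (Suc k)
    show ?thesis unfolding Suc
      by (rule qdiff_coeff_step[where b = hcoef and c = "2/15"])
        (use less Suc in \<open>auto simp: hcoef.simps(2) simp del: power_Suc\<close>)
  qed auto
qed

lemma hcoef_bound18: "\<bar>hcoef n\<bar> \<le> 1 / 18 ^ n"
  by (rule order_trans[OF hcoef_bound]) (auto intro!: divide_left_mono power_mono)

lemma gcoef_bound: "\<bar>gcoef n\<bar> \<le> 1 / 18 ^ n"
proof (induction n rule: less_induct)
  case (less n)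
  show ?case
  proof (cases n)
    case (Suc k)
    show ?thesis unfolding Suc
      by (rule qdiff_coeff_step[where b = hcoef and c = "2/9"])
        (use less Suc hcoef_bound18 in \<open>auto simp: gcoef.simps(2) simp del: power_Suc\<close>)
  qed auto
qed

lemma powser_summable_norm:
  fixes x :: "'a::{real_normed_field,banach}"
  assumes "\<And>n. \<bar>a n\<bar> \<le> 1 / r ^ n" "norm x < r"
  shows "summable (\<lambda>n. norm (of_real (a n) * x ^ n))"
proof (rule summable_comparison_test_ev)
  have r: "r > 0" using assms(2) norm_ge_zero[of x] by linarith
  show "summable (\<lambda>n. (norm x / r) ^ n)" using assms(2) r by (intro summable_geometric) auto
  have "norm (norm (of_real (a n) * x ^ n)) \<le> (norm x / r) ^ n" for n
    using mult_right_mono[OF assms(1)[of n], of "norm x ^ n"] r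
    by (simp add: norm_mult norm_power power_divide)
  then show "\<forall>\<^sub>F n in sequentially. norm (norm (of_real (a n) * x ^ n)) \<le> (norm x / r) ^ n" by simp
qed

lemma powser_summable:
  fixes x :: "'a::{real_normed_field,banach}"
  assumes "\<And>n. \<bar>a n\<bar> \<le> 1 / r ^ n" "norm x < r"
  shows "summable (\<lambda>n. of_real (a n) * x ^ n)"
  using powser_summable_norm[OF assms] by (rule summable_norm_cancel)

text \<open>Passing from x to 5x multiplies the n-th coefficient by 5^n, so the difference of the
  two values has coefficients \<open>(5^n - 1) * a n\<close>; the recursion identifies them with
  those of \<open>c * x\<close> times a Cauchy product.\<close>

lemma powser_qdiff:
  fixes x :: "'a::{real_normed_field,banach}"
  assumes rec: "\<And>k. a (Suc k) = c / (5 ^ Suc k - 1) * (\<Sum>i\<in>{..k}. b i * a (k - i))"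
    and a: "\<And>n. \<bar>a n\<bar> \<le> 1 / r ^ n" and b: "\<And>n. \<bar>b n\<bar> \<le> 1 / r ^ n"
    and x: "5 * norm x < r"
  shows "powser a (5 * x) = powser a x * (1 + of_real c * x * powser b x)"
proof -
  have x': "norm x < r" using x norm_ge_zero[of x] by linarith
  have x5: "norm (5 * x) < r" using x by (simp add: norm_mult)
  have sA: "(\<lambda>n. of_real (a n) * x ^ n) sums powser a x"
    unfolding powser_def using powser_summable[OF a x'] by (rule summable_sums)
  have sA5: "(\<lambda>n. of_real (a n) * (5 * x) ^ n) sums powser a (5 * x)"
    unfolding powser_def using powser_summable[OF a x5] by (rule summable_sums)
  have P: "(\<lambda>k. \<Sum>i\<le>k. (of_real (b i) * x ^ i) * (of_real (a (k - i)) * x ^ (k - i)))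
      sums (powser b x * powser a x)"
    unfolding powser_def
    by (intro Cauchy_product_sums powser_summable_norm[OF a x'] powser_summable_norm[OF b x'])
  have eq: "of_real c * x * (\<Sum>i\<le>k. (of_real (b i) * x ^ i) * (of_real (a (k - i)) * x ^ (k - i)))
      = of_real (a (Suc k)) * (5 * x) ^ Suc k - of_real (a (Suc k)) * x ^ Suc k" for k
  proof -
    have ne: "(5::real) ^ Suc k - 1 \<noteq> 0" using one_less_power[of "5::real" "Suc k"] by simp
    have ac: "a (Suc k) * (5 ^ Suc k - 1) = c * (\<Sum>i\<in>{..k}. b i * a (k - i))"
      using rec[of k] ne by (simp add: field_simps)
    have "(\<Sum>i\<le>k. (of_real (b i) * x ^ i) * (of_real (a (k - i)) * x ^ (k - i)))
        = (\<Sum>i\<le>k. of_real (b i * a (k - i)) * x ^ k)"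
      by (intro sum.cong) (auto simp: power_add[symmetric] mult_ac)
    also have "\<dots> = of_real (\<Sum>i\<le>k. b i * a (k - i)) * x ^ k"
      by (simp add: sum_distrib_right)
    finally have "of_real c * x * (\<Sum>i\<le>k. (of_real (b i) * x ^ i) * (of_real (a (k - i)) * x ^ (k - i)))
        = of_real (c * (\<Sum>i\<in>{..k}. b i * a (k - i))) * x ^ Suc k" by (simp add: mult_ac)
    also have "\<dots> = of_real (a (Suc k)) * (5 ^ Suc k - 1) * x ^ Suc k"
      unfolding ac[symmetric] by simp
    finally show ?thesis by (simp add: power_mult_distrib algebra_simps)
  qed
  have L: "(\<lambda>k. of_real (a (Suc k)) * (5 * x) ^ Suc k - of_real (a (Suc k)) * x ^ Suc k)
      sums ((powser a (5 * x) - of_real (a 0)) - (powser a x - of_real (a 0)))"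
    using sA5 sA
    by (intro sums_diff iffD2[OF sums_Suc_iff[of "\<lambda>k. of_real (a k) * (5 * x) ^ k"]]
        iffD2[OF sums_Suc_iff[of "\<lambda>k. of_real (a k) * x ^ k"]]) simp_all
  have "(\<lambda>k. of_real (a (Suc k)) * (5 * x) ^ Suc k - of_real (a (Suc k)) * x ^ Suc k)
      sums (of_real c * x * (powser b x * powser a x))"
    using sums_mult[OF P, of "of_real c * x"] unfolding eq .
  with L have "powser a (5 * x) - powser a x = of_real c * x * (powser b x * powser a x)"
    using sums_unique2 by fastforce
  then show ?thesis by (simp add: algebra_simps)
qed

text \<open>Iterating the functional equations below presents \<open>hat x\<close> and
  \<open>gam x\<close>, for norm x \<le> 6, as the infinite products of
  \<open>1 + psi (x/5^n) / 5\<close> and \<open>1 + psi (x/5^n) / 3\<close> over n \<ge> 1. The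
  factors of \<open>hat\<close> govern how differences shrink towards a corner; \<open>gam\<close>
  supplies the denominator of the normal derivative germ.\<close>

definition hat :: "'a \<Rightarrow> 'a::{real_normed_field,banach}" where "hat = powser hcoef"
definition gam :: "'a \<Rightarrow> 'a::{real_normed_field,banach}" where "gam = powser gcoef"
definition psi :: "'a \<Rightarrow> 'a::{real_normed_field,banach}" where "psi x = 2/3 * x * hat x"

lemma powser_0 [simp]: "powser a 0 = of_real (a 0)"
  by (simp add: powser_def)

lemma hat_0 [simp]: "hat 0 = 1" and gam_0 [simp]: "gam 0 = 1" and psi_0 [simp]: "psi 0 = 0"
  by (simp_all add: hat_def gam_def psi_def)

lemma powser_of_real:
  assumes "\<And>n. \<bar>a n\<bar> \<le> 1 / r ^ n" "\<bar>x\<bar> < r"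
  shows "powser a (of_real x :: 'a::{real_normed_field,banach}) = of_real (powser a x)"
proof -
  have "summable (\<lambda>n. a n * x ^ n)" using powser_summable[OF assms(1), of x] assms(2) by simp
  then show ?thesis unfolding powser_def
    by (simp add: suminf_of_real)
qed

lemma psi_of_real: "\<bar>x\<bar> < 6 \<Longrightarrow> psi (of_real x :: 'a::{real_normed_field,banach}) = of_real (psi x)"
  using powser_of_real[OF hcoef_bound, of x, where 'a = 'a] by (simp add: psi_def hat_def)

lemma hat_5: "norm x < 6 \<Longrightarrow> hat (5 * x) = hat x * (1 + psi x / 5)"
  unfolding hat_def psi_def
  by (subst powser_qdiff[where c = "2/15" and b = hcoef and r = 30])
    (auto simp: hcoef.simps(2) hcoef_bound simp del: power_Suc)

lemma psi_5: "norm x < 6 \<Longrightarrow> psi (5 * x) = psi x * (5 + psi x)"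
  unfolding psi_def[of "5 * x"] hat_5 by (simp add: psi_def algebra_simps)

lemma gam_5: "norm x < 18/5 \<Longrightarrow> gam (5 * x) = gam x * (1 + psi x / 3)"
  unfolding gam_def psi_def hat_def
  by (subst powser_qdiff[where c = "2/9" and b = hcoef and r = 18])
    (auto simp: gcoef.simps(2) gcoef_bound hcoef_bound18 simp del: power_Suc)

text \<open>The series is dominated by a geometric one with ratio norm x / 30 \<le> 1/5; the
  constant is 1/30 * 5/4 = 1/24.\<close>

lemma hat_minus_1:
  fixes x :: "'a::{real_normed_field,banach}"
  assumes "norm x \<le> 6"
  shows "norm (hat x - 1) \<le> norm x / 24"
proof -
  have x': "norm x < 30" using assms by linarith
  let ?y = "norm x / 30"
  have y: "?y \<le> 1/5" "?y \<ge> 0" using assms by auto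
  have "(\<lambda>n. of_real (hcoef n) * x ^ n) sums hat x"
    unfolding powser_def hat_def using powser_summable[OF hcoef_bound x'] by (rule summable_sums)
  then have s: "(\<lambda>n. of_real (hcoef (Suc n)) * x ^ Suc n) sums (hat x - 1)"
    by (subst sums_Suc_iff) auto
  have g: "(\<lambda>n. ?y * ?y ^ n) sums (?y * (1 / (1 - ?y)))"
    using y by (intro sums_mult geometric_sums) auto
  have "norm (of_real (hcoef (Suc n)) * x ^ Suc n) \<le> ?y * ?y ^ n" for n
  proof -
    have "norm (of_real (hcoef (Suc n)) * x ^ Suc n) \<le> 1 / 30 ^ Suc n * norm x ^ Suc n"
      unfolding norm_mult norm_power norm_of_real by (intro mult_right_mono hcoef_bound) auto
    also have "\<dots> = ?y ^ Suc n" by (simp only: power_divide) simp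
    finally show ?thesis by (simp only: power_Suc)
  qed
  then have "norm (hat x - 1) \<le> ?y * (1 / (1 - ?y))"
    unfolding sums_unique[OF s] sums_unique[OF g] by (intro norm_suminf_le sums_summable[OF g])
  also have "\<dots> \<le> ?y * (1 / (1 - 1/5))"
    using y by (intro mult_left_mono divide_left_mono) auto
  finally show ?thesis by simp
qed

lemma psi_approx:
  assumes "norm x \<le> 6"
  shows "norm (psi x - 2/3 * x) \<le> (norm x)\<^sup>2 / 36"
proof -
  have "psi x - 2/3 * x = 2/3 * x * (hat x - 1)" by (simp add: psi_def algebra_simps)
  then have "norm (psi x - 2/3 * x) = 2/3 * norm x * norm (hat x - 1)"
    by (simp only: norm_mult norm_divide norm_numeral)
  also have "\<dots> \<le> 2/3 * norm x * (norm x / 24)"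
    using hat_minus_1[OF assms] by (intro mult_left_mono) auto
  finally show ?thesis by (simp add: power2_eq_square)
qed

lemma norm_psi_le:
  assumes "norm x \<le> 6"
  shows "norm (psi x) \<le> 2/3 * norm x + (norm x)\<^sup>2 / 36"
  using norm_triangle_sub[of "psi x" "2/3 * x"] psi_approx[OF assms] by (simp add: norm_mult norm_divide)

lemma norm_psi_le':
  assumes "norm x \<le> 6"
  shows "norm (psi x) \<le> norm x"
proof -
  have "(norm x)\<^sup>2 \<le> 6 * norm x" using assms by (simp add: power2_eq_square mult_right_mono)
  with norm_psi_le[OF assms] norm_ge_zero[of x] show ?thesis by linarith
qed

lemma norm_psi_mono:
  assumes "norm x \<le> r" "r \<le> 6"
  shows "norm (psi x) \<le> 2/3 * r + r\<^sup>2 / 36"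
proof -
  have "(norm x)\<^sup>2 \<le> r\<^sup>2" using assms by (intro power_mono) auto
  with norm_psi_le[of x] assms show ?thesis by linarith
qed

lemma norm_psi_lt_5:
  assumes "norm x < 6" shows "norm (psi x) < 5"
proof -
  have "(norm x)\<^sup>2 < 6\<^sup>2" using assms by (intro power_strict_mono) auto
  with norm_psi_le[of x] assms show ?thesis by simp
qed

text \<open>Here 21/25 = 2/3 * 6/5 + (6/5)^2 / 36. Being below 1, it keeps 2 + psi, 3 + psi, 5 + psi
  and 6 + psi away from 0.\<close>

lemma norm_psi_lt_1: "norm x \<le> 6/5 \<Longrightarrow> norm (psi x) \<le> 21/25"
  using norm_psi_mono[of x "6/5"] by (simp add: power2_eq_square)

lemma norm_psi_fifth: "norm x \<le> 6/25 \<Longrightarrow> norm (psi x) \<le> 1/5"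
  using norm_psi_mono[of x "6/25"] by (simp add: power2_eq_square)

section \<open>Nonvanishing and injectivity of the decimation functions\<close>

lemma add_ne_0_of_norm_less: "norm (x::'a::real_normed_field) < norm a \<Longrightarrow> a + x \<noteq> 0"
  by (metis add_eq_0_iff norm_minus_cancel order_less_irrefl)

lemma div5_le: "norm (x::'a::real_normed_field) \<le> 6 \<Longrightarrow> norm (x / 5) \<le> 6/5" by (simp add: norm_divide)

lemma psi_div5: "norm x \<le> 6 \<Longrightarrow> psi x = psi (x/5) * (5 + psi (x/5))"
  using psi_5[of "x/5"] by (simp add: norm_divide)
lemma hat_div5: "norm x \<le> 6 \<Longrightarrow> hat x = hat (x/5) * (1 + psi (x/5) / 5)"
  using hat_5[of "x/5"] by (simp add: norm_divide)
lemma gam_div5: "norm x \<le> 6 \<Longrightarrow> gam x = gam (x/5) * (1 + psi (x/5) / 3)"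
  using gam_5[of "x/5"] by (simp add: norm_divide)

lemma isCont_powser:
  fixes x :: "'a::{real_normed_field,banach}"
  assumes "\<And>n. \<bar>a n\<bar> \<le> 1 / r ^ n" "norm x < r"
  shows "isCont (powser a) x"
proof -
  have "norm x < (norm x + r) / 2" "(norm x + r)/2 < r" using assms(2) by auto
  moreover have "norm (of_real ((norm x + r)/2) :: 'a) = (norm x + r) / 2"
    using le_less_trans[OF norm_ge_zero assms(2)] unfolding norm_of_real by (intro abs_of_nonneg) (simp add: less_imp_le)
  ultimately show ?thesis unfolding powser_def[abs_def]
    by (intro isCont_powser[of _ "of_real ((norm x + r)/2)"] powser_summable[OF assms(1)]) auto
qed

lemma tendsto_div_5_power: "(\<lambda>n. x / 5 ^ n) \<longlonglongrightarrow> (0::'a::{real_normed_field})"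
  by (rule tendsto_norm_zero_cancel) (simp add: norm_divide norm_power LIMSEQ_divide_realpow_zero)

lemma powser_div_5_tendsto:
  fixes x :: "'a::{real_normed_field,banach}"
  assumes "\<And>n. \<bar>a n\<bar> \<le> 1 / r ^ n" "r > 0"
  shows "(\<lambda>n. powser a (x / 5 ^ n)) \<longlonglongrightarrow> of_real (a 0)"
  using isCont_tendsto_compose[OF isCont_powser[OF assms(1), of 0] tendsto_div_5_power] assms(2) by simp

lemma norm_div_pow5_le: "norm (x::'a::real_normed_field) \<le> r \<Longrightarrow> norm (x / 5 ^ n) \<le> r"
proof -
  assume "norm x \<le> r"
  have "norm x / 5 ^ n \<le> norm x / 1" by (intro divide_left_mono) auto
  with \<open>norm x \<le> r\<close> show ?thesis by (simp add: norm_divide norm_power)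
qed

lemma div_pow5_Suc: "x / 5 ^ n / 5 = x / (5::'a::field) ^ Suc n"
  by (simp add: mult.commute)

text \<open>A zero at x would be passed on to every x/5^n, because the factors of the product do not
  vanish, and by continuity to 0, where \<open>hat\<close> is 1. The same argument serves
  \<open>gam\<close>.\<close>

lemma hat_nonzero:
  fixes x :: "'a::{real_normed_field,banach}"
  assumes "norm x \<le> 6" shows "hat x \<noteq> 0"
proof
  assume 0: "hat x = 0"
  have "hat (x / 5 ^ n) = 0" for n
  proof (induction n)
    case (Suc n)
    have "norm (psi (x / 5 ^ Suc n)) \<le> 21/25"
      using div5_le[OF norm_div_pow5_le[OF assms, of n]] by (intro norm_psi_lt_1) (simp add: field_simps)
    then have "5 + psi (x / 5 ^ Suc n) \<noteq> 0" by (intro add_ne_0_of_norm_less) auto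
    then have "1 + psi (x / 5 ^ Suc n) / 5 \<noteq> 0" by (simp add: add_divide_eq_iff del: power_Suc)
    then show ?case using Suc hat_div5[OF norm_div_pow5_le[OF assms, of n]]
      unfolding div_pow5_Suc by (simp del: power_Suc)
  qed (use 0 in auto)
  then show False using powser_div_5_tendsto[OF hcoef_bound, of x] by (simp add: hat_def LIMSEQ_const_iff)
qed

lemma gam_nonzero:
  fixes x :: "'a::{real_normed_field,banach}"
  assumes "norm x \<le> 6" shows "gam x \<noteq> 0"
proof
  assume 0: "gam x = 0"
  have "gam (x / 5 ^ n) = 0" for n
  proof (induction n)
    case (Suc n)
    have "norm (psi (x / 5 ^ Suc n)) \<le> 21/25"
      using div5_le[OF norm_div_pow5_le[OF assms, of n]] by (intro norm_psi_lt_1) (simp add: field_simps)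
    then have "3 + psi (x / 5 ^ Suc n) \<noteq> 0" by (intro add_ne_0_of_norm_less) auto
    then have "1 + psi (x / 5 ^ Suc n) / 3 \<noteq> 0" by (simp add: add_divide_eq_iff del: power_Suc)
    then show ?case using Suc gam_div5[OF norm_div_pow5_le[OF assms, of n]]
      unfolding div_pow5_Suc by (simp del: power_Suc)
  qed (use 0 in auto)
  then show False using powser_div_5_tendsto[OF gcoef_bound, of x] by (simp add: gam_def LIMSEQ_const_iff)
qed

text \<open>From a(5 + a) = b(5 + b) and \<bar>a + b\<bar> < 5 follows a = b, so \<open>psi\<close>
  agrees at x/5^n and y/5^n for all n. There it equals 2/3 of the argument up to a quadratic error,
  which still tends to 0 after multiplication by 5^n.\<close>

lemma psi_inj:
  fixes x y :: "'a::{real_normed_field,banach}"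
  assumes "norm x \<le> 6/5" "norm y \<le> 6/5" "psi x = psi y"
  shows "x = y"
proof -
  have eq: "psi (x / 5 ^ n) = psi (y / 5 ^ n)" for n
  proof (induction n)
    case (Suc n)
    let ?a = "psi (x / 5 ^ Suc n)" and ?b = "psi (y / 5 ^ Suc n)"
    have "norm ?a \<le> 21/25" "norm ?b \<le> 21/25"
      using norm_div_pow5_le[OF assms(1)] norm_div_pow5_le[OF assms(2)] norm_psi_lt_1 by blast+
    then have "norm (?a + ?b) < norm (5::'a)" using norm_triangle_ineq[of ?a ?b] by simp
    then have "5 + (?a + ?b) \<noteq> 0" by (rule add_ne_0_of_norm_less)
    moreover have "?a * (5 + ?a) = ?b * (5 + ?b)"
      using Suc psi_div5[of "x / 5 ^ n"] psi_div5[of "y / 5 ^ n"]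
        norm_div_pow5_le[OF assms(1), of n] norm_div_pow5_le[OF assms(2), of n]
      by (simp add: field_simps)
    then have "(?a - ?b) * (5 + (?a + ?b)) = 0" by (simp add: algebra_simps)
    ultimately show ?case by simp
  qed (use assms in auto)
  have *: "norm (x - y) \<le> norm (of_real (6/50) / (5::'a) ^ n)" for n
  proof -
    have "norm (2/3 * ((x - y) / 5 ^ n)) = norm ((psi (y / 5 ^ n) - 2/3 * (y/5^n)) - (psi (x / 5 ^ n) - 2/3 * (x/5^n)))"
      unfolding eq by (simp add: algebra_simps diff_divide_distrib)
    also have "\<dots> \<le> (norm (y/5^n))\<^sup>2/36 + (norm (x/5^n))\<^sup>2/36"
      using norm_div_pow5_le[OF assms(1), of n] norm_div_pow5_le[OF assms(2), of n]
      by (intro order_trans[OF norm_triangle_ineq4] add_mono psi_approx) auto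
    also have "\<dots> \<le> ((6/5) / 5^n)\<^sup>2/36 + ((6/5) / 5^n)\<^sup>2/36"
      using assms(1,2)
      by (intro add_mono divide_right_mono power_mono) (simp_all only: norm_divide norm_power norm_numeral divide_right_mono zero_le_power zero_le_numeral norm_ge_zero divide_nonneg_nonneg)
    also have "norm (2/3 * ((x - y) / 5 ^ n)) = 2/3 * norm (x - y) / 5 ^ n"
      by (simp only: norm_mult norm_divide norm_power norm_numeral)
    also have "((6/5) / 5^n)\<^sup>2/36 + ((6/5) / 5^n)\<^sup>2/36 = 2/25 / 5 ^ n / (5 ^ n :: real)"
      by (simp add: power_divide power2_eq_square)
    finally have "2/3 * norm (x - y) / 5 ^ n \<le> 2/25 / 5 ^ n / 5 ^ n" .
    then have "2/3 * norm (x - y) \<le> 2/25 / 5 ^ n" by (simp add: field_simps)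
    then show ?thesis by (simp add: norm_divide norm_power)
  qed
  have "(\<lambda>n. norm (of_real (6/50) / (5::'a) ^ n)) \<longlonglongrightarrow> 0"
    using tendsto_norm[OF tendsto_div_5_power[of "of_real (6/50) :: 'a"]] by simp
  then have "norm (x - y) \<le> 0" using * by (intro LIMSEQ_le_const) auto
  then show ?thesis by simp
qed

lemma continuous_on_hat: "continuous_on {x. norm x < 30} (hat :: 'a \<Rightarrow> 'a::{real_normed_field,banach})"
  unfolding hat_def using isCont_powser[OF hcoef_bound]
  by (auto intro!: continuous_at_imp_continuous_on)

lemma continuous_on_psi: "continuous_on {x. norm x < 30} (psi :: 'a \<Rightarrow> 'a::{real_normed_field,banach})"
  unfolding psi_def by (intro continuous_intros continuous_on_hat)

text \<open>The approximation is too coarse at -6, but at -6/5 it places \<open>psi\<close> between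
  -21/25 and -19/25, and one application of the functional equation gives psi (-6) \<le> -19/25 * (5
  - 21/25) < -3.\<close>

lemma ex_psi_eq_minus_3: "\<exists>z. 0 < z \<and> z < 6 \<and> psi (-z) = (-3::real)"
proof -
  have "\<bar>psi (-6/5) - 2/3 * (-6/5 :: real)\<bar> \<le> 1/25"
    using psi_approx[of "-6/5::real"] by (simp add: power2_eq_square)
  then have b: "psi (-6/5 :: real) \<le> -19/25" "psi (-6/5 :: real) \<ge> -21/25" by linarith+
  have "psi (-6 :: real) = psi (-6/5) * (5 + psi (-6/5))" using psi_div5[of "-6::real"] by simp
  also have "\<dots> \<le> (-19/25) * (5 + psi (-6/5))" using b by (intro mult_right_mono) auto
  also have "\<dots> \<le> (-19/25) * (5 - 21/25)" using b by (intro mult_left_mono_neg) auto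
  finally have "psi (-6 :: real) < -3" by simp
  moreover have "continuous_on {-6..0} (psi :: real \<Rightarrow> real)"
    by (rule continuous_on_subset[OF continuous_on_psi]) auto
  ultimately obtain x :: real where x: "-6 \<le> x" "x \<le> 0" "psi x = -3"
    using IVT'[of psi "-6" "-3" "0::real"] by auto
  then have "x \<noteq> 0" "x \<noteq> -6" using \<open>psi (-6 :: real) < -3\<close> by auto
  then show ?thesis using x by (intro exI[of _ "-x"]) simp
qed

text \<open>\<open>5 z0\<close> and \<open>25 z0\<close> are the first two nonzero Neumann eigenvalues.\<close>

definition z0 :: real where "z0 = (SOME z. 0 < z \<and> z < 6 \<and> psi (-z) = (-3::real))"

lemma z0: "0 < z0" "z0 < 6" "psi (-z0) = -3"
  unfolding z0_def using someI_ex[OF ex_psi_eq_minus_3] by auto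

text \<open>One step down reduces the claim to the injectivity of \<open>psi\<close> on radius 6/5.
  Thus the point chosen for \<open>z0\<close> is determined, and there are no non-real solutions in
  the disc.\<close>

lemma psi_eq_minus_3:
  fixes x :: "'a::{real_normed_field,banach}"
  assumes "norm x \<le> 6" "psi x = -3"
  shows "x = - of_real z0"
proof -
  let ?y = "of_real (-z0) :: 'a"
  have ny: "norm ?y \<le> 6" using z0 by (simp del: of_real_minus)
  have py: "psi ?y = -3" using psi_of_real[of "-z0", where 'a='a] z0 by simp
  let ?a = "psi (x/5)" and ?b = "psi (?y/5)"
  have n5: "norm (x/5) \<le> 6/5" "norm (?y/5) \<le> 6/5" using assms ny by (auto simp: norm_divide)
  have "norm ?a \<le> 21/25" "norm ?b \<le> 21/25" using n5 norm_psi_lt_1 by blast+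
  then have "norm (?a + ?b) < norm (5::'a)" using norm_triangle_ineq[of ?a ?b] by simp
  then have "5 + (?a + ?b) \<noteq> 0" by (rule add_ne_0_of_norm_less)
  moreover have "?a * (5 + ?a) = ?b * (5 + ?b)"
    using assms py psi_div5[of x] psi_div5[of ?y] ny by simp
  then have "(?a - ?b) * (5 + (?a + ?b)) = 0" by (simp add: algebra_simps)
  ultimately have "?a = ?b" by simp
  then have "x / 5 = ?y / 5" using psi_inj n5 by blast
  then show ?thesis by simp
qed

lemma psi_ne_minus_3:
  fixes x :: "'a::{real_normed_field,banach}"
  assumes "norm x < z0" shows "3 + psi x \<noteq> 0"
proof
  assume "3 + psi x = 0"
  then have "psi x = -3" by (simp add: add_eq_0_iff)
  with psi_eq_minus_3[of x] assms z0 have "x = - of_real z0" by auto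
  then show False using assms z0 by auto
qed

text \<open>The common value at the two other corners of the eigenfunction with value 0, normal
  derivative 1 and tangential derivative 0 at the centre; -1/2 is the harmonic case. With
  \<open>p = psi (x/5)\<close> the factor \<open>1 + psi x / 6\<close> is (2 + p)(3 + p)/6, so it
  cancels the zero that \<open>1 + p/3\<close> would give to \<open>gam\<close>.\<close>

definition sgerm :: "'a \<Rightarrow> 'a::{real_normed_field,banach}" where
  "sgerm x = - (hat x * (1 + psi x / 6) / gam x) / 2"

lemma sgerm_0 [simp]: "sgerm 0 = - 1/2" by (simp add: sgerm_def)

text \<open>The fraction on the right is the effect of one subdivision step on corner values 0, y,
  y; the factor 3/5 is the scaling under which a normal derivative persists.\<close>

lemma sgerm_div5:
  fixes x :: "'a::{real_normed_field,banach}"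
  assumes "norm x \<le> 6" and p: "p = psi (x/5)"
  shows "sgerm (x/5) * 3/5 = sgerm x * (6 + p) / ((2 + p) * (5 + p))"
proof -
  have n5: "norm (x/5) \<le> 6/5" using assms by (auto simp: norm_divide)
  have "norm p \<le> 21/25" using norm_psi_lt_1[OF n5] p by simp
  then have ne: "2 + p \<noteq> 0" "3 + p \<noteq> 0" "5 + p \<noteq> 0" "6 + p \<noteq> 0"
    by (auto intro!: add_ne_0_of_norm_less)
  have g: "gam (x/5) \<noteq> 0" using gam_nonzero[of "x/5"] n5 by auto
  have e: "1 + p / 5 = (5 + p) / 5" "1 + p / 3 = (3 + p) / 3" "1 + p / 6 = (6 + p) / 6"
    "1 + p * (5 + p) / 6 = (2 + p) * (3 + p) / 6"
    by (simp_all add: field_simps)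
  have "sgerm x = - (hat (x/5) * ((5 + p) * (2 + p)) / gam (x/5)) / 20"
    unfolding sgerm_def psi_div5[OF assms(1)] hat_div5[OF assms(1)] gam_div5[OF assms(1)] p[symmetric] e
  proof -
    have "- (h * (b/5) * (a * c / 6) / (g * (c/3))) / 2 = - (h * (b * a) / g) / 20"
      if "c \<noteq> 0" for a b c g h :: 'a
      using that by (simp add: field_simps)
    then show "- (hat (x/5) * ((5 + p)/5) * ((2 + p) * (3 + p) / 6) / (gam (x/5) * ((3 + p)/3))) / 2
        = - (hat (x/5) * ((5 + p) * (2 + p)) / gam (x/5)) / 20" using ne by blast
  qed
  moreover have "sgerm (x/5) = - (hat (x/5) * (6 + p) / gam (x/5)) / 12"
    unfolding sgerm_def p[symmetric] e by simp
  moreover have "- (h * c / g) / 12 * 3/5 = - (h * (b * a) / g) / 20 * c / (a * b)"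
    if "a \<noteq> 0" "b \<noteq> 0" for a b c g h :: 'a
    using that by (simp add: field_simps)
  ultimately show ?thesis using ne by metis
qed

lemma sgerm_nonzero:
  assumes "norm x < 6" shows "sgerm x \<noteq> 0"
proof -
  have "6 + psi x \<noteq> 0" using norm_psi_lt_5[OF assms] by (intro add_ne_0_of_norm_less) auto
  then have "1 + psi x / 6 \<noteq> 0" by (simp add: add_divide_eq_iff)
  then show ?thesis using hat_nonzero[of x] gam_nonzero[of x] assms by (simp add: sgerm_def)
qed

lemma powser_holomorphic:
  assumes "\<And>n. \<bar>a n\<bar> \<le> 1 / r ^ n"
  shows "powser a holomorphic_on ball 0 r"
proof (rule power_series_holomorphic)
  fix w :: complex assume "w \<in> ball 0 r"
  then show "(\<lambda>n. of_real (a n) * (w - 0) ^ n) sums powser a w"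
    unfolding powser_def using powser_summable[OF assms, of w] by (auto intro: summable_sums)
qed

lemma hat_holomorphic: "hat holomorphic_on ball (0::complex) 6"
  unfolding hat_def by (rule holomorphic_on_subset[OF powser_holomorphic[OF hcoef_bound]]) auto

lemma gam_holomorphic: "gam holomorphic_on ball (0::complex) 6"
  unfolding gam_def by (rule holomorphic_on_subset[OF powser_holomorphic[OF gcoef_bound]]) auto

lemma psi_holomorphic: "psi holomorphic_on ball (0::complex) 6"
  unfolding psi_def[abs_def] by (intro holomorphic_intros hat_holomorphic)

lemma sgerm_holomorphic: "sgerm holomorphic_on ball (0::complex) 6"
  unfolding sgerm_def[abs_def]
  by (intro holomorphic_intros hat_holomorphic psi_holomorphic gam_holomorphic)
    (auto simp: gam_nonzero)

section \<open>Eigenfunctions on words\<close>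

lemma three_ne [simp]: "(l::3) + 1 \<noteq> l" "l - 1 \<noteq> l" "l + 1 \<noteq> l - 1" "l - 1 \<noteq> l + 1" "l \<noteq> l + 1" "l \<noteq> l - 1"
  using exhaust_3[of l] by auto

lemma three_cases: obtains "j = l" | "j = l + 1" | "j = l - (1::3)"
  using exhaust_3[of l] exhaust_3[of j] by auto

lemma three_third: "j \<noteq> i \<Longrightarrow> \<exists>k. distinct [i, j, k::3]"
  using three_cases[of j i] three_ne by (metis distinct_length_2_or_more distinct_singleton)

lemma three_pair_cases:
  assumes "a \<noteq> (l::3)" obtains "a = l + 1" | "a = l - 1"
  using assms three_cases[of a l] by metis

definition tot :: "(3 \<Rightarrow> 'a) \<Rightarrow> 'a::comm_ring_1" where "tot X = (\<Sum>c\<in>UNIV. X c)"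

lemma UNIV_three: "UNIV = {l, l + 1, l - (1::3)}"
  using three_cases[of _ l] by blast

lemma tot_eq: "tot X = X l + X (l + 1) + X (l - 1)"
  unfolding tot_def UNIV_three[of l] by simp

lemma tot_eq': "distinct [a, b, c] \<Longrightarrow> tot X = X a + X b + X (c::3)"
  by (rule three_cases[of b a]; rule three_cases[of c a]) (auto simp: tot_eq[of X a])

text \<open>
  Given the values \<open>X\<close> at the corners of a cell, \<open>sub p i X\<close> are the values at the corners of its \<open>i\<close>th
  subcell for the extension solving the graph eigenvalue equation with eigenvalue \<open>p\<close> at the three midpoints
  (junk for \<open>p = -2\<close> and \<open>p = -5\<close>). The value \<open>flux p X i\<close> is one cell's share of that equation at a corner:
  the equation at a junction point says that the fluxes of the two adjacent cells cancel.
\<close>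

definition sub :: "'a \<Rightarrow> 3 \<Rightarrow> (3 \<Rightarrow> 'a) \<Rightarrow> 3 \<Rightarrow> 'a::field" where
  "sub p i X j = (if j = i then X i else ((2 + p) * (X i + X j) + 2 * tot X) / ((2 + p) * (5 + p)))"

definition flux :: "'a \<Rightarrow> (3 \<Rightarrow> 'a) \<Rightarrow> 3 \<Rightarrow> 'a::field" where
  "flux p X i = tot X - (3 + p/2) * X i"

definition dif :: "(3 \<Rightarrow> 'a) \<Rightarrow> 3 \<Rightarrow> 'a::comm_ring_1" where
  "dif X i = X (i + 1) - X (i - 1)"

lemma sub_self [simp]: "sub p i X i = X i" by (simp add: sub_def)

lemma sub_commute: "sub p a X b = sub p b X a"
  by (simp add: sub_def add.commute)

lemma tot_sub:
  "tot (sub p i X) = X i + ((2 + p) * (X i + tot X) + 4 * tot X) / ((2 + p) * (5 + p))"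
  unfolding tot_eq[of "sub p i X" i] sub_def
  by (simp add: tot_eq[of X i] flip: add_divide_distrib) (simp add: algebra_simps)

text \<open>Spectral decimation at an old corner: eigenvalue p on the fine graph becomes p(5 + p) on
  the coarse one, and the fluxes are proportional. The factor is the one in the scaling of
  \<open>sgerm\<close>.\<close>

lemma flux_sub_self:
  fixes p :: "'a::field_char_0"
  assumes "2 + p \<noteq> 0" "5 + p \<noteq> 0"
  shows "flux p (sub p i X) i = (6 + p) / ((2 + p) * (5 + p)) * flux (p * (5 + p)) X i"
proof -
  have *: "(a + N / d - c * a) * d = a * d + N - c * a * d" if "d \<noteq> 0" for a N d c :: 'a
    using that by (simp add: left_diff_distrib distrib_right)
  have "(a + ((2 + p) * (a + t) + 4 * t) / ((2 + p) * (5 + p)) - (3 + p/2) * a) * ((2 + p) * (5 + p))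
    = (6 + p) * (t - (3 + p * (5 + p)/2) * a)" for a t
    unfolding *[OF no_zero_divisors[OF assms]] by (simp add: field_simps)
  then show ?thesis
    using assms unfolding flux_def tot_sub sub_self by (simp add: nonzero_eq_divide_eq)
qed

text \<open>The eigenvalue equation at the midpoint created by this step, shared by the subcells a
  and b; the formula for \<open>sub\<close> is its solution.\<close>

lemma flux_birth:
  fixes p :: "'a::field_char_0"
  assumes "2 + p \<noteq> 0" "5 + p \<noteq> 0" "a \<noteq> b"
  shows "flux p (sub p a X) b + flux p (sub p b X) a = 0"
proof -
  define d where "d = (2 + p) * (5 + p)"
  have d: "d \<noteq> 0" using assms by (simp add: d_def)
  let ?t = "tot X" and ?y = "((2 + p) * (X a + X b) + 2 * tot X) / d"
  have y: "sub p a X b = ?y" "sub p b X a = ?y" using assms by (auto simp: sub_def d_def add.commute)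
  have "(X a + ((2 + p) * (X a + ?t) + 4 * ?t) / d - (3 + p/2) * ?y
      + (X b + ((2 + p) * (X b + ?t) + 4 * ?t) / d - (3 + p/2) * ?y)) * d
     = d * (X a + X b) + (2 + p) * (X a + X b) + (12 + 2 * p) * ?t - (6 + p) * ((2 + p) * (X a + X b) + 2 * ?t)"
  proof -
    have "(x + N / d - c * (M / d) + (y + K / d - c * (M / d))) * d = x * d + N + y * d + K - 2 * c * M"
      for x y N M K c :: 'a
      using d by (simp add: left_diff_distrib distrib_right)
    note g = this
    show ?thesis unfolding g by (simp add: algebra_simps)
  qed
  also have "\<dots> = 0" by (simp add: d_def algebra_simps)
  finally show ?thesis using d unfolding flux_def tot_sub y d_def[symmetric] by simp
qed

lemma dif_sub_self:
  fixes p :: "'a::field_char_0"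
  assumes "2 + p \<noteq> 0"
  shows "dif (sub p i X) i = dif X i / (5 + p)"
proof -
  have "dif (sub p i X) i = ((2 + p) * dif X i) / ((2 + p) * (5 + p))"
    by (simp add: dif_def sub_def algebra_simps flip: diff_divide_distrib)
  then show ?thesis using assms by simp
qed

lemma sub_cmult: "sub p i (\<lambda>j. c * X j) j = c * sub p i X j"
  by (simp add: sub_def tot_def sum_distrib_left algebra_simps flip: sum_distrib_left)

lemma sub_add: "sub p i (\<lambda>j. X j + Y j) j = sub p i X j + sub p i Y j"
  by (simp add: sub_def tot_def sum.distrib algebra_simps add_divide_distrib)

text \<open>The entry \<open>E \<mu> X w j\<close> is the value at \<open>F\<^sub>w q\<^sub>j\<close> of the solution of \<open>\<Delta>u = \<mu> u\<close> with boundary values \<open>X\<close>.\<close>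

primrec E :: "'a \<Rightarrow> (3 \<Rightarrow> 'a) \<Rightarrow> 3 list \<Rightarrow> 3 \<Rightarrow> 'a::{real_normed_field,banach}" where
  "E \<mu> X [] = X"
| "E \<mu> X (i # w) = (\<lambda>j. E (\<mu>/5) (sub (psi (\<mu>/5)) i X) w j)"

lemma E_append: "E \<mu> X (u @ v) = E (\<mu> / 5 ^ length u) (E \<mu> X u) v"
  by (induction u arbitrary: \<mu> X) (auto simp: mult.commute)

lemma E_cmult: "E \<mu> (\<lambda>j. c * X j) w = (\<lambda>j. c * E \<mu> X w j)"
  by (induction w arbitrary: \<mu> X) (auto simp: sub_cmult[abs_def])

lemma E_add: "E \<mu> (\<lambda>j. X j + Y j) w = (\<lambda>j. E \<mu> X w j + E \<mu> Y w j)"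
  by (induction w arbitrary: \<mu> X Y) (auto simp: sub_add[abs_def])

text \<open>Conditions on the first step only: norm \<mu> < 30 makes the functional equation
  available at \<mu>/5, and all later parameters have modulus at most 6/5. The range beyond 6 is
  needed for the parameter \<open>- 5 * z0\<close>.\<close>

definition regular :: "'a::{real_normed_field,banach} \<Rightarrow> bool" where
  "regular \<mu> \<longleftrightarrow> norm \<mu> < 30 \<and> 2 + psi (\<mu>/5) \<noteq> 0 \<and> 5 + psi (\<mu>/5) \<noteq> 0"

lemma regular_small: "norm \<mu> \<le> 6 \<Longrightarrow> regular \<mu>"
  using norm_psi_lt_1[of "\<mu>/5"] unfolding regular_def
  by (auto simp: norm_divide intro!: add_ne_0_of_norm_less)

lemma regular_div5: "regular \<mu> \<Longrightarrow> regular (\<mu>/5)"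
  by (rule regular_small) (auto simp: regular_def norm_divide)

lemma regular_psi: "regular \<mu> \<Longrightarrow> psi \<mu> = psi (\<mu>/5) * (5 + psi (\<mu>/5))"
  using psi_5[of "\<mu>/5"] by (simp add: regular_def norm_divide)

lemma E_self: "E \<mu> X (replicate k i) i = X i"
  by (induction k arbitrary: \<mu> X) auto

primrec rfac :: "'a \<Rightarrow> nat \<Rightarrow> 'a::{real_normed_field,banach}" where
  "rfac \<mu> 0 = 1"
| "rfac \<mu> (Suc k) = (6 + psi (\<mu>/5)) / ((2 + psi (\<mu>/5)) * (5 + psi (\<mu>/5))) * rfac (\<mu>/5) k"

lemma flux_replicate:
  assumes "regular \<mu>"
  shows "flux (psi (\<mu> / 5 ^ k)) (E \<mu> X (replicate k i)) i = rfac \<mu> k * flux (psi \<mu>) X i"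
  using assms
proof (induction k arbitrary: \<mu> X)
  case (Suc k)
  have "flux (psi (\<mu> / 5 ^ Suc k)) (E \<mu> X (replicate (Suc k) i)) i
      = rfac (\<mu>/5) k * flux (psi (\<mu>/5)) (sub (psi (\<mu>/5)) i X) i"
    using Suc.IH[OF regular_div5[OF Suc.prems]] by simp
  also have "flux (psi (\<mu>/5)) (sub (psi (\<mu>/5)) i X) i
      = (6 + psi (\<mu>/5)) / ((2 + psi (\<mu>/5)) * (5 + psi (\<mu>/5))) * flux (psi \<mu>) X i"
    using Suc.prems regular_psi[of \<mu>] by (subst flux_sub_self) (auto simp: regular_def)
  finally show ?case by simp
qed auto

text \<open>The flux factors telescope against \<open>sgerm\<close>. Hence fluxes towards a corner
  decay like (3/5)^k times a convergent quotient.\<close>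

lemma rfac_sgerm:
  assumes "norm \<mu> \<le> 6"
  shows "(3/5) ^ k * sgerm (\<mu> / 5 ^ k) = rfac \<mu> k * sgerm \<mu>"
  using assms
proof (induction k arbitrary: \<mu>)
  case (Suc k)
  have "norm (\<mu>/5) \<le> 6" using Suc.prems norm_ge_zero[of \<mu>] by (simp add: norm_divide)
  from Suc.IH[OF this] have "(3/5) ^ Suc k * sgerm (\<mu> / 5 ^ Suc k) = rfac (\<mu>/5) k * (sgerm (\<mu>/5) * 3/5)"
    by simp
  also have "\<dots> = rfac \<mu> (Suc k) * sgerm \<mu>"
    unfolding sgerm_div5[OF Suc.prems refl] by simp
  finally show ?case .
qed auto

text \<open>The two fluxes cancel when the point is born, and every further step multiplies both by
  the same factor, so they cancel on all finer levels.\<close>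

lemma E_flux_junction:
  assumes "regular \<mu>" "a \<noteq> b"
  shows "flux (psi (\<mu> / 5 ^ (length s + Suc k))) (E \<mu> X (s @ a # replicate k b)) b
       + flux (psi (\<mu> / 5 ^ (length s + Suc k))) (E \<mu> X (s @ b # replicate k a)) a = 0"
  using assms
proof (induction s arbitrary: \<mu> X)
  case Nil
  let ?p = "psi (\<mu>/5)"
  have eq: "\<mu> / 5 ^ (length ([] :: 3 list) + Suc k) = (\<mu>/5) / 5 ^ k" by simp
  show ?case
    unfolding eq append_Nil E.simps flux_replicate[OF regular_div5[OF Nil(1)]] distrib_left[symmetric]
    using flux_birth[of ?p a b X] Nil by (simp add: regular_def)
next
  case (Cons c s)
  have "\<mu> / 5 ^ (length (c # s) + Suc k) = (\<mu>/5) / 5 ^ (length s + Suc k)" by simp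
  then show ?case using Cons.IH[OF regular_div5[OF Cons.prems(1)] assms(2)] by simp
qed

section \<open>Bounds uniform over words\<close>

lemma norm_add_ge: "norm (x::'a::real_normed_field) \<le> e \<Longrightarrow> norm a - e \<le> norm (a + x)"
  using norm_triangle_ineq2[of a "-x"] by simp

text \<open>For p = 0 the rule is an average with weights 2/5, 2/5, 1/5 and does not increase the
  norm; a nonzero p costs a factor 1 + 3\<bar>p\<bar>, and since p decays geometrically along a word
  these factors have a bounded product.\<close>

lemma sub_bound:
  fixes p :: "'a::real_normed_field"
  assumes B: "\<And>j. norm (X j) \<le> B" and p: "norm p \<le> x" "x \<le> 1/5"
  shows "norm (sub p i X j) \<le> (1 + 3 * x) * B"
proof (cases "j = i")
  case True
  have "0 \<le> B" "0 \<le> x" using B[of 0] p norm_ge_zero order_trans by blast+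
  then have "1 * B \<le> (1 + 3 * x) * B" by (intro mult_right_mono) auto
  then show ?thesis using True B[of i] by simp
next
  case False
  then obtain k where d: "distinct [i, j, k]"
    using three_third by blast
  have B0: "0 \<le> B" "0 \<le> x" using B[of 0] p norm_ge_zero order_trans by blast+
  have n: "(2 + p) * (X i + X j) + 2 * tot X = (4 + p) * (X i + X j) + 2 * X k"
    unfolding tot_eq'[OF d] by (simp add: algebra_simps)
  have "norm ((4 + p) * (X i + X j) + 2 * X k) \<le> (4 + x) * (B + B) + 2 * B"
  proof -
    have "norm (4 + p) \<le> 4 + x" "norm (X i + X j) \<le> B + B"
      using p norm_triangle_ineq[of 4 p] norm_triangle_ineq[of "X i" "X j"] B[of i] B[of j] by auto
    then show ?thesis
      using B[of k] B0 by (intro norm_triangle_le add_mono) (auto simp: norm_mult intro!: mult_mono)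
  qed
  moreover have den: "(2 - x) * (5 - x) \<le> norm ((2 + p) * (5 + p))"
    using p norm_add_ge[of p x 2] norm_add_ge[of p x 5] unfolding norm_mult by (intro mult_mono) auto
  moreover have pos: "(2 - x) * (5 - x) > 0" using p by simp
  ultimately have "norm (sub p i X j) \<le> ((4 + x) * (B + B) + 2 * B) / ((2 - x) * (5 - x))"
    using False n B0 unfolding sub_def by (simp add: norm_divide frac_le)
  also have "\<dots> \<le> (1 + 3 * x) * B"
  proof -
    have "(10 + 2 * x) \<le> (1 + 3 * x) * ((2 - x) * (5 - x))"
    proof -
      have "(1 + 3 * x) * ((2 - x) * (5 - x)) - (10 + 2 * x) = x * (21 - 20 * x) + 3 * x * x * x" by (simp add: algebra_simps)
      moreover have "x * (21 - 20 * x) \<ge> 0" "3 * x * x * x \<ge> 0" using B0 p by auto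
      ultimately show ?thesis by linarith
    qed
    then have "(10 + 2 * x) * B \<le> (1 + 3 * x) * ((2 - x) * (5 - x)) * B" using B0 by (intro mult_right_mono)
    then show ?thesis using pos by (simp add: divide_le_eq algebra_simps)
  qed
  finally show ?thesis .
qed

text \<open>The harmonic rule contracts oscillation by 3/5; relaxing this to 4/5 leaves room for
  \<bar>p\<bar> \<le> 1/5, and the term x * B accounts for constants not being preserved when p is
  not 0.\<close>

lemma sub_osc:
  fixes p :: "'a::real_normed_field"
  assumes B: "\<And>j. norm (X j) \<le> B" and D: "\<And>j k. norm (X j - X k) \<le> D"
    and p: "norm p \<le> x" "x \<le> 1/5"
  shows "norm (sub p i X j - sub p i X k) \<le> 4/5 * D + x * B"
proof -
  have B0: "0 \<le> B" "0 \<le> D" "0 \<le> x"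
    using B[of 0] D[of 0 0] p norm_ge_zero order_trans by blast+
  have n2: "9/5 \<le> norm (2 + p)" "24/5 \<le> norm (5 + p)"
    using p norm_add_ge[of p x 2] norm_add_ge[of p x 5] by auto
  then have ne: "2 + p \<noteq> 0" "5 + p \<noteq> 0" by auto
  have *: "norm (sub p i X j - X i) \<le> 4/5 * D + x * B" if ji: "j \<noteq> i" for j
  proof -
    obtain k where d: "distinct [i, j, k]"
      using ji three_third by blast
    have "sub p i X j - X i = (((4 + p) * (X j - X i) + 2 * (X k - X i)) / (5 + p) - p * X i) / (2 + p)"
    proof -
      have "(sub p i X j - X i) * ((2 + p) * (5 + p)) = (4 + p) * (X j - X i) + 2 * (X k - X i) - p * X i * (5 + p)"
        using that ne unfolding sub_def tot_eq'[OF d] by (simp add: left_diff_distrib) (simp add: algebra_simps)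
      moreover have "z = (n / b - m) / a" if "z * (a * b) = n - m * b" "a \<noteq> 0" "b \<noteq> 0" for a b m n z :: 'a
        using that by (simp add: field_simps)
      ultimately show ?thesis using ne by blast
    qed
    also have "norm \<dots> \<le> (((4 + 1/5) * D + 2 * D) / (24/5) + x * B) / (9/5)"
    proof -
      have "norm (4 + p) \<le> 4 + 1/5" using p norm_triangle_ineq[of 4 p] by simp
      then have "norm ((4 + p) * (X j - X i) + 2 * (X k - X i)) \<le> (4 + 1/5) * D + 2 * D"
        using D B0 unfolding norm_mult[of "4 + p"]
        by (intro norm_triangle_le add_mono) (simp_all only: norm_mult norm_numeral mult_mono norm_ge_zero mult_left_mono zero_le_numeral)
      then have "norm (((4 + p) * (X j - X i) + 2 * (X k - X i)) / (5 + p)) \<le> ((4 + 1/5) * D + 2 * D) / (24/5)"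
        unfolding norm_divide using n2 B0 by (intro frac_le) auto
      moreover have "norm (p * X i) \<le> x * B" unfolding norm_mult using p B B0 by (intro mult_mono) auto
      ultimately have "norm (((4 + p) * (X j - X i) + 2 * (X k - X i)) / (5 + p) - p * X i)
          \<le> ((4 + 1/5) * D + 2 * D) / (24/5) + x * B"
        by (rule order_trans[OF norm_triangle_ineq4 add_mono])
      then show ?thesis unfolding norm_divide[of _ "2 + p"] using n2 B0 by (intro frac_le) (auto intro!: add_nonneg_nonneg)
    qed
    also have "\<dots> \<le> 4/5 * D + x * B"
    proof -
      have "(((4 + 1/5) * D + 2 * D) / (24/5) + y) / (9/5) \<le> 4/5 * D + y" if "0 \<le> y" for y
        using that B0 by simp
      then show ?thesis using mult_nonneg_nonneg[OF B0(3,1)] by blast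
    qed
    finally show ?thesis .
  qed
  have **: "norm (sub p i X j - sub p i X k) \<le> 4/5 * D + x * B" if "j \<noteq> i" "k \<noteq> i" for j k
  proof -
    have "sub p i X j - sub p i X k = ((2 + p) * (X j - X k)) / ((2 + p) * (5 + p))"
      using that by (simp add: sub_def algebra_simps flip: diff_divide_distrib)
    then have "sub p i X j - sub p i X k = (X j - X k) / (5 + p)" using ne by simp
    then have "norm (sub p i X j - sub p i X k) = norm (X j - X k) / norm (5 + p)" by (simp add: norm_divide)
    also have "\<dots> \<le> D / (24/5)" using n2 D B0 by (intro frac_le) auto
    finally have "norm (sub p i X j - sub p i X k) \<le> D / (24/5)" .
    moreover have "D / (24/5) \<le> 4/5 * D" using B0 by simp
    ultimately show ?thesis using mult_nonneg_nonneg[OF B0(3,1)] by linarith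
  qed
  show ?thesis
    using *[of j] *[of k] **[of j k] B0 by (cases "j = i"; cases "k = i") (simp_all add: norm_minus_commute)
qed

text \<open>The first letter costs at most exp (3/5 norm \<mu>) and the remaining word exp (norm
  \<mu> / 5), since the parameter falls by 5 with each letter; the product stays below exp (norm
  \<mu>), whatever the length.\<close>

lemma E_bound_aux:
  fixes \<mu> :: "'a::{real_normed_field,banach}"
  assumes "\<And>j. norm (X j) \<le> B" "norm \<mu> \<le> 6/5"
  shows "norm (E \<mu> X w j) \<le> exp (norm \<mu>) * B"
  using assms
proof (induction w arbitrary: \<mu> X B)
  case Nil
  have "0 \<le> B" using Nil(1)[of j] norm_ge_zero order_trans by blast
  then have "1 * B \<le> exp (norm \<mu>) * B" by (intro mult_right_mono) auto
  then show ?case using Nil(1)[of j] by simp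
next
  case (Cons i w)
  have B0: "0 \<le> B" using Cons.prems(1)[of j] norm_ge_zero order_trans by blast
  have n: "norm (\<mu>/5) \<le> 6/25" using Cons.prems by (simp add: norm_divide)
  have p: "norm (psi (\<mu>/5)) \<le> norm \<mu> / 5" using norm_psi_le'[of "\<mu>/5"] n by (simp add: norm_divide)
  have p': "norm (psi (\<mu>/5)) \<le> 1/5" using norm_psi_fifth[OF n] .
  have "norm (E \<mu> X (i # w) j) \<le> exp (norm (\<mu>/5)) * ((1 + 3 * norm (psi (\<mu>/5))) * B)"
    unfolding E.simps using n sub_bound[OF Cons.prems(1) order_refl p'] by (intro Cons.IH) auto
  also have "\<dots> \<le> exp (norm \<mu> / 5) * (exp (3 * norm \<mu> / 5) * B)"
  proof -
    have "1 + 3 * norm (psi (\<mu>/5)) \<le> 1 + 3 * norm \<mu> / 5" using p by simp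
    also have "\<dots> \<le> exp (3 * norm \<mu> / 5)" by (rule exp_ge_add_one_self)
    finally show ?thesis using B0 by (simp add: norm_divide mult_right_mono)
  qed
  also have "\<dots> = exp (4 * norm \<mu> / 5) * B" by (simp flip: exp_add mult.assoc)
  also have "\<dots> \<le> exp (norm \<mu>) * B" using B0 by (intro mult_right_mono) auto
  finally show ?case .
qed

lemma E_osc_aux:
  fixes \<mu> :: "'a::{real_normed_field,banach}"
  assumes "\<And>j. norm (X j) \<le> B" "\<And>j k. norm (X j - X k) \<le> D" "norm \<mu> \<le> 6/5"
  shows "norm (E \<mu> X w j - E \<mu> X w k) \<le> (4/5) ^ length w * (D + norm \<mu> * exp (norm \<mu>) * B)"
  using assms
proof (induction w arbitrary: \<mu> X B D)
  case Nil
  have "0 \<le> B" using Nil(1)[of j] norm_ge_zero order_trans by blast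
  then show ?case using Nil(2)[of j k] by (simp add: add_increasing2)
next
  case (Cons i w)
  let ?m = "norm \<mu>"
  have B0: "0 \<le> B" using Cons.prems(1)[of j] norm_ge_zero order_trans by blast
  have n: "norm (\<mu>/5) \<le> 6/25" using Cons.prems by (simp add: norm_divide)
  have p: "norm (psi (\<mu>/5)) \<le> ?m / 5" using norm_psi_le'[of "\<mu>/5"] n by (simp add: norm_divide)
  have p': "norm (psi (\<mu>/5)) \<le> 1/5" using norm_psi_fifth[OF n] .
  have e: "(1 + 3 * norm (psi (\<mu>/5))) \<le> exp (3 * ?m / 5)"
    using p exp_ge_add_one_self[of "3 * ?m / 5"] by linarith
  have "norm (E \<mu> X (i # w) j - E \<mu> X (i # w) k)
      \<le> (4/5) ^ length w * ((4/5 * D + norm (psi (\<mu>/5)) * B)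
          + norm (\<mu>/5) * exp (norm (\<mu>/5)) * ((1 + 3 * norm (psi (\<mu>/5))) * B))"
    unfolding E.simps using n sub_bound[OF Cons.prems(1) order_refl p'] sub_osc[OF Cons.prems(1,2) order_refl p']
    by (intro Cons.IH) auto
  also have "\<dots> \<le> (4/5) ^ length w * ((4/5 * D + ?m / 5 * B) + ?m / 5 * exp (?m/5) * (exp (3 * ?m / 5) * B))"
    using p e B0 by (intro mult_left_mono add_mono mult_right_mono order_refl) (auto simp: norm_divide intro!: mult_left_mono mult_right_mono)
  also have "\<dots> \<le> (4/5) ^ length w * (4/5 * (D + ?m * exp ?m * B))"
  proof (intro mult_left_mono)
    have "exp (?m/5) * exp (3 * ?m / 5) = exp (4 * ?m / 5)" by (simp flip: exp_add)
    also have "\<dots> \<le> exp ?m" by simp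
    finally have "?m / 5 * B * (exp (?m/5) * exp (3 * ?m / 5)) \<le> ?m / 5 * B * exp ?m"
      using B0 by (intro mult_left_mono) auto
    moreover have "?m / 5 * B * 1 \<le> ?m / 5 * B * exp ?m" using B0 by (intro mult_left_mono) auto
    moreover have "0 \<le> ?m / 5 * B * exp ?m" using B0 by auto
    ultimately show "(4/5 * D + ?m / 5 * B) + ?m / 5 * exp (?m/5) * (exp (3 * ?m / 5) * B) \<le> 4/5 * (D + ?m * exp ?m * B)"
      by (simp add: algebra_simps)
  qed auto
  also have "\<dots> = (4/5) ^ length (i # w) * (D + ?m * exp ?m * B)" by (simp add: algebra_simps)
  finally show ?case .
qed

lemma exp_6_5: "exp (6/5 :: real) \<le> 4"
proof -
  have "exp (6/5 :: real) = exp 1 * exp (1/5)" by (simp flip: exp_add)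
  also have "\<dots> \<le> 3 * (1 + 1/5 + (1/5)\<^sup>2)" using exp_le exp_bound[of "1/5::real"] by (intro mult_mono) auto
  finally show ?thesis by (simp add: power2_eq_square)
qed

lemma E_bound:
  fixes \<mu> :: "'a::{real_normed_field,banach}"
  assumes "\<And>j. norm (X j) \<le> B" "norm \<mu> \<le> 6/5"
  shows "norm (E \<mu> X w j) \<le> 4 * B"
proof -
  have B0: "0 \<le> B" using assms(1)[of j] norm_ge_zero order_trans by blast
  have "exp (norm \<mu>) \<le> 4" using exp_6_5 assms(2) by (meson exp_le_cancel_iff order_trans)
  then show ?thesis using E_bound_aux[OF assms, where w = w and j = j] B0 by (meson mult_right_mono order_trans)
qed

lemma E_osc:
  fixes \<mu> :: "'a::{real_normed_field,banach}"
  assumes "\<And>j. norm (X j) \<le> B" "norm \<mu> \<le> 6/5"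
  shows "norm (E \<mu> X w j - E \<mu> X w k) \<le> 8 * B * (4/5) ^ length w"
proof -
  have B0: "0 \<le> B" using assms(1)[of j] norm_ge_zero order_trans by blast
  have "exp (norm \<mu>) \<le> 4" using exp_6_5 assms(2) by (meson exp_le_cancel_iff order_trans)
  then have "norm \<mu> * exp (norm \<mu>) \<le> 6/5 * 4" using assms(2) by (intro mult_mono) auto
  then have "norm \<mu> * exp (norm \<mu>) * B \<le> 6/5 * 4 * B" using B0 by (intro mult_right_mono)
  then have "2 * B + norm \<mu> * exp (norm \<mu>) * B \<le> 8 * B" using B0 by simp
  then have "(4/5) ^ length w * (2 * B + norm \<mu> * exp (norm \<mu>) * B) \<le> (4/5) ^ length w * (8 * B)"
    by (intro mult_left_mono) auto
  moreover have "norm (X j - X k) \<le> 2 * B" for j k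
    using norm_triangle_ineq4[of "X j" "X k"] assms(1)[of j] assms(1)[of k] by simp
  ultimately have "norm (E \<mu> X w j - E \<mu> X w k) \<le> (4/5) ^ length w * (8 * B)"
    using E_osc_aux[of X B "2 * B" \<mu> w j k] assms by (meson order_trans)
  then show ?thesis by (simp add: mult.commute)
qed

section \<open>Holomorphic dependence on the parameter\<close>

lemma holomorphic_psi_compose:
  assumes "f holomorphic_on S" "\<And>z. z \<in> S \<Longrightarrow> norm (f z) < 6"
  shows "(\<lambda>z. psi (f z)) holomorphic_on S"
  using holomorphic_on_compose_gen[OF assms(1) psi_holomorphic] assms(2) by (force simp: o_def)

lemma holomorphic_tot:
  assumes "\<And>j. (\<lambda>z. X z j) holomorphic_on S"
  shows "(\<lambda>z. tot (X z)) holomorphic_on S"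
  unfolding tot_def using assms by (intro holomorphic_intros)

lemma holomorphic_sub:
  assumes "\<And>j. (\<lambda>z. X z j) holomorphic_on S" "p holomorphic_on S"
    and "\<And>z. z \<in> S \<Longrightarrow> 2 + p z \<noteq> 0" "\<And>z. z \<in> S \<Longrightarrow> 5 + p z \<noteq> 0"
  shows "(\<lambda>z. sub (p z) i (X z) j) holomorphic_on S"
  unfolding sub_def using assms by (cases "j = i") (auto intro!: holomorphic_intros holomorphic_tot)

lemma holomorphic_E:
  assumes "\<And>j. (\<lambda>z. X z j) holomorphic_on S" "f holomorphic_on S" "\<And>z. z \<in> S \<Longrightarrow> norm (f z) < 6"
  shows "(\<lambda>z. E (f z) (X z) w j) holomorphic_on S"
  using assms
proof (induction w arbitrary: X f)
  case (Cons i w)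
  have r: "regular (f z)" if "z \<in> S" for z using Cons.prems(3)[OF that] by (intro regular_small) auto
  have n: "norm (f z / 5) < 6" if "z \<in> S" for z using Cons.prems(3)[OF that] norm_ge_zero[of "f z"] by (simp add: norm_divide)
  show ?case unfolding E.simps using r Cons.prems n
    by (intro Cons.IH holomorphic_sub holomorphic_psi_compose holomorphic_intros) (auto simp: regular_def)
qed auto

text \<open>
  Boundary values of the eigenfunctions which at \<open>q\<^sub>l\<close> have value \<open>1\<close> (\<open>k = 1\<close>), normal derivative \<open>1\<close>
  (\<open>k = 2\<close>) or tangential derivative \<open>1\<close> (\<open>k = 3\<close>), the other two data being \<open>0\<close>. Composition with \<open>F\<^sub>l\<close>
  turns the parameter \<open>\<mu>\<close> into \<open>\<mu>/5\<close> and multiplies the function by \<open>kap k\<close>.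
\<close>

definition germ :: "nat \<Rightarrow> 3 \<Rightarrow> 'a \<Rightarrow> 3 \<Rightarrow> 'a::{real_normed_field,banach}" where
  "germ k l \<mu> j = (if k = 1 then (if j = l then 1 else 1 + psi \<mu> / 4)
     else if k = 2 then (if j = l then 0 else sgerm \<mu>)
     else (if j = l + 1 then hat \<mu> / 2 else if j = l - 1 then - hat \<mu> / 2 else 0))"

definition kap :: "nat \<Rightarrow> 'a::real_normed_field" where
  "kap k = (if k = 1 then 1 else if k = 2 then 3/5 else 1/5)"

lemma sub_1: "X (j::3) = x \<Longrightarrow> X k = x \<Longrightarrow> distinct [i, j, k] \<Longrightarrow>
   sub p i X j = ((4 + p) * X i + (6 + p) * x) / ((2 + p) * (5 + p))"
  unfolding sub_def by (auto simp add: tot_eq'[of i j k] algebra_simps)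

text \<open>Away from the centre each case is the functional equation of one decimation function:
  \<open>psi\<close> for k = 1, \<open>sgerm\<close> for k = 2, \<open>hat\<close> for k =
  3.\<close>

lemma sub_germ:
  assumes "norm \<mu> \<le> 6"
  shows "sub (psi (\<mu>/5)) l (germ k l \<mu>) = (\<lambda>j. kap k * germ k l (\<mu>/5) j)"
proof
  fix j
  let ?p = "psi (\<mu>/5)"
  have r: "2 + ?p \<noteq> 0" "5 + ?p \<noteq> 0" using regular_small[OF assms] by (auto simp: regular_def)
  show "sub ?p l (germ k l \<mu>) j = kap k * germ k l (\<mu>/5) j"
  proof (cases "j = l")
    case False
    then obtain i where d: "distinct [l, j, i]"
      using three_third by blast
    consider "k = 1" | "k = 2" | "k \<noteq> 1" "k \<noteq> 2" by blast
    then show ?thesis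
    proof cases
      case 1
      have "sub ?p l (germ k l \<mu>) j = ((4 + ?p) * 1 + (6 + ?p) * (1 + psi \<mu> / 4)) / ((2 + ?p) * (5 + ?p))"
        using d 1 by (subst sub_1[where k = i and x = "1 + psi \<mu> / 4"]) (auto simp: germ_def)
      also have "\<dots> = 1 + ?p / 4"
      proof -
        have "(4 + ?p) * 1 + (6 + ?p) * (1 + psi \<mu> / 4) = (1 + ?p / 4) * ((2 + ?p) * (5 + ?p))"
          unfolding psi_div5[OF assms] by (simp add: field_simps)
        then show ?thesis using r by (simp add: nonzero_divide_eq_eq)
      qed
      finally show ?thesis using 1 False by (simp add: germ_def kap_def)
    next
      case 2
      have "sub ?p l (germ k l \<mu>) j = ((4 + ?p) * 0 + (6 + ?p) * sgerm \<mu>) / ((2 + ?p) * (5 + ?p))"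
        using d 2 by (subst sub_1[where k = i and x = "sgerm \<mu>"]) (auto simp: germ_def)
      also have "\<dots> = sgerm (\<mu>/5) * 3/5" unfolding sgerm_div5[OF assms refl] by (simp add: mult.commute)
      finally show ?thesis using 2 False by (simp add: germ_def kap_def)
    next
      case 3
      have t: "tot (germ k l \<mu>) = 0" using 3 by (simp add: tot_eq[of _ l] germ_def)
      have "sub ?p l (germ k l \<mu>) j = ((2 + ?p) * germ k l \<mu> j) / ((2 + ?p) * (5 + ?p))"
        using False 3 by (simp add: sub_def t) (simp add: germ_def)
      also have "\<dots> = germ k l \<mu> j / (5 + ?p)" using r by simp
      also have "\<dots> = kap k * germ k l (\<mu>/5) j"
      proof -
        define e :: 'a where "e = (if j = l + 1 then 1/2 else if j = l - 1 then -1/2 else 0)"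
        have g: "germ k l \<nu> j = hat \<nu> * e" for \<nu> :: 'a using 3 by (simp add: germ_def e_def)
        have "hat \<mu> = hat (\<mu>/5) / 5 * (5 + ?p)" unfolding hat_div5[OF assms] by (simp add: field_simps)
        then have "hat \<mu> / (5 + ?p) = hat (\<mu>/5) / 5" using r by (simp add: nonzero_divide_eq_eq)
        then have "hat \<mu> * e / (5 + ?p) = hat (\<mu>/5) / 5 * e" by (metis times_divide_eq_left)
        then show ?thesis unfolding g using 3 by (simp add: kap_def)
      qed
      finally show ?thesis .
    qed
  next
    case True
    then show ?thesis by (simp add: germ_def kap_def)
  qed
qed

lemma E_germ_Cons: "norm \<mu> \<le> 6 \<Longrightarrow> E \<mu> (germ k l \<mu>) (l # w) = (\<lambda>j. kap k * E (\<mu>/5) (germ k l (\<mu>/5)) w j)"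
  by (simp add: sub_germ E_cmult)

text \<open>Value, flux and difference at l are dual coordinates to the three germs: the flux
  vanishes except on germ 2, where it is \<open>2 * sgerm \<mu>\<close>, and the difference vanishes
  except on germ 3, where it is \<open>hat \<mu>\<close>.\<close>

lemma germ_span:
  assumes "norm \<mu> < 6"
  shows "X = (\<lambda>j. X l * germ 1 l \<mu> j + flux (psi \<mu>) X l / (2 * sgerm \<mu>) * germ 2 l \<mu> j
      + dif X l / hat \<mu> * germ 3 l \<mu> j)"
proof
  fix j
  have ne: "sgerm \<mu> \<noteq> 0" "hat \<mu> \<noteq> 0" using sgerm_nonzero[OF assms] hat_nonzero[of \<mu>] assms by auto
  show "X j = X l * germ 1 l \<mu> j + flux (psi \<mu>) X l / (2 * sgerm \<mu>) * germ 2 l \<mu> j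
      + dif X l / hat \<mu> * germ 3 l \<mu> j"
    by (rule three_cases[of j l]) (use ne in \<open>auto simp: germ_def flux_def dif_def tot_eq[of X l] field_simps\<close>)
qed

section \<open>Analytic continuation in the spectral parameter\<close>

definition Lam :: real where "Lam = 25 * z0"

lemma Lam_pos: "0 < Lam" and Lam_less: "Lam < 150" using z0 by (auto simp: Lam_def)

definition tt :: "complex \<Rightarrow> complex" where "tt \<mu> = psi (\<mu> / 25)"
definition pp :: "complex \<Rightarrow> complex" where "pp \<mu> = tt \<mu> * (5 + tt \<mu>)"
text \<open>For norm \<mu> \<le> 6, \<open>ee \<mu>\<close> and \<open>bb \<mu>\<close> are
  \<open>sgerm \<mu>\<close> divided by \<open>(2 + pp \<mu>) * (5 + pp \<mu>)\<close> and
  \<open>hat \<mu>\<close> divided by \<open>2 * (5 + pp \<mu>)\<close>. Rewritten at \<mu>/25 these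
  quotients no longer see the zeros of their divisors; the factor \<open>3 + tt \<mu>\<close>
  vanishes at -\<open>Lam\<close>.\<close>

definition ee :: "complex \<Rightarrow> complex" where
  "ee \<mu> = 9/25 * sgerm (\<mu>/25) * (5 + tt \<mu>) / ((6 + tt \<mu>) * (3 + tt \<mu>))"
definition bb :: "complex \<Rightarrow> complex" where "bb \<mu> = hat (\<mu>/25) * (5 + tt \<mu>) / 50"

text \<open>
  The level-one triples of the three basic eigenfunctions centred at \<open>q\<^sub>l\<close>. Expressed through
  \<open>tt \<mu> = psi (\<mu>/25)\<close> they have no pole for \<open>\<bar>\<mu>\<bar> < Lam\<close>, and their totals are divisible by
  \<open>6 + pp \<mu> = (2 + tt \<mu>) * (3 + tt \<mu>)\<close>, which cancels the pole of the next subdivision step.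
\<close>

definition lev1 :: "nat \<Rightarrow> 3 \<Rightarrow> complex \<Rightarrow> 3 \<Rightarrow> 3 \<Rightarrow> complex" where
  "lev1 k l \<mu> a c =
    (if k = 1 then
       (if a = l then if c = l then 1 else 1 + pp \<mu> / 4
        else if c = l then 1 + pp \<mu> / 4 else if c = a then 1 + pp \<mu> * (5 + pp \<mu>) / 4 else 1 + pp \<mu> / 2)
     else if k = 2 then
       (if a = l then if c = l then 0 else (6 + pp \<mu>) * ee \<mu>
        else if c = l then (6 + pp \<mu>) * ee \<mu> else if c = a then (2 + pp \<mu>) * (5 + pp \<mu>) * ee \<mu>
        else 2 * (4 + pp \<mu>) * ee \<mu>)
     else if a = l then if c = l + 1 then bb \<mu> else if c = l - 1 then - bb \<mu> else 0
     else (if a = l + 1 then 1 else -1) * (if c = l then bb \<mu> else if c = a then (5 + pp \<mu>) * bb \<mu> else 0))"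

definition hh :: "nat \<Rightarrow> 3 \<Rightarrow> complex \<Rightarrow> 3 \<Rightarrow> complex" where
  "hh k l \<mu> a =
    (if k = 1 then if a = l then 1/2 else (pp \<mu> + 2) / 4
     else if k = 2 then if a = l then 2 * ee \<mu> else (pp \<mu> + 4) * ee \<mu>
     else if a = l then 0 else if a = l + 1 then bb \<mu> else - bb \<mu>)"

definition lev2 :: "nat \<Rightarrow> 3 \<Rightarrow> complex \<Rightarrow> 3 \<Rightarrow> 3 \<Rightarrow> 3 \<Rightarrow> complex" where
  "lev2 k l \<mu> a b c = (if c = b then lev1 k l \<mu> a c
     else (lev1 k l \<mu> a b + lev1 k l \<mu> a c + 2 * (3 + tt \<mu>) * hh k l \<mu> a) / (5 + tt \<mu>))"

lemma six_pp: "6 + pp \<mu> = (2 + tt \<mu>) * (3 + tt \<mu>)"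
  by (simp add: pp_def algebra_simps)

lemma tot_lev1: "tot (lev1 k l \<mu> a) = (6 + pp \<mu>) * hh k l \<mu> a"
proof -
  consider "k = 1" | "k = 2" | "k \<noteq> 1" "k \<noteq> 2" by blast
  then show ?thesis
  proof cases
    case 1
    show ?thesis
      by (rule three_cases[of a l]; simp add: 1 tot_eq[of _ l] lev1_def hh_def; simp add: field_simps)
  next
    case 2
    show ?thesis
      by (rule three_cases[of a l]; simp add: 2 tot_eq[of _ l] lev1_def hh_def; simp add: algebra_simps)
  next
    case 3
    show ?thesis
      by (rule three_cases[of a l]; simp add: 3 tot_eq[of _ l] lev1_def hh_def; simp add: algebra_simps)
  qed
qed

lemma small_facts:
  assumes "norm \<mu> \<le> 6"
  shows "psi (\<mu>/5) = pp \<mu>" "psi \<mu> = pp \<mu> * (5 + pp \<mu>)" "2 + pp \<mu> \<noteq> 0" "5 + pp \<mu> \<noteq> 0" "6 + pp \<mu> \<noteq> 0"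
    "2 + tt \<mu> \<noteq> 0" "3 + tt \<mu> \<noteq> 0" "5 + tt \<mu> \<noteq> 0" "6 + tt \<mu> \<noteq> 0"
proof -
  have n5: "norm (\<mu>/5) \<le> 6/5" "norm (\<mu>/25) \<le> 6/5" using assms norm_ge_zero[of \<mu>] by (auto simp: norm_divide)
  show p: "psi (\<mu>/5) = pp \<mu>" using psi_div5[of "\<mu>/5"] n5 by (simp add: pp_def tt_def)
  show "psi \<mu> = pp \<mu> * (5 + pp \<mu>)" using psi_div5[OF assms] p by simp
  have "norm (pp \<mu>) \<le> 21/25" "norm (tt \<mu>) \<le> 21/25"
    using norm_psi_lt_1[OF n5(1)] norm_psi_lt_1[OF n5(2)] p by (auto simp: tt_def)
  then show "2 + pp \<mu> \<noteq> 0" "5 + pp \<mu> \<noteq> 0" "6 + pp \<mu> \<noteq> 0"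
    "2 + tt \<mu> \<noteq> 0" "3 + tt \<mu> \<noteq> 0" "5 + tt \<mu> \<noteq> 0" "6 + tt \<mu> \<noteq> 0"
    by (auto intro!: add_ne_0_of_norm_less)
qed

text \<open>Two scaling steps of \<open>sgerm\<close> are composed. The divisor
  \<open>6 + pp \<mu>\<close> of the outer one splits as
  \<open>(2 + tt \<mu>) * (3 + tt \<mu>)\<close>, and its first factor cancels against the inner
  step.\<close>

lemma sgerm_ee: assumes "norm \<mu> \<le> 6" shows "sgerm \<mu> = (2 + pp \<mu>) * (5 + pp \<mu>) * ee \<mu>"
proof -
  note s = small_facts[OF assms]
  have n5: "norm (\<mu>/5) \<le> 6" using assms norm_ge_zero[of \<mu>] by (simp add: norm_divide)
  have 1: "sgerm (\<mu>/5) * 3/5 = sgerm \<mu> * (6 + pp \<mu>) / ((2 + pp \<mu>) * (5 + pp \<mu>))"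
    using sgerm_div5[OF assms refl] s by simp
  have 2: "sgerm (\<mu>/25) * 3/5 = sgerm (\<mu>/5) * (6 + tt \<mu>) / ((2 + tt \<mu>) * (5 + tt \<mu>))"
    using sgerm_div5[OF n5 refl] by (simp add: tt_def)
  have *: "x = u * v * (9/25 * z * t5 / (t6 * t3))"
    if "y * 3/5 = x * (t2 * t3) / (u * v)" "z * 3/5 = y * t6 / (t2 * t5)"
      "u \<noteq> 0" "v \<noteq> 0" "t2 \<noteq> 0" "t3 \<noteq> 0" "t5 \<noteq> 0" "t6 \<noteq> 0"
    for x y z u v t2 t3 t5 t6 :: complex
  proof -
    have y: "y = z * 3/5 * (t2 * t5) / t6" using that by (simp add: field_simps)
    have "x = y * 3/5 * (u * v) / (t2 * t3)" using that by (simp add: field_simps)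
    also have "\<dots> = u * v * (9/25 * z * t5 / (t6 * t3))" unfolding y using that(5) by simp
    finally show ?thesis .
  qed
  show ?thesis unfolding ee_def by (rule *[OF 1[unfolded six_pp] 2]) (use s in auto)
qed

lemma hat_bb: assumes "norm \<mu> \<le> 6" shows "hat \<mu> = 2 * (5 + pp \<mu>) * bb \<mu>"
proof -
  have n5: "norm (\<mu>/5) \<le> 6" using assms norm_ge_zero[of \<mu>] by (simp add: norm_divide)
  have "hat \<mu> = hat (\<mu>/25) * (1 + tt \<mu> / 5) * (1 + pp \<mu> / 5)"
    using hat_div5[OF assms] hat_div5[OF n5] small_facts(1)[OF assms] by (simp add: tt_def)
  also have "\<dots> = 2 * (5 + pp \<mu>) * bb \<mu>" by (simp add: bb_def field_simps)
  finally show ?thesis .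
qed

lemma sub_germ_lev1:
  assumes "norm \<mu> \<le> 6"
  shows "sub (psi (\<mu>/5)) a (germ k l \<mu>) = lev1 k l \<mu> a"
proof
  fix c
  note s = small_facts[OF assms] and g = sgerm_ee[OF assms] hat_bb[OF assms]
  consider "k = 1" | "k = 2" | "k \<noteq> 1" "k \<noteq> 2" by blast
  then show "sub (psi (\<mu>/5)) a (germ k l \<mu>) c = lev1 k l \<mu> a c"
  proof cases
    case 1
    have "(2 + pp \<mu>) * (germ k l \<mu> a + germ k l \<mu> c) + 2 * tot (germ k l \<mu>) = lev1 k l \<mu> a c * ((2 + pp \<mu>) * (5 + pp \<mu>))"
      if "c \<noteq> a"
      using that 1 by (rule_tac three_cases[of a l]; rule_tac three_cases[of c l];
          simp add: germ_def lev1_def tot_eq[of _ l] s(2); simp add: field_simps)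
    moreover have "germ k l \<mu> a = lev1 k l \<mu> a a" using 1 s by (simp add: germ_def lev1_def)
    ultimately show ?thesis unfolding sub_def s(1) using s(3,4) by simp
  next
    case 2
    have "(2 + pp \<mu>) * (germ k l \<mu> a + germ k l \<mu> c) + 2 * tot (germ k l \<mu>) = lev1 k l \<mu> a c * ((2 + pp \<mu>) * (5 + pp \<mu>))"
      if "c \<noteq> a"
      using that 2 by (rule_tac three_cases[of a l]; rule_tac three_cases[of c l];
          simp add: germ_def lev1_def tot_eq[of _ l] g; simp add: algebra_simps)
    moreover have "germ k l \<mu> a = lev1 k l \<mu> a a" using 2 g by (simp add: germ_def lev1_def)
    ultimately show ?thesis unfolding sub_def s(1) using s(3,4) by simp
  next
    case 3
    have "(2 + pp \<mu>) * (germ k l \<mu> a + germ k l \<mu> c) + 2 * tot (germ k l \<mu>) = lev1 k l \<mu> a c * ((2 + pp \<mu>) * (5 + pp \<mu>))"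
      if "c \<noteq> a"
      using that 3 by (rule_tac three_cases[of a l]; rule_tac three_cases[of c l];
          simp add: germ_def lev1_def tot_eq[of _ l] g; simp add: algebra_simps)
    moreover have "germ k l \<mu> a = lev1 k l \<mu> a a"
      using 3 g by (rule_tac three_cases[of a l]) (simp_all add: germ_def lev1_def)
    ultimately show ?thesis unfolding sub_def s(1) using s(3,4) by simp
  qed
qed

text \<open>The factor \<open>2 + tt \<mu>\<close> divides the total and hence the whole numerator
  of the rule. The quotient \<open>lev2\<close> remains meaningful where that factor vanishes, which
  happens inside the disc.\<close>

lemma sub_lev1_lev2:
  assumes "2 + tt \<mu> \<noteq> 0" "5 + tt \<mu> \<noteq> 0"
  shows "sub (tt \<mu>) b (lev1 k l \<mu> a) = lev2 k l \<mu> a b"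
proof
  fix c
  have "((2 + tt \<mu>) * (x + y) + 2 * ((2 + tt \<mu>) * (3 + tt \<mu>) * h)) / ((2 + tt \<mu>) * (5 + tt \<mu>))
      = (x + y + 2 * (3 + tt \<mu>) * h) / (5 + tt \<mu>)" for x y h
  proof -
    have "(2 + tt \<mu>) * (x + y) + 2 * ((2 + tt \<mu>) * (3 + tt \<mu>) * h) = (2 + tt \<mu>) * (x + y + 2 * (3 + tt \<mu>) * h)"
      by (simp add: algebra_simps)
    then show ?thesis using assms by simp
  qed
  then show "sub (tt \<mu>) b (lev1 k l \<mu> a) c = lev2 k l \<mu> a b c"
    unfolding sub_def lev2_def tot_lev1 six_pp by simp
qed

text \<open>The value 0 on words shorter than two is a placeholder; a short address is prolonged by
  repeating its corner letter before \<open>fbig\<close> is used.\<close>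

fun fbig :: "nat \<Rightarrow> 3 \<Rightarrow> 3 list \<Rightarrow> 3 \<Rightarrow> complex \<Rightarrow> complex" where
  "fbig k l (a # b # w) j \<mu> = E (\<mu>/25) (lev2 k l \<mu> a b) w j"
| "fbig k l _ j \<mu> = 0"

definition fsm :: "nat \<Rightarrow> 3 \<Rightarrow> 3 list \<Rightarrow> 3 \<Rightarrow> complex \<Rightarrow> complex" where
  "fsm k l w j \<mu> = E \<mu> (germ k l \<mu>) w j"

lemma fsm_fbig: "norm \<mu> \<le> 6 \<Longrightarrow> fsm k l (a # b # w) j \<mu> = fbig k l (a # b # w) j \<mu>"
  using small_facts[of \<mu>] sub_germ_lev1[of \<mu> a k l] sub_lev1_lev2[of \<mu> b k l a]
  by (simp add: fsm_def flip: tt_def)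

lemma Lam_facts:
  assumes "\<mu> \<in> ball 0 Lam"
  shows "norm (\<mu>/25) < 6" "3 + tt \<mu> \<noteq> 0" "5 + tt \<mu> \<noteq> 0" "6 + tt \<mu> \<noteq> 0"
proof -
  have n: "norm (\<mu>/25) < z0" using assms by (simp add: norm_divide Lam_def)
  then show n6: "norm (\<mu>/25) < 6" using z0 by simp
  show "3 + tt \<mu> \<noteq> 0" unfolding tt_def by (rule psi_ne_minus_3[OF n])
  show "5 + tt \<mu> \<noteq> 0" "6 + tt \<mu> \<noteq> 0"
    using norm_psi_lt_5[OF n6] by (auto simp: tt_def intro!: add_ne_0_of_norm_less)
qed

lemma holomorphic_compose_25:
  assumes "f holomorphic_on ball 0 6" shows "(\<lambda>\<mu>. f (\<mu>/25)) holomorphic_on ball 0 Lam"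
proof -
  have "(f \<circ> (\<lambda>\<mu>. \<mu>/25)) holomorphic_on ball 0 Lam"
    by (rule holomorphic_on_compose_gen[OF _ assms]) (use Lam_less in \<open>auto intro!: holomorphic_intros simp: norm_divide\<close>)
  then show ?thesis by (simp add: o_def)
qed

lemma holomorphic_tt [holomorphic_intros]: "tt holomorphic_on ball 0 Lam"
  unfolding tt_def[abs_def] by (rule holomorphic_compose_25[OF psi_holomorphic])
lemma holomorphic_pp [holomorphic_intros]: "pp holomorphic_on ball 0 Lam"
  unfolding pp_def[abs_def] by (intro holomorphic_intros)
lemma holomorphic_ee [holomorphic_intros]: "ee holomorphic_on ball 0 Lam"
  unfolding ee_def[abs_def]
  by (intro holomorphic_intros holomorphic_compose_25[OF sgerm_holomorphic]) (use Lam_facts in auto)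
lemma holomorphic_bb [holomorphic_intros]: "bb holomorphic_on ball 0 Lam"
  unfolding bb_def[abs_def] by (intro holomorphic_intros holomorphic_compose_25[OF hat_holomorphic]) auto

lemma holomorphic_if:
  "(P \<Longrightarrow> f holomorphic_on S) \<Longrightarrow> (\<not> P \<Longrightarrow> g holomorphic_on S) \<Longrightarrow> (\<lambda>z. if P then f z else g z) holomorphic_on S"
  by (cases P) simp_all

lemma holomorphic_lev1: "(\<lambda>\<mu>. lev1 k l \<mu> a c) holomorphic_on ball 0 Lam"
  unfolding lev1_def by (intro holomorphic_if holomorphic_intros) auto
lemma holomorphic_hh: "(\<lambda>\<mu>. hh k l \<mu> a) holomorphic_on ball 0 Lam"
  unfolding hh_def by (intro holomorphic_if holomorphic_intros) auto
lemma holomorphic_lev2: "(\<lambda>\<mu>. lev2 k l \<mu> a b c) holomorphic_on ball 0 Lam"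
  unfolding lev2_def by (intro holomorphic_if holomorphic_intros holomorphic_lev1 holomorphic_hh Lam_facts)

lemma holomorphic_fbig: "fbig k l w j holomorphic_on ball 0 Lam"
proof -
  consider a b v where "w = a # b # v" | "w = []" | a where "w = [a]"
    by (metis neq_Nil_conv)
  then show ?thesis
  proof cases
    case 1
    have "(\<lambda>\<mu>. E (\<mu>/25) (lev2 k l \<mu> a b) v j) holomorphic_on ball 0 Lam"
      by (intro holomorphic_E holomorphic_lev2 holomorphic_intros) (use Lam_facts in auto)
    moreover have "fbig k l w j = (\<lambda>\<mu>. E (\<mu>/25) (lev2 k l \<mu> a b) v j)" using 1 by auto
    ultimately show ?thesis by simp
  qed (auto simp: fun_eq_iff cong: holomorphic_cong)
qed

lemma holomorphic_germ: "(\<lambda>\<mu>. germ k l \<mu> j) holomorphic_on ball 0 6"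
  unfolding germ_def
  by (intro holomorphic_if holomorphic_intros hat_holomorphic psi_holomorphic sgerm_holomorphic) auto

lemma holomorphic_fsm: "fsm k l w j holomorphic_on ball 0 6"
  unfolding fsm_def[abs_def] by (intro holomorphic_E holomorphic_germ holomorphic_intros) auto

text \<open>There are finitely many words of length three, and on each the function is continuous on
  a compact disc. Below them the parameter \<mu>/125 has modulus at most 6/5 because
  \<open>Lam\<close> < 150, so the uniform bounds for \<open>E\<close> take over.\<close>

lemma fbig_bound:
  assumes r: "0 < r" "r < Lam"
  obtains M where "0 \<le> M"
    "\<And>k l w j \<mu>. k \<in> {1..3} \<Longrightarrow> 3 \<le> length w \<Longrightarrow> norm \<mu> \<le> r \<Longrightarrow> norm (fbig k l w j \<mu>) \<le> M"
    "\<And>k l w i j \<mu>. k \<in> {1..3} \<Longrightarrow> 3 \<le> length w \<Longrightarrow> norm \<mu> \<le> r \<Longrightarrow>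
       norm (fbig k l w j \<mu> - fbig k l w i \<mu>) \<le> M * (4/5) ^ length w"
proof -
  define Z where "Z = (\<Union>(k, l, a, b, c, j) \<in> {1..3} \<times> UNIV \<times> UNIV \<times> UNIV \<times> UNIV \<times> UNIV.
     (\<lambda>\<mu>. fbig k l [a, b, c] j \<mu>) ` cball 0 r)"
  have "bounded Z" unfolding Z_def
  proof (intro bounded_UN finite_cartesian_product; clarify?)
    fix k l a b c j
    have "continuous_on (cball 0 r) (fbig k l [a, b, c] j)"
      by (rule holomorphic_on_imp_continuous_on[OF holomorphic_on_subset[OF holomorphic_fbig]]) (use r in auto)
    then show "bounded ((\<lambda>\<mu>. fbig k l [a, b, c] j \<mu>) ` cball 0 r)"
      by (intro compact_imp_bounded compact_continuous_image) auto
  qed auto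
  then obtain B where B: "0 < B" "\<And>z. z \<in> Z \<Longrightarrow> norm z \<le> B" by (auto simp: bounded_pos)
  have ex: "\<exists>X v. w = take 3 w @ v \<and> (\<forall>j. norm (X j) \<le> B) \<and> norm (\<mu>/125) \<le> 6/5
      \<and> (\<forall>j. fbig k l w j \<mu> = E (\<mu>/125) X v j)"
    if that: "k \<in> {1..3}" and w3: "3 \<le> length w" and nr: "norm \<mu> \<le> r" for k l w \<mu>
  proof -
    obtain a b c v where w: "w = a # b # c # v"
      using w3 by (metis Suc_le_length_iff numeral_3_eq_3)
    let ?X = "\<lambda>j. fbig k l [a, b, c] j \<mu>"
    have "fbig k l [a, b, c] j \<mu> \<in> Z" for j
      unfolding Z_def by (rule UN_I[of "(k, l, a, b, c, j)"]) (use that nr in auto)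
    then have "norm (?X j) \<le> B" for j using B by blast
    moreover have "fbig k l w j \<mu> = E (\<mu>/125) ?X v j" for j
      by (simp add: w)
    moreover have "norm (\<mu>/125) \<le> 6/5" using nr r Lam_less by (simp add: norm_divide)
    ultimately show ?thesis by (intro exI[of _ ?X] exI[of _ v]) (simp add: w)
  qed
  show ?thesis
  proof (rule that[of "16 * B"])
    fix k :: nat and l and w :: "3 list" and j and \<mu> :: complex assume A: "k \<in> {1..3}" "3 \<le> length w" "norm \<mu> \<le> r"
    from ex[OF this, of l] obtain X v where X: "\<forall>j. norm (X j) \<le> B" "norm (\<mu>/125) \<le> 6/5"
      "\<forall>j. fbig k l w j \<mu> = E (\<mu>/125) X v j" by blast
    show "norm (fbig k l w j \<mu>) \<le> 16 * B"
      using E_bound[of X B "\<mu>/125" v j] X B by auto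
  next
    fix k :: nat and l and w :: "3 list" and i j and \<mu> :: complex assume A: "k \<in> {1..3}" "3 \<le> length w" "norm \<mu> \<le> r"
    from ex[OF this, of l] obtain X v where X: "\<forall>j. norm (X j) \<le> B" "norm (\<mu>/125) \<le> 6/5"
      "\<forall>j. fbig k l w j \<mu> = E (\<mu>/125) X v j" "w = take 3 w @ v" by blast
    have len: "length w = 3 + length v" using X(4) A(2) by (metis length_append length_take min.absorb2)
    have "norm (fbig k l w j \<mu> - fbig k l w i \<mu>) \<le> 8 * B * (4/5) ^ length v"
      using E_osc[of X B "\<mu>/125" v j i] X by auto
    \<comment> \<open>Removing three letters costs (5/4)^3 < 2.\<close>
    also have "\<dots> \<le> 16 * B * (4/5) ^ length w"
      using B unfolding len power_add by (simp add: power3_eq_cube)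
    finally show "norm (fbig k l w j \<mu> - fbig k l w i \<mu>) \<le> 16 * B * (4/5) ^ length w" .
  qed (use B in auto)
qed

subsection \<open>Taylor coefficients\<close>

definition cf :: "(complex \<Rightarrow> complex) \<Rightarrow> nat \<Rightarrow> complex" where
  "cf f j = fps_nth (fps_expansion f 0) j"

lemma cf_cong:
  assumes "\<And>z. norm z < r \<Longrightarrow> f z = g z" "0 < r" shows "cf f j = cf g j"
proof -
  have "eventually (\<lambda>z. f z = g z) (nhds 0)"
    using assms by (auto simp: eventually_nhds_metric intro!: exI[of _ r])
  then show ?thesis unfolding cf_def by (subst fps_expansion_cong) auto
qed

lemma fps_ball: "f holomorphic_on ball 0 6 \<Longrightarrow> f has_fps_expansion fps_expansion f 0"
  by (rule has_fps_expansion_fps_expansion) auto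

lemma cf_eqI: "f has_fps_expansion H \<Longrightarrow> cf f j = fps_nth H j"
  by (simp add: cf_def fps_expansion_eqI)

lemma cf_add:
  assumes "f holomorphic_on ball 0 6" "g holomorphic_on ball 0 6"
  shows "cf (\<lambda>z. f z + g z) j = cf f j + cf g j"
  using cf_eqI[OF has_fps_expansion_add[OF fps_ball[OF assms(1)] fps_ball[OF assms(2)]]] by (simp add: cf_def)

lemma cf_diff:
  assumes "f holomorphic_on ball 0 6" "g holomorphic_on ball 0 6"
  shows "cf (\<lambda>z. f z - g z) j = cf f j - cf g j"
  using cf_eqI[OF has_fps_expansion_diff[OF fps_ball[OF assms(1)] fps_ball[OF assms(2)]]] by (simp add: cf_def)

lemma cf_cmult:
  assumes "f holomorphic_on ball 0 6"
  shows "cf (\<lambda>z. c * f z) j = c * cf f j"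
  using cf_eqI[OF has_fps_expansion_cmult_left[OF fps_ball[OF assms(1)]]] by (simp add: cf_def)

lemma cf_mult:
  assumes "f holomorphic_on ball 0 6" "g holomorphic_on ball 0 6"
  shows "cf (\<lambda>z. f z * g z) j = (\<Sum>i=0..j. cf f i * cf g (j - i))"
  using cf_eqI[OF has_fps_expansion_mult[OF fps_ball[OF assms(1)] fps_ball[OF assms(2)]]]
  by (simp add: cf_def fps_mult_nth)

lemma cf_X_mult:
  assumes "f holomorphic_on ball 0 6"
  shows "cf (\<lambda>z. z * f z) j = (if j = 0 then 0 else cf f (j - 1))"
  using cf_eqI[OF has_fps_expansion_mult[OF has_fps_expansion_fps_X fps_ball[OF assms(1)]]]
  by (simp add: cf_def fps_X_mult_nth)

lemma cf_deriv: "f holomorphic_on ball 0 6 \<Longrightarrow> cf f j = (deriv ^^ j) f 0 / fact j"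
  unfolding cf_def by (rule fps_nth_fps_expansion[OF fps_ball])

lemma cf_scale:
  assumes "f holomorphic_on ball 0 6" shows "cf (\<lambda>z. f (z/5)) j = (1/5) ^ j * cf f j"
proof -
  have *: "(\<lambda>z. f (z/5)) holomorphic_on ball 0 6"
  proof -
    have "(f \<circ> (\<lambda>z. z/5)) holomorphic_on ball 0 6"
      by (rule holomorphic_on_compose_gen[OF _ assms]) (auto intro!: holomorphic_intros simp: norm_divide)
    then show ?thesis by (simp add: o_def)
  qed
  have "(deriv ^^ j) (\<lambda>z. f (1/5 * z)) 0 = (1/5) ^ j * (deriv ^^ j) f (1/5 * 0)"
    by (rule higher_deriv_compose_linear[OF assms, where S = "ball 0 6"]) (auto simp: norm_mult norm_divide)
  then show ?thesis using cf_deriv[OF assms] cf_deriv[OF *] by simp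
qed

lemma cf_0: "f holomorphic_on ball 0 6 \<Longrightarrow> cf f 0 = f 0"
  by (simp add: cf_deriv)

lemma cf_const: "cf (\<lambda>z. c) j = (if j = 0 then c else 0)"
  using cf_eqI[OF has_fps_expansion_const[of c]] by simp

lemma cf_bound:
  assumes "f holomorphic_on ball 0 R" "0 < r" "r < R" "\<And>z. norm z \<le> r \<Longrightarrow> norm (f z) \<le> B"
  shows "norm (cf f j) \<le> B / r ^ j"
proof -
  have "norm ((deriv ^^ j) f 0) \<le> fact j * B / r ^ j"
    by (rule Cauchy_inequality)
      (use assms in \<open>auto intro!: holomorphic_on_subset[OF assms(1)] holomorphic_on_imp_continuous_on\<close>)
  moreover have "cf f j = (deriv ^^ j) f 0 / fact j"
    unfolding cf_def by (rule fps_nth_fps_expansion, rule has_fps_expansion_fps_expansion[of "ball 0 R"]) (use assms in auto)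
  ultimately have "norm (cf f j) \<le> fact j * B / r ^ j / norm (fact j :: complex)"
    using divide_right_mono[OF _ norm_ge_zero] by (simp only: norm_divide) blast
  then show ?thesis by simp
qed

text \<open>Derivatives along the real axis are limits of real difference quotients. This returns
  from the complex parameter, needed for Cauchy's estimate, to real-valued functions.\<close>

lemma higher_deriv_Reals:
  assumes "f holomorphic_on ball 0 R" "\<And>x. \<bar>x\<bar> < R \<Longrightarrow> f (of_real x) \<in> \<real>" "\<bar>x\<bar> < R"
  shows "(deriv ^^ n) f (of_real x) \<in> \<real>"
  using assms(3)
proof (induction n arbitrary: x)
  case (Suc n)
  let ?g = "(deriv ^^ n) f"
  have "?g holomorphic_on ball 0 R" by (intro holomorphic_higher_deriv assms(1)) auto
  then have D: "(?g has_field_derivative deriv ?g (of_real x)) (at (of_real x))"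
    using Suc.prems by (intro holomorphic_derivI[where S = "ball 0 R"]) auto
  define h where "h n = (R - \<bar>x\<bar>) / (real n + 2)" for n :: nat
  have h: "0 < h n" "h n < R - \<bar>x\<bar>" for n using Suc.prems by (auto simp: h_def divide_simps)
  have "(\<lambda>n. (R - \<bar>x\<bar>) / (real n + 2)) \<longlonglongrightarrow> 0" by real_asymp
  then have "(\<lambda>n. of_real (h n) :: complex) \<longlonglongrightarrow> of_real 0" unfolding h_def[symmetric] by (rule tendsto_of_real)
  then have "filterlim (\<lambda>n. of_real (h n) :: complex) (at 0) sequentially"
    using h by (auto simp: filterlim_at intro!: always_eventually) (metis less_irrefl)
  then have "(\<lambda>n. (?g (of_real x + of_real (h n)) - ?g (of_real x)) / of_real (h n)) \<longlonglongrightarrow> deriv ?g (of_real x)"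
    using D unfolding DERIV_def by (rule filterlim_compose[rotated])
  moreover have "(?g (of_real x + of_real (h n)) - ?g (of_real x)) / of_real (h n) \<in> \<real>" for n
  proof -
    have "\<bar>x + h n\<bar> < R" using h[of n] by linarith
    then have "?g (of_real (x + h n)) \<in> \<real>" by (rule Suc.IH)
    then show ?thesis using Suc.IH[OF Suc.prems] by (auto intro!: Reals_divide Reals_diff)
  qed
  ultimately have "deriv ?g (of_real x) \<in> \<real>"
    by (intro Lim_in_closed_set[OF closed_complex_Reals]) auto
  then show ?case by simp
qed (use assms(2) in auto)

lemma cf_Reals:
  assumes "f holomorphic_on ball 0 6" "\<And>x. \<bar>x\<bar> < 6 \<Longrightarrow> f (of_real x) \<in> \<real>"
  shows "cf f j \<in> \<real>"
  using higher_deriv_Reals[OF assms, of 0 j] unfolding cf_deriv[OF assms(1)]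
  by simp (metis Reals_divide Reals_of_nat of_nat_fact)

lemma small_Reals:
  fixes x :: real assumes "\<bar>x\<bar> < 6"
  shows "psi (of_real x) \<in> (\<real>::complex set)" "hat (of_real x) \<in> (\<real>::complex set)" "gam (of_real x) \<in> (\<real>::complex set)"
  using psi_of_real[of x, where 'a = complex] powser_of_real[OF hcoef_bound, of x, where 'a = complex]
    powser_of_real[OF gcoef_bound, of x, where 'a = complex] assms
  by (simp_all add: hat_def gam_def)

lemma germ_Reals:
  assumes "\<bar>x\<bar> < 6" shows "germ k l (of_real x) j \<in> (\<real>::complex set)"
  using small_Reals[OF assms]
  by (auto simp: germ_def sgerm_def intro!: Reals_add Reals_divide Reals_mult)

lemma sub_Reals:
  assumes "p \<in> \<real>" "\<And>j. X j \<in> \<real>" shows "sub p i X j \<in> (\<real>::complex set)"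
  using assms by (auto simp: sub_def tot_def intro!: Reals_add Reals_divide Reals_mult sum_in_Reals)

lemma E_Reals:
  assumes "\<bar>x\<bar> < 6" "\<And>j. X j \<in> \<real>" shows "E (of_real x) X w j \<in> (\<real>::complex set)"
  using assms
proof (induction w arbitrary: x X)
  case (Cons i w)
  have x: "\<bar>x/5\<bar> < 6" using Cons.prems by simp
  show ?case using Cons.IH[OF x, of "sub (psi (of_real (x/5))) i X"] small_Reals(1)[OF x] Cons.prems
    by (simp add: sub_Reals)
qed auto

text \<open>The value at the vertex with address (w, i) of the monomial of index (j, k) centred at
  l. Taking the real part loses nothing, since the coefficient is real.\<close>

definition Pc :: "nat \<Rightarrow> 3 \<Rightarrow> nat \<Rightarrow> 3 list \<Rightarrow> 3 \<Rightarrow> real" where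
  "Pc k l j w i = Re (cf (fsm k l w i) j)"

lemma of_real_Pc: "of_real (Pc k l j w i) = cf (fsm k l w i) j"
proof -
  have "cf (fsm k l w i) j \<in> \<real>"
    by (intro cf_Reals holomorphic_fsm) (auto simp: fsm_def intro!: E_Reals germ_Reals)
  then show ?thesis unfolding Pc_def by (rule of_real_Re)
qed

lemma Pc_eqI: "cf (fsm k l w i) j = of_real c \<Longrightarrow> Pc k l j w i = c"
  by (simp add: Pc_def)

lemma Pc_extend: "Pc k l j (w @ replicate n i) i = Pc k l j w i"
proof -
  have "E \<mu> X (w @ replicate n i) i = E \<mu> X w i" for \<mu> and X :: "3 \<Rightarrow> complex"
    unfolding E_append by (rule E_self)
  then have "fsm k l (w @ replicate n i) i = fsm k l w i" by (simp add: fsm_def fun_eq_iff)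
  then show ?thesis by (simp add: Pc_def)
qed

lemma Pc_junction: "Pc k l j (s @ a # replicate n b) b = Pc k l j (s @ b # replicate n a) a"
proof -
  have "E \<mu> X (s @ a # replicate n b) b = E \<mu> X (s @ b # replicate n a) a" for \<mu> and X :: "3 \<Rightarrow> complex"
    unfolding E_append by (simp add: E_self sub_commute)
  then have "fsm k l (s @ a # replicate n b) b = fsm k l (s @ b # replicate n a) a" by (simp add: fsm_def fun_eq_iff)
  then show ?thesis by (simp add: Pc_def)
qed

lemma cf_fbig: "2 \<le> length w \<Longrightarrow> cf (fsm k l w i) j = cf (fbig k l w i) j"
proof -
  assume "2 \<le> length w"
  then obtain a b v where "w = a # b # v" by (metis Suc_le_length_iff numeral_2_eq_2)
  then show ?thesis by (intro cf_cong[of 6]) (auto simp: fsm_fbig simp del: fbig.simps)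
qed

text \<open>Cauchy's estimate on the circle of radius r for the continued function. For the first
  bound the address is prolonged by three copies of its corner, which does not move the
  point.\<close>

lemma Pc_bound:
  assumes r: "0 < r" "r < Lam"
  obtains M where "0 \<le> M" "\<And>k l j w i. k \<in> {1..3} \<Longrightarrow> \<bar>Pc k l j w i\<bar> \<le> M / r ^ j"
    "\<And>k l j w i i'. k \<in> {1..3} \<Longrightarrow> \<bar>Pc k l j w i - Pc k l j w i'\<bar> \<le> M * (4/5) ^ length w / r ^ j"
proof -
  obtain M where M: "0 \<le> M"
    "\<And>k l w j \<mu>. k \<in> {1..3} \<Longrightarrow> 3 \<le> length w \<Longrightarrow> norm \<mu> \<le> r \<Longrightarrow> norm (fbig k l w j \<mu>) \<le> M"
    "\<And>k l w i j \<mu>. k \<in> {1..3} \<Longrightarrow> 3 \<le> length w \<Longrightarrow> norm \<mu> \<le> r \<Longrightarrow>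
       norm (fbig k l w j \<mu> - fbig k l w i \<mu>) \<le> M * (4/5) ^ length w"
    using fbig_bound[OF r] by metis
  have b1: "\<bar>Pc k l j w i\<bar> \<le> M / r ^ j" if "k \<in> {1..3}" for k l j w i
  proof -
    have "\<bar>Pc k l j w i\<bar> = \<bar>Pc k l j (w @ replicate 3 i) i\<bar>" unfolding Pc_extend ..
    also have "\<dots> \<le> norm (cf (fbig k l (w @ replicate 3 i) i) j)"
      unfolding Pc_def by (subst cf_fbig) (auto simp: abs_Re_le_cmod)
    also have "\<dots> \<le> M / r ^ j"
      by (rule cf_bound[OF holomorphic_fbig r]) (use that in \<open>auto intro!: M\<close>)
    finally show ?thesis .
  qed
  have b2: "\<bar>Pc k l j w i - Pc k l j w i'\<bar> \<le> 4 * M * (4/5) ^ length w / r ^ j" if k: "k \<in> {1..3}" for k l j w i i'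
  proof (cases "3 \<le> length w")
    case True
    have "\<bar>Pc k l j w i - Pc k l j w i'\<bar> \<le> norm (cf (fsm k l w i) j - cf (fsm k l w i') j)"
      unfolding Pc_def minus_complex.sel(1)[symmetric] by (rule abs_Re_le_cmod)
    also have "cf (fsm k l w i) j - cf (fsm k l w i') j = cf (\<lambda>z. fsm k l w i z - fsm k l w i' z) j"
      by (simp add: cf_diff holomorphic_fsm)
    also have "\<dots> = cf (\<lambda>z. fbig k l w i z - fbig k l w i' z) j"
    proof -
      obtain a b v where "w = a # b # v" using True by (metis Suc_le_length_iff numeral_3_eq_3)
      then show ?thesis by (intro cf_cong[of 6]) (auto simp: fsm_fbig simp del: fbig.simps)
    qed
    also have "norm \<dots> \<le> M * (4/5) ^ length w / r ^ j"
      by (rule cf_bound[OF _ r]) (use k True in \<open>auto intro!: M holomorphic_intros holomorphic_fbig\<close>)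
    also have "\<dots> \<le> 4 * M * (4/5) ^ length w / r ^ j"
      using M r by (intro divide_right_mono mult_right_mono) auto
    finally show ?thesis .
  next
    case False
    \<comment> \<open>On words shorter than three the decay factor is at least 16/25, so twice the
      sup bound is absorbed by the constant 4M.\<close>
    have "(4/5 :: real) ^ 2 \<le> (4/5) ^ length w" using False by (intro power_decreasing) auto
    then have "1/2 \<le> (4/5 :: real) ^ length w" by (simp add: power2_eq_square)
    then have "2 * M \<le> 4 * M * (4/5) ^ length w" using M(1) mult_left_mono[of "1/2" "(4/5) ^ length w" "4 * M"] by simp
    then have "2 * M / r ^ j \<le> 4 * M * (4/5) ^ length w / r ^ j" using r by (intro divide_right_mono) auto
    moreover have "\<bar>Pc k l j w i - Pc k l j w i'\<bar> \<le> M / r ^ j + M / r ^ j"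
      using b1[OF k, of l j w i] b1[OF k, of l j w i'] by (intro order_trans[OF abs_triangle_ineq4 add_mono])
    moreover have "M / r ^ j + M / r ^ j = 2 * M / r ^ j" by simp
    ultimately show ?thesis by linarith
  qed
  show ?thesis
  proof (rule that[of "4 * M"])
    fix k l j w i assume "k \<in> {1..3::nat}"
    then have "\<bar>Pc k l j w i\<bar> \<le> M / r ^ j" by (rule b1)
    also have "\<dots> \<le> 4 * M / r ^ j" using M(1) r by (intro divide_right_mono) auto
    finally show "\<bar>Pc k l j w i\<bar> \<le> 4 * M / r ^ j" .
  qed (use M b2 in auto)
qed

lemma cf_sum:
  assumes "\<And>i. i \<in> I \<Longrightarrow> f i holomorphic_on ball 0 6"
  shows "cf (\<lambda>z. \<Sum>i\<in>I. f i z) j = (\<Sum>i\<in>I. cf (f i) j)"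
  using assms
proof (induction I rule: infinite_finite_induct)
  case (insert x I)
  have "cf (\<lambda>z. f x z + (\<Sum>i\<in>I. f i z)) j = cf (f x) j + cf (\<lambda>z. \<Sum>i\<in>I. f i z) j"
    by (rule cf_add) (auto intro!: holomorphic_intros insert.prems)
  then show ?case using insert by simp
qed (simp_all add: cf_const)

lemma of_real_kap: "of_real (kap k :: real) = (kap k :: complex)"
  by (simp add: kap_def)

lemma Pc_scale: "Pc k l j (l # w) i = kap k * (1/5) ^ j * Pc k l j w i"
proof -
  have h: "(\<lambda>z. fsm k l w i (z/5)) holomorphic_on ball 0 6"
  proof -
    have "(fsm k l w i \<circ> (\<lambda>z. z/5)) holomorphic_on ball 0 6"
      by (rule holomorphic_on_compose_gen[OF _ holomorphic_fsm]) (auto intro!: holomorphic_intros simp: norm_divide)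
    then show ?thesis by (simp add: o_def)
  qed
  have "cf (fsm k l (l # w) i) j = cf (\<lambda>z. kap k * fsm k l w i (z/5)) j"
    by (rule cf_cong[of 6]) (simp_all only: fsm_def E_germ_Cons less_imp_le zero_less_numeral)
  also have "\<dots> = kap k * ((1/5) ^ j * cf (fsm k l w i) j)"
    unfolding cf_cmult[OF h] cf_scale[OF holomorphic_fsm] ..
  also have "\<dots> = of_real (kap k * (1/5) ^ j * Pc k l j w i)"
    by (simp add: of_real_kap of_real_Pc)
  finally show ?thesis by (rule Pc_eqI)
qed

lemma Pc_centre: "Pc k l j [] l = of_bool (k = 1 \<and> j = 0)"
proof -
  have "fsm k l [] l = (\<lambda>\<mu>. if k = 1 then 1 else 0)" by (auto simp: fsm_def germ_def fun_eq_iff)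
  then show ?thesis by (intro Pc_eqI) (simp add: cf_const)
qed

lemma Pc_vertex_sym: "k \<noteq> 3 \<Longrightarrow> k \<in> {1..3} \<Longrightarrow> Pc k l j [] (l - 1) = Pc k l j [] (l + 1)"
proof -
  assume "k \<noteq> 3" "k \<in> {1..3}"
  then have "k = 1 \<or> k = 2" by auto
  then have "fsm k l [] (l - 1) = fsm k l [] (l + 1)" by (auto simp: fsm_def germ_def fun_eq_iff)
  then show ?thesis by (simp add: Pc_def)
qed

lemma Pc_vertex_antisym: "Pc 3 l j [] (l - 1) = - Pc 3 l j [] (l + 1)"
proof -
  have "cf (\<lambda>z. -1 * (hat z / 2)) j = -1 * cf (\<lambda>z. hat z / 2) j"
    by (intro cf_cmult holomorphic_intros hat_holomorphic) auto
  then show ?thesis unfolding Pc_def fsm_def germ_def by simp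
qed

lemma Pc_vertex_0:
  "Pc 1 l 0 [] i = 1" "Pc 2 l 0 [] (l + 1) = -1/2" "Pc 3 l 0 [] (l + 1) = 1/2"
  unfolding Pc_def cf_0[OF holomorphic_fsm] by (auto simp: fsm_def germ_def)

text \<open>The two cancelling fluxes read as a graph eigenvalue equation: of each
  \<open>3 + p/2\<close> the 3 goes into the differences, and the two halves of p add up to the
  eigenvalue.\<close>

lemma fsm_junction_sum:
  assumes "norm \<mu> \<le> 6" "a \<noteq> b" and w: "w = s @ a # replicate n b" and v: "v = s @ b # replicate n a"
  shows "(tot (\<lambda>c. fsm k l w c \<mu>) - 3 * fsm k l w b \<mu>) + (tot (\<lambda>c. fsm k l v c \<mu>) - 3 * fsm k l v a \<mu>)
    = psi (\<mu> / 5 ^ length w) * fsm k l w b \<mu>"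
proof -
  have eq: "fsm k l v a \<mu> = fsm k l w b \<mu>"
    unfolding fsm_def w v E_append by (simp add: E_self sub_commute)
  have "flux (psi (\<mu> / 5 ^ length w)) (\<lambda>c. fsm k l w c \<mu>) b + flux (psi (\<mu> / 5 ^ length w)) (\<lambda>c. fsm k l v c \<mu>) a = 0"
    using E_flux_junction[OF regular_small[OF assms(1)] assms(2), where s = s and k = n and X = "germ k l \<mu>"]
    by (simp add: fsm_def w v)
  then show ?thesis unfolding flux_def eq by (simp add: algebra_simps)
qed

definition Pd :: "nat \<Rightarrow> 3 \<Rightarrow> nat \<Rightarrow> 3 list \<Rightarrow> 3 \<Rightarrow> real" where
  "Pd k l j w i = (if j = 0 then 0 else Pc k l (j - 1) w i)"

text \<open>On the germs the renormalised graph Laplacian is multiplication by 3/2 * 5^m * psi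
  (\<mu>/5^m), which differs from \<mu> by O(5^-m) on the whole disc. Cauchy's estimate for this
  difference times the germ bounds all orders j at once; multiplication by \<mu> lowers the order by
  one, which is \<open>Pd\<close>. The factor r^-j later permits exchanging Laplacian and
  series.\<close>

lemma Pc_laplacian:
  assumes r: "0 < r" "r < Lam"
  obtains C where "0 \<le> C" "\<And>k l j s a b n w v. k \<in> {1..3} \<Longrightarrow> a \<noteq> b \<Longrightarrow> w = s @ a # replicate n b \<Longrightarrow>
     v = s @ b # replicate n a \<Longrightarrow> 3 \<le> length w \<Longrightarrow>
     \<bar>3/2 * 5 ^ length w * ((tot (Pc k l j w) - 3 * Pc k l j w b) + (tot (Pc k l j v) - 3 * Pc k l j v a))
       - Pd k l j w b\<bar> \<le> C / 5 ^ length w / r ^ j"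
proof -
  obtain M where M: "0 \<le> M"
    "\<And>k l w j \<mu>. k \<in> {1..3} \<Longrightarrow> 3 \<le> length w \<Longrightarrow> norm \<mu> \<le> r \<Longrightarrow> norm (fbig k l w j \<mu>) \<le> M"
    using fbig_bound[OF r] by metis
  show ?thesis
  proof (rule that[of "r\<^sup>2 * M"])
    fix k :: nat and l j s a b n and w v :: "3 list"
    assume k: "k \<in> {1..3}" and ab: "a \<noteq> b" and w: "w = s @ a # replicate n b"
      and v: "v = s @ b # replicate n a" and len: "3 \<le> length w"
    let ?m = "length w"
    let ?g = "\<lambda>z. (tot (\<lambda>c. fsm k l w c z) - 3 * fsm k l w b z) + (tot (\<lambda>c. fsm k l v c z) - 3 * fsm k l v a z)"
    let ?h = "\<lambda>z. 3/2 * 5 ^ ?m * psi (z / 5 ^ ?m) - z :: complex"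
    have five: "(125::real) \<le> 5 ^ ?m" using power_increasing[OF len, of "5::real"] by simp
    have small: "norm (z / 5 ^ ?m) < 6" if "norm z < Lam" for z :: complex
    proof -
      have "norm z / 5 ^ ?m \<le> norm z / 125" using five by (intro divide_left_mono) auto
      then have "norm z / 5 ^ ?m < 6" using that Lam_less by linarith
      then show ?thesis by (simp add: norm_divide norm_power)
    qed
    have htot: "(\<lambda>z. tot (\<lambda>c. fsm k l u c z)) holomorphic_on ball 0 6" for u
      by (rule holomorphic_tot[OF holomorphic_fsm])
    have hg: "?g holomorphic_on ball 0 6"
      by (intro holomorphic_intros holomorphic_fsm htot)
    have ct: "cf (\<lambda>z. tot (\<lambda>c. fsm k l u c z)) j = of_real (tot (Pc k l j u))" for u
      unfolding tot_def by (subst cf_sum) (auto simp: holomorphic_fsm of_real_Pc)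
    have hd: "(\<lambda>z. tot (\<lambda>c. fsm k l u c z) - 3 * fsm k l u c z) holomorphic_on ball 0 6" for u c
      by (intro holomorphic_intros holomorphic_fsm htot)
    have "cf (\<lambda>z. tot (\<lambda>c. fsm k l u c z) - 3 * fsm k l u c z) j = of_real (tot (Pc k l j u) - 3 * Pc k l j u c)" for u c
      by (subst cf_diff) (auto simp: htot holomorphic_fsm cf_cmult ct of_real_Pc intro!: holomorphic_intros)
    then have cg: "cf ?g j = of_real ((tot (Pc k l j w) - 3 * Pc k l j w b) + (tot (Pc k l j v) - 3 * Pc k l j v a))"
      by (subst cf_add[OF hd hd]) simp
    have "cf (\<lambda>z. 3/2 * 5 ^ ?m * ?g z - z * fsm k l w b z) j
        = of_real (3/2 * 5 ^ ?m * ((tot (Pc k l j w) - 3 * Pc k l j w b) + (tot (Pc k l j v) - 3 * Pc k l j v a)) - Pd k l j w b)"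
      (is "_ = of_real ?L")
    proof -
      have "cf (\<lambda>z. 3/2 * 5 ^ ?m * ?g z - z * fsm k l w b z) j
          = cf (\<lambda>z. 3/2 * 5 ^ ?m * ?g z) j - cf (\<lambda>z. z * fsm k l w b z) j"
        by (rule cf_diff) (intro holomorphic_intros holomorphic_fsm hg)+
      also have "cf (\<lambda>z. 3/2 * 5 ^ ?m * ?g z) j = 3/2 * 5 ^ ?m * cf ?g j"
        by (rule cf_cmult[OF hg])
      also have "cf (\<lambda>z. z * fsm k l w b z) j = of_real (Pd k l j w b)"
        unfolding cf_X_mult[OF holomorphic_fsm] Pd_def by (simp add: of_real_Pc)
      finally show ?thesis unfolding cg by simp
    qed
    moreover have "cf (\<lambda>z. 3/2 * 5 ^ ?m * ?g z - z * fsm k l w b z) j = cf (\<lambda>z. ?h z * fbig k l w b z) j"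
    proof (rule cf_cong[of 6])
      fix z :: complex assume z: "norm z < 6"
      obtain a' b' u where "w = a' # b' # u" using len by (metis Suc_le_length_iff numeral_3_eq_3)
      then have "fsm k l w b z = fbig k l w b z" using fsm_fbig[of z] z by simp
      moreover have "?g z = psi (z / 5 ^ ?m) * fsm k l w b z"
        by (rule fsm_junction_sum[OF _ ab w v]) (use z in simp)
      ultimately show "3/2 * 5 ^ ?m * ?g z - z * fsm k l w b z = ?h z * fbig k l w b z"
        by (simp add: algebra_simps)
    qed auto
    moreover have "norm (cf (\<lambda>z. ?h z * fbig k l w b z) j) \<le> (r\<^sup>2 / 5 ^ ?m * M) / r ^ j"
    proof (rule cf_bound[OF _ r])
      show "(\<lambda>z. ?h z * fbig k l w b z) holomorphic_on ball 0 Lam"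
        by (intro holomorphic_intros holomorphic_psi_compose holomorphic_fbig) (use small in auto)
      fix z :: complex assume z: "norm z \<le> r"
      have "?h z = 3/2 * 5 ^ ?m * (psi (z / 5 ^ ?m) - 2/3 * (z / 5 ^ ?m))" by (simp add: algebra_simps)
      then have "norm (?h z) = 3/2 * 5 ^ ?m * norm (psi (z / 5 ^ ?m) - 2/3 * (z / 5 ^ ?m))"
        by (simp only: norm_mult norm_divide norm_power norm_numeral)
      also have "\<dots> \<le> 3/2 * 5 ^ ?m * ((norm (z / 5 ^ ?m))\<^sup>2 / 36)"
        using small[of z] z r by (intro mult_left_mono psi_approx) auto
      also have "\<dots> = (norm z)\<^sup>2 / 24 / 5 ^ ?m"
        by (simp add: norm_divide norm_power power_divide power2_eq_square)
      also have "\<dots> \<le> r\<^sup>2 / 1 / 5 ^ ?m"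
        using z by (intro divide_right_mono frac_le power_mono) auto
      finally have "norm (?h z) \<le> r\<^sup>2 / 5 ^ ?m" by simp
      then show "norm (?h z * fbig k l w b z) \<le> r\<^sup>2 / 5 ^ ?m * M"
        unfolding norm_mult using M(2)[OF k len z] by (intro mult_mono) auto
    qed
    ultimately have "norm (of_real ?L :: complex) \<le> (r\<^sup>2 / 5 ^ ?m * M) / r ^ j" by simp
    then show "\<bar>?L\<bar> \<le> r\<^sup>2 * M / 5 ^ ?m / r ^ j" unfolding norm_of_real by simp
  qed (use M in auto)
qed

text \<open>
  Re-expansion of the germ centred at \<open>q\<^sub>l\<^sub>'\<close> about \<open>q\<^sub>l\<close>: value, flux and difference are read off on
  the level-two cell at \<open>q\<^sub>l\<close>, which makes the coefficients holomorphic for \<open>\<bar>\<mu>\<bar> < Lam\<close>.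
\<close>

definition mb :: "nat \<Rightarrow> 3 \<Rightarrow> 3 \<Rightarrow> nat \<Rightarrow> complex \<Rightarrow> complex" where
  "mb k l' l k' \<mu> = (if k' = 1 then lev2 k l' \<mu> l l l
     else if k' = 2 then flux (psi (\<mu>/25)) (lev2 k l' \<mu> l l) l / (2 * (9/25 * sgerm (\<mu>/25)))
     else 25 * dif (lev2 k l' \<mu> l l) l / hat (\<mu>/25))"

lemma holomorphic_mb: "mb k l' l k' holomorphic_on ball 0 Lam"
proof -
  have ne: "sgerm (z/25) \<noteq> 0" "hat (z/25) \<noteq> 0" if "z \<in> ball 0 Lam" for z :: complex
    using sgerm_nonzero[OF Lam_facts(1)[OF that]] hat_nonzero[OF less_imp_le[OF Lam_facts(1)[OF that]]] by auto
  show ?thesis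
  unfolding mb_def[abs_def] flux_def dif_def
  by (intro holomorphic_if holomorphic_intros holomorphic_lev2 holomorphic_tot
      holomorphic_compose_25[OF psi_holomorphic] holomorphic_compose_25[OF sgerm_holomorphic]
      holomorphic_compose_25[OF hat_holomorphic])
    (use ne in auto)
qed

lemma mb_small:
  assumes "norm \<mu> < 6"
  shows "mb k l' l 1 \<mu> = germ k l' \<mu> l"
    "mb k l' l 2 \<mu> = flux (psi \<mu>) (germ k l' \<mu>) l / (2 * sgerm \<mu>)"
    "mb k l' l 3 \<mu> = dif (germ k l' \<mu>) l / hat \<mu>"
proof -
  have n: "norm \<mu> \<le> 6" using assms by simp
  note s = small_facts[OF n]
  have E2: "lev2 k l' \<mu> l l = E \<mu> (germ k l' \<mu>) [l, l]"
    using fsm_fbig[OF n, of k l' l l "[]"] by (auto simp: fsm_def fun_eq_iff)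
  show "mb k l' l 1 \<mu> = germ k l' \<mu> l"
    by (simp add: mb_def E2)
  have f: "flux (psi (\<mu>/25)) (E \<mu> (germ k l' \<mu>) [l, l]) l = rfac \<mu> 2 * flux (psi \<mu>) (germ k l' \<mu>) l"
    using flux_replicate[OF regular_small[OF n], of 2 "germ k l' \<mu>" l] by (simp add: numeral_2_eq_2)
  have g: "9/25 * sgerm (\<mu>/25) = rfac \<mu> 2 * sgerm \<mu>"
    using rfac_sgerm[OF n, of 2] by (simp add: power2_eq_square)
  have "sgerm (\<mu>/25) \<noteq> 0" using assms by (intro sgerm_nonzero) (simp add: norm_divide)
  then have "rfac \<mu> 2 \<noteq> 0" using g by auto
  then show "mb k l' l 2 \<mu> = flux (psi \<mu>) (germ k l' \<mu>) l / (2 * sgerm \<mu>)"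
    unfolding mb_def E2 f g by simp
  have d1: "dif (E \<mu> (germ k l' \<mu>) [l, l]) l = dif (germ k l' \<mu>) l / (5 + pp \<mu>) / (5 + tt \<mu>)"
    using s by (simp add: dif_sub_self flip: tt_def)
  have d2: "hat \<mu> = (5 + pp \<mu>) * (5 + tt \<mu>) * hat (\<mu>/25) / 25"
    unfolding hat_bb[OF n] bb_def by simp
  show "mb k l' l 3 \<mu> = dif (germ k l' \<mu>) l / hat \<mu>"
    unfolding mb_def E2 d1 d2 by simp
qed

lemma atLeastAtMost_1_3: "{1..3::nat} = {1, 2, 3}" by auto

lemma fsm_change_centre:
  assumes "norm \<mu> < 6"
  shows "fsm k l' w i \<mu> = (\<Sum>k'\<in>{1..3}. mb k l' l k' \<mu> * fsm k' l w i \<mu>)"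
proof -
  have "E \<mu> (germ k l' \<mu>) w = E \<mu> (\<lambda>j. mb k l' l 1 \<mu> * germ 1 l \<mu> j + mb k l' l 2 \<mu> * germ 2 l \<mu> j
      + mb k l' l 3 \<mu> * germ 3 l \<mu> j) w"
    unfolding mb_small[OF assms] germ_span[OF assms, of "germ k l' \<mu>" l, symmetric] ..
  also have "\<dots> = (\<lambda>j. mb k l' l 1 \<mu> * E \<mu> (germ 1 l \<mu>) w j + mb k l' l 2 \<mu> * E \<mu> (germ 2 l \<mu>) w j
      + mb k l' l 3 \<mu> * E \<mu> (germ 3 l \<mu>) w j)"
    unfolding E_add E_cmult ..
  finally show ?thesis unfolding fsm_def atLeastAtMost_1_3 by simp
qed

lemma mb_Reals: "k' \<in> {1..3} \<Longrightarrow> \<bar>x\<bar> < 6 \<Longrightarrow> mb k l' l k' (of_real x) \<in> \<real>"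
proof -
  assume k': "k' \<in> {1..3}" and x: "\<bar>x\<bar> < 6"
  have n: "norm (complex_of_real x) < 6" using x by simp
  note r = small_Reals[OF x] germ_Reals[OF x]
  have "sgerm (complex_of_real x) \<in> \<real>" using germ_Reals[OF x, of 2 0 1] by (simp add: germ_def)
  then show ?thesis
    using k' r unfolding atLeastAtMost_1_3
    by (auto simp only: mb_small[OF n] insert_iff flux_def dif_def tot_def empty_iff
        intro!: Reals_add Reals_diff Reals_divide Reals_mult sum_in_Reals Reals_numeral)
qed

definition Mc :: "nat \<Rightarrow> 3 \<Rightarrow> 3 \<Rightarrow> nat \<Rightarrow> nat \<Rightarrow> real" where
  "Mc k l' l k' a = Re (cf (mb k l' l k') a)"

text \<open>The inequality norm (psi x) \<le> norm x at -\<open>z0\<close> reads 3 \<le>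
  \<open>z0\<close>, so \<open>Lam\<close> is at least 75.\<close>

lemma Lam_ge_6: "6 \<le> Lam"
proof -
  have "norm (psi (- z0)) \<le> norm (- z0)" using z0 by (intro norm_psi_le') simp
  then show ?thesis using z0 by (simp add: Lam_def)
qed

lemma holomorphic_mb6: "mb k l' l k' holomorphic_on ball 0 6"
  by (rule holomorphic_on_subset[OF holomorphic_mb]) (use Lam_ge_6 in auto)

lemma of_real_Mc: "k' \<in> {1..3} \<Longrightarrow> of_real (Mc k l' l k' a) = cf (mb k l' l k') a"
  unfolding Mc_def by (intro of_real_Re cf_Reals holomorphic_mb6 mb_Reals)

lemma Pc_change_centre:
  "Pc k l' j w i = (\<Sum>k'\<in>{1..3}. \<Sum>a=0..j. Mc k l' l k' a * Pc k' l (j - a) w i)"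
proof (rule Pc_eqI)
  have "cf (fsm k l' w i) j = cf (\<lambda>\<mu>. \<Sum>k'\<in>{1..3}. mb k l' l k' \<mu> * fsm k' l w i \<mu>) j"
    by (rule cf_cong[of 6], rule fsm_change_centre, simp_all)
  also have "\<dots> = (\<Sum>k'\<in>{1..3}. cf (\<lambda>\<mu>. mb k l' l k' \<mu> * fsm k' l w i \<mu>) j)"
    by (rule cf_sum) (intro holomorphic_intros holomorphic_mb6 holomorphic_fsm)
  also have "\<dots> = (\<Sum>k'\<in>{1..3}. \<Sum>a=0..j. cf (mb k l' l k') a * cf (fsm k' l w i) (j - a))"
    by (intro sum.cong refl cf_mult holomorphic_mb6 holomorphic_fsm)
  also have "\<dots> = of_real (\<Sum>k'\<in>{1..3}. \<Sum>a=0..j. Mc k l' l k' a * Pc k' l (j - a) w i)"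
    by (simp add: of_real_Mc of_real_Pc)
  finally show "cf (fsm k l' w i) j = of_real (\<Sum>k'\<in>{1..3}. \<Sum>a=0..j. Mc k l' l k' a * Pc k' l (j - a) w i)" .
qed

lemma Mc_bound:
  assumes r: "0 < r" "r < Lam"
  obtains C where "0 \<le> C" "\<And>a. \<bar>Mc k l' l k' a\<bar> \<le> C / r ^ a"
proof -
  have "continuous_on (cball 0 r) (mb k l' l k')"
    by (rule holomorphic_on_imp_continuous_on[OF holomorphic_on_subset[OF holomorphic_mb]]) (use r in auto)
  then have "bounded (mb k l' l k' ` cball 0 r)"
    by (intro compact_imp_bounded compact_continuous_image) auto
  then obtain C where C: "0 < C" "\<And>z. norm z \<le> r \<Longrightarrow> norm (mb k l' l k' z) \<le> C"
    by (auto simp: bounded_pos)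
  have "\<bar>Mc k l' l k' a\<bar> \<le> C / r ^ a" for a
    unfolding Mc_def by (rule order_trans[OF abs_Re_le_cmod cf_bound[OF holomorphic_mb r C(2)]])
  then show ?thesis using that[of C] C(1) by simp
qed

section \<open>Geometry of the gasket\<close>

locale gasket =
  fixes q :: "3 \<Rightarrow> real^2"
  assumes equi: "equilateral q"
begin

text \<open>Barycentric coordinates: the second factor is twice the vector from the midpoint of the
  opposite side to q_i, which is perpendicular to that side.\<close>

definition bc :: "3 \<Rightarrow> real^2 \<Rightarrow> real" where
  "bc i x = ((x - q (i + 1)) \<bullet> ((q i - q (i + 1)) + (q i - q (i - 1))))
     / ((q i - q (i + 1)) \<bullet> ((q i - q (i + 1)) + (q i - q (i - 1))))"

lemma bc_q: "bc i (q j) = of_bool (i = j)"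
proof -
  obtain s where s: "s > 0" "\<And>i j. i \<noteq> j \<Longrightarrow> dist (q i) (q j) = s" using equi by (auto simp: equilateral_def)
  let ?u = "q i - q (i + 1)" and ?v = "q i - q (i - 1)"
  have u: "?u \<bullet> ?u = s\<^sup>2" and v: "?v \<bullet> ?v = s\<^sup>2"
    using s(2)[of i "i + 1"] s(2)[of i "i - 1"] by (auto simp: dist_norm power2_norm_eq_inner[symmetric])
  have "(?u - ?v) \<bullet> (?u - ?v) = s\<^sup>2"
    using s(2)[of "i - 1" "i + 1"] by (simp add: dist_norm power2_norm_eq_inner[symmetric])
  then have uv: "?u \<bullet> ?v = s\<^sup>2 / 2" using u v by (simp only: inner_diff_left inner_diff_right) (simp add: inner_commute)
  have d: "?u \<bullet> (?u + ?v) = 3/2 * s\<^sup>2" unfolding inner_add_right u uv by simp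
  have dn: "?u \<bullet> (?u + ?v) \<noteq> 0" unfolding d using s(1) by simp
  have "q (i - 1) - q (i + 1) = ?u - ?v" by simp
  then have "(q (i - 1) - q (i + 1)) \<bullet> (?u + ?v) = (?u - ?v) \<bullet> (?u + ?v)" by (simp only:)
  also have "\<dots> = ?u \<bullet> ?u - ?v \<bullet> ?v"
  proof -
    have "(a - b) \<bullet> (a + b) = a \<bullet> a - b \<bullet> b" for a b :: "real^2"
      by (simp add: inner_diff_left inner_diff_right inner_add_left inner_add_right inner_commute)
    then show ?thesis .
  qed
  also have "\<dots> = 0" unfolding u v by simp
  finally have z: "(q (i - 1) - q (i + 1)) \<bullet> (?u + ?v) = 0" .
  show ?thesis
    by (rule three_cases[of j i]) (use dn z in \<open>simp_all only: bc_def, simp_all\<close>)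
qed

lemma q_eq_iff [simp]: "q i = q j \<longleftrightarrow> i = j"
  using bc_q[of i i] bc_q[of i j] by auto

lemma F_alt: "F q i x = (1/2) *\<^sub>R x + (1/2) *\<^sub>R q i"
  by (simp add: F_def scaleR_right_distrib)

lemma bc_F: "bc j (F q i x) = (bc j x + of_bool (j = i)) / 2"
proof -
  have "bc j (F q i x) = (bc j x + bc j (q i)) / 2"
  proof -
    have "((1/2) *\<^sub>R x + (1/2) *\<^sub>R y - p) \<bullet> N = ((x - p) \<bullet> N + (y - p) \<bullet> N) / 2" for x y p N :: "real^2"
      by (simp add: inner_diff_left inner_add_left field_simps)
    then have "((1/2) *\<^sub>R x + (1/2) *\<^sub>R y - p) \<bullet> N / d = ((x - p) \<bullet> N / d + (y - p) \<bullet> N / d) / 2"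
      for x y p N :: "real^2" and d :: real
      by (simp only: add_divide_distrib divide_divide_eq_left mult.commute)
    then show ?thesis unfolding bc_def F_alt .
  qed
  then show ?thesis by (simp add: bc_q)
qed

lemma F_q_self [simp]: "F q a (q a) = q a" by (simp only: F_def scaleR_half_double)

text \<open>The closed triangle. The representation of x is part of the definition, which yields
  boundedness and the recognition of corners directly.\<close>

definition T :: "(real^2) set" where
  "T = {x. (\<forall>j. 0 \<le> bc j x) \<and> (\<Sum>j\<in>UNIV. bc j x) = 1 \<and> x = (\<Sum>j\<in>UNIV. bc j x *\<^sub>R q j)}"

lemma continuous_bc: "continuous_on S (bc i)"
  unfolding bc_def[abs_def] divide_inverse by (intro continuous_intros)

lemma bc_le_1: "x \<in> T \<Longrightarrow> bc j x \<le> 1"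
  using sum_mono2[of UNIV "{j}" "\<lambda>j. bc j x"] by (auto simp: T_def)

lemma T_sum: "x \<in> T \<Longrightarrow> bc i x + bc (i + 1) x + bc (i - 1) x = 1"
  using tot_eq[of "\<lambda>j. bc j x" i] by (simp add: T_def tot_def)

lemma q_in_T: "q i \<in> T"
  unfolding T_def by (auto simp: bc_q of_bool_def if_distrib[of "\<lambda>c. c *\<^sub>R _"] cong: if_cong)

lemma F_in_T: assumes "x \<in> T" shows "F q i x \<in> T"
proof -
  have 1: "x = (\<Sum>j\<in>UNIV. bc j x *\<^sub>R q j)" "(\<Sum>j\<in>UNIV. bc j x) = 1" "\<And>j. 0 \<le> bc j x" using assms by (auto simp: T_def)
  have 2: "q i = (\<Sum>j\<in>UNIV. of_bool (j = i) *\<^sub>R q j)"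
    by (simp add: of_bool_def if_distrib[of "\<lambda>c. c *\<^sub>R _"] cong: if_cong)
  have "F q i x = (\<Sum>j\<in>UNIV. (1/2) *\<^sub>R (bc j x *\<^sub>R q j)) + (\<Sum>j\<in>UNIV. (1/2) *\<^sub>R (of_bool (j = i) *\<^sub>R q j))"
    unfolding F_alt using arg_cong[OF 1(1), of "scaleR (1/2)"] arg_cong[OF 2, of "scaleR (1/2)"]
    by (simp only: scaleR_sum_right)
  also have "\<dots> = (\<Sum>j\<in>UNIV. bc j (F q i x) *\<^sub>R q j)"
    unfolding bc_F sum.distrib[symmetric] by (intro sum.cong) (auto simp: scaleR_left_distrib[symmetric] add_divide_distrib)
  finally have "F q i x = (\<Sum>j\<in>UNIV. bc j (F q i x) *\<^sub>R q j)" .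
  moreover have "(\<Sum>j\<in>UNIV. bc j (F q i x)) = 1"
    unfolding bc_F using 1(2) by (simp add: sum_divide_distrib[symmetric] sum.distrib of_bool_def)
  moreover have "\<forall>j. 0 \<le> bc j (F q i x)" using 1(3) by (simp add: bc_F)
  ultimately show ?thesis unfolding T_def mem_Collect_eq by blast
qed

lemma closed_T: "closed T"
proof -
  have "T = (\<Inter>j. {x. 0 \<le> bc j x}) \<inter> {x. (\<Sum>j\<in>UNIV. bc j x) = 1} \<inter> {x. x = (\<Sum>j\<in>UNIV. bc j x *\<^sub>R q j)}"
    by (auto simp: T_def)
  moreover have "closed \<dots>"
    by (intro closed_Int closed_INT ballI closed_Collect_le closed_Collect_eq continuous_intros continuous_bc)
  ultimately show ?thesis by simp
qed

lemma bounded_T: "bounded T"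
proof (rule boundedI)
  fix x assume x: "x \<in> T"
  have "x = (\<Sum>j\<in>UNIV. bc j x *\<^sub>R q j)" using x by (auto simp: T_def)
  then have "norm x \<le> (\<Sum>j\<in>UNIV. norm (bc j x *\<^sub>R q j))" by (metis norm_sum)
  also have "\<dots> \<le> (\<Sum>j\<in>UNIV. norm (q j))"
    using x bc_le_1[OF x] by (intro sum_mono) (auto simp: T_def intro!: mult_left_le_one_le)
  finally show "norm x \<le> (\<Sum>j\<in>UNIV. norm (q j))" .
qed

section \<open>Existence and uniqueness of the self-similar set\<close>

definition Vs :: "(real^2) set" where "Vs = (\<Union>m. V q m)"

lemma V_mono_Suc: "V q m \<subseteq> V q (Suc m)"
proof (induction m)
  case 0
  show ?case
  proof
    fix x assume "x \<in> V q 0"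
    then obtain i where "x = F q i (q i)" by auto
    then have "x \<in> F q i ` range q" by blast
    then show "x \<in> V q (Suc 0)" by (simp only: V.simps) (rule UN_I[OF UNIV_I])
  qed
next
  case (Suc m)
  have "(\<Union>i. F q i ` V q m) \<subseteq> (\<Union>i. F q i ` V q (Suc m))" by (intro UN_mono image_mono Suc) auto
  then show ?case by (simp only: V.simps(2))
qed

lemma V_mono: "m \<le> n \<Longrightarrow> V q m \<subseteq> V q n"
  using V_mono_Suc by (rule lift_Suc_mono_le)

lemma V_subset_T: "V q m \<subseteq> T"
  by (induction m) (auto simp: q_in_T F_in_T)

lemma continuous_F: "continuous_on S (F q i)"
  unfolding F_def[abs_def] by (intro continuous_intros)

definition attractor :: "(real^2) set \<Rightarrow> bool" where
  "attractor K \<longleftrightarrow> K \<noteq> {} \<and> compact K \<and> K = (\<Union>i. F q i ` K)"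

lemma F_Vs: "F q i ` Vs \<subseteq> Vs"
  unfolding Vs_def using V.simps(2) by fastforce

lemma Vs_subset: "Vs \<subseteq> (\<Union>i. F q i ` Vs)"
proof
  fix x assume "x \<in> Vs"
  then obtain m where "x \<in> V q m" by (auto simp: Vs_def)
  then have "x \<in> V q (Suc m)" using V_mono_Suc by blast
  then show "x \<in> (\<Union>i. F q i ` Vs)" by (auto simp: Vs_def)
qed

lemma attractor_closure: "attractor (closure Vs)"
proof -
  have "Vs \<subseteq> T" using V_subset_T by (auto simp: Vs_def)
  then have comp: "compact (closure Vs)" using bounded_subset[OF bounded_T] by (simp add: compact_closure)
  have "q 0 \<in> Vs" unfolding Vs_def by (auto intro!: exI[of _ 0])
  then have ne: "closure Vs \<noteq> {}" using closure_subset by blast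
  have "F q i ` closure Vs \<subseteq> closure Vs" for i
    by (rule image_closure_subset[OF continuous_F closed_closure]) (use F_Vs closure_subset in blast)
  moreover have "closure Vs \<subseteq> (\<Union>i. F q i ` closure Vs)"
  proof (rule closure_minimal)
    show "Vs \<subseteq> (\<Union>i. F q i ` closure Vs)" using Vs_subset closure_subset[of Vs] by blast
    show "closed (\<Union>i. F q i ` closure Vs)"
      by (intro closed_UN compact_imp_closed compact_continuous_image[OF continuous_F comp] ballI) auto
  qed
  ultimately show ?thesis unfolding attractor_def using comp ne by blast
qed

lemma dist_F: "dist (F q i x) (F q i y) = dist x y / 2"
proof -
  have "F q i x - F q i y = (1/2) *\<^sub>R (x - y)" by (simp add: F_alt scaleR_diff_right)
  then show ?thesis by (simp add: dist_norm)
qed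

text \<open>A point x of K farthest from L is the image of some y in K; the maps halve distances and
  preserve L, so the maximal distance is at most half of itself.\<close>

lemma attractor_subset:
  assumes K: "attractor K" and L: "attractor L" shows "K \<subseteq> L"
proof -
  have K': "compact K" "K \<noteq> {}" and L': "closed L" "L \<noteq> {}" using K L by (auto simp: attractor_def compact_imp_closed)
  obtain x where x: "x \<in> K" "\<And>y. y \<in> K \<Longrightarrow> infdist y L \<le> infdist x L"
    using continuous_attains_sup[OF K' continuous_on_infdist[OF continuous_on_id], of L] by auto
  obtain i y where y: "y \<in> K" "x = F q i y" using K x(1) unfolding attractor_def by blast
  obtain z where z: "z \<in> L" "infdist y L = dist y z" using infdist_attains_inf[OF L'] by metis
  have "F q i z \<in> L" using L z unfolding attractor_def by blast
  then have "infdist x L \<le> dist (F q i y) (F q i z)" unfolding y(2) by (rule infdist_le)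
  also have "\<dots> \<le> infdist x L / 2" using x(2)[OF y(1)] z(2) by (simp add: dist_F)
  finally have "infdist x L \<le> 0" by simp
  then have "infdist y L = 0" if "y \<in> K" for y using x(2)[OF that] infdist_nonneg[of y L] by linarith
  then show ?thesis using in_closed_iff_infdist_zero[OF L'] by blast
qed

lemma SG_eq: "SG q = closure Vs"
proof -
  have "SG q = (THE K. attractor K)" by (simp add: SG_def attractor_def)
  also have "\<dots> = closure Vs"
    by (rule the_equality) (use attractor_closure attractor_subset in blast)+
  finally show ?thesis .
qed

lemma attractor_SG: "attractor (SG q)" using attractor_closure by (simp add: SG_eq)

lemma SG_fix: "SG q = (\<Union>i. F q i ` SG q)" and compact_SG: "compact (SG q)" and SG_ne: "SG q \<noteq> {}"
  using attractor_SG by (auto simp: attractor_def)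

lemma F_in_SG: "x \<in> SG q \<Longrightarrow> F q i x \<in> SG q" using SG_fix by blast

lemma V_subset_SG: "V q m \<subseteq> SG q" unfolding SG_eq using closure_subset[of Vs] by (auto simp: Vs_def)

lemma q_in_SG: "q i \<in> SG q" using V_subset_SG[of 0] by auto

lemma SG_subset_T: "SG q \<subseteq> T"
  unfolding SG_eq by (rule closure_minimal[OF _ closed_T]) (use V_subset_T in \<open>auto simp: Vs_def\<close>)

lemma F_inj: "F q i x = F q i y \<longleftrightarrow> x = y" by (simp add: F_def)

lemma sum_three: "(\<Sum>j\<in>UNIV. f j) = f l + f (l + 1) + f (l - (1::3))" for f :: "3 \<Rightarrow> 'b::comm_monoid_add"
  unfolding UNIV_three[of l] by (simp add: add.assoc)

lemma T_corner: assumes "x \<in> T" "bc j x = 1" shows "x = q j"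
proof -
  have "0 \<le> bc (j + 1) x" "0 \<le> bc (j - 1) x" using assms by (auto simp: T_def)
  then have 0: "bc (j + 1) x = 0" "bc (j - 1) x = 0" using T_sum[OF assms(1), of j] assms(2) by linarith+
  have "x = (\<Sum>j\<in>UNIV. bc j x *\<^sub>R q j)" using assms(1) by (auto simp: T_def)
  also have "\<dots> = q j" unfolding sum_three[of _ j] using 0 assms(2) by simp
  finally show ?thesis .
qed

text \<open>Comparing the coordinate of index b gives \<open>bc b x = bc b y + 1\<close>;
  coordinates lie between 0 and 1, so x is the corner q_b.\<close>

lemma F_eq_F:
  assumes "x \<in> SG q" "y \<in> SG q" "F q a x = F q b y" "a \<noteq> b"
  shows "x = q b" "y = q a"
proof -
  have *: "x = q b" if x: "x \<in> T" and y: "y \<in> T" and e: "F q a x = F q b y" and ab: "a \<noteq> b" for x y a b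
  proof -
    have "bc b (F q a x) = bc b (F q b y)" using e by simp
    then have "bc b x = bc b y + 1" using ab by (simp add: bc_F)
    moreover have "0 \<le> bc b y" using y by (auto simp: T_def)
    ultimately have "bc b x = 1" using bc_le_1[OF x, of b] by linarith
    then show ?thesis by (rule T_corner[OF x])
  qed
  show "x = q b" "y = q a"
    using *[OF _ _ assms(3,4)] *[OF _ _ assms(3)[symmetric] assms(4)[symmetric]] assms(1,2) SG_subset_T by blast+
qed

lemma F_q_commute: "F q a (q b) = F q b (q a)" by (simp add: F_def add.commute)

lemma F_eq_q: assumes "x \<in> SG q" "F q i x = q j" shows "i = j" "x = q j"
proof -
  have x: "x \<in> T" using assms SG_subset_T by blast
  have "bc j (F q i x) = 1" using assms(2) bc_q[of j j] by simp
  then have "bc j x + of_bool (j = i) = 2" by (simp add: bc_F)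
  then show "i = j" "x = q j" using bc_le_1[OF x, of j] T_corner[OF x, of j] by (cases "j = i"; simp)+
qed

section \<open>Addresses of points\<close>

lemma Fw_append: "Fw q (u @ v) x = Fw q u (Fw q v x)"
  by (induction u) auto

lemma Fw_inj: "Fw q w x = Fw q w y \<longleftrightarrow> x = y"
  by (induction w) (auto simp: F_inj)

lemma Fw_in_SG: "x \<in> SG q \<Longrightarrow> Fw q w x \<in> SG q"
  by (induction w) (auto simp: F_in_SG)

lemma Fw_replicate [simp]: "Fw q (replicate n i) (q i) = q i"
  by (induction n) auto

lemma Fw_eq_q: "x \<in> SG q \<Longrightarrow> Fw q w x = q j \<Longrightarrow> w = replicate (length w) j \<and> x = q j"
proof (induction w)
  case (Cons i w)
  then have "F q i (Fw q w x) = q j" by simp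
  from F_eq_q[OF Fw_in_SG[OF Cons.prems(1)] this] show ?case using Cons by auto
qed auto

lemma Fw_junction: "Fw q (s @ a # replicate n b) (q b) = Fw q (s @ b # replicate n a) (q a)"
  by (simp add: Fw_append F_q_commute)

text \<open>After the common prefix the words split into letters a and b, and the point is the
  midpoint between these subcells; it is a corner of both, which forces all remaining letters to be
  constant.\<close>

lemma Fw_eq_Fw:
  "x \<in> SG q \<Longrightarrow> y \<in> SG q \<Longrightarrow> Fw q w x = Fw q v y \<Longrightarrow> length w = length v \<Longrightarrow> w \<noteq> v \<Longrightarrow>
   \<exists>s a b n. a \<noteq> b \<and> w = s @ a # replicate n b \<and> v = s @ b # replicate n a \<and> x = q b \<and> y = q a"
proof (induction w arbitrary: v)
  case (Cons a w)
  then obtain b v' where v: "v = b # v'" by (cases v) auto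
  have S: "Fw q w x \<in> SG q" "Fw q v' y \<in> SG q" using Cons Fw_in_SG by auto
  have e: "F q a (Fw q w x) = F q b (Fw q v' y)" using Cons v by simp
  show ?case
  proof (cases "a = b")
    case True
    then have "Fw q w x = Fw q v' y" "length w = length v'" "w \<noteq> v'" using e Cons v by (auto simp: F_inj)
    from Cons.IH[OF Cons.prems(1,2) this] obtain s a' b' n where
      "a' \<noteq> b'" "w = s @ a' # replicate n b'" "v' = s @ b' # replicate n a'" "x = q b'" "y = q a'" by blast
    then show ?thesis using v True by (intro exI[of _ "a # s"]) auto
  next
    case False
    from F_eq_F[OF S e False] have h: "Fw q w x = q b" "Fw q v' y = q a" by auto
    have "w = replicate (length w) b" "x = q b" "v' = replicate (length v') a" "y = q a"
      using Fw_eq_q[OF Cons.prems(1) h(1)] Fw_eq_q[OF Cons.prems(2) h(2)] by auto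
    moreover have "length v' = length w" using Cons v by simp
    ultimately show ?thesis using v False
      by (intro exI[of _ "[]"] exI[of _ a] exI[of _ b] exI[of _ "length w"]) auto
  qed
qed auto

text \<open>Independence of the address \<open>(w, i)\<close> of a point \<open>F\<^sub>w q\<^sub>i\<close>.\<close>

definition coherent :: "(3 list \<Rightarrow> 3 \<Rightarrow> 'b) \<Rightarrow> bool" where
  "coherent g \<longleftrightarrow> (\<forall>w i n. g (w @ replicate n i) i = g w i) \<and>
     (\<forall>s a b n. g (s @ a # replicate n b) b = g (s @ b # replicate n a) a)"

text \<open>Both addresses are prolonged to the same length by repeating their corner letters; the
  only coincidence left between different words is then the junction identity.\<close>

lemma coherentD:
  assumes g: "coherent g" and e: "Fw q w (q i) = Fw q v (q j)" shows "g w i = g v j"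
proof -
  let ?w = "w @ replicate (length v) i" and ?v = "v @ replicate (length w) j"
  have e': "Fw q ?w (q i) = Fw q ?v (q j)" using e by (simp add: Fw_append)
  have "g ?w i = g ?v j"
  proof (cases "?w = ?v")
    case True
    then have "i = j" using e' by (simp add: Fw_inj)
    then show ?thesis using True by metis
  next
    case False
    from Fw_eq_Fw[OF q_in_SG q_in_SG e' _ False] obtain s a b n where
      "?w = s @ a # replicate n b" "?v = s @ b # replicate n a" "q i = q b" "q j = q a" by auto
    then show ?thesis using g unfolding coherent_def by (metis q_eq_iff)
  qed
  then show ?thesis using g unfolding coherent_def by metis
qed

lemma V_eq: "V q m = {Fw q w (q i) | w i. length w = m}"
proof (induction m)
  case (Suc m)
  have "V q (Suc m) = {F q a (Fw q w (q i)) | a w i. length w = m}" by (auto simp: Suc)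
  also have "\<dots> = {Fw q w (q i) | w i. length w = Suc m}"
  proof safe
    fix w :: "3 list" and i assume l: "length w = Suc m"
    then obtain a v where "w = a # v" "length v = m" by (metis length_Suc_conv)
    then show "\<exists>a v j. Fw q w (q i) = F q a (Fw q v (q j)) \<and> length v = m" by auto
  qed (metis Fw.simps(2) comp_apply length_Cons)
  finally show ?case .
qed auto

section \<open>Cells and neighbours at a junction point\<close>

lemma decompose_word:
  "w \<noteq> replicate (length w) b \<Longrightarrow> \<exists>s a n. a \<noteq> b \<and> w = s @ a # replicate n (b::3)"
proof (induction w rule: rev_induct)
  case (snoc c w)
  show ?case
  proof (cases "c = b")
    case True
    then have "w \<noteq> replicate (length w) b"
      using snoc.prems by (auto simp: replicate_append_same[symmetric])
    then obtain s a n where "a \<noteq> b" "w = s @ a # replicate n b" using snoc.IH by blast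
    then show ?thesis using True by (intro exI[of _ s] exI[of _ a] exI[of _ "Suc n"]) (simp add: replicate_append_same)
  next
    case False
    then show ?thesis by (intro exI[of _ w] exI[of _ c] exI[of _ 0]) auto
  qed
qed auto

lemma decompose_unique:
  "s @ a # replicate n b = s' @ a' # replicate n' b \<Longrightarrow> a \<noteq> b \<Longrightarrow> a' \<noteq> b \<Longrightarrow> s = s' \<and> a = a' \<and> n = (n'::nat)"
proof (induction n arbitrary: n')
  case 0
  show ?case
  proof (cases n')
    case (Suc k)
    then have "s @ [a] = (s' @ a' # replicate k b) @ [b]" using 0 by (simp add: replicate_append_same)
    then have "a = b" by (metis last_snoc)
    then show ?thesis using 0 by simp
  qed (use 0 in auto)
next
  case (Suc n)
  show ?case
  proof (cases n')
    case 0
    then have "(s @ a # replicate n b) @ [b] = s' @ [a']" using Suc.prems by (simp add: replicate_append_same)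
    then have "b = a'" by (metis last_snoc)
    then show ?thesis using Suc.prems by simp
  next
    case (Suc k)
    then have "(s @ a # replicate n b) @ [b] = (s' @ a' # replicate k b) @ [b]"
      using Suc.prems by (simp add: replicate_append_same)
    then have "s @ a # replicate n b = s' @ a' # replicate k b" by simp
    then show ?thesis using Suc.IH[OF _ Suc.prems(2,3)] Suc by simp
  qed
qed

lemma junctionE:
  assumes "x \<in> V q m - V q 0"
  obtains s a b n where "a \<noteq> b" "length s + Suc n = m" "x = Fw q (s @ a # replicate n b) (q b)"
proof -
  obtain w i where w: "x = Fw q w (q i)" "length w = m" using assms by (auto simp: V_eq[of m])
  have "w \<noteq> replicate (length w) i"
  proof
    assume "w = replicate (length w) i"
    then have "x = q i" using w by (metis Fw_replicate)
    then show False using assms by auto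
  qed
  then obtain s a n where "a \<noteq> i" "w = s @ a # replicate n i" using decompose_word by blast
  then show ?thesis using that[of a i s n] w by auto
qed

lemma junction_not_V0: "a \<noteq> b \<Longrightarrow> Fw q (s @ a # replicate n b) (q b) \<notin> V q 0"
proof
  assume ab: "a \<noteq> b" and "Fw q (s @ a # replicate n b) (q b) \<in> V q 0"
  then obtain j where "Fw q (s @ a # replicate n b) (q b) = q j" by auto
  from Fw_eq_q[OF q_in_SG this] have "j = b" "s @ a # replicate n b = replicate (length s + Suc n) b" by auto
  then show False using ab by (metis in_set_conv_decomp in_set_replicate)
qed

text \<open>Uniqueness of the decomposition at the last letter different from b shows that only the
  cells of w and v contain x. Two different cells of one level meet in at most one point, so the two
  neighbour sets are disjoint.\<close>

lemma neighbours:
  assumes ab: "a \<noteq> b" and w: "w = s @ a # replicate n b" and v: "v = s @ b # replicate n a"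
    and x: "x = Fw q w (q b)"
  shows "{y. adj q (length w) x y} = (\<lambda>c. Fw q w (q c)) ` (UNIV - {b}) \<union> (\<lambda>c. Fw q v (q c)) ` (UNIV - {a})"
    "(\<lambda>c. Fw q w (q c)) ` (UNIV - {b}) \<inter> (\<lambda>c. Fw q v (q c)) ` (UNIV - {a}) = {}"
proof -
  have len: "length v = length w" by (simp add: w v)
  have x': "x = Fw q v (q a)" unfolding x w v by (rule Fw_junction)
  have wv: "w \<noteq> v" using ab by (simp add: w v)
  have xV: "x \<in> V q (length w)" using x by (auto simp: V_eq)
  have "c = b" if "Fw q w (q c) = Fw q v (q d)" for c d
  proof -
    from Fw_eq_Fw[OF q_in_SG q_in_SG that len[symmetric] wv] obtain s' a' b' n' where
      h: "a' \<noteq> b'" "w = s' @ a' # replicate n' b'" "v = s' @ b' # replicate n' a'" "c = b'" "d = a'" by auto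
    have "\<not> length s' < length s"
    proof
      assume l: "length s' < length s"
      have "w ! length s' = s ! length s'" "v ! length s' = s ! length s'" using l by (simp_all add: w v nth_append)
      moreover have "w ! length s' = a'" "v ! length s' = b'" unfolding h(2,3) by simp_all
      ultimately show False using h(1) by simp
    qed
    moreover have "\<not> length s < length s'"
    proof
      assume l: "length s < length s'"
      have "w ! length s = s' ! length s" "v ! length s = s' ! length s" unfolding h(2,3) using l by (simp_all add: nth_append)
      moreover have "w ! length s = a" "v ! length s = b" by (auto simp: w v)
      ultimately show False using ab by simp
    qed
    ultimately have "length s = length s'" by linarith
    then have "a' = a" "b' = b" using h w v by auto
    then show "c = b" using h by simp
  qed
  then show "(\<lambda>c. Fw q w (q c)) ` (UNIV - {b}) \<inter> (\<lambda>c. Fw q v (q c)) ` (UNIV - {a}) = {}" by auto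
  show "{y. adj q (length w) x y} = (\<lambda>c. Fw q w (q c)) ` (UNIV - {b}) \<union> (\<lambda>c. Fw q v (q c)) ` (UNIV - {a})"
  proof (intro subset_antisym subsetI)
    fix y assume "y \<in> {y. adj q (length w) x y}"
    then obtain u where y: "y \<in> V q (length w)" "y \<noteq> x" "length u = length w" "x \<in> cell q u" "y \<in> cell q u"
      by (auto simp: adj_def)
    obtain z where z: "z \<in> SG q" "x = Fw q u z" using y by (auto simp: cell_def)
    have u: "u = w \<or> u = v"
    proof (cases "u = w")
      case False
      have "Fw q w (q b) = Fw q u z" using x z by simp
      from Fw_eq_Fw[OF q_in_SG z(1) this y(3)[symmetric] False[symmetric]] obtain s' a' n' where
        h: "a' \<noteq> b" "w = s' @ a' # replicate n' b" "u = s' @ b # replicate n' a'" by auto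
      then show ?thesis using decompose_unique[of s a n b s' a' n'] ab w v by auto
    qed auto
    obtain y' where y': "y' \<in> SG q" "y = Fw q u y'" using y by (auto simp: cell_def)
    obtain u' c where u': "y = Fw q u' (q c)" "length u' = length w" using y(1) by (auto simp: V_eq)
    have "\<exists>d. y' = q d"
    proof (cases "u' = u")
      case True then show ?thesis using u' y' by (auto simp: Fw_inj)
    next
      case False
      have "Fw q u' (q c) = Fw q u y'" using u' y' by simp
      from Fw_eq_Fw[OF q_in_SG y'(1) this _ False] u' y show ?thesis by auto
    qed
    then obtain d where d: "y = Fw q u (q d)" using y' by auto
    show "y \<in> (\<lambda>c. Fw q w (q c)) ` (UNIV - {b}) \<union> (\<lambda>c. Fw q v (q c)) ` (UNIV - {a})"
      using u
    proof
      assume "u = w"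
      then have "d \<noteq> b" using d y(2) x by auto
      then show ?thesis using d \<open>u = w\<close> by auto
    next
      assume "u = v"
      then have "d \<noteq> a" using d y(2) x' by auto
      then show ?thesis using d \<open>u = v\<close> by auto
    qed
  next
    fix y assume "y \<in> (\<lambda>c. Fw q w (q c)) ` (UNIV - {b}) \<union> (\<lambda>c. Fw q v (q c)) ` (UNIV - {a})"
    then show "y \<in> {y. adj q (length w) x y}"
    proof
      assume "y \<in> (\<lambda>c. Fw q w (q c)) ` (UNIV - {b})"
      then obtain c where c: "y = Fw q w (q c)" "c \<noteq> b" by auto
      have "y \<in> V q (length w)" "y \<noteq> x" using c x by (auto simp: V_eq Fw_inj)
      moreover have "x \<in> cell q w" "y \<in> cell q w" using c x q_in_SG by (auto simp: cell_def)
      ultimately show ?thesis unfolding adj_def using xV by auto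
    next
      assume "y \<in> (\<lambda>c. Fw q v (q c)) ` (UNIV - {a})"
      then obtain c where c: "y = Fw q v (q c)" "c \<noteq> a" by auto
      have "y \<in> V q (length w)" "y \<noteq> x" using c x' len by (auto simp: V_eq Fw_inj)
      moreover have "x \<in> cell q v" "y \<in> cell q v" using c x' q_in_SG by (auto simp: cell_def)
      ultimately show ?thesis unfolding adj_def using xV len by auto
    qed
  qed
qed

lemma laplacian_sum:
  fixes u :: "real^2 \<Rightarrow> real"
  assumes ab: "a \<noteq> b" and w: "w = s @ a # replicate n b" and v: "v = s @ b # replicate n a"
    and x: "x = Fw q w (q b)"
  shows "(\<Sum>y | adj q (length w) x y. u y - u x)
    = (tot (\<lambda>c. u (Fw q w (q c))) - 3 * u x) + (tot (\<lambda>c. u (Fw q v (q c))) - 3 * u x)"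
proof -
  have x': "x = Fw q v (q a)" unfolding x w v by (rule Fw_junction)
  have *: "(\<Sum>y\<in>(\<lambda>c. Fw q z (q c)) ` (UNIV - {e}). u y - u x) = tot (\<lambda>c. u (Fw q z (q c))) - 3 * u x"
    if "x = Fw q z (q e)" for z e
  proof -
    have "(\<Sum>y\<in>(\<lambda>c. Fw q z (q c)) ` (UNIV - {e}). u y - u x) = (\<Sum>c\<in>UNIV - {e}. u (Fw q z (q c)) - u x)"
      by (subst sum.reindex) (auto simp: inj_on_def Fw_inj)
    also have "\<dots> = (\<Sum>c\<in>UNIV. u (Fw q z (q c)) - u x)"
      by (subst (2) sum.remove[of _ e]) (auto simp: that)
    also have "\<dots> = tot (\<lambda>c. u (Fw q z (q c))) - 3 * u x" by (simp add: sum_subtractf tot_def)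
    finally show ?thesis .
  qed
  show ?thesis
    unfolding neighbours(1)[OF assms]
    by (subst sum.union_disjoint) (auto simp: *[OF x] *[OF x'] neighbours(2)[OF assms] simp del: Int_iff)
qed

lemma finite_words: "finite {w :: 3 list. length w = m}"
  using finite_lists_length_eq[of "UNIV :: 3 set" m] by simp

lemma SG_cells: "SG q = (\<Union>w\<in>{w. length w = m}. cell q w)"
proof (induction m)
  case (Suc m)
  have "SG q = (\<Union>i. F q i ` SG q)" by (rule SG_fix)
  also have "\<dots> = (\<Union>i. F q i ` (\<Union>w\<in>{w. length w = m}. cell q w))" using Suc by simp
  also have "\<dots> = (\<Union>w\<in>{w. length w = Suc m}. cell q w)"
  proof safe
    fix w x assume "length (w :: 3 list) = Suc m" "x \<in> cell q w"
    then obtain a v where "w = a # v" "length v = m" "x \<in> cell q (a # v)" by (metis length_Suc_conv)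
    then show "x \<in> (\<Union>i. F q i ` (\<Union>w\<in>{w. length w = m}. cell q w))" by (auto simp: cell_def)
  next
    fix i w x assume "x \<in> cell q w" "m = length w"
    then have "F q i x \<in> cell q (i # w)" by (auto simp: cell_def)
    then show "F q i x \<in> (\<Union>w'\<in>{w'. length w' = Suc (length w)}. cell q w')" by (intro UN_I[of "i # w"]) auto
  qed
  finally show ?case .
qed (simp add: cell_def)

lemma continuous_Fw: "continuous_on S (Fw q w)"
  by (induction w) (auto intro!: continuous_on_compose2[OF continuous_F] simp: o_def id_def)

lemma compact_cell: "compact (cell q w)"
  unfolding cell_def by (rule compact_continuous_image[OF continuous_Fw compact_SG])

end

section \<open>Functions on the gasket from functions on words\<close>

context gasket
begin

lemma Vs_eq: "Vs = {Fw q w (q i) | w i. True}"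
  unfolding Vs_def V_eq by auto

lemma Fw_q_in_SG: "Fw q w (q i) \<in> SG q"
  by (simp add: Fw_in_SG q_in_SG)

lemma le_on_SG:
  fixes f :: "real^2 \<Rightarrow> real"
  assumes "continuous_on (SG q) f" "\<And>w i. f (Fw q w (q i)) \<le> c" "x \<in> SG q"
  shows "f x \<le> c"
  using continuous_le_on_closure[of Vs f x c] assms by (auto simp: SG_eq Vs_eq)

lemma eq_on_SG:
  fixes f g :: "real^2 \<Rightarrow> real"
  assumes "continuous_on (SG q) f" "continuous_on (SG q) g"
    "\<And>w i. f (Fw q w (q i)) = g (Fw q w (q i))" "x \<in> SG q"
  shows "f x = g x"
proof -
  have "f x - g x \<le> 0" "g x - f x \<le> 0"
    by (rule le_on_SG[where f = "\<lambda>x. f x - g x"], insert assms, auto intro!: continuous_intros)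
      (rule le_on_SG[where f = "\<lambda>x. g x - f x" and c = 0, simplified], insert assms, auto intro!: continuous_intros)
  then show ?thesis by simp
qed

text \<open>A telescoping sum along v; the last factor is the partial sum of the geometric series of
  ratio 4/5, whose total is 5.\<close>

lemma osc_subcell:
  fixes g :: "3 list \<Rightarrow> 3 \<Rightarrow> real"
  assumes g: "coherent g" and K: "\<And>w i j. \<bar>g w i - g w j\<bar> \<le> K * (4/5) ^ length w"
  shows "\<bar>g (w @ v) i - g w j\<bar> \<le> K * (4/5) ^ length w * (5 - 4 * (4/5) ^ length v)"
proof (induction v arbitrary: i rule: rev_induct)
  case (snoc c v)
  have c: "g (w @ v) c = g (w @ v @ [c]) c"
    using g unfolding coherent_def by (metis append_assoc replicate_0 replicate_Suc)
  have "\<bar>g (w @ v @ [c]) i - g w j\<bar> \<le> \<bar>g (w @ v @ [c]) i - g (w @ v @ [c]) c\<bar> + \<bar>g (w @ v) c - g w j\<bar>"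
    unfolding c by linarith
  also have "\<dots> \<le> K * (4/5) ^ length (w @ v @ [c]) + K * (4/5) ^ length w * (5 - 4 * (4/5) ^ length v)"
    by (intro add_mono K snoc.IH)
  also have "\<dots> = K * (4/5) ^ length w * (5 - 4 * (4/5) ^ length (v @ [c]))"
    by (simp add: power_add algebra_simps)
  finally show ?case by simp
qed (use K in simp)

text \<open>A vertex may lie in the cell of u although its address does not begin with u. It is then
  shared by two cells of the same level and hence a corner of the cell of u.\<close>

lemma osc_cell:
  fixes g :: "3 list \<Rightarrow> 3 \<Rightarrow> real"
  assumes g: "coherent g" and K: "\<And>w i j. \<bar>g w i - g w j\<bar> \<le> K * (4/5) ^ length w"
    and x: "Fw q w (q i) \<in> cell q u"
  shows "\<bar>g w i - g u j\<bar> \<le> 5 * K * (4/5) ^ length u"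
proof -
  have K0: "0 \<le> K" using K[of "[]" 0 0] by simp
  let ?w = "w @ replicate (length u) i" and ?m = "length u"
  let ?r = "drop ?m ?w"
  have gw: "g ?w i = g w i" using g by (simp add: coherent_def)
  have w: "?w = take ?m ?w @ ?r" by (rule append_take_drop_id[symmetric])
  have lt: "length (take ?m ?w) = ?m" by simp
  have fw: "Fw q w (q i) = Fw q (take ?m ?w) (Fw q ?r (q i))"
  proof -
    have "Fw q w (q i) = Fw q ?w (q i)" by (simp only: Fw_append Fw_replicate)
    also have "\<dots> = Fw q (take ?m ?w @ ?r) (q i)" by (simp only: append_take_drop_id)
    finally show ?thesis unfolding Fw_append .
  qed
  obtain y where y: "y \<in> SG q" "Fw q w (q i) = Fw q u y" using x by (auto simp: cell_def)
  show ?thesis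
  proof (cases "take ?m ?w = u")
    case True
    then have "?w = u @ ?r" using w by metis
    then have "\<bar>g w i - g u j\<bar> \<le> K * (4/5) ^ ?m * (5 - 4 * (4/5) ^ length ?r)"
      using osc_subcell[OF g K, of u ?r i j] gw by simp
    also have "\<dots> \<le> K * (4/5) ^ ?m * 5" using K0 by (intro mult_left_mono) auto
    finally show ?thesis by (simp add: mult_ac)
  next
    case False
    have e: "Fw q (take ?m ?w) (Fw q ?r (q i)) = Fw q u y" using fw y by simp
    obtain a where "y = q a"
      using Fw_eq_Fw[OF Fw_q_in_SG y(1) e lt False] by blast
    then have "g w i = g u a" using coherentD[OF g] y(2) by blast
    moreover have "K * (4/5) ^ ?m \<le> 5 * K * (4/5) ^ ?m" using K0 by simp
    ultimately show ?thesis using K[of u a j] by simp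
  qed
qed

lemma cells_touch:
  assumes "cell q u \<inter> cell q v \<noteq> {}" "length u = length v"
  obtains a b where "Fw q u (q a) = Fw q v (q b)"
proof (cases "u = v")
  case False
  obtain x y where "x \<in> SG q" "y \<in> SG q" "Fw q u x = Fw q v y" using assms by (auto simp: cell_def)
  from Fw_eq_Fw[OF this assms(2) False] show ?thesis using that \<open>Fw q u x = Fw q v y\<close> by blast
qed (use that in auto)

text \<open>There are finitely many cells of level m, and disjoint compact cells have positive
  distance.\<close>

lemma close_points_touch:
  obtains \<delta> where "\<delta> > 0" "\<And>x y. x \<in> SG q \<Longrightarrow> y \<in> SG q \<Longrightarrow> dist x y < \<delta> \<Longrightarrow>
    \<exists>u v. length u = m \<and> length v = m \<and> x \<in> cell q u \<and> y \<in> cell q v \<and> cell q u \<inter> cell q v \<noteq> {}"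
proof -
  let ?W = "{w :: 3 list. length w = m}"
  let ?P = "{p \<in> ?W \<times> ?W. cell q (fst p) \<inter> cell q (snd p) = {}}"
  have fin: "finite ?P" using finite_words[of m] by simp
  have "\<forall>p\<in>?P. \<exists>d>0. \<forall>x\<in>cell q (fst p). \<forall>y\<in>cell q (snd p). d \<le> dist x y"
    using separate_compact_closed[OF compact_cell compact_imp_closed[OF compact_cell]] by auto
  from bchoice[OF this] obtain d where
    d0: "\<forall>p\<in>?P. 0 < d p \<and> (\<forall>x\<in>cell q (fst p). \<forall>y\<in>cell q (snd p). d p \<le> dist x y)" by (elim exE)
  then have d: "\<And>p. p \<in> ?P \<Longrightarrow> d p > (0::real)"
    "\<And>p x y. p \<in> ?P \<Longrightarrow> x \<in> cell q (fst p) \<Longrightarrow> y \<in> cell q (snd p) \<Longrightarrow> d p \<le> dist x y"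
    by blast+
  let ?\<delta> = "Min (insert 1 (d ` ?P))"
  show ?thesis
  proof (rule that[of ?\<delta>])
    show "?\<delta> > 0" using fin d(1) by (subst Min_gr_iff) auto
    fix x y assume xy: "x \<in> SG q" "y \<in> SG q" "dist x y < ?\<delta>"
    obtain u v where uv: "length u = m" "length v = m" "x \<in> cell q u" "y \<in> cell q v"
      using xy SG_cells[of m] by auto
    have "cell q u \<inter> cell q v \<noteq> {}"
    proof
      assume "cell q u \<inter> cell q v = {}"
      then have p: "(u, v) \<in> ?P" using uv by auto
      then have "?\<delta> \<le> d (u, v)" using fin by (intro Min_le) auto
      also have "\<dots> \<le> dist x y" using d(2)[OF p] uv by simp
      finally show False using xy by simp
    qed
    then show "\<exists>u v. length u = m \<and> length v = m \<and> x \<in> cell q u \<and> y \<in> cell q v \<and> cell q u \<inter> cell q v \<noteq> {}"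
      using uv by blast
  qed
qed

text \<open>Close vertices lie in touching cells of level m, which share a corner, so their values
  differ by at most 10K(4/5)^m. The vertex function is thus uniformly continuous and extends to the
  closure.\<close>

lemma extension_exists:
  fixes g :: "3 list \<Rightarrow> 3 \<Rightarrow> real"
  assumes g: "coherent g" and K: "\<And>w i j. \<bar>g w i - g w j\<bar> \<le> K * (4/5) ^ length w"
  shows "\<exists>f. f \<in> extensional (SG q) \<and> continuous_on (SG q) f \<and> (\<forall>w i. f (Fw q w (q i)) = g w i)"
proof -
  define val where "val x = (SOME c. \<exists>w i. x = Fw q w (q i) \<and> c = g w i)" for x
  have val: "val (Fw q w (q i)) = g w i" for w i
  proof -
    have "\<exists>c w' i'. Fw q w (q i) = Fw q w' (q i') \<and> c = g w' i'" by blast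
    from someI_ex[OF this] obtain w' i' where "Fw q w (q i) = Fw q w' (q i')" "val (Fw q w (q i)) = g w' i'"
      unfolding val_def by blast
    then show ?thesis using coherentD[OF g] by metis
  qed
  have K0: "0 \<le> K" using K[of "[]" 0 0] by simp
  have "uniformly_continuous_on Vs val"
    unfolding uniformly_continuous_on_def
  proof (intro allI impI)
    fix \<epsilon> :: real assume e: "\<epsilon> > 0"
    have "(\<lambda>m. 10 * K * (4/5) ^ m) \<longlonglongrightarrow> 10 * K * 0" by (intro tendsto_intros LIMSEQ_power_zero) auto
    then have "\<forall>\<^sub>F m in sequentially. 10 * K * (4/5) ^ m < \<epsilon>" using e by (intro order_tendstoD(2)) auto
    then obtain m where m: "10 * K * (4/5) ^ m < \<epsilon>" by (auto simp: eventually_sequentially)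
    obtain \<delta> where \<delta>: "\<delta> > 0" "\<And>x y. x \<in> SG q \<Longrightarrow> y \<in> SG q \<Longrightarrow> dist x y < \<delta> \<Longrightarrow>
      \<exists>u v. length u = m \<and> length v = m \<and> x \<in> cell q u \<and> y \<in> cell q v \<and> cell q u \<inter> cell q v \<noteq> {}"
      by (rule close_points_touch[of m]) blast
    show "\<exists>d>0. \<forall>x\<in>Vs. \<forall>x'\<in>Vs. dist x' x < d \<longrightarrow> dist (val x') (val x) < \<epsilon>"
    proof (intro exI[of _ \<delta>] conjI ballI impI)
      fix x x' assume x: "x \<in> Vs" "x' \<in> Vs" "dist x' x < \<delta>"
      obtain w i w' i' where w: "x = Fw q w (q i)" "x' = Fw q w' (q i')" using x by (auto simp: Vs_eq)
      obtain u v where uv: "length u = m" "length v = m" "x' \<in> cell q u" "x \<in> cell q v" "cell q u \<inter> cell q v \<noteq> {}"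
        using \<delta>(2)[of x' x] x w Fw_q_in_SG by blast
      then obtain a b where "Fw q u (q a) = Fw q v (q b)" using cells_touch by metis
      then have ab: "g u a = g v b" using coherentD[OF g] by blast
      have "\<bar>g w' i' - g u a\<bar> \<le> 5 * K * (4/5) ^ m" "\<bar>g w i - g v b\<bar> \<le> 5 * K * (4/5) ^ m"
        using osc_cell[OF g K, of w' i' u a] osc_cell[OF g K, of w i v b] uv w by auto
      then have "\<bar>g w' i' - g w i\<bar> \<le> 10 * K * (4/5) ^ m" using ab by linarith
      then show "dist (val x') (val x) < \<epsilon>" using m by (simp add: w val dist_real_def)
    qed (use \<delta> in auto)
  qed
  then obtain f where f: "uniformly_continuous_on (closure Vs) f" "\<And>x. x \<in> Vs \<Longrightarrow> val x = f x"
    using uniformly_continuous_on_extension_on_closure by metis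
  let ?f = "restrict f (SG q)"
  have "continuous_on (SG q) ?f"
    using uniformly_continuous_imp_continuous[OF f(1)]
    by (subst continuous_on_cong[OF refl, where g = f]) (auto simp: SG_eq)
  moreover have "?f (Fw q w (q i)) = g w i" for w i
  proof -
    have "Fw q w (q i) \<in> Vs" by (auto simp: Vs_eq)
    then show ?thesis using f(2)[of "Fw q w (q i)"] val Fw_q_in_SG by simp
  qed
  ultimately show ?thesis by (intro exI[of _ ?f]) auto
qed

section \<open>The Laplacian in terms of addresses\<close>

definition jpt :: "3 list \<Rightarrow> 3 \<Rightarrow> 3 \<Rightarrow> nat \<Rightarrow> real^2" where
  "jpt s a b n = Fw q (s @ a # replicate n b) (q b)"

text \<open>The unnormalised graph Laplacian at \<open>jpt s a b n\<close> on level
  \<open>length s + Suc n\<close>, split into the contributions of the two cells that meet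
  there.\<close>

definition jsum :: "(real^2 \<Rightarrow> real) \<Rightarrow> 3 list \<Rightarrow> 3 \<Rightarrow> 3 \<Rightarrow> nat \<Rightarrow> real" where
  "jsum u s a b n = (tot (\<lambda>c. u (Fw q (s @ a # replicate n b) (q c))) - 3 * u (jpt s a b n))
     + (tot (\<lambda>c. u (Fw q (s @ b # replicate n a) (q c))) - 3 * u (jpt s a b n))"

lemma has_laplacian_iff:
  "has_laplacian q u f \<longleftrightarrow> continuous_on (SG q) u \<and> continuous_on (SG q) f \<and>
    (\<forall>\<epsilon>>0. \<forall>\<^sub>F m in sequentially. \<forall>s a b n. a \<noteq> b \<longrightarrow> length s + Suc n = m \<longrightarrow>
       \<bar>3/2 * 5 ^ m * jsum u s a b n - f (jpt s a b n)\<bar> < \<epsilon>)"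
proof -
  have 1: "(\<Sum>y | adj q (length s + Suc n) (jpt s a b n) y. u y - u (jpt s a b n)) = jsum u s a b n"
    if "a \<noteq> b" for s a b n
    using laplacian_sum[OF that refl refl refl, where s = s and n = n and u = u] by (simp add: jsum_def jpt_def)
  have 2: "jpt s a b n \<in> V q (length s + Suc n) - V q 0" if "a \<noteq> b" for s a b n
  proof -
    have "jpt s a b n \<in> V q (length s + Suc n)" unfolding V_eq jpt_def
      by (intro CollectI exI[of _ "s @ a # replicate n b"] exI[of _ b]) simp
    then show ?thesis using junction_not_V0[OF that, of s n] by (simp add: jpt_def)
  qed
  have "(\<forall>x \<in> V q m - V q 0. \<bar>3/2 * 5^m * (\<Sum>y | adj q m x y. u y - u x) - f x\<bar> < \<epsilon>) \<longleftrightarrow>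
    (\<forall>s a b n. a \<noteq> b \<longrightarrow> length s + Suc n = m \<longrightarrow> \<bar>3/2 * 5 ^ m * jsum u s a b n - f (jpt s a b n)\<bar> < \<epsilon>)" for m \<epsilon>
  proof (intro iffI allI impI ballI)
    fix s :: "3 list" and a b :: 3 and n
    assume "\<forall>x \<in> V q m - V q 0. \<bar>3/2 * 5^m * (\<Sum>y | adj q m x y. u y - u x) - f x\<bar> < \<epsilon>"
      and ab: "a \<noteq> b" and m: "length s + Suc n = m"
    then show "\<bar>3/2 * 5 ^ m * jsum u s a b n - f (jpt s a b n)\<bar> < \<epsilon>"
      using 1[OF ab, of s n] 2[OF ab, of s n] m by metis
  next
    fix x assume *: "\<forall>s a b n. a \<noteq> b \<longrightarrow> length s + Suc n = m \<longrightarrow> \<bar>3/2 * 5 ^ m * jsum u s a b n - f (jpt s a b n)\<bar> < \<epsilon>"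
      and "x \<in> V q m - V q 0"
    then obtain s a b n where h: "a \<noteq> b" "length s + Suc n = m" "x = jpt s a b n"
      unfolding jpt_def by (elim junctionE)
    then show "\<bar>3/2 * 5^m * (\<Sum>y | adj q m x y. u y - u x) - f x\<bar> < \<epsilon>"
      using 1[OF h(1), of s n] * by metis
  qed
  then show ?thesis unfolding has_laplacian_def by simp
qed

lemma jsum_add: "jsum (\<lambda>x. u x + v x) s a b n = jsum u s a b n + jsum v s a b n"
  by (simp add: jsum_def tot_def sum.distrib algebra_simps)

lemma jsum_cmult: "jsum (\<lambda>x. c * u x) s a b n = c * jsum u s a b n"
  by (simp add: jsum_def tot_def algebra_simps flip: sum_distrib_left)

lemma has_laplacian_add:
  assumes "has_laplacian q u f" "has_laplacian q v g"
  shows "has_laplacian q (\<lambda>x. u x + v x) (\<lambda>x. f x + g x)"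
  unfolding has_laplacian_iff
proof (intro conjI allI impI)
  fix \<epsilon> :: real assume "\<epsilon> > 0"
  then have e: "\<epsilon>/2 > 0" by simp
  have "\<forall>\<^sub>F m in sequentially. \<forall>s a b n. a \<noteq> b \<longrightarrow> length s + Suc n = m \<longrightarrow>
      \<bar>3/2 * 5 ^ m * jsum u s a b n - f (jpt s a b n)\<bar> < \<epsilon>/2"
    "\<forall>\<^sub>F m in sequentially. \<forall>s a b n. a \<noteq> b \<longrightarrow> length s + Suc n = m \<longrightarrow>
      \<bar>3/2 * 5 ^ m * jsum v s a b n - g (jpt s a b n)\<bar> < \<epsilon>/2"
    using assms e unfolding has_laplacian_iff by blast+
  then show "\<forall>\<^sub>F m in sequentially. \<forall>s a b n. a \<noteq> b \<longrightarrow> length s + Suc n = m \<longrightarrow>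
      \<bar>3/2 * 5 ^ m * jsum (\<lambda>x. u x + v x) s a b n - (f (jpt s a b n) + g (jpt s a b n))\<bar> < \<epsilon>"
  proof eventually_elim
    case (elim m)
    show ?case
    proof (intro allI impI)
      fix s :: "3 list" and a b :: 3 and n assume ab: "a \<noteq> b" "length s + Suc n = m"
      have "\<bar>3/2 * 5 ^ m * jsum u s a b n - f (jpt s a b n)\<bar> < \<epsilon>/2"
        "\<bar>3/2 * 5 ^ m * jsum v s a b n - g (jpt s a b n)\<bar> < \<epsilon>/2" using elim ab by blast+
      then show "\<bar>3/2 * 5 ^ m * jsum (\<lambda>x. u x + v x) s a b n - (f (jpt s a b n) + g (jpt s a b n))\<bar> < \<epsilon>"
        unfolding jsum_add distrib_left by linarith
    qed
  qed
qed (use assms in \<open>auto simp: has_laplacian_def intro!: continuous_intros\<close>)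

lemma has_laplacian_cmult:
  assumes "has_laplacian q u f"
  shows "has_laplacian q (\<lambda>x. c * u x) (\<lambda>x. c * f x)"
  unfolding has_laplacian_iff
proof (intro conjI allI impI)
  fix \<epsilon> :: real assume "\<epsilon> > 0"
  then have e: "\<epsilon> / (\<bar>c\<bar> + 1) > 0" by (simp add: add_nonneg_pos)
  have "\<forall>\<^sub>F m in sequentially. \<forall>s a b n. a \<noteq> b \<longrightarrow> length s + Suc n = m \<longrightarrow>
      \<bar>3/2 * 5 ^ m * jsum u s a b n - f (jpt s a b n)\<bar> < \<epsilon> / (\<bar>c\<bar> + 1)"
    using assms e unfolding has_laplacian_iff by blast
  then show "\<forall>\<^sub>F m in sequentially. \<forall>s a b n. a \<noteq> b \<longrightarrow> length s + Suc n = m \<longrightarrow>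
      \<bar>3/2 * 5 ^ m * jsum (\<lambda>x. c * u x) s a b n - c * f (jpt s a b n)\<bar> < \<epsilon>"
  proof eventually_elim
    case (elim m)
    show ?case
    proof (intro allI impI)
      fix s :: "3 list" and a b :: 3 and n assume ab: "a \<noteq> b" "length s + Suc n = m"
      let ?z = "3/2 * 5 ^ m * jsum u s a b n - f (jpt s a b n)"
      have "\<bar>?z\<bar> < \<epsilon> / (\<bar>c\<bar> + 1)" using elim ab by blast
      then have "(\<bar>c\<bar> + 1) * \<bar>?z\<bar> < \<epsilon>" by (simp add: pos_less_divide_eq mult.commute add_nonneg_pos)
      moreover have "\<bar>c\<bar> * \<bar>?z\<bar> \<le> (\<bar>c\<bar> + 1) * \<bar>?z\<bar>" by (intro mult_right_mono) auto
      moreover have "3/2 * 5 ^ m * jsum (\<lambda>x. c * u x) s a b n - c * f (jpt s a b n) = c * ?z"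
        unfolding jsum_cmult by (simp add: algebra_simps)
      ultimately show "\<bar>3/2 * 5 ^ m * jsum (\<lambda>x. c * u x) s a b n - c * f (jpt s a b n)\<bar> < \<epsilon>"
        by (simp add: abs_mult)
    qed
  qed
qed (use assms in \<open>auto simp: has_laplacian_def intro!: continuous_intros\<close>)

lemma has_laplacian_diff:
  assumes "has_laplacian q u f" "has_laplacian q v g"
  shows "has_laplacian q (\<lambda>x. u x - v x) (\<lambda>x. f x - g x)"
  using has_laplacian_add[OF assms(1) has_laplacian_cmult[OF assms(2), of "-1"]] by simp

lemma has_laplacian_cong:
  assumes "has_laplacian q u f" "\<And>x. x \<in> SG q \<Longrightarrow> u x = u' x" "\<And>x. x \<in> SG q \<Longrightarrow> f x = f' x"
  shows "has_laplacian q u' f'"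
proof -
  have "jsum u s a b n = jsum u' s a b n" "f (jpt s a b n) = f' (jpt s a b n)" for s a b n
    unfolding jsum_def jpt_def by (simp_all add: assms Fw_q_in_SG)
  moreover have "continuous_on (SG q) u = continuous_on (SG q) u'" "continuous_on (SG q) f = continuous_on (SG q) f'"
    by (rule continuous_on_cong; simp add: assms)+
  ultimately show ?thesis using assms(1) unfolding has_laplacian_iff by simp
qed

text \<open>At a junction point both functions are limits of the same numbers; the corners of the
  triangle are reached by continuity, and all other points by density of the vertices.\<close>

lemma has_laplacian_unique:
  assumes "has_laplacian q u f" "has_laplacian q u g" "x \<in> SG q"
  shows "f x = g x"
proof -
  have c: "continuous_on (SG q) f" "continuous_on (SG q) g" using assms by (auto simp: has_laplacian_def)
  have j: "f (jpt s a b n) = g (jpt s a b n)" if ab: "a \<noteq> b" for s a b n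
  proof (rule ccontr)
    assume ne: "f (jpt s a b n) \<noteq> g (jpt s a b n)"
    define e where "e = \<bar>f (jpt s a b n) - g (jpt s a b n)\<bar> / 2"
    have e: "e > 0" using ne by (simp add: e_def)
    have "\<forall>\<^sub>F m in sequentially. \<forall>s a b n. a \<noteq> b \<longrightarrow> length s + Suc n = m \<longrightarrow> \<bar>3/2 * 5 ^ m * jsum u s a b n - f (jpt s a b n)\<bar> < e"
      "\<forall>\<^sub>F m in sequentially. \<forall>s a b n. a \<noteq> b \<longrightarrow> length s + Suc n = m \<longrightarrow> \<bar>3/2 * 5 ^ m * jsum u s a b n - g (jpt s a b n)\<bar> < e"
      using assms e unfolding has_laplacian_iff by blast+
    then have "\<forall>\<^sub>F m in sequentially. (\<forall>s a b n. a \<noteq> b \<longrightarrow> length s + Suc n = m \<longrightarrow> \<bar>3/2 * 5 ^ m * jsum u s a b n - f (jpt s a b n)\<bar> < e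
      \<and> \<bar>3/2 * 5 ^ m * jsum u s a b n - g (jpt s a b n)\<bar> < e)" by eventually_elim blast
    then obtain N where N: "\<And>m s a b n. N \<le> m \<Longrightarrow> a \<noteq> b \<Longrightarrow> length s + Suc n = m \<Longrightarrow> \<bar>3/2 * 5 ^ m * jsum u s a b n - f (jpt s a b n)\<bar> < e
      \<and> \<bar>3/2 * 5 ^ m * jsum u s a b n - g (jpt s a b n)\<bar> < e" unfolding eventually_sequentially by blast
    \<comment> \<open>Increasing n refines the level without moving the point.\<close>
    have "jpt s a b (n + N) = jpt s a b n"
      unfolding jpt_def replicate_add by (simp add: Fw_append)
    moreover have "N \<le> length s + Suc (n + N)" by simp
    ultimately obtain X where "\<bar>X - f (jpt s a b n)\<bar> < e" "\<bar>X - g (jpt s a b n)\<bar> < e"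
      using N[OF _ ab refl, of s "n + N"] by metis
    then have "\<bar>f (jpt s a b n) - g (jpt s a b n)\<bar> < 2 * e" by linarith
    then show False by (simp add: e_def)
  qed
  have V: "f (Fw q w (q i)) = g (Fw q w (q i))" if nV: "Fw q w (q i) \<notin> V q 0" for w i
  proof -
    have "Fw q w (q i) \<in> V q (length w) - V q 0" using nV by (auto simp: V_eq)
    then show ?thesis using j unfolding jpt_def by (elim junctionE) simp
  qed
  have "f (q i) = g (q i)" for i
  proof -
    have lim: "(\<lambda>n. Fw q (replicate n i) (q (i + 1))) \<longlonglongrightarrow> q i"
    proof -
      have "dist (Fw q (replicate n i) (q (i + 1))) (q i) = (1/2) ^ n * dist (q (i + 1)) (q i)" for n
      proof (induction n)
        case (Suc n)
        have "dist (Fw q (replicate (Suc n) i) (q (i + 1))) (q i)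
            = dist (F q i (Fw q (replicate n i) (q (i + 1)))) (F q i (q i))" by simp
        then show ?case unfolding dist_F Suc by simp
      qed simp
      moreover have "(\<lambda>n. (1/2) ^ n * dist (q (i + 1)) (q i)) \<longlonglongrightarrow> 0 * dist (q (i + 1)) (q i)"
        by (intro tendsto_intros LIMSEQ_power_zero) auto
      ultimately show ?thesis by (subst tendsto_dist_iff) simp
    qed
    have L: "(\<lambda>n. h (Fw q (replicate n i) (q (i + 1)))) \<longlonglongrightarrow> h (q i)" if "continuous_on (SG q) h" for h :: "real^2 \<Rightarrow> real"
      by (rule continuous_on_tendsto_compose[OF that lim]) (auto simp: q_in_SG Fw_q_in_SG)
    have "f (Fw q (replicate n i) (q (i + 1))) = g (Fw q (replicate n i) (q (i + 1)))" if "n \<ge> 1" for n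
    proof (rule V)
      show "Fw q (replicate n i) (q (i + 1)) \<notin> V q 0"
      proof
        assume "Fw q (replicate n i) (q (i + 1)) \<in> V q 0"
        then obtain j where "Fw q (replicate n i) (q (i + 1)) = q j" by auto
        from Fw_eq_q[OF q_in_SG this] have "replicate n i = replicate n (i + 1)" by auto
        then show False using that by (cases n) auto
      qed
    qed
    then have "\<forall>\<^sub>F n in sequentially. f (Fw q (replicate n i) (q (i + 1))) = g (Fw q (replicate n i) (q (i + 1)))"
      unfolding eventually_sequentially by blast
    then have "(\<lambda>n. f (Fw q (replicate n i) (q (i + 1)))) \<longlonglongrightarrow> g (q i)"
      using L[OF c(2)] by (subst tendsto_cong) auto
    then show ?thesis using L[OF c(1)] LIMSEQ_unique by blast
  qed
  then have "f (Fw q w (q i)) = g (Fw q w (q i))" for w i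
    using V[of w i] by (cases "Fw q w (q i) \<in> V q 0") auto
  then show ?thesis using eq_on_SG[OF c _ assms(3)] by blast
qed

subsection \<open>The maximum principle\<close>

lemma finite_V: "finite (V q m)"
  by (induction m) auto

text \<open>At an interior maximum on a graph the graph Laplacian is at most 0, whereas on fine
  levels it is within \<delta> of a value f \<ge> \<delta>. Hence the maximum over such a graph sits
  at a corner.\<close>

lemma max_principle:
  assumes u: "has_laplacian q u f" and f: "\<And>x. x \<in> SG q \<Longrightarrow> \<delta> \<le> f x" "0 < \<delta>"
    and c: "\<And>i. u (q i) \<le> c" and x: "x \<in> SG q"
  shows "u x \<le> c"
proof -
  have "\<forall>\<^sub>F m in sequentially. \<forall>s a b n. a \<noteq> b \<longrightarrow> length s + Suc n = m \<longrightarrow>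
      \<bar>3/2 * 5 ^ m * jsum u s a b n - f (jpt s a b n)\<bar> < \<delta>"
    using u f(2) unfolding has_laplacian_iff by blast
  then obtain N where N: "\<And>m s a b n. N \<le> m \<Longrightarrow> a \<noteq> b \<Longrightarrow> length s + Suc n = m \<Longrightarrow>
      \<bar>3/2 * 5 ^ m * jsum u s a b n - f (jpt s a b n)\<bar> < \<delta>"
    unfolding eventually_sequentially by blast
  have V: "u y \<le> c" if m: "N \<le> m" and y: "y \<in> V q m" for m y
  proof -
    have ne: "u ` V q m \<noteq> {}" using y by auto
    have "Max (u ` V q m) \<in> u ` V q m" using finite_V ne by (intro Max_in) auto
    then obtain z where z: "z \<in> V q m" "\<And>y. y \<in> V q m \<Longrightarrow> u y \<le> u z"
      using finite_V[of m] by (metis Max_ge finite_imageI image_eqI imageE)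
    have "z \<in> V q 0"
    proof (rule ccontr)
      assume "z \<notin> V q 0"
      then obtain s a b n where h: "a \<noteq> b" "length s + Suc n = m" "z = jpt s a b n"
        using z(1) unfolding jpt_def by (metis DiffI junctionE)
      have t: "tot (\<lambda>c. u (Fw q w (q c))) \<le> 3 * u z" if "length w = m" for w
        using sum_mono[of UNIV "\<lambda>c. u (Fw q w (q c))" "\<lambda>_. u z"] z(2) that by (auto simp: tot_def V_eq)
      have "jsum u s a b n \<le> 0"
        unfolding jsum_def h(3)[symmetric] using t[of "s @ a # replicate n b"] t[of "s @ b # replicate n a"] h(2) by simp
      then have "3/2 * 5 ^ m * jsum u s a b n \<le> 0" by (simp add: mult_nonneg_nonpos)
      moreover have "\<delta> \<le> f (jpt s a b n)" by (rule f) (simp add: jpt_def Fw_q_in_SG)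
      ultimately show False using N[OF m h(1,2)] by linarith
    qed
    then have "u z \<le> c" using c by auto
    then show ?thesis using z(2)[OF y] by linarith
  qed
  have "u (Fw q w (q i)) \<le> c" for w i
  proof (rule V)
    have "Fw q w (q i) \<in> V q (length w)" by (auto simp: V_eq)
    then show "Fw q w (q i) \<in> V q (max N (length w))" using V_mono[of "length w" "max N (length w)"] by auto
  qed auto
  then show ?thesis using le_on_SG[of u] u x by (auto simp: has_laplacian_def)
qed

subsection \<open>The basic polyharmonic functions\<close>

text \<open>The candidate for \<open>monomial\<close>, defined by its vertex values; the
  identification follows in \<open>monomial_eq\<close>, once the defining data are known to have
  only one solution.\<close>

definition pmono :: "nat \<Rightarrow> 3 \<Rightarrow> nat \<Rightarrow> real^2 \<Rightarrow> real" where
  "pmono k l j = (SOME f. f \<in> extensional (SG q) \<and> continuous_on (SG q) f \<and> (\<forall>w i. f (Fw q w (q i)) = Pc k l j w i))"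

lemma coherent_Pc: "coherent (Pc k l j)"
  unfolding coherent_def by (intro conjI allI Pc_extend Pc_junction)

lemma Lam_half: "0 < Lam / 2" "Lam / 2 < Lam" using Lam_pos by auto

lemma pmono:
  assumes "k \<in> {1..3}"
  shows "pmono k l j \<in> extensional (SG q)" "continuous_on (SG q) (pmono k l j)" "pmono k l j (Fw q w (q i)) = Pc k l j w i"
proof -
  obtain M where "\<And>k l j w i i'. k \<in> {1..3} \<Longrightarrow> \<bar>Pc k l j w i - Pc k l j w i'\<bar> \<le> M * (4/5) ^ length w / (Lam/2) ^ j"
    using Pc_bound[OF Lam_half] by metis
  then have "\<bar>Pc k l j w i - Pc k l j w i'\<bar> \<le> M / (Lam/2) ^ j * (4/5) ^ length w" for w i i'
    using assms by simp
  from someI_ex[OF extension_exists[OF coherent_Pc this]]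
  show "pmono k l j \<in> extensional (SG q)" "continuous_on (SG q) (pmono k l j)" "pmono k l j (Fw q w (q i)) = Pc k l j w i"
    unfolding pmono_def by auto
qed

lemma mono_q: "k \<in> {1..3} \<Longrightarrow> pmono k l j (q i) = Pc k l j [] i"
  using pmono(3)[of k l j "[]" i] by simp

lemma mono_bound:
  assumes "0 < r" "r < Lam"
  obtains M where "0 \<le> M" "\<And>k l j x. k \<in> {1..3} \<Longrightarrow> x \<in> SG q \<Longrightarrow> \<bar>pmono k l j x\<bar> \<le> M / r ^ j"
proof -
  obtain M where M: "0 \<le> M" "\<And>k l j w i. k \<in> {1..3} \<Longrightarrow> \<bar>Pc k l j w i\<bar> \<le> M / r ^ j"
    using Pc_bound[OF assms] by metis
  have "\<bar>pmono k l j x\<bar> \<le> M / r ^ j" if "k \<in> {1..3}" "x \<in> SG q" for k l j x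
    by (rule le_on_SG[where f = "\<lambda>x. \<bar>pmono k l j x\<bar>"])
      (use that M in \<open>auto simp: pmono intro!: continuous_intros\<close>)
  then show ?thesis using that M by blast
qed

lemma jsum_mono:
  assumes "k \<in> {1..3}"
  shows "jsum (pmono k l j) s a b n = (tot (Pc k l j (s @ a # replicate n b)) - 3 * Pc k l j (s @ a # replicate n b) b)
     + (tot (Pc k l j (s @ b # replicate n a)) - 3 * Pc k l j (s @ b # replicate n a) a)"
  unfolding jsum_def jpt_def pmono(3)[OF assms] Pc_junction[of k l j s a n b] by simp

definition monod :: "nat \<Rightarrow> 3 \<Rightarrow> nat \<Rightarrow> real^2 \<Rightarrow> real" where
  "monod k l j = (if j = 0 then (\<lambda>_. 0) else pmono k l (j - 1))"

lemma mono_laplacian_error: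
  assumes "0 < r" "r < Lam"
  obtains C where "0 \<le> C" "\<And>k l j s a b n m. k \<in> {1..3} \<Longrightarrow> a \<noteq> b \<Longrightarrow> length s + Suc n = m \<Longrightarrow> 3 \<le> m \<Longrightarrow>
     \<bar>3/2 * 5 ^ m * jsum (pmono k l j) s a b n - monod k l j (jpt s a b n)\<bar> \<le> C / 5 ^ m / r ^ j"
proof -
  obtain C where C: "0 \<le> C" "\<And>k l j s a b n w v. k \<in> {1..3} \<Longrightarrow> a \<noteq> b \<Longrightarrow> w = s @ a # replicate n b \<Longrightarrow>
     v = s @ b # replicate n a \<Longrightarrow> 3 \<le> length w \<Longrightarrow>
     \<bar>3/2 * 5 ^ length w * ((tot (Pc k l j w) - 3 * Pc k l j w b) + (tot (Pc k l j v) - 3 * Pc k l j v a))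
       - Pd k l j w b\<bar> \<le> C / 5 ^ length w / r ^ j"
    using Pc_laplacian[OF assms] by metis
  show ?thesis
  proof (rule that[OF C(1)])
    fix k :: nat and l j n m and s :: "3 list" and a b :: 3
    assume h: "k \<in> {1..3}" "a \<noteq> b" "length s + Suc n = m" "3 \<le> m"
    have "monod k l j (jpt s a b n) = Pd k l j (s @ a # replicate n b) b"
      unfolding monod_def Pd_def jpt_def using pmono(3)[OF h(1)] by simp
    moreover have len: "length (s @ a # replicate n b) = m" using h(3) by simp
    then have "3 \<le> length (s @ a # replicate n b)" using h(4) by simp
    from C(2)[OF h(1,2) refl refl this, of l j]
    show "\<bar>3/2 * 5 ^ m * jsum (pmono k l j) s a b n - monod k l j (jpt s a b n)\<bar> \<le> C / 5 ^ m / r ^ j"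
      unfolding jsum_mono[OF h(1)] len calculation .
  qed
qed

lemma tendsto_const_div_5: "(\<lambda>m. C / 5 ^ m) \<longlonglongrightarrow> (0::real)"
  by (rule LIMSEQ_divide_realpow_zero) auto

lemma mono_laplacian:
  assumes "k \<in> {1..3}"
  shows "has_laplacian q (pmono k l j) (monod k l j)"
  unfolding has_laplacian_iff
proof (intro conjI allI impI)
  fix \<epsilon> :: real assume e: "\<epsilon> > 0"
  obtain C where C: "0 \<le> C" "\<And>k l j s a b n m. k \<in> {1..3} \<Longrightarrow> a \<noteq> b \<Longrightarrow> length s + Suc n = m \<Longrightarrow> 3 \<le> m \<Longrightarrow>
     \<bar>3/2 * 5 ^ m * jsum (pmono k l j) s a b n - monod k l j (jpt s a b n)\<bar> \<le> C / 5 ^ m / (Lam/2) ^ j"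
    using mono_laplacian_error[OF Lam_half] by metis
  have "\<forall>\<^sub>F m in sequentially. C / (Lam/2) ^ j / 5 ^ m < \<epsilon>"
    using tendsto_const_div_5 e by (intro order_tendstoD(2))
  then show "\<forall>\<^sub>F m in sequentially. \<forall>s a b n. a \<noteq> b \<longrightarrow> length s + Suc n = m \<longrightarrow>
       \<bar>3/2 * 5 ^ m * jsum (pmono k l j) s a b n - monod k l j (jpt s a b n)\<bar> < \<epsilon>"
    using eventually_ge_at_top[of 3]
  proof eventually_elim
    case (elim m)
    then show ?case using C(2)[OF assms, of _ _ _ _ m l j] by (fastforce simp: mult.commute)
  qed
qed (use pmono(2)[OF assms] in \<open>auto simp: monod_def\<close>)

end

lemma E_0_const: "E 0 (\<lambda>_. 1) w = (\<lambda>_. 1 :: 'a::{real_normed_field,banach})"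
proof (induction w)
  case (Cons i w)
  have "sub 0 i (\<lambda>_. 1) = (\<lambda>_. 1 :: 'a)" by (auto simp: sub_def tot_def fun_eq_iff)
  then show ?case using Cons by simp
qed auto

lemma Pc_1_0: "Pc 1 l 0 w i = 1"
proof -
  have "germ 1 l 0 = (\<lambda>_. 1 :: complex)" by (auto simp: germ_def fun_eq_iff)
  then show ?thesis unfolding Pc_def cf_0[OF holomorphic_fsm] by (simp add: fsm_def E_0_const)
qed

lemma Pc_replicate: "Pc k l j (replicate m l @ w) i = (kap k * (1/5) ^ j) ^ m * Pc k l j w i"
  by (induction m) (simp_all add: Pc_scale)

context gasket
begin

lemma mono_1_0: "x \<in> SG q \<Longrightarrow> pmono 1 l 0 x = 1"
  by (rule eq_on_SG[where g = "\<lambda>_. 1"]) (auto simp: pmono Pc_1_0[simplified])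

text \<open>Comparison with the monomial h of index j = 1, k = 1, whose Laplacian is the constant 1:
  for K' > K the function u + K'h has a Laplacian bounded below by K' - K and obeys the maximum
  principle.\<close>

lemma laplacian_sup_bound:
  obtains B where "0 \<le> B" "\<And>u f K x. has_laplacian q u f \<Longrightarrow> (\<And>x. x \<in> SG q \<Longrightarrow> \<bar>f x\<bar> \<le> K) \<Longrightarrow>
    (\<And>i. u (q i) = 0) \<Longrightarrow> x \<in> SG q \<Longrightarrow> \<bar>u x\<bar> \<le> B * K"
proof -
  obtain M where M: "0 \<le> M" "\<And>k l j x. k \<in> {1..3} \<Longrightarrow> x \<in> SG q \<Longrightarrow> \<bar>pmono k l j x\<bar> \<le> M / (Lam/2) ^ j"
    using mono_bound[OF Lam_half] by metis
  define B where "B = M / (Lam/2) ^ 1"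
  let ?h = "pmono 1 0 1"
  have B0: "0 \<le> B" using M Lam_pos by (simp add: B_def)
  have hB: "\<bar>?h x\<bar> \<le> B" if "x \<in> SG q" for x using M(2)[of 1 x 0 1] that by (simp add: B_def)
  have h: "has_laplacian q ?h (\<lambda>_. 1)"
    by (rule has_laplacian_cong[OF mono_laplacian[of 1 0 1]]) (auto simp: monod_def mono_1_0[simplified])
  have up: "u x \<le> 2 * B * K" if u: "has_laplacian q u f" and f: "\<And>x. x \<in> SG q \<Longrightarrow> \<bar>f x\<bar> \<le> K"
    and b: "\<And>i. u (q i) = 0" and x: "x \<in> SG q" for u f K x
  proof (rule field_le_epsilon)
    fix e :: real assume e: "0 < e"
    \<comment> \<open>K' has to exceed K for strict positivity; the surplus is chosen so that it
      raises the final bound 2BK by at most e.\<close>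
    define K' where "K' = K + e / (2 * B + 1)"
    have K': "K < K'" using e B0 by (simp add: K'_def)
    have K0: "0 \<le> K" using f[OF x] by linarith
    have "has_laplacian q (\<lambda>x. u x + K' * ?h x) (\<lambda>x. f x + K' * 1)"
      by (intro has_laplacian_add u has_laplacian_cmult h)
    then have "u x + K' * ?h x \<le> K' * B"
    proof (rule max_principle[where \<delta> = "K' - K"])
      fix y assume "y \<in> SG q" then show "K' - K \<le> f y + K' * 1" using f[of y] by linarith
    next
      fix i show "u (q i) + K' * ?h (q i) \<le> K' * B"
        using hB[OF q_in_SG, of i] K0 K' b[of i] by (simp add: abs_le_iff mult_left_mono)
    qed (use K' x in auto)
    moreover have "- (K' * B) \<le> K' * ?h x"
      using hB[OF x] K0 K' mult_left_mono[of "-B" "?h x" K'] by (simp add: abs_le_iff)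
    moreover have "2 * B * K' = K' * B + K' * B" by simp
    ultimately have "u x \<le> 2 * B * K'" by linarith
    also have "\<dots> = 2 * B * K + (2 * B) / (2 * B + 1) * e" using B0 by (simp add: K'_def algebra_simps)
    also have "(2 * B) / (2 * B + 1) * e \<le> 1 * e" using B0 e by (intro mult_right_mono) (auto simp: divide_simps)
    finally show "u x \<le> 2 * B * K + e" by simp
  qed
  show ?thesis
  proof (rule that[of "2 * B"])
    fix u f K x assume u: "has_laplacian q u f" and f: "\<And>x. x \<in> SG q \<Longrightarrow> \<bar>f x\<bar> \<le> K"
      and b: "\<And>i. u (q i) = 0" and x: "x \<in> SG q"
    have "u x \<le> 2 * B * K" by (rule up[OF u f b x])
    moreover have "-1 * u x \<le> 2 * B * K"
      by (rule up[OF has_laplacian_cmult[OF u, of "-1"] _ _ x]) (use f b in auto)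
    ultimately show "\<bar>u x\<bar> \<le> 2 * B * K" by simp
  qed (use B0 in simp)
qed

lemma dirichlet_unique:
  assumes "has_laplacian q u (\<lambda>_. 0)" "\<And>i. u (q i) = 0" "x \<in> SG q"
  shows "u x = 0"
proof -
  obtain B where "0 \<le> B" "\<And>u f K x. has_laplacian q u f \<Longrightarrow> (\<And>x. x \<in> SG q \<Longrightarrow> \<bar>f x\<bar> \<le> K) \<Longrightarrow>
    (\<And>i. u (q i) = 0) \<Longrightarrow> x \<in> SG q \<Longrightarrow> \<bar>u x\<bar> \<le> B * K"
    by (rule laplacian_sup_bound) blast
  from this(2)[OF assms(1), of 0 x] assms show ?thesis by simp
qed

lemma monod_0 [simp]: "monod k l 0 = (\<lambda>_. 0)" by (simp add: monod_def)

text \<open>At parameter 0 the three germs span all boundary triples, and a harmonic function is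
  determined by its boundary values.\<close>

lemma harmonic_span:
  assumes h: "has_laplacian q h (\<lambda>_. 0)"
  obtains b c where "\<And>x. x \<in> SG q \<Longrightarrow> h x = h (q l) * pmono 1 l 0 x + b * pmono 2 l 0 x + c * pmono 3 l 0 x"
proof -
  let ?X = "\<lambda>i. h (q i)"
  define b where "b = flux (psi 0) ?X l / (2 * sgerm 0)"
  define c where "c = dif ?X l / hat 0"
  let ?r = "\<lambda>x. h (q l) * pmono 1 l 0 x + b * pmono 2 l 0 x + c * pmono 3 l 0 x"
  have sp: "?X = (\<lambda>j. ?X l * germ 1 l 0 j + b * germ 2 l 0 j + c * germ 3 l 0 j)"
    unfolding b_def c_def by (rule germ_span) simp
  have P0: "Pc k l 0 [] i = germ k l 0 i" if "k \<in> {1, 2, 3}" for k i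
    using that by (rule_tac three_cases[of i l])
      (auto simp: Pc_vertex_0[simplified] Pc_vertex_antisym Pc_vertex_sym[of 2] germ_def Pc_centre)
  have m: "has_laplacian q (pmono k l 0) (\<lambda>_. 0)" if "k \<in> {1..3}" for k
    using mono_laplacian[OF that, of l 0] by simp
  have "has_laplacian q ?r (\<lambda>x. h (q l) * 0 + b * 0 + c * 0)"
    by (intro has_laplacian_add has_laplacian_cmult m) auto
  from has_laplacian_diff[OF h this] have "has_laplacian q (\<lambda>x. h x - ?r x) (\<lambda>_. 0)" by simp
  moreover have "h (q i) - ?r (q i) = 0" for i
    using fun_cong[OF sp, of i] by (simp add: mono_q P0 del: One_nat_def)
  ultimately have "h x - ?r x = 0" if "x \<in> SG q" for x using dirichlet_unique that by blast
  then show ?thesis using that[of b c] by simp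
qed

section \<open>Normal and tangential derivatives of the monomials\<close>

lemma F_funpow: "(F q l ^^ m) x = Fw q (replicate m l) x"
  by (induction m) auto

lemma mono_replicate:
  "k \<in> {1..3} \<Longrightarrow> pmono k l j ((F q l ^^ m) (q i)) = (kap k * (1/5) ^ j) ^ m * Pc k l j [] i"
  using Pc_replicate[of k l j m "[]" i] by (simp add: F_funpow pmono(3))

lemma tendsto_const_power: "0 \<le> \<rho> \<Longrightarrow> \<rho> < 1 \<Longrightarrow> (\<lambda>m. \<rho> ^ m * c) \<longlonglongrightarrow> (0::real)"
  using tendsto_mult_right[OF LIMSEQ_power_zero, of \<rho> c] by simp

lemma fifth_power_le: "0 < j \<Longrightarrow> (1/5 :: real) ^ j \<le> 1/5"
  using power_decreasing[of 1 j "1/5::real"] by simp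

text \<open>Along the ray into q_l a monomial scales by \<open>kap k * (1/5)^j\<close> per step.
  Multiplied by 5/3 this is less than 1 except for j = 0 with k = 1 or k = 2: the case k = 1 is
  constant, and k = 2 gives -2 * (-1/2) = 1. For k = 3 antisymmetry cancels the two terms.\<close>

lemma mono_normal:
  assumes k: "k \<in> {1..3}"
  shows "has_normal_deriv q (pmono k l j) l (of_bool (k = 2 \<and> j = 0))"
proof -
  have "(\<lambda>m. (5/3) ^ m * (2 * Pc k l j [] l - (kap k * (1/5) ^ j) ^ m * Pc k l j [] (l + 1)
     - (kap k * (1/5) ^ j) ^ m * Pc k l j [] (l - 1))) \<longlonglongrightarrow> of_bool (k = 2 \<and> j = 0)"
  proof -
    consider "k = 1" "j = 0" | "k = 1" "0 < j" | "k = 2" "j = 0" | "k = 2" "0 < j" | "k = 3" using k by fastforce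
    then show ?thesis
    proof cases
      case 1 then show ?thesis by (simp add: Pc_1_0[simplified] kap_def)
    next
      case 2
      have e: "(5/3) ^ m * (2 * Pc k l j [] l - (kap k * (1/5) ^ j) ^ m * Pc k l j [] (l + 1)
        - (kap k * (1/5) ^ j) ^ m * Pc k l j [] (l - 1)) = ((5/3) ^ m * ((1/5) ^ j) ^ m) * (- 2 * Pc 1 l j [] (l + 1))" for m
        using 2 Pc_vertex_sym[of 1 l j] by (simp add: Pc_centre kap_def)
      have z: "of_bool (k = 2 \<and> j = 0) = (0::real)" using 2 by simp
      show ?thesis unfolding e power_mult_distrib[symmetric] z
        by (intro tendsto_const_power) (use 2 fifth_power_le[of j] in auto)
    next
      case 3
      have e: "(5/3) ^ m * (2 * Pc k l j [] l - (kap k * (1/5) ^ j) ^ m * Pc k l j [] (l + 1)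
        - (kap k * (1/5) ^ j) ^ m * Pc k l j [] (l - 1)) = ((5/3) ^ m * (3/5) ^ m) * (- 2 * Pc 2 l 0 [] (l + 1))" for m
        using 3 Pc_vertex_sym[of 2 l 0] by (simp add: Pc_centre kap_def)
      show ?thesis unfolding e power_mult_distrib[symmetric] using 3 by (simp add: Pc_vertex_0)
    next
      case 4
      have e: "(5/3) ^ m * (2 * Pc k l j [] l - (kap k * (1/5) ^ j) ^ m * Pc k l j [] (l + 1)
        - (kap k * (1/5) ^ j) ^ m * Pc k l j [] (l - 1)) = ((5/3) ^ m * (3/5 * (1/5) ^ j) ^ m) * (- 2 * Pc 2 l j [] (l + 1))" for m
        using 4 Pc_vertex_sym[of 2 l j] by (simp add: Pc_centre kap_def)
      have z: "of_bool (k = 2 \<and> j = 0) = (0::real)" using 4 by simp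
      show ?thesis unfolding e power_mult_distrib[symmetric, of "5/3"] z
        by (intro tendsto_const_power) (use 4 fifth_power_le[of j] in auto)
    next
      case 5 then show ?thesis by (simp add: Pc_centre Pc_vertex_antisym)
    qed
  qed
  then show ?thesis
    unfolding has_normal_deriv_def by (simp add: mono_replicate[OF k] mono_q[OF k])
qed

lemma mono_tangential:
  assumes k: "k \<in> {1..3}"
  shows "has_tangential_deriv q (pmono k l j) l (of_bool (k = 3 \<and> j = 0))"
proof -
  have "(\<lambda>m. 5 ^ m * ((kap k * (1/5) ^ j) ^ m * Pc k l j [] (l + 1)
     - (kap k * (1/5) ^ j) ^ m * Pc k l j [] (l - 1))) \<longlonglongrightarrow> of_bool (k = 3 \<and> j = 0)"
  proof -
    consider "k \<noteq> 3" | "k = 3" "j = 0" | "k = 3" "0 < j" by fastforce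
    then show ?thesis
    proof cases
      case 1 then show ?thesis using k by (simp add: Pc_vertex_sym)
    next
      case 2
      have e: "5 ^ m * ((kap k * (1/5) ^ j) ^ m * Pc k l j [] (l + 1)
        - (kap k * (1/5) ^ j) ^ m * Pc k l j [] (l - 1)) = (5 ^ m * (1/5) ^ m) * (2 * Pc 3 l 0 [] (l + 1))" for m
        using 2 by (simp add: Pc_vertex_antisym kap_def)
      show ?thesis unfolding e power_mult_distrib[symmetric] using 2 by (simp add: Pc_vertex_0)
    next
      case 3
      have e: "5 ^ m * ((kap k * (1/5) ^ j) ^ m * Pc k l j [] (l + 1)
        - (kap k * (1/5) ^ j) ^ m * Pc k l j [] (l - 1)) = (5 ^ m * (1/5 * (1/5) ^ j) ^ m) * (2 * Pc 3 l j [] (l + 1))" for m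
        using 3 by (simp add: Pc_vertex_antisym kap_def)
      have z: "of_bool (k = 3 \<and> j = 0) = (0::real)" using 3 by simp
      show ?thesis unfolding e power_mult_distrib[symmetric, of 5] z
        by (intro tendsto_const_power) (use 3 fifth_power_le[of j] in auto)
    qed
  qed
  then show ?thesis
    unfolding has_tangential_deriv_def by (simp add: mono_replicate[OF k])
qed

lemma funpow_in_SG: "(F q l ^^ m) (q i) \<in> SG q"
  by (simp add: F_funpow Fw_q_in_SG)

lemma has_normal_deriv_cong: "(\<And>x. x \<in> SG q \<Longrightarrow> u x = v x) \<Longrightarrow> has_normal_deriv q u l d = has_normal_deriv q v l d"
  by (simp add: has_normal_deriv_def funpow_in_SG q_in_SG)
lemma has_tangential_deriv_cong: "(\<And>x. x \<in> SG q \<Longrightarrow> u x = v x) \<Longrightarrow> has_tangential_deriv q u l d = has_tangential_deriv q v l d"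
  by (simp add: has_tangential_deriv_def funpow_in_SG)

lemma has_normal_deriv_add:
  "has_normal_deriv q u l d \<Longrightarrow> has_normal_deriv q v l e \<Longrightarrow> has_normal_deriv q (\<lambda>x. u x + v x) l (d + e)"
  unfolding has_normal_deriv_def by (drule (1) tendsto_add) (simp add: algebra_simps)
lemma has_tangential_deriv_add:
  "has_tangential_deriv q u l d \<Longrightarrow> has_tangential_deriv q v l e \<Longrightarrow> has_tangential_deriv q (\<lambda>x. u x + v x) l (d + e)"
  unfolding has_tangential_deriv_def by (drule (1) tendsto_add) (simp add: algebra_simps)
lemma has_normal_deriv_cmult:
  "has_normal_deriv q u l d \<Longrightarrow> has_normal_deriv q (\<lambda>x. c * u x) l (c * d)"
  unfolding has_normal_deriv_def by (drule tendsto_mult_left[of _ _ _ c]) (simp add: algebra_simps)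
lemma has_tangential_deriv_cmult:
  "has_tangential_deriv q u l d \<Longrightarrow> has_tangential_deriv q (\<lambda>x. c * u x) l (c * d)"
  unfolding has_tangential_deriv_def by (drule tendsto_mult_left[of _ _ _ c]) (simp add: algebra_simps)
lemma has_normal_deriv_unique: "has_normal_deriv q u l d \<Longrightarrow> has_normal_deriv q u l e \<Longrightarrow> d = e"
  unfolding has_normal_deriv_def by (rule LIMSEQ_unique)
lemma has_tangential_deriv_unique: "has_tangential_deriv q u l d \<Longrightarrow> has_tangential_deriv q u l e \<Longrightarrow> d = e"
  unfolding has_tangential_deriv_def by (rule LIMSEQ_unique)

lemma harmonic_zero:
  assumes h: "has_laplacian q h (\<lambda>_. 0)" "h (q l) = 0" "has_normal_deriv q h l 0" "has_tangential_deriv q h l 0"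
    and x: "x \<in> SG q"
  shows "h x = 0"
proof -
  obtain b c where bc: "\<And>x. x \<in> SG q \<Longrightarrow> h x = h (q l) * pmono 1 l 0 x + b * pmono 2 l 0 x + c * pmono 3 l 0 x"
    using harmonic_span[OF h(1)] by metis
  then have e: "\<And>x. x \<in> SG q \<Longrightarrow> h x = b * pmono 2 l 0 x + c * pmono 3 l 0 x" using h(2) by simp
  have "has_normal_deriv q (\<lambda>x. b * pmono 2 l 0 x + c * pmono 3 l 0 x) l (b * of_bool ((2::nat) = 2 \<and> (0::nat) = 0) + c * of_bool ((3::nat) = 2 \<and> (0::nat) = 0))"
    by (intro has_normal_deriv_add has_normal_deriv_cmult mono_normal) simp_all
  moreover have "has_normal_deriv q (\<lambda>x. b * pmono 2 l 0 x + c * pmono 3 l 0 x) l 0"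
    using h(3) has_normal_deriv_cong[of h "\<lambda>x. b * pmono 2 l 0 x + c * pmono 3 l 0 x" l 0] e by blast
  ultimately have b: "b = 0" by (auto dest: has_normal_deriv_unique)
  have "has_tangential_deriv q (\<lambda>x. b * pmono 2 l 0 x + c * pmono 3 l 0 x) l (b * of_bool ((2::nat) = 3 \<and> (0::nat) = 0) + c * of_bool ((3::nat) = 3 \<and> (0::nat) = 0))"
    by (intro has_tangential_deriv_add has_tangential_deriv_cmult mono_tangential) simp_all
  moreover have "has_tangential_deriv q (\<lambda>x. b * pmono 2 l 0 x + c * pmono 3 l 0 x) l 0"
    using h(4) has_tangential_deriv_cong[of h "\<lambda>x. b * pmono 2 l 0 x + c * pmono 3 l 0 x" l 0] e by blast
  ultimately have c: "c = 0" by (auto dest: has_tangential_deriv_unique)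
  show ?thesis using e[OF x] b c by simp
qed

section \<open>Uniqueness of the monomials\<close>

lemma pow_unique: "has_laplacian_pow q n u f \<Longrightarrow> has_laplacian_pow q n u g \<Longrightarrow> x \<in> SG q \<Longrightarrow> f x = g x"
proof (induction n arbitrary: f g x)
  case (Suc n)
  then obtain f' g' where h: "has_laplacian_pow q n u f'" "has_laplacian q f' f" "has_laplacian_pow q n u g'" "has_laplacian q g' g" by auto
  have "has_laplacian q f' g" by (rule has_laplacian_cong[OF h(4)]) (use Suc.IH[OF h(3,1)] in auto)
  then show ?case using has_laplacian_unique[OF h(2)] Suc.prems by blast
qed auto

text \<open>Powers of the Laplacian are defined through an existential intermediate function; by
  uniqueness any representative of the n-th power can take its place.\<close>

lemma pow_step: "has_laplacian_pow q (Suc n) u f \<Longrightarrow> has_laplacian_pow q n u g \<Longrightarrow> has_laplacian q g f"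
proof -
  assume a: "has_laplacian_pow q (Suc n) u f" "has_laplacian_pow q n u g"
  then obtain f' where h: "has_laplacian_pow q n u f'" "has_laplacian q f' f" by auto
  show "has_laplacian q g f" by (rule has_laplacian_cong[OF h(2)]) (use pow_unique[OF h(1) a(2)] in auto)
qed

lemma pow_prev: "n \<le> m \<Longrightarrow> has_laplacian_pow q m u f \<Longrightarrow> \<exists>g. has_laplacian_pow q n u g"
proof (induction m arbitrary: f)
  case (Suc m)
  then show ?case by (cases "n = Suc m") auto
qed auto

lemma mono_pow: "k \<in> {1..3} \<Longrightarrow> n \<le> Suc j \<Longrightarrow>
   has_laplacian_pow q n (pmono k l j) (if n \<le> j then pmono k l (j - n) else (\<lambda>_. 0))"
proof (induction n)
  case (Suc n)
  then have "has_laplacian_pow q n (pmono k l j) (pmono k l (j - n))" by simp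
  moreover have "has_laplacian q (pmono k l (j - n)) (if Suc n \<le> j then pmono k l (j - Suc n) else (\<lambda>_. 0))"
    using mono_laplacian[OF Suc.prems(1), of l "j - n"] Suc.prems(2) by (auto simp: monod_def split: if_splits)
  ultimately show ?case by auto
qed auto

definition mono_data :: "(real^2 \<Rightarrow> real) \<Rightarrow> 3 \<Rightarrow> nat \<Rightarrow> nat \<Rightarrow> bool" where
  "mono_data P l j k \<longleftrightarrow> P \<in> extensional (SG q) \<and> P \<in> polyharmonic q j \<and>
     (\<forall>m\<le>j. \<exists>g. has_laplacian_pow q m P g \<and>
        g (q l) = of_bool (m = j \<and> k = 1) \<and>
        has_normal_deriv q g l (of_bool (m = j \<and> k = 2)) \<and>
        has_tangential_deriv q g l (of_bool (m = j \<and> k = 3)))"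

lemma mono_data_mono: "k \<in> {1..3} \<Longrightarrow> mono_data (pmono k l j) l j k"
  unfolding mono_data_def
proof (intro conjI allI impI)
  assume k: "k \<in> {1..3}"
  show "pmono k l j \<in> extensional (SG q)" by (rule pmono[OF k])
  show "pmono k l j \<in> polyharmonic q j"
    unfolding polyharmonic_def using mono_pow[OF k, of "Suc j" j l] by auto
  fix m assume m: "m \<le> j"
  then have z: "m = j \<longleftrightarrow> j - m = 0" by auto
  have "has_laplacian_pow q m (pmono k l j) (pmono k l (j - m))" using mono_pow[OF k, of m j l] m by simp
  then show "\<exists>g. has_laplacian_pow q m (pmono k l j) g \<and> g (q l) = of_bool (m = j \<and> k = 1) \<and>
      has_normal_deriv q g l (of_bool (m = j \<and> k = 2)) \<and> has_tangential_deriv q g l (of_bool (m = j \<and> k = 3))"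
    using mono_normal[OF k, of l "j - m"] mono_tangential[OF k, of l "j - m"] mono_q[OF k, of l "j - m" l]
    unfolding z by (intro exI[of _ "pmono k l (j - m)"]) (simp add: Pc_centre conj_commute)
qed

text \<open>Descending induction on the power m: if the powers m + 1 agree, the difference of the
  powers m is harmonic with zero value, normal and tangential derivative at q_l, hence zero.\<close>

lemma mono_data_unique:
  assumes P: "mono_data P l j k" and P': "mono_data P' l j k"
  shows "P = P'"
proof -
  have pow: "has_laplacian_pow q (Suc j) P (\<lambda>_. 0)" "has_laplacian_pow q (Suc j) P' (\<lambda>_. 0)"
    using P P' by (simp_all only: mono_data_def polyharmonic_def mem_Collect_eq)
  have "m \<le> Suc j \<Longrightarrow> (\<forall>g g'. has_laplacian_pow q m P g \<longrightarrow> has_laplacian_pow q m P' g' \<longrightarrow> (\<forall>x\<in>SG q. g x = g' x))" for m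
  proof (induction rule: inc_induct)
    case base
    then show ?case using pow_unique[OF pow(1)] pow_unique[OF pow(2)] by metis
  next
    case (step m)
    show ?case
    proof (intro allI impI ballI)
      fix g g' x assume g: "has_laplacian_pow q m P g" "has_laplacian_pow q m P' g'" and x: "x \<in> SG q"
      have mj: "m \<le> j" "Suc m \<le> Suc j" using step by auto
      obtain G G' where G: "has_laplacian_pow q (Suc m) P G" "has_laplacian_pow q (Suc m) P' G'"
        using pow_prev[OF mj(2) pow(1)] pow_prev[OF mj(2) pow(2)] by blast
      have eq: "G x = G' x" if "x \<in> SG q" for x using step.IH G that by blast
      have "has_laplacian q (\<lambda>x. g x - g' x) (\<lambda>x. G x - G' x)"
        by (rule has_laplacian_diff[OF pow_step[OF G(1) g(1)] pow_step[OF G(2) g(2)]])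
      then have L: "has_laplacian q (\<lambda>x. g x + (-1) * g' x) (\<lambda>_. 0)" by (rule has_laplacian_cong) (auto simp: eq)
      have data: "h (q l) = of_bool (m = j \<and> k = 1)" "has_normal_deriv q h l (of_bool (m = j \<and> k = 2))"
        "has_tangential_deriv q h l (of_bool (m = j \<and> k = 3))"
        if Q: "mono_data Q l j k" and h: "has_laplacian_pow q m Q h" for Q h
      proof -
        obtain g0 where g0: "has_laplacian_pow q m Q g0" "g0 (q l) = of_bool (m = j \<and> k = 1)"
          "has_normal_deriv q g0 l (of_bool (m = j \<and> k = 2))" "has_tangential_deriv q g0 l (of_bool (m = j \<and> k = 3))"
          using Q mj unfolding mono_data_def by blast
        have e: "h x = g0 x" if "x \<in> SG q" for x using pow_unique[OF h g0(1) that] .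
        show "h (q l) = of_bool (m = j \<and> k = 1)" "has_normal_deriv q h l (of_bool (m = j \<and> k = 2))"
          "has_tangential_deriv q h l (of_bool (m = j \<and> k = 3))"
          using g0 has_normal_deriv_cong[OF e] has_tangential_deriv_cong[OF e] e[OF q_in_SG] by auto
      qed
      note d = data[OF P g(1)] and d' = data[OF P' g(2)]
      have "g x + (-1) * g' x = 0"
        using harmonic_zero[OF L _ _ _ x, of l] d(1) d'(1)
          has_normal_deriv_add[OF d(2) has_normal_deriv_cmult[OF d'(2), of "-1"]]
          has_tangential_deriv_add[OF d(3) has_tangential_deriv_cmult[OF d'(3), of "-1"]] by simp
      then show "g x = g' x" by simp
    qed
  qed
  from this[of 0] have "\<forall>x\<in>SG q. P x = P' x" by (metis has_laplacian_pow.simps(1) le0)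
  moreover have "P \<in> extensional (SG q)" "P' \<in> extensional (SG q)"
    using P P' unfolding mono_data_def by blast+
  ultimately show ?thesis by (intro extensionalityI[of P "SG q" P']) auto
qed

lemma monomial_eq: assumes k: "k \<in> {1..3}" shows "monomial q l j k = pmono k l j"
  unfolding monomial_def mono_data_def[symmetric]
  by (rule the_equality, rule mono_data_mono[OF k], erule mono_data_unique[OF _ mono_data_mono[OF k]])

section \<open>Power series\<close>

text \<open>A bound at every j rather than eventually, so that series can be majorised term by
  term.\<close>

definition geo :: "real \<Rightarrow> (nat \<Rightarrow> real) \<Rightarrow> bool" where
  "geo R a \<longleftrightarrow> (\<exists>C\<ge>0. \<forall>j. \<bar>a j\<bar> \<le> C * R ^ j)"

lemma geo_cong_bigo:
  assumes "0 < R" shows "geo R a \<longleftrightarrow> a \<in> O(\<lambda>j. R ^ j)"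
proof
  assume "geo R a"
  then obtain C where "\<And>j. \<bar>a j\<bar> \<le> C * R ^ j" by (auto simp: geo_def)
  then show "a \<in> O(\<lambda>j. R ^ j)" using assms by (intro bigoI[of _ C]) simp
next
  assume "a \<in> O(\<lambda>j. R ^ j)"
  then obtain c where c: "c > 0" "\<forall>\<^sub>F j in sequentially. norm (a j) \<le> c * norm (R ^ j)" by (elim landau_o.bigE)
  then obtain N where N: "\<And>j. j \<ge> N \<Longrightarrow> \<bar>a j\<bar> \<le> c * R ^ j" using assms by (auto simp: eventually_sequentially)
  define D where "D = (\<Sum>j<N. \<bar>a j\<bar> / R ^ j)"
  have D: "\<bar>a j\<bar> / R ^ j \<le> D" if "j < N" for j
    unfolding D_def using that assms by (intro member_le_sum) auto
  have D0: "0 \<le> D" unfolding D_def using assms by (intro sum_nonneg) auto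
  have "\<bar>a j\<bar> \<le> (c + D) * R ^ j" for j
  proof (cases "j < N")
    case True
    have "\<bar>a j\<bar> \<le> D * R ^ j" using D[OF True] assms by (simp add: pos_divide_le_eq)
    also have "\<dots> \<le> (c + D) * R ^ j" using c assms by (intro mult_right_mono) auto
    finally show ?thesis .
  next
    case False
    then have "\<bar>a j\<bar> \<le> c * R ^ j" using N by simp
    also have "\<dots> \<le> (c + D) * R ^ j" using D0 assms by (intro mult_right_mono) auto
    finally show ?thesis .
  qed
  then show "geo R a" unfolding geo_def using c D0 by (intro exI[of _ "c + D"]) auto
qed

lemma geo_Suc: "geo R a \<Longrightarrow> geo R (\<lambda>j. a (Suc j))"
proof -
  assume "geo R a"
  then obtain C where C: "0 \<le> C" "\<And>j. \<bar>a j\<bar> \<le> C * R ^ j" by (auto simp: geo_def)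
  have "\<bar>a (Suc j)\<bar> \<le> C * \<bar>R\<bar> * R ^ j" for j
  proof -
    have "0 \<le> C * R ^ j" using C(2)[of j] by linarith
    then have "C * R ^ j * R \<le> C * R ^ j * \<bar>R\<bar>" by (intro mult_left_mono) auto
    then show ?thesis using C(2)[of "Suc j"] by (simp add: mult_ac)
  qed
  then show ?thesis using C unfolding geo_def by (intro exI[of _ "C * \<bar>R\<bar>"]) auto
qed

definition mser :: "nat \<Rightarrow> 3 \<Rightarrow> (nat \<Rightarrow> real) \<Rightarrow> real^2 \<Rightarrow> real" where
  "mser k l a x = (\<Sum>j. a j * pmono k l j x)"

text \<open>A radius r strictly between R and \<open>Lam\<close> makes the monomials O(r^-j), and
  the terms are then dominated by powers of R/r < 1.\<close>

lemma mser_majorant: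
  assumes a: "geo R a" and R: "0 < R" "R < Lam"
  obtains r C where "R < r" "r < Lam" "0 \<le> C" "\<And>j. \<bar>a j\<bar> \<le> C * R ^ j" "summable (\<lambda>j. (R / r) ^ j)"
proof -
  obtain C where C: "0 \<le> C" "\<And>j. \<bar>a j\<bar> \<le> C * R ^ j" using a by (auto simp: geo_def)
  obtain r where r: "R < r" "r < Lam" using R dense by blast
  then have "summable (\<lambda>j. (R / r) ^ j)" using R by (intro summable_geometric) auto
  then show ?thesis using that r C by blast
qed

lemma mser_terms:
  assumes a: "geo R a" and R: "0 < R" "R < Lam" and k: "k \<in> {1..3}"
  obtains M where "summable M" "\<And>j x. x \<in> SG q \<Longrightarrow> \<bar>a j * pmono k l j x\<bar> \<le> M j"
proof -
  obtain r C where r: "R < r" "r < Lam" "0 \<le> C" "\<And>j. \<bar>a j\<bar> \<le> C * R ^ j" "summable (\<lambda>j. (R / r) ^ j)"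
    using mser_majorant[OF a R] by metis
  have r0: "0 < r" using r R by simp
  obtain M where M: "0 \<le> M" "\<And>k l j x. k \<in> {1..3} \<Longrightarrow> x \<in> SG q \<Longrightarrow> \<bar>pmono k l j x\<bar> \<le> M / r ^ j"
    using mono_bound[OF r0 r(2)] by metis
  have "\<bar>a j * pmono k l j x\<bar> \<le> C * M * (R / r) ^ j" if "x \<in> SG q" for j x
  proof -
    have "\<bar>a j * pmono k l j x\<bar> \<le> (C * R ^ j) * (M / r ^ j)"
      unfolding abs_mult using r M(1) M(2)[OF k that] R by (intro mult_mono) auto
    then show ?thesis by (simp add: power_divide mult_ac)
  qed
  moreover have "summable (\<lambda>j. C * M * (R / r) ^ j)" using r(5) by (rule summable_mult)
  ultimately show ?thesis using that by blast
qed

lemma mser_summable: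
  assumes "geo R a" "0 < R" "R < Lam" "k \<in> {1..3}" "x \<in> SG q"
  shows "summable (\<lambda>j. a j * pmono k l j x)"
proof -
  obtain M where M: "summable M" "\<And>j x. x \<in> SG q \<Longrightarrow> \<bar>a j * pmono k l j x\<bar> \<le> M j"
    using mser_terms[OF assms(1-4)] by metis
  show ?thesis by (rule summable_comparison_test[OF _ M(1)]) (use M(2)[OF assms(5)] in auto)
qed

lemma mser_continuous:
  assumes "geo R a" "0 < R" "R < Lam" "k \<in> {1..3}"
  shows "continuous_on (SG q) (mser k l a)"
proof -
  obtain M where M: "summable M" "\<And>j x. x \<in> SG q \<Longrightarrow> \<bar>a j * pmono k l j x\<bar> \<le> M j"
    using mser_terms[OF assms] by metis
  have "uniform_limit (SG q) (\<lambda>n x. \<Sum>j<n. a j * pmono k l j x) (mser k l a) sequentially"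
    unfolding mser_def[abs_def] by (rule Weierstrass_m_test[OF _ M(1)]) (use M(2) in auto)
  then show ?thesis
    by (rule uniform_limit_theorem[rotated])
      (auto intro!: always_eventually continuous_intros pmono(2)[OF assms(4)])
qed

text \<open>Laplacian and sum can be exchanged because the error of the j-th term is at most a
  constant times 5^-m (R/r)^j: summing over j leaves O(5^-m), uniformly over the junction points of
  level m.\<close>

lemma mser_laplacian:
  assumes a: "geo R a" and R: "0 < R" "R < Lam" and k: "k \<in> {1..3}"
  shows "has_laplacian q (mser k l a) (mser k l (\<lambda>j. a (Suc j)))"
  unfolding has_laplacian_iff
proof (intro conjI allI impI mser_continuous[OF a R k] mser_continuous[OF geo_Suc[OF a] R k])
  fix \<epsilon> :: real assume e: "\<epsilon> > 0"
  obtain r C where r: "R < r" "r < Lam" "0 \<le> C" "\<And>j. \<bar>a j\<bar> \<le> C * R ^ j" "summable (\<lambda>j. (R / r) ^ j)"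
    using mser_majorant[OF a R] by metis
  have r0: "0 < r" using r R by simp
  obtain D where D: "0 \<le> D" "\<And>k l j s a b n m. k \<in> {1..3} \<Longrightarrow> a \<noteq> b \<Longrightarrow> length s + Suc n = m \<Longrightarrow> 3 \<le> m \<Longrightarrow>
     \<bar>3/2 * 5 ^ m * jsum (pmono k l j) s a b n - monod k l j (jpt s a b n)\<bar> \<le> D / 5 ^ m / r ^ j"
    using mono_laplacian_error[OF r0 r(2)] by metis
  let ?S = "\<Sum>j. (R / r) ^ j"
  have "\<forall>\<^sub>F m in sequentially. C * D * ?S / 5 ^ m < \<epsilon>"
    using tendsto_const_div_5 e by (intro order_tendstoD(2))
  then show "\<forall>\<^sub>F m in sequentially. \<forall>s a' b n. a' \<noteq> b \<longrightarrow> length s + Suc n = m \<longrightarrow>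
     \<bar>3/2 * 5 ^ m * jsum (mser k l a) s a' b n - mser k l (\<lambda>j. a (Suc j)) (jpt s a' b n)\<bar> < \<epsilon>"
    using eventually_ge_at_top[of 3]
  proof eventually_elim
    case (elim m)
    show ?case
    proof (intro allI impI)
      fix s :: "3 list" and a' b :: 3 and n assume h: "a' \<noteq> b" "length s + Suc n = m"
      have sums: "(\<lambda>j. a j * pmono k l j x) sums mser k l a x" if "x \<in> SG q" for x
        unfolding mser_def by (rule summable_sums[OF mser_summable[OF a R k that]])
      have P: "jpt s a' b n \<in> SG q" by (simp add: jpt_def Fw_q_in_SG)
      have "(\<lambda>j. jsum (\<lambda>x. a j * pmono k l j x) s a' b n) sums jsum (mser k l a) s a' b n"
        unfolding jsum_def tot_def
        by (intro sums_add sums_diff sums_sum sums_mult sums P Fw_q_in_SG)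
      then have "(\<lambda>j. a j * jsum (pmono k l j) s a' b n) sums jsum (mser k l a) s a' b n"
        unfolding jsum_cmult .
      moreover have "(\<lambda>j. a j * monod k l j (jpt s a' b n)) sums mser k l (\<lambda>j. a (Suc j)) (jpt s a' b n)"
      proof -
        have "(\<lambda>j. a (Suc j) * pmono k l j (jpt s a' b n)) sums mser k l (\<lambda>j. a (Suc j)) (jpt s a' b n)"
          unfolding mser_def by (rule summable_sums[OF mser_summable[OF geo_Suc[OF a] R k P]])
        then have "(\<lambda>j. a (Suc j) * monod k l (Suc j) (jpt s a' b n)) sums mser k l (\<lambda>j. a (Suc j)) (jpt s a' b n)"
          by (simp add: monod_def)
        from sums_Suc[OF this] show ?thesis by simp
      qed
      ultimately have S: "(\<lambda>j. 3/2 * 5 ^ m * (a j * jsum (pmono k l j) s a' b n) - a j * monod k l j (jpt s a' b n))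
         sums (3/2 * 5 ^ m * jsum (mser k l a) s a' b n - mser k l (\<lambda>j. a (Suc j)) (jpt s a' b n))"
        by (intro sums_diff sums_mult)
      have T: "\<bar>3/2 * 5 ^ m * (a j * jsum (pmono k l j) s a' b n) - a j * monod k l j (jpt s a' b n)\<bar>
          \<le> C * D / 5 ^ m * (R / r) ^ j" for j
      proof -
        have "3/2 * 5 ^ m * (a j * jsum (pmono k l j) s a' b n) - a j * monod k l j (jpt s a' b n)
          = a j * (3/2 * 5 ^ m * jsum (pmono k l j) s a' b n - monod k l j (jpt s a' b n))" by (simp add: algebra_simps)
        also have "\<bar>\<dots>\<bar> \<le> (C * R ^ j) * (D / 5 ^ m / r ^ j)"
          unfolding abs_mult using r(3) r(4)[of j] R D(2)[OF k h elim(2)] by (intro mult_mono) auto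
        finally show ?thesis by (simp add: power_divide mult_ac)
      qed
      have "\<bar>\<Sum>j. 3/2 * 5 ^ m * (a j * jsum (pmono k l j) s a' b n) - a j * monod k l j (jpt s a' b n)\<bar>
         \<le> (\<Sum>j. C * D / 5 ^ m * (R / r) ^ j)"
        unfolding real_norm_def[symmetric]
        by (rule norm_suminf_le[OF _ summable_mult[OF r(5)]]) (use T in simp)
      also have "\<dots> = C * D * ?S / 5 ^ m" using r(5) by (subst suminf_mult) auto
      finally show "\<bar>3/2 * 5 ^ m * jsum (mser k l a) s a' b n - mser k l (\<lambda>j. a (Suc j)) (jpt s a' b n)\<bar> < \<epsilon>"
        using elim(1) sums_unique[OF S] by simp
    qed
  qed
qed

end

section \<open>The second Neumann eigenvalue\<close>

lemma psi_scaled_error: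
  fixes \<mu> :: real
  assumes "\<bar>\<mu> / 5 ^ m\<bar> \<le> 6"
  shows "\<bar>3/2 * 5 ^ m * psi (\<mu> / 5 ^ m) - \<mu>\<bar> \<le> \<mu>\<^sup>2 / 5 ^ m"
proof -
  let ?z = "\<mu> / 5 ^ m"
  have "3/2 * 5 ^ m * psi ?z - \<mu> = 3/2 * 5 ^ m * (psi ?z - 2/3 * ?z)" by (simp add: algebra_simps)
  then have "\<bar>3/2 * 5 ^ m * psi ?z - \<mu>\<bar> = \<bar>3/2 * 5 ^ m * (psi ?z - 2/3 * ?z)\<bar>" by (simp only:)
  also have "\<dots> = 3/2 * 5 ^ m * \<bar>psi ?z - 2/3 * ?z\<bar>" unfolding abs_mult by simp
  also have "\<dots> \<le> 3/2 * 5 ^ m * (\<bar>?z\<bar>\<^sup>2 / 36)"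
    using psi_approx[of ?z] assms by (intro mult_left_mono) auto
  also have "\<dots> = \<mu>\<^sup>2 / 24 / 5 ^ m" by (simp add: power_divide power2_eq_square)
  also have "\<dots> \<le> \<mu>\<^sup>2 / 1 / 5 ^ m" by (intro divide_right_mono frac_le) auto
  finally show ?thesis by simp
qed

lemma eventually_div_5_le: "0 < e \<Longrightarrow> \<forall>\<^sub>F m in sequentially. \<bar>c / 5 ^ m\<bar> \<le> (e::real)"
  using order_tendstoD(2)[OF tendsto_rabs_zero[OF tendsto_div_5_power[of c]], of e]
  by (rule eventually_mono) auto

lemma psi_scaled_tendsto: "(\<lambda>m. 3/2 * 5 ^ m * psi (\<mu> / 5 ^ m)) \<longlonglongrightarrow> (\<mu>::real)"
proof (rule LIM_zero_cancel, rule Lim_null_comparison)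
  show "\<forall>\<^sub>F m in sequentially. norm (3/2 * 5 ^ m * psi (\<mu> / 5 ^ m) - \<mu>) \<le> \<mu>\<^sup>2 / 5 ^ m"
  proof (rule eventually_mono)
    show "\<forall>\<^sub>F m in sequentially. \<bar>\<mu> / 5 ^ m\<bar> \<le> 6" by (rule eventually_div_5_le) simp
    fix m assume "\<bar>\<mu> / 5 ^ m\<bar> \<le> 6"
    then show "norm (3/2 * 5 ^ m * psi (\<mu> / 5 ^ m) - \<mu>) \<le> \<mu>\<^sup>2 / 5 ^ m"
      unfolding real_norm_def by (rule psi_scaled_error)
  qed
  show "(\<lambda>m. \<mu>\<^sup>2 / 5 ^ m) \<longlonglongrightarrow> 0" by (rule tendsto_div_5_power)
qed

lemma psi_div_5_tendsto: "(\<lambda>m. psi (\<mu> / 5 ^ m)) \<longlonglongrightarrow> (0::real)"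
proof -
  have "(\<lambda>m. 3/2 * 5 ^ m * psi (\<mu> / 5 ^ m) * (2/3 / 5 ^ m)) \<longlonglongrightarrow> \<mu> * 0"
    by (intro tendsto_mult psi_scaled_tendsto tendsto_div_5_power)
  then show ?thesis by simp
qed

lemma sgerm_div_5_tendsto: "(\<lambda>m. sgerm (\<mu> / 5 ^ m)) \<longlonglongrightarrow> (-1/2::real)"
proof -
  have "(\<lambda>m. - (hat (\<mu> / 5 ^ m) * (1 + psi (\<mu> / 5 ^ m) / 6) / gam (\<mu> / 5 ^ m)) / 2) \<longlonglongrightarrow> - (1 * (1 + 0/6) / 1) / 2"
    using powser_div_5_tendsto[OF hcoef_bound, of \<mu>] powser_div_5_tendsto[OF gcoef_bound, of \<mu>]
    by (intro tendsto_intros psi_div_5_tendsto) (auto simp: hat_def gam_def)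
  then show ?thesis by (simp add: sgerm_def)
qed

context gasket
begin

lemma coherent_E: "coherent (E \<mu> X)"
  unfolding coherent_def E_append by (auto simp: E_self sub_commute)

text \<open>After two letters the parameter is at most 30/25 = 6/5, and the finitely many level-two
  values have a common bound B. Values on shorter words are among them, by repeating the corner
  letter.\<close>

lemma E_holder:
  fixes \<mu> :: real
  assumes "\<bar>\<mu>\<bar> \<le> 30"
  obtains K where "\<And>w i j. \<bar>E \<mu> X w i - E \<mu> X w j\<bar> \<le> K * (4/5) ^ length w"
proof -
  define B where "B = (\<Sum>(a, b, j)\<in>UNIV. \<bar>E \<mu> X [a, b] j\<bar>)"
  have B: "\<bar>E \<mu> X [a, b] j\<bar> \<le> B" for a b j
    unfolding B_def by (rule order_trans[OF _ member_le_sum[of "(a, b, j)"]]) auto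
  have B0: "0 \<le> B" using B[of 0 0 0] by linarith
  have "\<bar>E \<mu> X w i - E \<mu> X w j\<bar> \<le> 16 * B * (4/5) ^ length w" for w i j
  proof -
    have short: ?thesis if "\<bar>E \<mu> X w i\<bar> \<le> B" "\<bar>E \<mu> X w j\<bar> \<le> B" "length w \<le> 1"
    proof -
      have "(4/5 :: real) ^ 1 \<le> (4/5) ^ length w" using that by (intro power_decreasing) auto
      then have "16 * B * (4/5) \<le> 16 * B * (4/5) ^ length w" using B0 by (intro mult_left_mono) auto
      then show ?thesis using that B0 by linarith
    qed
    consider "w = []" | a where "w = [a]" | a b v where "w = a # b # v" by (metis neq_Nil_conv)
    then show ?thesis
    proof cases
      case 1
      have "E \<mu> X w c = E \<mu> X [c, c] c" for c using 1 by simp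
      then show ?thesis using short B 1 by (metis list.size(3) zero_le)
    next
      case 2
      have "E \<mu> X w c = E \<mu> X [a, c] c" for c using 2 by simp
      then show ?thesis using short B 2 by (metis One_nat_def length_Cons list.size(3) order_refl)
    next
      case 3
      have e: "E \<mu> X w c = E (\<mu>/25) (E \<mu> X [a, b]) v c" for c using 3 by simp
      have "\<bar>E \<mu> X w i - E \<mu> X w j\<bar> \<le> 8 * B * (4/5) ^ length v"
        using E_osc[of "E \<mu> X [a, b]" B "\<mu>/25" v i j] B assms unfolding e by simp
      also have "\<dots> \<le> 16 * B * (4/5) ^ length w" using B0 3 by simp
      finally show ?thesis .
    qed
  qed
  then show ?thesis using that by blast
qed

lemma eigen_extension:
  fixes g :: "3 list \<Rightarrow> 3 \<Rightarrow> real"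
  assumes g: "coherent g" and K: "\<And>w i j. \<bar>g w i - g w j\<bar> \<le> K * (4/5) ^ length w"
    and j: "\<And>s a b n. a \<noteq> b \<Longrightarrow> flux (psi (\<mu> / 5 ^ (length s + Suc n))) (g (s @ a # replicate n b)) b
       + flux (psi (\<mu> / 5 ^ (length s + Suc n))) (g (s @ b # replicate n a)) a = 0"
  obtains u where "has_laplacian q u (\<lambda>x. \<mu> * u x)" "\<And>w i. u (Fw q w (q i)) = g w i"
proof -
  obtain u where u: "continuous_on (SG q) u" "\<And>w i. u (Fw q w (q i)) = g w i"
    using extension_exists[OF g K] by blast
  define G where "G = \<bar>g [] 0\<bar> + 5 * K"
  have G: "\<bar>g w i\<bar> \<le> G" for w i
  proof -
    have "\<bar>g w i - g [] 0\<bar> \<le> 5 * K * (4/5) ^ length ([] :: 3 list)"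
      by (rule osc_cell[OF g K]) (auto simp: cell_def intro: Fw_q_in_SG)
    then show ?thesis by (simp add: G_def)
  qed
  have "has_laplacian q u (\<lambda>x. \<mu> * u x)"
    unfolding has_laplacian_iff
  proof (intro conjI allI impI u continuous_intros)
    fix \<epsilon> :: real assume e: "0 < \<epsilon>"
    have "\<forall>\<^sub>F m in sequentially. \<mu>\<^sup>2 * G / 5 ^ m < \<epsilon>"
      using tendsto_const_div_5 e by (intro order_tendstoD(2))
    then show "\<forall>\<^sub>F m in sequentially. \<forall>s a b n. a \<noteq> b \<longrightarrow> length s + Suc n = m \<longrightarrow>
       \<bar>3/2 * 5 ^ m * jsum u s a b n - \<mu> * u (jpt s a b n)\<bar> < \<epsilon>"
      using eventually_div_5_le[of 6 \<mu>, simplified]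
    proof eventually_elim
      case (elim m)
      show ?case
      proof (intro allI impI)
        fix s :: "3 list" and a b :: 3 and n assume h: "a \<noteq> b" "length s + Suc n = m"
        let ?w = "s @ a # replicate n b" and ?v = "s @ b # replicate n a"
        have eq: "g ?v a = g ?w b" using g by (simp add: coherent_def)
        have "jsum u s a b n = (tot (g ?w) - 3 * g ?w b) + (tot (g ?v) - 3 * g ?w b)"
          unfolding jsum_def jpt_def u(2) ..
        also have "\<dots> = psi (\<mu> / 5 ^ m) * g ?w b"
          using j[OF h(1), of s n] unfolding h(2) flux_def eq by (simp add: algebra_simps)
        finally have "3/2 * 5 ^ m * jsum u s a b n - \<mu> * u (jpt s a b n)
          = (3/2 * 5 ^ m * psi (\<mu> / 5 ^ m) - \<mu>) * g ?w b"
          by (simp add: jpt_def u(2) algebra_simps)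
        also have "\<bar>\<dots>\<bar> \<le> \<mu>\<^sup>2 / 5 ^ m * G"
          unfolding abs_mult using psi_scaled_error[of \<mu> m] elim G by (intro mult_mono) auto
        finally show "\<bar>3/2 * 5 ^ m * jsum u s a b n - \<mu> * u (jpt s a b n)\<bar> < \<epsilon>"
          using elim(1) by simp
      qed
    qed
  qed
  then show ?thesis using u(2) that by blast
qed

text \<open>Zero flux at a corner turns the difference in the normal derivative into -psi
  (\<mu>/5^m)/2 times the corner value, of order 5^-m, which outweighs the factor (5/3)^m.\<close>

lemma neumann_from_words:
  fixes g :: "3 list \<Rightarrow> 3 \<Rightarrow> real"
  assumes g: "coherent g" and K: "\<And>w i j. \<bar>g w i - g w j\<bar> \<le> K * (4/5) ^ length w"
    and j: "\<And>s a b n. a \<noteq> b \<Longrightarrow> flux (psi (\<mu> / 5 ^ (length s + Suc n))) (g (s @ a # replicate n b)) b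
       + flux (psi (\<mu> / 5 ^ (length s + Suc n))) (g (s @ b # replicate n a)) a = 0"
    and b: "\<And>i k. flux (psi (\<mu> / 5 ^ Suc k)) (g (replicate (Suc k) i)) i = 0"
    and nz: "g [] 0 \<noteq> 0"
  shows "neumann_eigenvalue q (- \<mu>)"
proof -
  obtain u where u: "has_laplacian q u (\<lambda>x. \<mu> * u x)" "\<And>w i. u (Fw q w (q i)) = g w i"
    using eigen_extension[OF g K j] by blast
  have "has_normal_deriv q u i 0" for i
    unfolding has_normal_deriv_def
  proof (rule Lim_transform_eventually)
    have gi: "g (replicate m i) i = u (q i)" for m using u(2)[of "replicate m i" i] by simp
    have "(\<lambda>m. (1/3) ^ m * (3/2 * 5 ^ m * psi (\<mu> / 5 ^ m)) * (- u (q i) / 3)) \<longlonglongrightarrow> 0 * \<mu> * (- u (q i) / 3)"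
      by (intro tendsto_mult psi_scaled_tendsto LIMSEQ_power_zero tendsto_const) auto
    then show "(\<lambda>m. (1/3) ^ m * (3/2 * 5 ^ m * psi (\<mu> / 5 ^ m)) * (- u (q i) / 3)) \<longlonglongrightarrow> 0" by simp
    show "\<forall>\<^sub>F m in sequentially. (1/3) ^ m * (3/2 * 5 ^ m * psi (\<mu> / 5 ^ m)) * (- u (q i) / 3) =
      (5/3) ^ m * (2 * u (q i) - u ((F q i ^^ m) (q (i + 1))) - u ((F q i ^^ m) (q (i - 1))))"
      using eventually_ge_at_top[of 1]
    proof eventually_elim
      case (elim m)
      then obtain k where k: "m = Suc k" by (cases m) auto
      have "flux (psi (\<mu> / 5 ^ m)) (g (replicate m i)) i = 0" using b unfolding k .
      then have "g (replicate m i) (i + 1) + g (replicate m i) (i - 1) = (2 + psi (\<mu> / 5 ^ m) / 2) * u (q i)"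
        unfolding flux_def tot_eq[of _ i] gi by (simp add: algebra_simps)
      then have e: "2 * u (q i) - u ((F q i ^^ m) (q (i + 1))) - u ((F q i ^^ m) (q (i - 1))) = - psi (\<mu> / 5 ^ m) / 2 * u (q i)"
        unfolding F_funpow u(2) by (simp add: algebra_simps)
      show ?case unfolding e by (simp add: power_divide mult_ac)
    qed
  qed
  moreover have "u (q 0) \<noteq> 0" using u(2)[of "[]" 0] nz by simp
  ultimately show ?thesis unfolding neumann_eigenvalue_def using u(1) q_in_SG by auto
qed

section \<open>Eigenfunctions for the first two nonzero eigenvalues\<close>

lemma psi_m5z0: "psi (- 5 * z0) = -6" "regular (- 5 * z0)"
proof -
  have e: "- 5 * z0 / 5 = - z0" by simp
  have "regular (-5 * z0)" using z0 by (auto simp: regular_def)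
  then show "regular (- 5 * z0)" .
  then show "psi (- 5 * z0) = -6" using regular_psi[of "-5 * z0"] z0(3) unfolding e by simp
qed

definition ytri :: "3 \<Rightarrow> 3 \<Rightarrow> real" where "ytri i j = (if j = i then -2 else 1)"

lemma tot_ytri: "tot (ytri i) = 0" by (simp add: tot_eq[of _ i] ytri_def)

text \<open>The eigenvalue psi (-5 z0) = -3 * (5 - 3) = -6 makes \<open>3 + p/2\<close> vanish, so
  the flux is the total of the three values at every corner, and -2 + 1 + 1 = 0.\<close>

lemma flux_ytri: "flux (psi (- 5 * z0 / 5 ^ k)) (E (- 5 * z0) (ytri a) (replicate k b)) b = 0"
proof -
  have "flux (psi (- 5 * z0)) (ytri a) b = 0" unfolding psi_m5z0(1) flux_def tot_ytri by simp
  then show ?thesis unfolding flux_replicate[OF psi_m5z0(2)] by simp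
qed

lemma neumann_5z0: "neumann_eigenvalue q (5 * z0)"
proof -
  let ?g = "E (- 5 * z0) (ytri 0)"
  obtain K where K: "\<And>w i j. \<bar>?g w i - ?g w j\<bar> \<le> K * (4/5) ^ length w"
    using E_holder[of "-5 * z0" "ytri 0"] z0 by auto
  have "neumann_eigenvalue q (- (- 5 * z0))"
  proof (rule neumann_from_words[OF coherent_E K])
    show "flux (psi (- 5 * z0 / 5 ^ (length s + Suc n))) (?g (s @ a # replicate n b)) b
       + flux (psi (- 5 * z0 / 5 ^ (length s + Suc n))) (?g (s @ b # replicate n a)) a = 0" if "a \<noteq> b" for s a b n
      by (rule E_flux_junction[OF psi_m5z0(2) that])
    show "flux (psi (- 5 * z0 / 5 ^ Suc k)) (?g (replicate (Suc k) i)) i = 0" for i k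
      by (rule flux_ytri)
  qed (simp add: ytri_def)
  then show ?thesis by simp
qed

text \<open>The eigenfunction for \<open>Lam\<close> consists of three eigenfunctions for \<open>Lam/5\<close>, glued at the midpoints.\<close>

primrec glue :: "3 list \<Rightarrow> 3 \<Rightarrow> real" where
  "glue [] i = -2"
| "glue (a # w) i = E (- 5 * z0) (ytri a) w i"

text \<open>Every corner flux of a piece vanishes by itself, so gluing creates no source at the
  midpoints; the values match since each \<open>ytri a\<close> is 1 away from its own corner.
  Inserting one level multiplies the parameter by 5.\<close>

lemma neumann_Lam: "neumann_eigenvalue q Lam"
proof -
  have "\<forall>a. \<exists>K. \<forall>w i j. \<bar>E (- 5 * z0) (ytri a) w i - E (- 5 * z0) (ytri a) w j\<bar> \<le> K * (4/5) ^ length w"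
  proof
    fix a show "\<exists>K. \<forall>w i j. \<bar>E (- 5 * z0) (ytri a) w i - E (- 5 * z0) (ytri a) w j\<bar> \<le> K * (4/5) ^ length w"
    proof -
      obtain K where "\<And>w i j. \<bar>E (- 5 * z0) (ytri a) w i - E (- 5 * z0) (ytri a) w j\<bar> \<le> K * (4/5) ^ length w"
        using E_holder[of "-5 * z0" "ytri a"] z0 by auto
      then show ?thesis by blast
    qed
  qed
  then obtain K where K: "\<And>a w i j. \<bar>E (- 5 * z0) (ytri a) w i - E (- 5 * z0) (ytri a) w j\<bar> \<le> K a * (4/5) ^ length w"
    by metis
  have K0: "0 \<le> K a" for a using K[of a "[]" 0 0] by simp
  define L where "L = 2 * (\<Sum>a\<in>UNIV. K a)"
  have L: "\<bar>glue w i - glue w j\<bar> \<le> L * (4/5) ^ length w" for w i j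
  proof (cases w)
    case Nil then show ?thesis using K0 by (simp add: L_def sum_nonneg)
  next
    case (Cons a v)
    have "K a \<le> (\<Sum>a\<in>UNIV. K a)" using K0 by (intro member_le_sum) auto
    then have "K a \<le> L * (4/5)" using K0[of a] by (simp add: L_def)
    then have "K a * (4/5) ^ length v \<le> L * (4/5) * (4/5) ^ length v" by (intro mult_right_mono) auto
    with K[of a v i j] have "\<bar>glue w i - glue w j\<bar> \<le> L * (4/5) * (4/5) ^ length v"
      unfolding Cons glue.simps by (rule order_trans)
    then show ?thesis using Cons by simp
  qed
  have e: "- 25 * z0 / 5 ^ Suc m = - 5 * z0 / 5 ^ m" for m by simp
  have "neumann_eigenvalue q (- (- 25 * z0))"
  proof (rule neumann_from_words[OF _ L])
    show "coherent glue" unfolding coherent_def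
    proof (intro conjI allI)
      fix w i n show "glue (w @ replicate n i) i = glue w i"
      proof (cases w)
        case Nil then show ?thesis by (cases n) (auto simp: E_self ytri_def)
      qed (auto simp: E_append E_self)
    next
      fix s a b n show "glue (s @ a # replicate n b) b = glue (s @ b # replicate n a) a"
      proof (cases s)
        case Nil then show ?thesis by (auto simp: E_self ytri_def)
      qed (auto simp: E_append E_self sub_commute)
    qed
    show "flux (psi (- 25 * z0 / 5 ^ (length s + Suc n))) (glue (s @ a # replicate n b)) b
       + flux (psi (- 25 * z0 / 5 ^ (length s + Suc n))) (glue (s @ b # replicate n a)) a = 0" if ab: "a \<noteq> b" for s a b n
    proof (cases s)
      case Nil
      have "glue (a # replicate n b) = E (- 5 * z0) (ytri a) (replicate n b)" for a b by (simp add: fun_eq_iff)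
      then show ?thesis using flux_ytri[of n a b] flux_ytri[of n b a] unfolding Nil append_Nil list.size add_0 e by simp
    next
      case (Cons c v)
      have g: "glue (s @ x # replicate n y) = E (- 5 * z0) (ytri c) (v @ x # replicate n y)" for x y
        by (simp add: fun_eq_iff Cons)
      have l: "length s + Suc n = Suc (length v + Suc n)" using Cons by simp
      show ?thesis unfolding g l e by (rule E_flux_junction[OF psi_m5z0(2) ab])
    qed
    show "flux (psi (- 25 * z0 / 5 ^ Suc k)) (glue (replicate (Suc k) i)) i = 0" for i k
    proof -
      have "glue (replicate (Suc k) i) = E (- 5 * z0) (ytri i) (replicate k i)" by (simp add: fun_eq_iff)
      then show ?thesis using flux_ytri[of k i i] unfolding e by simp
    qed
  qed simp
  then show ?thesis by (simp add: Lam_def)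
qed

subsection \<open>Spectral decimation of an arbitrary Neumann eigenfunction\<close>

text \<open>Level m inside the cell is level \<open>length w + m\<close> outside, which accounts for
  the factor 5^-length w.\<close>

lemma has_laplacian_Fw:
  assumes "has_laplacian q u f"
  shows "has_laplacian q (\<lambda>x. u (Fw q w x)) (\<lambda>x. f (Fw q w x) / 5 ^ length w)"
  unfolding has_laplacian_iff
proof (intro conjI allI impI)
  show "continuous_on (SG q) (\<lambda>x. u (Fw q w x))" "continuous_on (SG q) (\<lambda>x. f (Fw q w x) / 5 ^ length w)"
    using assms by (auto simp: has_laplacian_def Fw_in_SG intro!: continuous_intros continuous_on_compose2[OF _ continuous_Fw])
  fix \<epsilon> :: real assume e: "0 < \<epsilon>"
  have j: "jsum (\<lambda>x. u (Fw q w x)) s a b n = jsum u (w @ s) a b n" "Fw q w (jpt s a b n) = jpt (w @ s) a b n" for s a b n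
    by (simp_all add: jsum_def jpt_def Fw_append)
  have pos: "\<epsilon> * 5 ^ length w > 0" using e by simp
  have "\<forall>\<^sub>F m in sequentially. \<forall>s a b n. a \<noteq> b \<longrightarrow> length s + Suc n = m \<longrightarrow>
      \<bar>3/2 * 5 ^ m * jsum u s a b n - f (jpt s a b n)\<bar> < \<epsilon> * 5 ^ length w"
    using assms unfolding has_laplacian_iff by (elim conjE allE[of _ "\<epsilon> * 5 ^ length w"] impE[OF _ pos])
  then obtain N where N: "\<And>m s a b n. N \<le> m \<Longrightarrow> a \<noteq> b \<Longrightarrow> length s + Suc n = m \<Longrightarrow>
      \<bar>3/2 * 5 ^ m * jsum u s a b n - f (jpt s a b n)\<bar> < \<epsilon> * 5 ^ length w"
    unfolding eventually_sequentially by blast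
  show "\<forall>\<^sub>F m in sequentially. \<forall>s a b n. a \<noteq> b \<longrightarrow> length s + Suc n = m \<longrightarrow>
     \<bar>3/2 * 5 ^ m * jsum (\<lambda>x. u (Fw q w x)) s a b n - f (Fw q w (jpt s a b n)) / 5 ^ length w\<bar> < \<epsilon>"
    using eventually_ge_at_top[of N]
  proof eventually_elim
    case (elim m)
    show ?case
    proof (intro allI impI)
      fix s :: "3 list" and a b :: 3 and n assume h: "a \<noteq> b" "length s + Suc n = m"
      let ?z = "3/2 * 5 ^ (length w + m) * jsum u (w @ s) a b n - f (jpt (w @ s) a b n)"
      have "\<bar>?z\<bar> < \<epsilon> * 5 ^ length w"
        using N[of "length w + m" a b "w @ s" n] elim h by simp
      then have "\<bar>?z\<bar> / 5 ^ length w < \<epsilon>" by (simp add: pos_divide_less_eq)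
      moreover have "3/2 * 5 ^ m * jsum u (w @ s) a b n - f (jpt (w @ s) a b n) / 5 ^ length w = ?z / 5 ^ length w"
        by (simp add: power_add field_simps)
      ultimately show "\<bar>3/2 * 5 ^ m * jsum (\<lambda>x. u (Fw q w x)) s a b n - f (Fw q w (jpt s a b n)) / 5 ^ length w\<bar> < \<epsilon>"
        unfolding j by simp
    qed
  qed
qed

text \<open>With B\<eta> \<le> 1/2 the sup bound applied to the difference d of two eigenfunctions
  with equal boundary values gives sup \<bar>d\<bar> \<le> 1/2 sup \<bar>d\<bar>, so d = 0.\<close>

lemma small_eigen_unique:
  obtains \<eta> where "0 < \<eta>" "\<eta> \<le> 6/5"
    "\<And>\<nu> v w i. \<bar>\<nu>\<bar> \<le> \<eta> \<Longrightarrow> has_laplacian q v (\<lambda>x. \<nu> * v x) \<Longrightarrow> v (Fw q w (q i)) = E \<nu> (\<lambda>i. v (q i)) w i"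
proof -
  obtain B where B: "0 \<le> B" "\<And>u f K x. has_laplacian q u f \<Longrightarrow> (\<And>x. x \<in> SG q \<Longrightarrow> \<bar>f x\<bar> \<le> K) \<Longrightarrow>
    (\<And>i. u (q i) = 0) \<Longrightarrow> x \<in> SG q \<Longrightarrow> \<bar>u x\<bar> \<le> B * K"
    by (rule laplacian_sup_bound) blast
  define \<eta> where "\<eta> = 1 / (2 * B + 1)"
  have \<eta>: "0 < \<eta>" "\<eta> \<le> 1" "B * \<eta> \<le> 1/2" using B(1) by (auto simp: \<eta>_def divide_simps)
  show ?thesis
  proof (rule that[of \<eta>])
    fix \<nu> v w i assume nu: "\<bar>\<nu>\<bar> \<le> \<eta>" and v: "has_laplacian q v (\<lambda>x. \<nu> * v x)"
    let ?X = "\<lambda>i. v (q i)"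
    have r: "regular \<nu>" using nu \<eta> by (intro regular_small) auto
    obtain K where K: "\<And>w i j. \<bar>E \<nu> ?X w i - E \<nu> ?X w j\<bar> \<le> K * (4/5) ^ length w"
      using E_holder[of \<nu> ?X] nu \<eta> by auto
    have J: "flux (psi (\<nu> / 5 ^ (length s + Suc n))) (E \<nu> ?X (s @ a # replicate n b)) b
       + flux (psi (\<nu> / 5 ^ (length s + Suc n))) (E \<nu> ?X (s @ b # replicate n a)) a = 0" if "a \<noteq> b" for s a b n
      by (rule E_flux_junction[OF r that])
    obtain e where e: "has_laplacian q e (\<lambda>x. \<nu> * e x)" "\<And>w i. e (Fw q w (q i)) = E \<nu> ?X w i"
      using eigen_extension[OF coherent_E K J] by blast
    let ?d = "\<lambda>x. v x - e x"
    have d: "has_laplacian q ?d (\<lambda>x. \<nu> * v x - \<nu> * e x)" by (rule has_laplacian_diff[OF v e(1)])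
    have "continuous_on (SG q) (\<lambda>x. \<bar>?d x\<bar>)" using d by (auto simp: has_laplacian_def intro!: continuous_intros)
    from continuous_attains_sup[OF compact_SG SG_ne this]
    obtain x0 where x0: "x0 \<in> SG q" "\<And>x. x \<in> SG q \<Longrightarrow> \<bar>?d x\<bar> \<le> \<bar>?d x0\<bar>" by blast
    have "\<bar>?d x0\<bar> \<le> B * (\<eta> * \<bar>?d x0\<bar>)"
    proof (rule B(2)[OF d _ _ x0(1)])
      fix x assume "x \<in> SG q"
      then show "\<bar>\<nu> * v x - \<nu> * e x\<bar> \<le> \<eta> * \<bar>?d x0\<bar>"
        using x0(2)[of x] nu \<eta> unfolding right_diff_distrib[symmetric] abs_mult by (intro mult_mono) auto
    next
      fix i show "?d (q i) = 0" using e(2)[of "[]" i] by simp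
    qed
    also have "\<dots> \<le> 1/2 * \<bar>?d x0\<bar>" using mult_right_mono[OF \<eta>(3), of "\<bar>?d x0\<bar>"] by (simp add: mult_ac)
    finally have "?d x0 = 0" by simp
    then have "?d (Fw q w (q i)) = 0" using x0(2)[of "Fw q w (q i)"] Fw_q_in_SG by simp
    then show "v (Fw q w (q i)) = E \<nu> ?X w i" using e(2) by simp
  qed (use \<eta> in auto)
qed

text \<open>The corner condition is the discrete Neumann condition: the eigenvalue equation after
  even reflection across the corner.\<close>

definition graph_eigen :: "(3 list \<Rightarrow> 3 \<Rightarrow> real) \<Rightarrow> real \<Rightarrow> nat \<Rightarrow> bool" where
  "graph_eigen U p m \<longleftrightarrow>
     (\<forall>s a b n. a \<noteq> b \<longrightarrow> length s + Suc n = m \<longrightarrow> flux p (U (s @ a # replicate n b)) b + flux p (U (s @ b # replicate n a)) a = 0) \<and>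
     (\<forall>i. flux p (U (replicate m i)) i = 0)"

text \<open>On small cells u is given by \<open>E\<close>, so at k further levels each flux equals
  (3/5)^k times a quotient with nonzero limit times the flux at level m. A nonzero sum at a junction
  would make the renormalised Laplacian grow like 3^k, and a nonzero corner flux would give a
  nonzero normal derivative.\<close>

lemma eigen_graph:
  assumes u: "has_laplacian q u (\<lambda>x. \<mu> * u x)" and nd: "\<And>i. has_normal_deriv q u i 0"
  obtains N where "\<bar>\<mu>\<bar> / 5 ^ N \<le> 6/5" "\<And>m. N \<le> m \<Longrightarrow> graph_eigen (\<lambda>w i. u (Fw q w (q i))) (psi (\<mu> / 5 ^ m)) m"
    "\<And>w v i. N \<le> length w \<Longrightarrow> u (Fw q (w @ v) (q i)) = E (\<mu> / 5 ^ length w) (\<lambda>i. u (Fw q w (q i))) v i"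
proof -
  define U where "U w i = u (Fw q w (q i))" for w i
  obtain \<eta> where \<eta>: "0 < \<eta>" "\<eta> \<le> 6/5"
    "\<And>\<nu> v w i. \<bar>\<nu>\<bar> \<le> \<eta> \<Longrightarrow> has_laplacian q v (\<lambda>x. \<nu> * v x) \<Longrightarrow> v (Fw q w (q i)) = E \<nu> (\<lambda>i. v (q i)) w i"
    by (rule small_eigen_unique) blast
  obtain N where N: "\<And>m. N \<le> m \<Longrightarrow> \<bar>\<mu> / 5 ^ m\<bar> \<le> \<eta>"
    using eventually_div_5_le[OF \<eta>(1), of \<mu>] unfolding eventually_sequentially by blast
  have E: "U (w @ v) = E (\<mu> / 5 ^ length w) (U w) v" if "N \<le> length w" for w v
  proof
    fix i
    have "has_laplacian q (\<lambda>x. u (Fw q w x)) (\<lambda>x. \<mu> / 5 ^ length w * u (Fw q w x))"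
      using has_laplacian_Fw[OF u, of w] by simp
    from \<eta>(3)[OF N[OF that] this, of v i] show "U (w @ v) i = E (\<mu> / 5 ^ length w) (U w) v i"
      unfolding U_def by (simp add: Fw_append)
  qed
  have reg: "regular (\<mu> / 5 ^ m)" "\<bar>\<mu> / 5 ^ m\<bar> \<le> 6" "sgerm (\<mu> / 5 ^ m) \<noteq> 0" if "N \<le> m" for m
    using N[OF that] \<eta> by (auto intro!: regular_small sgerm_nonzero)
  have rf: "rfac (\<mu> / 5 ^ m) k = (3/5) ^ k * sgerm (\<mu> / 5 ^ (m + k)) / sgerm (\<mu> / 5 ^ m)" if "N \<le> m" for m k
    using rfac_sgerm[of "\<mu> / 5 ^ m" k] reg[OF that] by (simp add: power_add field_simps)
  have fl: "flux (psi (\<mu> / 5 ^ (length w + k))) (U (w @ replicate k b)) b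
      = (3/5) ^ k * sgerm (\<mu> / 5 ^ (length w + k)) / sgerm (\<mu> / 5 ^ length w) * flux (psi (\<mu> / 5 ^ length w)) (U w) b"
    if "N \<le> length w" for w k b
    using flux_replicate[OF reg(1)[OF that], of k "U w" b] unfolding E[OF that] rf[OF that]
    by (simp add: power_add)
  have st: "(\<lambda>k. sgerm (\<mu> / 5 ^ (m + k)) / sgerm (\<mu> / 5 ^ m) * \<Phi>) \<longlonglongrightarrow> (-1/2) / sgerm (\<mu> / 5 ^ m) * \<Phi>" if "N \<le> m" for m \<Phi>
    using LIMSEQ_ignore_initial_segment[OF sgerm_div_5_tendsto[of \<mu>], of m] reg(3)[OF that]
    by (intro tendsto_intros) (auto simp: add.commute)
  have psc: "(\<lambda>k. 3/2 * 5 ^ (m + k) * psi (\<mu> / 5 ^ (m + k))) \<longlonglongrightarrow> \<mu>" for m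
    using LIMSEQ_ignore_initial_segment[OF psi_scaled_tendsto[of \<mu>], of m] by (simp add: add.commute)
  have J: "flux (psi (\<mu> / 5 ^ m)) (U (s @ a # replicate n b)) b + flux (psi (\<mu> / 5 ^ m)) (U (s @ b # replicate n a)) a = 0"
    (is "?\<Phi> = 0") if ab: "a \<noteq> b" and m: "length s + Suc n = m" "N \<le> m" for s a b n m
  proof -
    let ?w = "s @ a # replicate n b" and ?v = "s @ b # replicate n a"
    have lw: "length ?w = m" "length ?v = m" using m by auto
    let ?x = "U ?w b"
    have jp: "jpt s a b (n + k) = Fw q ?w (q b)" for k unfolding jpt_def replicate_add by (simp add: Fw_append)
    have js: "jsum u s a b (n + k) = (3/5) ^ k * (sgerm (\<mu> / 5 ^ (m + k)) / sgerm (\<mu> / 5 ^ m) * ?\<Phi>) + psi (\<mu> / 5 ^ (m + k)) * ?x" for k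
    proof -
      have wk: "s @ a # replicate (n + k) b = ?w @ replicate k b" "s @ b # replicate (n + k) a = ?v @ replicate k a"
        by (simp_all add: replicate_add)
      have x1: "U (?w @ replicate k b) b = ?x" unfolding U_def by (simp add: Fw_append)
      have x2: "U (?v @ replicate k a) a = ?x" unfolding U_def using Fw_junction[of s a n b] by (simp add: Fw_append)
      have "jsum u s a b (n + k) = flux (psi (\<mu> / 5 ^ (m + k))) (U (?w @ replicate k b)) b
         + flux (psi (\<mu> / 5 ^ (m + k))) (U (?v @ replicate k a)) a + psi (\<mu> / 5 ^ (m + k)) * ?x"
        unfolding jsum_def jp wk flux_def x1 x2 U_def[symmetric] by (simp add: algebra_simps)
      then show ?thesis
        using fl[of ?w k b] fl[of ?v k a] m unfolding lw by (simp add: algebra_simps)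
    qed
    have L1: "(\<lambda>k. 3/2 * 5 ^ (m + k) * jsum u s a b (n + k)) \<longlonglongrightarrow> \<mu> * ?x"
    proof (rule LIMSEQ_I)
      fix \<epsilon> :: real assume eps: "0 < \<epsilon>"
      have "\<forall>\<^sub>F m in sequentially. \<forall>s a b n. a \<noteq> b \<longrightarrow> length s + Suc n = m \<longrightarrow>
        \<bar>3/2 * 5 ^ m * jsum u s a b n - \<mu> * u (jpt s a b n)\<bar> < \<epsilon>"
        using u unfolding has_laplacian_iff by (elim conjE allE[of _ \<epsilon>] impE[OF _ eps])
      then obtain M where M: "\<And>m s a b n. M \<le> m \<Longrightarrow> a \<noteq> b \<Longrightarrow> length s + Suc n = m \<Longrightarrow>
        \<bar>3/2 * 5 ^ m * jsum u s a b n - \<mu> * u (jpt s a b n)\<bar> < \<epsilon>"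
        unfolding eventually_sequentially by blast
      show "\<exists>M. \<forall>k\<ge>M. norm (3/2 * 5 ^ (m + k) * jsum u s a b (n + k) - \<mu> * ?x) < \<epsilon>"
      proof (intro exI[of _ M] allI impI)
        fix k assume "M \<le> k"
        then show "norm (3/2 * 5 ^ (m + k) * jsum u s a b (n + k) - \<mu> * ?x) < \<epsilon>"
          using M[of "m + k" a b s "n + k"] ab m unfolding jp U_def by simp
      qed
    qed
    \<comment> \<open>The factor (1/3)^k offsets the growth 5^k (3/5)^k = 3^k of the flux term,
      while it sends the bounded remainder to 0.\<close>
    have "(\<lambda>k. (1/3) ^ k * (3/2 * 5 ^ (m + k) * jsum u s a b (n + k) - 3/2 * 5 ^ (m + k) * psi (\<mu> / 5 ^ (m + k)) * ?x)) \<longlonglongrightarrow> 0 * (\<mu> * ?x - \<mu> * ?x)"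
      by (rule tendsto_mult[OF LIMSEQ_power_zero tendsto_diff[OF L1 tendsto_mult_right[OF psc]]]) simp
    moreover have "(1/3) ^ k * (3/2 * 5 ^ (m + k) * jsum u s a b (n + k) - 3/2 * 5 ^ (m + k) * psi (\<mu> / 5 ^ (m + k)) * ?x)
       = 3/2 * 5 ^ m * (sgerm (\<mu> / 5 ^ (m + k)) / sgerm (\<mu> / 5 ^ m) * ?\<Phi>)" for k
    proof -
      have "(1/3) ^ k * 5 ^ k * (3/5) ^ k = (1::real)" by (simp flip: power_mult_distrib)
      then have *: "(1/3) ^ k * (3/2 * (5 ^ m * 5 ^ k) * ((3/5) ^ k * y + p * x) - 3/2 * (5 ^ m * 5 ^ k) * p * x) = 3/2 * 5 ^ m * y" for y p x :: real
        by (simp add: algebra_simps)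
      show ?thesis unfolding js power_add[of 5 m k] by (rule *)
    qed
    ultimately have "(\<lambda>k. 3/2 * 5 ^ m * (sgerm (\<mu> / 5 ^ (m + k)) / sgerm (\<mu> / 5 ^ m) * ?\<Phi>)) \<longlonglongrightarrow> 0" by simp
    moreover have "(\<lambda>k. 3/2 * 5 ^ m * (sgerm (\<mu> / 5 ^ (m + k)) / sgerm (\<mu> / 5 ^ m) * ?\<Phi>)) \<longlonglongrightarrow> 3/2 * 5 ^ m * ((-1/2) / sgerm (\<mu> / 5 ^ m) * ?\<Phi>)"
      by (intro tendsto_mult tendsto_const st m)
    ultimately have "3/2 * 5 ^ m * ((-1/2) / sgerm (\<mu> / 5 ^ m) * ?\<Phi>) = 0" using LIMSEQ_unique by blast
    then show "?\<Phi> = 0" using reg(3)[OF m(2)] by simp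
  qed
  have Bd: "flux (psi (\<mu> / 5 ^ m)) (U (replicate m i)) i = 0" (is "?\<Phi> = 0") if m: "N \<le> m" for m i
  proof -
    have lw: "length (replicate m i) = m" by simp
    have x: "U (replicate k i) i = u (q i)" for k by (simp add: U_def)
    have "(\<lambda>k. (5/3) ^ (k + m) * (2 * u (q i) - u ((F q i ^^ (k + m)) (q (i + 1))) - u ((F q i ^^ (k + m)) (q (i - 1))))) \<longlonglongrightarrow> 0"
      using nd[of i] unfolding has_normal_deriv_def by (rule LIMSEQ_ignore_initial_segment)
    moreover have "(5/3) ^ (k + m) * (2 * u (q i) - u ((F q i ^^ (k + m)) (q (i + 1))) - u ((F q i ^^ (k + m)) (q (i - 1))))
       = - ((5/3) ^ m * (sgerm (\<mu> / 5 ^ (m + k)) / sgerm (\<mu> / 5 ^ m) * ?\<Phi>)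
          + (1/3) ^ m * (1/3) ^ k * (3/2 * 5 ^ (m + k) * psi (\<mu> / 5 ^ (m + k))) * (u (q i) / 3))" for k
    proof -
      have rk: "replicate (k + m) i = replicate m i @ replicate k i" by (simp add: replicate_add[symmetric] add.commute)
      have "2 * u (q i) - u ((F q i ^^ (k + m)) (q (i + 1))) - u ((F q i ^^ (k + m)) (q (i - 1)))
        = - (flux (psi (\<mu> / 5 ^ (m + k))) (U (replicate (k + m) i)) i + psi (\<mu> / 5 ^ (m + k)) / 2 * u (q i))"
        unfolding F_funpow U_def[symmetric] flux_def tot_eq[of _ i] x by (simp add: algebra_simps)
      also have "flux (psi (\<mu> / 5 ^ (m + k))) (U (replicate (k + m) i)) i = (3/5) ^ k * (sgerm (\<mu> / 5 ^ (m + k)) / sgerm (\<mu> / 5 ^ m) * ?\<Phi>)"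
        unfolding rk using fl[of "replicate m i" k i] m unfolding lw by simp
      finally have a: "2 * u (q i) - u ((F q i ^^ (k + m)) (q (i + 1))) - u ((F q i ^^ (k + m)) (q (i - 1)))
        = - ((3/5) ^ k * (sgerm (\<mu> / 5 ^ (m + k)) / sgerm (\<mu> / 5 ^ m) * ?\<Phi>) + psi (\<mu> / 5 ^ (m + k)) / 2 * u (q i))" .
      have "(5/3 :: real) ^ k * (3/5) ^ k = 1" by (simp flip: power_mult_distrib)
      then have *: "(5/3) ^ (k + m) * (- ((3/5) ^ k * y + p / 2 * x)) = - ((5/3) ^ m * y + (1/3) ^ m * (1/3) ^ k * (3/2 * 5 ^ (m + k) * p) * (x / 3))" for y p x :: real
        by (simp add: power_add power_divide field_simps)
      show ?thesis unfolding a by (rule *)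
    qed
    ultimately have "(\<lambda>k. - ((5/3) ^ m * (sgerm (\<mu> / 5 ^ (m + k)) / sgerm (\<mu> / 5 ^ m) * ?\<Phi>)
          + (1/3) ^ m * (1/3) ^ k * (3/2 * 5 ^ (m + k) * psi (\<mu> / 5 ^ (m + k))) * (u (q i) / 3))) \<longlonglongrightarrow> 0" by simp
    moreover have "(\<lambda>k. - ((5/3) ^ m * (sgerm (\<mu> / 5 ^ (m + k)) / sgerm (\<mu> / 5 ^ m) * ?\<Phi>)
          + (1/3) ^ m * (1/3) ^ k * (3/2 * 5 ^ (m + k) * psi (\<mu> / 5 ^ (m + k))) * (u (q i) / 3)))
       \<longlonglongrightarrow> - ((5/3) ^ m * ((-1/2) / sgerm (\<mu> / 5 ^ m) * ?\<Phi>) + (1/3) ^ m * 0 * \<mu> * (u (q i) / 3))"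
      by (intro tendsto_minus tendsto_add tendsto_mult tendsto_const st m psc LIMSEQ_power_zero) auto
    ultimately have "- ((5/3) ^ m * ((-1/2) / sgerm (\<mu> / 5 ^ m) * ?\<Phi>) + (1/3) ^ m * 0 * \<mu> * (u (q i) / 3)) = 0"
      using LIMSEQ_unique by blast
    then show "?\<Phi> = 0" using reg(3)[OF m] by simp
  qed
  show ?thesis
  proof (rule that[of N])
    have "\<bar>\<mu>\<bar> / 5 ^ N \<le> \<eta>" using N[of N] by simp
    then show "\<bar>\<mu>\<bar> / 5 ^ N \<le> 6/5" using \<eta>(2) by (rule order_trans)
    fix m assume "N \<le> m"
    then show "graph_eigen (\<lambda>w i. u (Fw q w (q i))) (psi (\<mu> / 5 ^ m)) m"
      unfolding graph_eigen_def using J Bd unfolding U_def by blast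
  next
    fix w v :: "3 list" and i assume "N \<le> length w"
    from E[OF this, of v] show "u (Fw q (w @ v) (q i)) = E (\<mu> / 5 ^ length w) (\<lambda>i. u (Fw q w (q i))) v i"
      unfolding U_def by (simp add: fun_eq_iff)
  qed
qed

end

section \<open>Descent and ascent between graph levels\<close>

lemma quad_eq:
  fixes a b :: real
  assumes "a * (5 + a) = b * (5 + b)" "0 < 5 + a + b"
  shows "a = b"
proof -
  have "(a - b) * (5 + a + b) = 0" using assms(1) by (simp add: algebra_simps)
  then show ?thesis using assms(2) by simp
qed

text \<open>Corners are x, midpoints y. The midpoints are eliminated without dividing, so that p =
  -2 and p = -5, where \<open>sub\<close> is meaningless, are covered.\<close>

lemma decimation_algebra:
  fixes p x1 x2 x3 y12 y13 y23 :: real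
  assumes e1: "(x1 + y12 + y13) + (x2 + y12 + y23) = (6 + p) * y12"
    and e2: "(x1 + y12 + y13) + (x3 + y13 + y23) = (6 + p) * y13"
    and e3: "(x2 + y12 + y23) + (x3 + y13 + y23) = (6 + p) * y23"
  shows "(6 + p) * (x1 + x2 + x3 - (3 + p * (5 + p) / 2) * x1)
    = (2 + p) * (5 + p) * (x1 + y12 + y13 - (3 + p / 2) * x1)"
proof -
  define S where "S = y12 + y13"
  define t where "t = x2 + x3"
  have a: "(3 + p) * S = 2 * x1 + t + 2 * y23" using e1 e2 by (simp add: S_def t_def algebra_simps)
  have b: "(4 + p) * y23 = t + S" using e3 by (simp add: S_def t_def algebra_simps)
  have "(4 + p) * ((3 + p) * S) = (4 + p) * (2 * x1 + t) + 2 * ((4 + p) * y23)" unfolding a by (simp add: algebra_simps)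
  then have c: "(2 + p) * (5 + p) * S = 2 * (4 + p) * x1 + (6 + p) * t" unfolding b by (simp add: algebra_simps)
  have "(2 + p) * (5 + p) * (x1 + y12 + y13 - (3 + p / 2) * x1) = (2 + p) * (5 + p) * S - (2 + p) * (5 + p) * (2 + p / 2) * x1"
    by (simp add: S_def algebra_simps)
  also have "\<dots> = (6 + p) * (x1 + x2 + x3 - (3 + p * (5 + p) / 2) * x1)"
    unfolding c by (simp add: t_def field_simps)
  finally show ?thesis by simp
qed

text \<open>Adding the equations gives p(6 + p)Q = 0 for the sum Q of the corner values, and
  afterwards (3 + p)(6 + p) x1 = 0. The excluded values correspond to constants (0), the eigenvalue
  5 z0 (-3) and \<open>Lam\<close> (-6).\<close>

lemma level1_algebra:
  fixes p x1 x2 x3 y12 y13 y23 :: real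
  assumes e1: "(x1 + y12 + y13) + (x2 + y12 + y23) = (6 + p) * y12"
    and e2: "(x1 + y12 + y13) + (x3 + y13 + y23) = (6 + p) * y13"
    and e3: "(x2 + y12 + y23) + (x3 + y13 + y23) = (6 + p) * y23"
    and c1: "x1 + y12 + y13 = (3 + p/2) * x1" and c2: "x2 + y12 + y23 = (3 + p/2) * x2"
    and c3: "x3 + y13 + y23 = (3 + p/2) * x3" and p: "p \<noteq> 0" "p \<noteq> -3" "p \<noteq> -6"
  shows "x1 = 0 \<and> y23 = 0"
proof -
  define Q where "Q = x1 + x2 + x3"
  define Y where "Y = y12 + y13 + y23"
  have b: "(5 + p) * y23 = x2 + x3 + Y" using e3 by (simp add: Y_def algebra_simps)
  have a: "(2 + p) * Y = 2 * Q" using e1 e2 e3 by (simp add: Y_def Q_def algebra_simps)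
  have Y: "2 * Y = (2 + p/2) * Q"
  proof -
    have "y12 + y13 = (2 + p/2) * x1" "y12 + y23 = (2 + p/2) * x2" "y13 + y23 = (2 + p/2) * x3"
      using c1 c2 c3 by (simp_all add: algebra_simps)
    moreover have "2 * Y = (y12 + y13) + (y12 + y23) + (y13 + y23)" by (simp add: Y_def)
    ultimately show ?thesis by (simp only: Q_def distrib_left)
  qed
  have "(2 + p) * ((2 + p/2) * Q) = 2 * ((2 + p) * Y)" unfolding Y[symmetric] by simp
  also have "\<dots> = 4 * Q" unfolding a by simp
  finally have "(2 + p) * ((2 + p/2) * Q) = 4 * Q" .
  then have "p * (6 + p) * Q = 0" by (simp add: field_simps)
  then have Q0: "Q = 0" using p by auto
  then have Y0: "Y = 0" using Y by simp
  have "y23 = - (2 + p/2) * x1" using c1 Y0 by (simp add: Y_def algebra_simps)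
  moreover have "(5 + p) * y23 = - x1" using b Y0 Q0 by (simp add: Q_def)
  ultimately have "(5 + p) * (- (2 + p/2) * x1) = - x1" by simp
  then have "(3 + p) * (6 + p) * x1 = 0" by (simp add: field_simps)
  then have "x1 = 0" using p by auto
  then show ?thesis using \<open>y23 = - (2 + p/2) * x1\<close> by simp
qed

context gasket
begin

lemma coherent_fun: "coherent (\<lambda>w i. u (Fw q w (q i)))"
  unfolding coherent_def using Fw_junction by (auto simp: Fw_append)

lemma coherent_last: "coherent U \<Longrightarrow> U (w @ [a]) a = U w a"
  unfolding coherent_def by (metis replicate_0 replicate_Suc)

lemma coherent_mid: "coherent U \<Longrightarrow> U (w @ [a]) b = U (w @ [b]) a"
  unfolding coherent_def by (metis replicate_0)

lemma cell_values:
  fixes U :: "3 list \<Rightarrow> 3 \<Rightarrow> real"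
  assumes U: "coherent U" and d: "distinct [i, j, k]"
  shows "tot (U (w @ [i])) = U w i + U (w @ [i]) j + U (w @ [i]) k"
    "tot (U (w @ [j])) = U w j + U (w @ [i]) j + U (w @ [j]) k"
    "tot (U (w @ [k])) = U w k + U (w @ [i]) k + U (w @ [j]) k"
  using tot_eq'[OF d, where 'a = real] coherent_last[OF U] coherent_mid[OF U, of w j i] coherent_mid[OF U, of w k i] coherent_mid[OF U, of w k j]
  by (simp_all add: ac_simps)

lemma graph_birth: "graph_eigen U p (Suc m) \<Longrightarrow> length w = m \<Longrightarrow> a \<noteq> b \<Longrightarrow> flux p (U (w @ [a])) b + flux p (U (w @ [b])) a = 0"
  unfolding graph_eigen_def by (metis (no_types, lifting) add.right_neutral add_Suc_right replicate_0)

lemma birth_eqs: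
  assumes U: "coherent U" and g: "graph_eigen U p (Suc m)" and w: "length w = m" and d: "distinct [i, j, k]"
  shows "(U w i + U (w @ [i]) j + U (w @ [i]) k) + (U w j + U (w @ [i]) j + U (w @ [j]) k) = (6 + p) * U (w @ [i]) j"
    "(U w i + U (w @ [i]) j + U (w @ [i]) k) + (U w k + U (w @ [i]) k + U (w @ [j]) k) = (6 + p) * U (w @ [i]) k"
    "(U w j + U (w @ [i]) j + U (w @ [j]) k) + (U w k + U (w @ [i]) k + U (w @ [j]) k) = (6 + p) * U (w @ [j]) k"
  using graph_birth[OF g w, of i j] graph_birth[OF g w, of i k] graph_birth[OF g w, of j k] d
    coherent_mid[OF U, of w j i] coherent_mid[OF U, of w k i] coherent_mid[OF U, of w k j]
  unfolding flux_def cell_values[OF U d] by (simp_all add: algebra_simps)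

lemma flux_down:
  assumes U: "coherent U" and g: "graph_eigen U p (Suc m)" and w: "length w = m"
  shows "(6 + p) * flux (p * (5 + p)) (U w) i = (2 + p) * (5 + p) * flux p (U (w @ [i])) i"
proof -
  have d: "distinct [i, i + 1, i - 1]" by simp
  show ?thesis
    using decimation_algebra[OF birth_eqs[OF U g w d]]
    unfolding flux_def cell_values(1)[OF U d] tot_eq[of _ i] coherent_last[OF U] .
qed

text \<open>For p = -6 the identity of \<open>flux_down\<close> says nothing about the coarse level,
  so this value is excluded.\<close>

lemma graph_down:
  assumes U: "coherent U" and g: "graph_eigen U p (Suc m)" and p: "6 + p \<noteq> 0"
  shows "graph_eigen U (p * (5 + p)) m"
  unfolding graph_eigen_def
proof (intro conjI allI impI)
  fix s :: "3 list" and a b :: 3 and n assume ab: "a \<noteq> b" and m: "length s + Suc n = m"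
  let ?w = "s @ a # replicate n b" and ?v = "s @ b # replicate n a"
  have l: "length ?w = m" "length ?v = m" using m by auto
  have r: "?w @ [b] = s @ a # replicate (Suc n) b" "?v @ [a] = s @ b # replicate (Suc n) a"
    by (simp_all add: replicate_append_same)
  have "flux p (U (?w @ [b])) b + flux p (U (?v @ [a])) a = 0"
    unfolding r using g ab m unfolding graph_eigen_def by (metis add_Suc_right)
  moreover have "(6 + p) * (flux (p * (5 + p)) (U ?w) b + flux (p * (5 + p)) (U ?v) a)
      = (2 + p) * (5 + p) * (flux p (U (?w @ [b])) b + flux p (U (?v @ [a])) a)"
    unfolding distrib_left[of "6 + p"] distrib_left[of "(2 + p) * (5 + p)"]
      flux_down[OF U g l(1)] flux_down[OF U g l(2)] ..
  ultimately have "(6 + p) * (flux (p * (5 + p)) (U ?w) b + flux (p * (5 + p)) (U ?v) a) = 0"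
    by simp
  then show "flux (p * (5 + p)) (U ?w) b + flux (p * (5 + p)) (U ?v) a = 0" using p by simp
next
  fix i
  have "flux p (U (replicate m i @ [i])) i = 0"
    using g unfolding graph_eigen_def by (simp add: replicate_append_same)
  then have "(6 + p) * flux (p * (5 + p)) (U (replicate m i)) i = 0"
    using flux_down[OF U g, of "replicate m i" i] by simp
  then show "flux (p * (5 + p)) (U (replicate m i)) i = 0" using p by simp
qed

text \<open>With vanishing corners the midpoints solve a homogeneous linear system with eigenvalues
  5 + p (twice) and 2 + p.\<close>

lemma graph_up_zero:
  assumes U: "coherent U" and g: "graph_eigen U p (Suc m)" and p: "2 + p \<noteq> 0" "5 + p \<noteq> 0"
    and z: "\<And>w i. length w = m \<Longrightarrow> U w i = 0" and w: "length w = Suc m"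
  shows "U w i = 0"
proof -
  obtain v a where v: "w = v @ [a]" "length v = m" using w by (metis length_Suc_conv_rev)
  have "U (v @ [a]) j = 0" if ja: "j \<noteq> a" for j
  proof -
    obtain k where d: "distinct [a, j, k]" using three_third[OF ja] by blast
    let ?y = "U (v @ [a]) j + U (v @ [a]) k + U (v @ [j]) k"
    note e = birth_eqs[OF U g v(2) d]
    have "(6 + p) * ?y = 4 * ?y" unfolding distrib_left using e z[OF v(2)] by simp
    then have "(2 + p) * ?y = 0" by (simp only: distrib_right)
    then have y: "?y = 0" using p by simp
    have "(5 + p) * U (v @ [a]) j = ?y" using e(1) z[OF v(2)] by (simp add: algebra_simps)
    then show ?thesis using y p by simp
  qed
  moreover have "U (v @ [a]) a = 0" using coherent_last[OF U] z[OF v(2)] by simp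
  ultimately show ?thesis using v by (cases "i = a") auto
qed

lemma graph_level1_zero:
  assumes U: "coherent U" and g: "graph_eigen U p 1" and p: "p \<noteq> 0" "p \<noteq> -3" "p \<noteq> -6"
    and w: "length w = 1"
  shows "U w i = 0"
proof -
  have g': "graph_eigen U p (Suc 0)" using g by simp
  have X: "U [a] c = 0" for a c
  proof -
    have *: "U [] i = 0 \<and> U ([] @ [j]) k = 0" if d: "distinct [i, j, k]" for i j k
    proof -
      have "flux p (U ([] @ [l])) l = 0" for l using g unfolding graph_eigen_def by simp
      then have c: "tot (U ([] @ [l])) = (3 + p/2) * U [] l" for l
        unfolding flux_def coherent_last[OF U] by simp
      show ?thesis
        by (rule level1_algebra[OF birth_eqs[OF U g' _ d] c[of i, unfolded cell_values[OF U d]]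
              c[of j, unfolded cell_values[OF U d]] c[of k, unfolded cell_values[OF U d]] p]) simp_all
    qed
    show ?thesis
    proof (cases "a = c")
      case True
      have "distinct [c, c + 1, c - 1]" by simp
      from *[OF this] show ?thesis using True coherent_last[OF U, of "[]" c] by simp
    next
      case False
      then obtain k where "distinct [a, c, k]" using three_third[of c a] by auto
      then have "distinct [k, a, c]" by auto
      from *[OF this] show ?thesis by simp
    qed
  qed
  then show ?thesis using w by (metis One_nat_def length_0_conv length_Suc_conv)
qed

text \<open>For p = -2 the level-one eigenvalue is the exceptional -6, where only the totals of the
  first-level cells are known to vanish. With S a the sum of the midpoint values in cell a, the
  corner condition gives S a = U [a] a, the junctions give 2 U [a] b = U [a] a + U [b] b, and the
  zero totals become a nonsingular system for the three corners.\<close>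

lemma graph_level2_zero:
  assumes U: "coherent U" and g: "graph_eigen U (-2) 2" and w: "length w = 2"
  shows "U w i = 0"
proof -
  have g': "graph_eigen U (-2) (Suc 1)" using g by (simp add: numeral_2_eq_2)
  have t0: "tot (U [a]) = 0" for a
    using flux_down[OF U g', of "[a]" a] by (simp add: flux_def)
  define S where "S a = tot (\<lambda>i. U [a, i] (i + 1))" for a
  have n: "c + 1 + 1 = c - 1" "c + 1 - 1 = c" "c - 1 + 1 = c" "c - 1 - 1 = c + 1" for c :: 3
    using exhaust_3[of c] by auto
  have S: "S a = U [a, i] j + U [a, i] k + U [a, j] k" if d: "distinct [i, j, k]" for a i j k
  proof -
    have c: "U [a, c] d = U [a, d] c" for c d using coherent_mid[OF U, of "[a]" c d] by simp
    have S: "S a = U [a, i] (i + 1) + U [a, i + 1] (i - 1) + U [a, i - 1] i"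
      unfolding S_def tot_eq[of _ i] n ..
    have "j \<noteq> i" using d by auto
    then show ?thesis
    proof (rule three_pair_cases)
      assume j: "j = i + 1"
      then have "k = i - 1" using d three_cases[of k i] by auto
      then show ?thesis using S j c[of "i - 1" i] by simp
    next
      assume j: "j = i - 1"
      then have "k = i + 1" using d three_cases[of k i] by auto
      then show ?thesis using S j c[of "i - 1" i] c[of "i + 1" "i - 1"] by simp
    qed
  qed
  have Y: "3 * U [a, i] j = S a - U [a] k" if d: "distinct [i, j, k]" for a i j k
    using birth_eqs(1)[OF U g', of "[a]" i j k] d t0[of a] tot_eq'[OF d, of "U [a]"] S[OF d, of a] by simp
  have fl: "flux (-2) (U [a, i]) i = 2/3 * (S a - U [a] i)" for a i
  proof -
    have d: "distinct [i, i + 1, i - 1]" and d': "distinct [i, i - 1, i + 1]" by simp_all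
    have "flux (-2) (U [a, i]) i = U [a, i] (i + 1) + U [a, i] (i - 1) - U [a] i"
      using cell_values(1)[OF U d, of "[a]"] coherent_last[OF U, of "[a]" i] by (simp add: flux_def)
    then show ?thesis using Y[OF d, of a] Y[OF d', of a] t0[of a] tot_eq[of "U [a]" i] by simp
  qed
  have Sa: "S a = U [a] a" for a
  proof -
    have "flux (-2) (U (replicate 2 a)) a = 0" using g unfolding graph_eigen_def by blast
    then show ?thesis using fl[of a a] by (simp add: numeral_2_eq_2)
  qed
  have z: "2 * U [a] b = U [a] a + U [b] b" for a b
  proof (cases "a = b")
    case False
    have "flux (-2) (U ([] @ a # replicate 1 b)) b + flux (-2) (U ([] @ b # replicate 1 a)) a = 0"
      using g False unfolding graph_eigen_def by (metis list.size(3) add_0 numeral_2_eq_2 One_nat_def)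
    then have "flux (-2) (U [a, b]) b + flux (-2) (U [b, a]) a = 0" by simp
    then have "2/3 * ((S a - U [a] b) + (S b - U [b] a)) = 0" unfolding fl by (simp only: distrib_left)
    then have "(S a - U [a] b) + (S b - U [b] a) = 0" by simp
    then have "S a + S b = U [a] b + U [b] a" by (simp add: algebra_simps)
    then show ?thesis using Sa coherent_mid[OF U, of "[]" a b] by simp
  qed simp
  have X: "U [a] a = 0" for a
  proof -
    have e: "4 * U [c] c + (U [c + 1] (c + 1) + U [c - 1] (c - 1)) = 0" for c
      using t0[of c] tot_eq[of "U [c]" c] z[of c "c + 1"] z[of c "c - 1"] by simp
    have "distinct [a, a + 1, a - 1]" by simp
    show ?thesis using e[of a] e[of "a + 1"] e[of "a - 1"] unfolding n by linarith
  qed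
  have Z: "U [a] b = 0" for a b using z[of a b] X by simp
  have "U [a, c] d = 0" for a c d
  proof (cases "c = d")
    case True then show ?thesis using coherent_last[OF U, of "[a]" d] Z by simp
  next
    case False
    then obtain k where "distinct [c, d, k]" using three_third[of d c] by auto
    from Y[OF this, of a] show ?thesis using Sa Z by simp
  qed
  then have "U [a, c] i = 0" for a c by blast
  moreover obtain a v where v: "w = a # v" "length v = 1" using w by (cases w) auto
  moreover obtain c where "v = [c]" using v(2) by (cases v) auto
  ultimately show ?thesis by (simp only:)
qed

text \<open>Restricted to a fine level the eigenfunction is a graph eigenfunction; descending by p
  \<mapsto> p(5 + p) to level 1 or 2 shows that it vanishes there, and ascending again that it
  vanishes on the fine level and hence everywhere.\<close>

lemma neumann_eigenvalue_below_Lam: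
  assumes ev: "neumann_eigenvalue q ev" and nz: "ev \<noteq> 0" and less: "ev < Lam"
  shows "ev = 5 * z0"
proof (rule ccontr)
  assume not: "ev \<noteq> 5 * z0"
  define \<mu> where "\<mu> = - ev"
  obtain u where u: "has_laplacian q u (\<lambda>x. \<mu> * u x)" "\<And>i. has_normal_deriv q u i 0" and u0: "\<exists>x\<in>SG q. u x \<noteq> 0"
    using ev unfolding neumann_eigenvalue_def \<mu>_def by auto
  define U where "U = (\<lambda>w i. u (Fw q w (q i)))"
  have U: "coherent U" unfolding U_def by (rule coherent_fun)
  obtain N where N: "\<bar>\<mu>\<bar> / 5 ^ N \<le> 6/5" "\<And>m. N \<le> m \<Longrightarrow> graph_eigen U (psi (\<mu> / 5 ^ m)) m"
    "\<And>w v i. N \<le> length w \<Longrightarrow> U (w @ v) i = E (\<mu> / 5 ^ length w) (U w) v i"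
    using eigen_graph[OF u] unfolding U_def by blast
  define M where "M = max N 3"
  have M: "N \<le> M" "3 \<le> M" by (auto simp: M_def)
  then have M': "2 \<le> M" "1 \<le> M" "(1::nat) \<le> 1" "(1::nat) \<le> 2" by auto
  have small: "\<bar>\<mu> / 5 ^ M\<bar> \<le> 6/5"
  proof -
    have "\<bar>\<mu>\<bar> / 5 ^ M \<le> \<bar>\<mu>\<bar> / 5 ^ N" using M by (intro divide_left_mono) auto
    then have "\<bar>\<mu>\<bar> / 5 ^ M \<le> 6/5" using N(1) by (rule order_trans)
    then show ?thesis by simp
  qed
  have nonzero: False if z: "\<And>w i. length w = M \<Longrightarrow> U w i = 0"
  proof -
    have "u (Fw q w (q i)) = 0" for w i
    proof -
      have "U w i = U (w @ replicate M i) i" using U unfolding coherent_def by simp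
      also have "\<dots> = U (take M (w @ replicate M i) @ drop M (w @ replicate M i)) i" by (simp only: append_take_drop_id)
      also have "\<dots> = 0"
      proof -
        let ?t = "take M (w @ replicate M i)"
        have lt: "length ?t = M" by simp
        have "U ?t = (\<lambda>j. 0 * 0)" using z[OF lt] by (auto simp: fun_eq_iff)
        then show ?thesis using N(3)[of ?t "drop M (w @ replicate M i)" i] M(1) E_cmult[of _ 0 "\<lambda>_. 0 :: real"] unfolding lt by simp
      qed
      finally show ?thesis by (simp add: U_def)
    qed
    then have "u x = 0" if "x \<in> SG q" for x
      using eq_on_SG[of u "\<lambda>_. 0" x] u(1) that by (auto simp: has_laplacian_def)
    then show False using u0 by blast
  qed
  \<comment> \<open>P m is the graph eigenvalue at level m, and m0 the level where vanishing is
    checked by hand: descent needs 6 + P m nonzero, ascent above m0 needs 2 + P m and 5 + P m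
    nonzero.\<close>
  have conclude: "(\<And>w i. length w = M \<Longrightarrow> U w i = 0)" "graph_eigen U (P m) m"
    if P: "P M = psi (\<mu> / 5 ^ M)" "\<And>m. 1 \<le> m \<Longrightarrow> m < M \<Longrightarrow> P m = P (Suc m) * (5 + P (Suc m))"
      "\<And>m. 2 \<le> m \<Longrightarrow> m \<le> M \<Longrightarrow> 6 + P m \<noteq> 0"
      and Q: "m0 \<le> M" "1 \<le> m0" "\<And>w i. length w = m0 \<Longrightarrow> graph_eigen U (P m0) m0 \<Longrightarrow> U w i = 0"
      "\<And>m. m0 < m \<Longrightarrow> m \<le> M \<Longrightarrow> 2 + P m \<noteq> 0 \<and> 5 + P m \<noteq> 0"
      and m: "1 \<le> m" "m \<le> M" for P m0 m
  proof -
    have G: "1 \<le> m \<longrightarrow> graph_eigen U (P m) m" if "m \<le> M" for m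
      using that
    proof (induction rule: inc_induct)
      case base show ?case using N(2)[OF M(1)] P(1) by simp
    next
      case (step m)
      show ?case
      proof
        assume m: "1 \<le> m"
        have "graph_eigen U (P (Suc m) * (5 + P (Suc m))) m"
          by (rule graph_down[OF U]) (use step m P(3)[of "Suc m"] in auto)
        then show "graph_eigen U (P m) m" using P(2)[OF m] step by simp
      qed
    qed
    then show "graph_eigen U (P m) m" using m by blast
    have "\<forall>w i. length w = M \<longrightarrow> U w i = 0" using Q(1)
    proof (induction rule: dec_induct)
      case base show ?case using Q(1-3) G by blast
    next
      case (step m)
      have g: "graph_eigen U (P (Suc m)) (Suc m)" using G[of "Suc m"] step by simp
      have p: "2 + P (Suc m) \<noteq> 0" "5 + P (Suc m) \<noteq> 0" using Q(4)[of "Suc m"] step by auto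
      show ?case using graph_up_zero[OF U g p] step.IH by blast
    qed
    then show "\<And>w i. length w = M \<Longrightarrow> U w i = 0" by blast
  qed
  show False
  proof (cases "\<mu> > 0")
    case True
    let ?x = "\<mu> / 5 ^ M"
    \<comment> \<open>For positive \<mu> all iterates are positive, so no exceptional value can
      occur.\<close>
    define P where "P m = ((\<lambda>x. x * (5 + x)) ^^ (M - m)) (psi ?x)" for m
    have "norm ?x \<le> 6" unfolding real_norm_def by (rule order_trans[OF small]) simp
    then have "norm (hat ?x - 1) \<le> norm ?x / 24" by (rule hat_minus_1)
    also have "\<dots> \<le> (6/5) / 24" unfolding real_norm_def using small by (rule divide_right_mono) simp
    finally have "0 < hat ?x" unfolding real_norm_def by linarith
    moreover have "0 < 2/3 * ?x" using True by simp
    ultimately have "0 < psi ?x" unfolding psi_def by (rule mult_pos_pos[rotated])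
    then have "0 < ((\<lambda>x. x * (5 + x)) ^^ k) (psi ?x)" for k
      by (induction k) (auto intro!: mult_pos_pos add_pos_pos)
    then have pos: "0 < P m" for m by (simp add: P_def)
    have rec: "P m = P (Suc m) * (5 + P (Suc m))" if "m < M" for m
    proof -
      have "M - m = Suc (M - Suc m)" using that by simp
      then show ?thesis by (simp add: P_def)
    qed
    have "U w i = 0" if "length w = M" for w i
    proof (rule conclude(1)[of P 1 1 w i])
      show "U w i = 0" if "length w = 1" "graph_eigen U (P 1) 1" for w i
        by (rule graph_level1_zero[OF U that(2) _ _ _ that(1)]) (use pos[of 1] in auto)
      show "6 + P m \<noteq> 0" for m using pos[of m] by simp
      show "2 + P m \<noteq> 0 \<and> 5 + P m \<noteq> 0" for m using pos[of m] by simp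
    qed (use rec M that in \<open>auto simp: P_def\<close>)
    then show False by (rule nonzero)
  next
    case False
    then have neg: "\<mu> < 0" "- Lam < \<mu>" using nz less by (auto simp: \<mu>_def)
    let ?x = "\<mu> / 25"
    have x: "- z0 < ?x" "?x < 0" using neg by (auto simp: Lam_def)
    have x6: "\<bar>?x\<bar> < 6" using x z0 by auto
    define t where "t = psi ?x"
    \<comment> \<open>Otherwise \<open>psi\<close> would take the value -3 strictly between
      -\<open>z0\<close> and 0, against the uniqueness of that solution.\<close>
    have t3: "-3 < t"
    proof (rule ccontr)
      assume "\<not> -3 < t"
      then have le: "psi ?x \<le> -3" by (simp add: t_def)
      have "continuous_on {?x..0} (psi :: real \<Rightarrow> real)"
        by (rule continuous_on_subset[OF continuous_on_psi]) (use x6 in auto)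
      then obtain y where y: "?x \<le> y" "y \<le> 0" "psi y = -3"
        using IVT'[of psi ?x "-3" 0] le x by auto
      then have "y = - z0" using psi_eq_minus_3[of y] x6 by simp
      then show False using y x by simp
    qed
    have t5: "\<bar>t\<bar> < 5" using norm_psi_lt_5[of ?x] x6 by (simp add: t_def)
    have pm: "\<bar>psi (\<mu> / 5 ^ m)\<bar> \<le> 21/25" if "3 \<le> m" for m
    proof (rule norm_psi_lt_1[of "\<mu> / 5 ^ m", unfolded real_norm_def])
      have "\<bar>\<mu>\<bar> / 5 ^ m \<le> \<bar>\<mu>\<bar> / 5 ^ 3" using that by (intro divide_left_mono power_increasing) auto
      also have "\<dots> \<le> 6/5" using x6 by simp
      finally show "\<bar>\<mu> / 5 ^ m\<bar> \<le> 6/5" by simp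
    qed
    define P where "P m = (if m = 1 then t * (5 + t) else psi (\<mu> / 5 ^ m))" for m :: nat
    have P2: "P 2 = t" by (simp add: P_def t_def)
    have rec: "P m = P (Suc m) * (5 + P (Suc m))" if "1 \<le> m" for m
    proof (cases "m = 1")
      case True then show ?thesis using P2 by (simp add: P_def numeral_2_eq_2)
    next
      case False
      then have m2: "2 \<le> m" using that by simp
      have "\<bar>\<mu>\<bar> / 5 ^ m \<le> \<bar>\<mu>\<bar> / 5 ^ 2" using m2 by (intro divide_left_mono power_increasing) auto
      also have "\<dots> \<le> 6" using x6 by simp
      finally have "\<bar>\<mu> / 5 ^ m\<bar> \<le> 6" by simp
      then show ?thesis using psi_div5[of "\<mu> / 5 ^ m"] m2 unfolding P_def div_pow5_Suc by simp
    qed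
    have P6: "6 + P m \<noteq> 0" if "2 \<le> m" for m
    proof (cases "m = 2")
      case True then show ?thesis using P2 t5 by auto
    next
      case False
      then show ?thesis using pm[of m] that by (auto simp: P_def)
    qed
    have PM: "P M = psi (\<mu> / 5 ^ M)" using M by (simp add: P_def)
    have up: "2 + P m \<noteq> 0 \<and> 5 + P m \<noteq> 0" if "2 < m" for m
      using pm[of m] that by (auto simp: P_def)
    have P1: "P 1 = t * (5 + t)" by (simp add: P_def)
    consider "P 1 = 0" | "P 1 = -3" | "P 1 = -6" | "P 1 \<noteq> 0" "P 1 \<noteq> -3" "P 1 \<noteq> -6" by blast
    then show False
    proof cases
      case 1
      then have "t = 0" using P1 t5 by auto
      moreover have "hat ?x \<noteq> 0" using hat_nonzero[of ?x] x6 by simp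
      ultimately show False using x by (simp add: t_def psi_def)
    next
      case 2
      \<comment> \<open>The parameter \<mu>/25 may lie outside the disc where \<open>psi\<close> is
        known to be injective, so the equation is traced one level lower before \<mu> = -5 z0 is
        concluded.\<close>
      let ?a = "psi (\<mu> / 125)" and ?b = "psi (- z0 / 25)" and ?c = "psi (- z0 / 5)"
      have c: "?c * (5 + ?c) = -3" using psi_div5[of "- z0"] z0 by simp
      have cb: "\<bar>?c\<bar> \<le> 21/25" using norm_psi_lt_1[of "- z0 / 5"] z0 by simp
      have "0 < 5 + t + ?c" using t3 cb by linarith
      with trans[OF P1[symmetric] trans[OF 2 c[symmetric]]] have tc: "t = ?c" by (rule quad_eq)
      have ta: "t = ?a * (5 + ?a)" using psi_div5[of ?x] x6 by (simp add: t_def)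
      have cb': "?c = ?b * (5 + ?b)" using psi_div5[of "- z0 / 5"] z0 by simp
      have ab: "\<bar>?a\<bar> \<le> 21/25" "\<bar>?b\<bar> \<le> 21/25"
        using pm[of 3] norm_psi_lt_1[of "- z0 / 25"] z0 by simp_all
      have "?a * (5 + ?a) = ?b * (5 + ?b)" by (rule trans[OF ta[symmetric] trans[OF tc cb']])
      moreover have "0 < 5 + ?a + ?b" using ab by linarith
      ultimately have "?a = ?b" by (rule quad_eq)
      moreover have "norm (\<mu> / 125) \<le> 6/5" "norm (- z0 / 25) \<le> 6/5" using x6 z0 by simp_all
      ultimately have "\<mu> / 125 = - z0 / 25" using psi_inj by blast
      then show False using not by (simp add: \<mu>_def)
    next
      case 3
      \<comment> \<open>Of the two preimages of -6 only -2 lies above -3; the argument then starts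
        from level 2.\<close>
      then have "(t + 2) * (t + 3) = 0" using P1 by (simp add: algebra_simps)
      then have t2: "t = -2" using t3 by auto
      have "U w i = 0" if "length w = M" for w i
      proof (rule conclude(1)[of P 2 1 w i])
        show "U w i = 0" if "length w = 2" "graph_eigen U (P 2) 2" for w i
          using graph_level2_zero[OF U _ that(1)] that(2) P2 t2 by simp
      qed (use M' rec P6 up PM that in blast)+
      then show False by (rule nonzero)
    next
      case 4
      have "t \<noteq> -2" using 4 P1 by auto
      then have up1: "2 + P m \<noteq> 0 \<and> 5 + P m \<noteq> 0" if "1 < m" for m
        using up[of m] that P2 t5 by (cases "m = 2") auto
      have "U w i = 0" if "length w = M" for w i
      proof (rule conclude(1)[of P 1 1 w i])
        show "U w i = 0" if "length w = 1" "graph_eigen U (P 1) 1" for w i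
          by (rule graph_level1_zero[OF U that(2) 4 that(1)])
      qed (use M' rec P6 up1 PM that in blast)+
      then show False by (rule nonzero)
    qed
  qed
qed

text \<open>A candidate below \<open>Lam\<close> can only be \<open>5 * z0\<close>, with no
  eigenvalue to count below it; a candidate above \<open>Lam\<close> has both \<open>5 * z0\<close>
  and \<open>Lam\<close> below it.\<close>

lemma lambda2_eq: "lambda2 q = Lam"
  unfolding lambda2_def
proof (rule the_equality)
  have s: "{\<nu>. neumann_eigenvalue q \<nu> \<and> \<nu> \<noteq> 0 \<and> \<nu> < Lam} = {5 * z0}"
  proof -
    have "5 * z0 < Lam" using z0(1) unfolding Lam_def by linarith
    moreover have "5 * z0 \<noteq> 0" using z0(1) by linarith
    ultimately have a: "5 * z0 \<in> {\<nu>. neumann_eigenvalue q \<nu> \<and> \<nu> \<noteq> 0 \<and> \<nu> < Lam}"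
      using neumann_5z0 by (intro CollectI conjI)
    have b: "\<nu> = 5 * z0" if "\<nu> \<in> {\<nu>. neumann_eigenvalue q \<nu> \<and> \<nu> \<noteq> 0 \<and> \<nu> < Lam}" for \<nu>
      using that by (elim CollectE conjE) (rule neumann_eigenvalue_below_Lam)
    show ?thesis
    proof (rule equalityI; rule subsetI)
      fix x assume "x \<in> {\<nu>. neumann_eigenvalue q \<nu> \<and> \<nu> \<noteq> 0 \<and> \<nu> < Lam}"
      then show "x \<in> {5 * z0}" unfolding singleton_iff by (rule b)
    next
      fix x assume "x \<in> {5 * z0}"
      then have "x = 5 * z0" by (rule singletonD)
      then show "x \<in> {\<nu>. neumann_eigenvalue q \<nu> \<and> \<nu> \<noteq> 0 \<and> \<nu> < Lam}" using a by (rule ssubst)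
    qed
  qed
  show L: "neumann_eigenvalue q Lam \<and> Lam \<noteq> 0 \<and> card {\<nu>. neumann_eigenvalue q \<nu> \<and> \<nu> \<noteq> 0 \<and> \<nu> < Lam} = 1"
    unfolding s using neumann_Lam Lam_pos by simp
  fix \<mu> assume m: "neumann_eigenvalue q \<mu> \<and> \<mu> \<noteq> 0 \<and> card {\<nu>. neumann_eigenvalue q \<nu> \<and> \<nu> \<noteq> 0 \<and> \<nu> < \<mu>} = 1"
  show "\<mu> = Lam"
  proof (rule ccontr)
    assume "\<mu> \<noteq> Lam"
    then consider "\<mu> < Lam" | "Lam < \<mu>" by linarith
    then show False
    proof cases
      case 1
      then have mu: "\<mu> = 5 * z0" using m neumann_eigenvalue_below_Lam[of \<mu>] by simp
      have "{\<nu>. neumann_eigenvalue q \<nu> \<and> \<nu> \<noteq> 0 \<and> \<nu> < \<mu>} = {}"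
      proof (rule equals0I)
        fix \<nu> assume v: "\<nu> \<in> {\<nu>. neumann_eigenvalue q \<nu> \<and> \<nu> \<noteq> 0 \<and> \<nu> < \<mu>}"
        then have "\<nu> < Lam" using 1 by auto
        then have "\<nu> = 5 * z0" using v neumann_eigenvalue_below_Lam[of \<nu>] by simp
        then show False using v unfolding mu by blast
      qed
      then have "card {\<nu>. neumann_eigenvalue q \<nu> \<and> \<nu> \<noteq> 0 \<and> \<nu> < \<mu>} = 0" by (rule ssubst) (rule card.empty)
      then show False using m by linarith
    next
      case 2
      obtain \<nu> where eq: "{\<nu>. neumann_eigenvalue q \<nu> \<and> \<nu> \<noteq> 0 \<and> \<nu> < \<mu>} = {\<nu>}"
        by (rule card_1_singletonE[OF conjunct2[OF conjunct2[OF m]]])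
      have l: "Lam \<in> {\<nu>. neumann_eigenvalue q \<nu> \<and> \<nu> \<noteq> 0 \<and> \<nu> < \<mu>}" using L 2 by simp
      have f: "5 * z0 \<in> {\<nu>. neumann_eigenvalue q \<nu> \<and> \<nu> \<noteq> 0 \<and> \<nu> < \<mu>}"
      proof -
        have "5 * z0 < \<mu>" using z0(1) 2 unfolding Lam_def by linarith
        moreover have "5 * z0 \<noteq> 0" using z0(1) by linarith
        ultimately show ?thesis using neumann_5z0 by (intro CollectI conjI)
      qed
      have "Lam = 5 * z0"
        by (rule trans[OF singletonD[OF l[unfolded eq]] sym[OF singletonD[OF f[unfolded eq]]]])
      then show False using z0(1) unfolding Lam_def by linarith
    qed
  qed
qed

end

section \<open>Entire analytic functions\<close>

text \<open>The partial sums run over the triangle i + n < J. For each n the missing tail is of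
  order \<rho>^(J - n), and the factor of index n contributes \<rho>^n, with \<rho> = R/r; the total
  error is at most K J \<rho>^J.\<close>

lemma triangle_limit:
  fixes a m p :: "nat \<Rightarrow> real"
  assumes R: "0 < R" "R < r" and C: "0 \<le> C" "0 \<le> D" "0 \<le> B"
    and a: "\<And>j. \<bar>a j\<bar> \<le> C * R ^ j" and m: "\<And>i. \<bar>m i\<bar> \<le> D / r ^ i" and p: "\<And>n. \<bar>p n\<bar> \<le> B / r ^ n"
  shows "summable (\<lambda>i. a (n + i) * m i)" "\<bar>\<Sum>i. a (n + i) * m i\<bar> \<le> C * D / (1 - R / r) * R ^ n"
    "(\<lambda>j. a j * (\<Sum>i=0..j. m i * p (j - i))) sums (\<Sum>n. (\<Sum>i. a (n + i) * m i) * p n)"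
proof -
  define \<rho> where "\<rho> = R / r"
  have \<rho>: "0 < \<rho>" "\<rho> < 1" using R by (auto simp: \<rho>_def)
  have t: "\<bar>a (n + i) * m i\<bar> \<le> C * D * R ^ n * \<rho> ^ i" for n i
  proof -
    have "\<bar>a (n + i) * m i\<bar> \<le> (C * R ^ (n + i)) * (D / r ^ i)"
      unfolding abs_mult using a m C R by (intro mult_mono) auto
    then show ?thesis by (simp add: \<rho>_def power_add power_divide mult_ac)
  qed
  have gs: "summable (\<lambda>i. C * D * R ^ n * \<rho> ^ i)" for n
    using \<rho> by (intro summable_mult summable_geometric) auto
  have sm: "summable (\<lambda>i. a (n + i) * m i)" for n
    by (rule summable_comparison_test[OF _ gs[of n]]) (use t in auto)
  then show "summable (\<lambda>i. a (n + i) * m i)" .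
  have tail: "\<bar>\<Sum>i. a (n + (i + N)) * m (i + N)\<bar> \<le> C * D / (1 - \<rho>) * R ^ n * \<rho> ^ N" for n N
  proof -
    have s: "summable (\<lambda>i. C * D * R ^ n * \<rho> ^ N * \<rho> ^ i)" using \<rho> by (intro summable_mult summable_geometric) auto
    have "norm (a (n + (i + N)) * m (i + N)) \<le> C * D * R ^ n * \<rho> ^ N * \<rho> ^ i" for i
      using t[of n "i + N"] by (simp add: power_add mult_ac)
    then have "norm (\<Sum>i. a (n + (i + N)) * m (i + N)) \<le> (\<Sum>i. C * D * R ^ n * \<rho> ^ N * \<rho> ^ i)"
      by (rule norm_suminf_le[OF _ s])
    also have "\<dots> = C * D * R ^ n * \<rho> ^ N * (1 / (1 - \<rho>))"
      using \<rho> by (subst suminf_mult) (auto simp: suminf_geometric)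
    finally show ?thesis by (simp add: mult_ac)
  qed
  show sb: "\<bar>\<Sum>i. a (n + i) * m i\<bar> \<le> C * D / (1 - R / r) * R ^ n" for n
    using tail[of n 0] by (simp add: \<rho>_def)
  let ?s = "\<lambda>n. \<Sum>i. a (n + i) * m i"
  define K where "K = C * D / (1 - \<rho>) * B"
  have K: "0 \<le> K" using C \<rho> by (simp add: K_def)
  have s1: "summable (\<lambda>n. ?s n * p n)"
  proof (rule summable_comparison_test)
    show "summable (\<lambda>n. K * \<rho> ^ n)" using \<rho> by (intro summable_mult summable_geometric) auto
    have "norm (?s n * p n) \<le> K * \<rho> ^ n" for n
    proof -
      have "norm (?s n * p n) \<le> (C * D / (1 - \<rho>) * R ^ n) * (B / r ^ n)"
        unfolding real_norm_def abs_mult using sb[of n] p[of n] C \<rho> R unfolding \<rho>_def[symmetric] by (intro mult_mono) auto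
      then show ?thesis by (simp add: K_def \<rho>_def power_divide mult_ac)
    qed
    then show "\<exists>N. \<forall>n\<ge>N. norm (?s n * p n) \<le> K * \<rho> ^ n" by blast
  qed
  have part: "(\<Sum>j<J. a j * (\<Sum>i=0..j. m i * p (j - i))) = (\<Sum>n<J. (\<Sum>i<J - n. a (n + i) * m i) * p n)" for J
  proof -
    have "(\<Sum>j<J. a j * (\<Sum>i=0..j. m i * p (j - i))) = (\<Sum>k<J. \<Sum>i\<le>k. a (i + (k - i)) * m i * p (k - i))"
      by (intro sum.cong refl) (auto simp: sum_distrib_left atLeast0AtMost mult_ac intro!: sum.cong)
    also have "\<dots> = (\<Sum>(i, n)\<in>{(i, n). i + n < J}. a (i + n) * m i * p n)"
      by (rule sum.triangle_reindex[symmetric])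
    also have "\<dots> = (\<Sum>(n, i)\<in>(SIGMA n:{..<J}. {..<J - n}). a (n + i) * m i * p n)"
      by (rule sum.reindex_bij_witness[of _ "\<lambda>(n, i). (i, n)" "\<lambda>(i, n). (n, i)"]) (auto simp: add.commute)
    also have "\<dots> = (\<Sum>n<J. \<Sum>i<J - n. a (n + i) * m i * p n)" by (rule sum.Sigma[symmetric]) auto
    finally show ?thesis by (simp add: sum_distrib_right)
  qed
  have "(\<lambda>J. (\<Sum>n<J. ?s n * p n) - (\<Sum>n<J. (\<Sum>i<J - n. a (n + i) * m i) * p n)) \<longlonglongrightarrow> 0"
  proof (rule Lim_null_comparison)
    have "norm ((\<Sum>n<J. ?s n * p n) - (\<Sum>n<J. (\<Sum>i<J - n. a (n + i) * m i) * p n)) \<le> K * (real J * \<rho> ^ J)" for J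
    proof -
      have "(\<Sum>n<J. ?s n * p n) - (\<Sum>n<J. (\<Sum>i<J - n. a (n + i) * m i) * p n)
          = (\<Sum>n<J. (\<Sum>i. a (n + (i + (J - n))) * m (i + (J - n))) * p n)"
        unfolding sum_subtractf[symmetric] left_diff_distrib[symmetric]
        by (intro sum.cong refl arg_cong2[where f = times]) (rule suminf_minus_initial_segment[OF sm, symmetric])
      also have "norm \<dots> \<le> (\<Sum>n<J. K * \<rho> ^ J)"
      proof (rule sum_norm_le)
        fix n assume n: "n \<in> {..<J}"
        have "norm ((\<Sum>i. a (n + (i + (J - n))) * m (i + (J - n))) * p n)
            \<le> (C * D / (1 - \<rho>) * R ^ n * \<rho> ^ (J - n)) * (B / r ^ n)"
          unfolding real_norm_def abs_mult using tail[of n "J - n"] p[of n] C \<rho> R by (intro mult_mono) auto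
        also have "\<dots> = K * (\<rho> ^ n * \<rho> ^ (J - n))" by (simp add: K_def \<rho>_def power_divide mult_ac)
        also have "\<rho> ^ n * \<rho> ^ (J - n) = \<rho> ^ J" using n by (simp flip: power_add)
        finally show "norm ((\<Sum>i. a (n + (i + (J - n))) * m (i + (J - n))) * p n) \<le> K * \<rho> ^ J" .
      qed
      finally show ?thesis by (simp add: mult_ac)
    qed
    then show "\<forall>\<^sub>F J in sequentially. norm ((\<Sum>n<J. ?s n * p n) - (\<Sum>n<J. (\<Sum>i<J - n. a (n + i) * m i) * p n)) \<le> K * (real J * \<rho> ^ J)" by simp
    show "(\<lambda>J. K * (real J * \<rho> ^ J)) \<longlonglongrightarrow> 0"
      using tendsto_mult_right_zero[OF powser_times_n_limit_0[of \<rho>]] \<rho> by simp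
  qed
  from tendsto_diff[OF summable_LIMSEQ[OF s1] this]
  show "(\<lambda>j. a j * (\<Sum>i=0..j. m i * p (j - i))) sums (\<Sum>n. ?s n * p n)"
    unfolding sums_def part by simp
qed

lemma ray_limit:
  fixes \<alpha> :: "nat \<Rightarrow> real"
  assumes "\<And>j. \<bar>\<alpha> j\<bar> \<le> K * \<sigma> ^ j" "0 < \<sigma>" "\<sigma> < 1"
  shows "\<bar>x\<bar> \<le> 1 \<Longrightarrow> summable (\<lambda>j. \<alpha> j * x ^ j)" "(\<lambda>m. \<Sum>j. \<alpha> j * ((1/5) ^ m) ^ j) \<longlonglongrightarrow> \<alpha> 0"
proof -
  have s: "summable (\<lambda>j. \<alpha> j * x ^ j)" if "\<bar>x\<bar> \<le> 1" for x
  proof (rule summable_comparison_test)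
    show "summable (\<lambda>j. K * \<sigma> ^ j)" using assms by (intro summable_mult summable_geometric) auto
    have "norm (\<alpha> j * x ^ j) \<le> K * \<sigma> ^ j" for j
    proof -
      have "\<bar>\<alpha> j\<bar> * \<bar>x\<bar> ^ j \<le> \<bar>\<alpha> j\<bar> * 1" using that by (intro mult_left_mono power_le_one) auto
      then show ?thesis using assms(1)[of j] by (simp add: abs_mult power_abs)
    qed
    then show "\<exists>N. \<forall>j\<ge>N. norm (\<alpha> j * x ^ j) \<le> K * \<sigma> ^ j" by blast
  qed
  then show "\<bar>x\<bar> \<le> 1 \<Longrightarrow> summable (\<lambda>j. \<alpha> j * x ^ j)" .
  have "((\<lambda>x. \<Sum>j. \<alpha> j * x ^ j) \<longlongrightarrow> \<alpha> 0) (at 0)"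
    by (rule powser_limit_0[of 1]) (auto intro!: summable_sums s)
  moreover have "filterlim (\<lambda>m. (1/5::real) ^ m) (at 0) sequentially"
    by (auto simp: filterlim_at intro!: LIMSEQ_power_zero)
  ultimately show "(\<lambda>m. \<Sum>j. \<alpha> j * ((1/5) ^ m) ^ j) \<longlonglongrightarrow> \<alpha> 0"
    by (rule filterlim_compose)
qed

context gasket
begin

section \<open>Recentring, restriction and extension of series\<close>

lemma geo_mono: "geo R a \<Longrightarrow> 0 < R \<Longrightarrow> R \<le> R' \<Longrightarrow> geo R' a"
  unfolding geo_def by (meson mult_left_mono order_trans power_mono less_imp_le)

lemma geo_add: assumes "geo R a" "geo R b" shows "geo R (\<lambda>j. a j + b j)"
proof -
  obtain C D where C: "0 \<le> C" "\<And>j. \<bar>a j\<bar> \<le> C * R ^ j" and D: "0 \<le> D" "\<And>j. \<bar>b j\<bar> \<le> D * R ^ j"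
    using assms by (auto simp: geo_def)
  have "\<bar>a j + b j\<bar> \<le> (C + D) * R ^ j" for j
    unfolding distrib_right by (rule order_trans[OF abs_triangle_ineq add_mono[OF C(2) D(2)]])
  then show ?thesis using C D unfolding geo_def by (intro exI[of _ "C + D"]) auto
qed

lemma geo_weight:
  assumes "geo R a" "0 < R" "\<And>j. \<bar>b j\<bar> \<le> K * t ^ j * \<bar>a j\<bar>" "0 \<le> K" "0 < t"
  shows "geo (t * R) b"
proof -
  obtain C where C: "0 \<le> C" "\<And>j. \<bar>a j\<bar> \<le> C * R ^ j" using assms by (auto simp: geo_def)
  have "\<bar>b j\<bar> \<le> K * C * (t * R) ^ j" for j
  proof -
    have "K * t ^ j * \<bar>a j\<bar> \<le> K * t ^ j * (C * R ^ j)" using assms C by (intro mult_left_mono) auto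
    then show ?thesis using assms(3)[of j] by (simp add: power_mult_distrib mult_ac)
  qed
  then show ?thesis using C assms unfolding geo_def by (intro exI[of _ "K * C"]) auto
qed

lemma mser_add:
  assumes "geo R a" "geo R b" "0 < R" "R < Lam" "k \<in> {1..3}" "x \<in> SG q"
  shows "mser k l (\<lambda>j. a j + b j) x = mser k l a x + mser k l b x"
  using suminf_add[OF mser_summable[OF assms(1,3-6)] mser_summable[OF assms(2,3-6)]]
  by (simp add: mser_def distrib_right)

lemma mser_cmult:
  assumes "geo R a" "0 < R" "R < Lam" "k \<in> {1..3}" "x \<in> SG q"
  shows "mser k l (\<lambda>j. c * a j) x = c * mser k l a x"
  using suminf_mult[OF mser_summable[OF assms], of c] by (simp add: mser_def mult.assoc)

lemma mono_change_centre:
  assumes k: "k \<in> {1..3}" and x: "x \<in> SG q"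
  shows "pmono k l' j x = (\<Sum>k'\<in>{1..3}. \<Sum>i=0..j. Mc k l' l k' i * pmono k' l (j - i) x)"
proof (rule eq_on_SG[OF pmono(2)[OF k] _ _ x])
  show "continuous_on (SG q) (\<lambda>x. \<Sum>k'\<in>{1..3}. \<Sum>i=0..j. Mc k l' l k' i * pmono k' l (j - i) x)"
    by (intro continuous_intros pmono(2))
  show "pmono k l' j (Fw q w (q i)) = (\<Sum>k'\<in>{1..3}. \<Sum>ia=0..j. Mc k l' l k' ia * pmono k' l (j - ia) (Fw q w (q i)))" for w i
    unfolding pmono(3)[OF k] Pc_change_centre[of k l' j w i l] by (intro sum.cong refl) (simp only: pmono(3))
qed

lemma mser_change_centre:
  assumes a: "geo R a" and R: "0 < R" "R < Lam" and k: "k \<in> {1..3}"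
  obtains b where "\<And>k'. k' \<in> {1..3} \<Longrightarrow> geo R (b k')"
    "\<And>x. x \<in> SG q \<Longrightarrow> mser k l' a x = (\<Sum>k'\<in>{1..3}. mser k' l (b k') x)"
proof -
  obtain r C where r: "R < r" "r < Lam" "0 \<le> C" "\<And>j. \<bar>a j\<bar> \<le> C * R ^ j" "summable (\<lambda>j. (R / r) ^ j)"
    using mser_majorant[OF a R] by metis
  have r0: "0 < r" using r R by simp
  obtain B where B: "0 \<le> B" "\<And>k l j x. k \<in> {1..3} \<Longrightarrow> x \<in> SG q \<Longrightarrow> \<bar>pmono k l j x\<bar> \<le> B / r ^ j"
    using mono_bound[OF r0 r(2)] by metis
  \<comment> \<open>The coefficient of the monomial of order n about the new centre collects all
    pairs of orders j = n + i.\<close>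
  define b where "b k' n = (\<Sum>i. a (n + i) * Mc k l' l k' i)" for k' n
  have b: "geo R (b k')" "(\<lambda>j. a j * (\<Sum>i=0..j. Mc k l' l k' i * pmono k' l (j - i) x)) sums mser k' l (b k') x"
    if k': "k' \<in> {1..3}" and x: "x \<in> SG q" for k' x
  proof -
    obtain D where D: "0 \<le> D" "\<And>i. \<bar>Mc k l' l k' i\<bar> \<le> D / r ^ i" using Mc_bound[OF r0 r(2)] by metis
    note T = triangle_limit[OF R(1) r(1,3) D(1) B(1) r(4) D(2) B(2)[OF k' x, of l]]
    have "0 \<le> C * D / (1 - R / r)" using r(1,3) D(1) r0 by simp
    then show "geo R (b k')" unfolding geo_def b_def using T(2) by blast
    show "(\<lambda>j. a j * (\<Sum>i=0..j. Mc k l' l k' i * pmono k' l (j - i) x)) sums mser k' l (b k') x"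
      unfolding mser_def b_def by (rule T(3))
  qed
  show ?thesis
  proof (rule that[of b])
    show "geo R (b k')" if "k' \<in> {1..3}" for k' using b(1)[OF that q_in_SG] .
    fix x assume x: "x \<in> SG q"
    have "(\<lambda>j. \<Sum>k'\<in>{1..3}. a j * (\<Sum>i=0..j. Mc k l' l k' i * pmono k' l (j - i) x)) sums (\<Sum>k'\<in>{1..3}. mser k' l (b k') x)"
      by (intro sums_sum b(2) x)
    moreover have "(\<Sum>k'\<in>{1..3}. a j * (\<Sum>i=0..j. Mc k l' l k' i * pmono k' l (j - i) x)) = a j * pmono k l' j x" for j
      unfolding mono_change_centre[OF k x, of l' j l] sum_distrib_left ..
    ultimately show "mser k l' a x = (\<Sum>k'\<in>{1..3}. mser k' l (b k') x)"
      unfolding mser_def[of k] by (simp add: sums_unique[symmetric])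
  qed
qed

definition ser :: "3 \<Rightarrow> (nat \<Rightarrow> nat \<Rightarrow> real) \<Rightarrow> real^2 \<Rightarrow> real" where
  "ser l c x = (\<Sum>k\<in>{1..3}. mser k l (\<lambda>j. c j k) x)"

definition geo3 :: "real \<Rightarrow> (nat \<Rightarrow> nat \<Rightarrow> real) \<Rightarrow> bool" where
  "geo3 R c \<longleftrightarrow> (\<forall>k\<in>{1..3}. geo R (\<lambda>j. c j k))"

lemma ser_expand: "ser l c x = mser 1 l (\<lambda>j. c j 1) x + mser 2 l (\<lambda>j. c j 2) x + mser 3 l (\<lambda>j. c j 3) x"
  unfolding ser_def atLeastAtMost_1_3 by simp

text \<open>The growth rate is a parameter because restriction and extension change it by powers of
  5; \<open>An_centre\<close> shows that the centre can be prescribed.\<close>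

definition An :: "real \<Rightarrow> (real^2 \<Rightarrow> real) \<Rightarrow> bool" where
  "An R u \<longleftrightarrow> (\<exists>l c. geo3 R c \<and> (\<forall>x\<in>SG q. u x = ser l c x))"

lemma An_centre:
  assumes u: "An R u" and R: "0 < R" "R < Lam"
  obtains c where "geo3 R c" "\<And>x. x \<in> SG q \<Longrightarrow> u x = ser l c x"
proof -
  obtain l' c where c: "geo3 R c" "\<And>x. x \<in> SG q \<Longrightarrow> u x = ser l' c x" using u unfolding An_def by blast
  have i: "1 \<in> {1..3::nat}" "2 \<in> {1..3::nat}" "3 \<in> {1..3::nat}" by auto
  have "\<exists>b. \<forall>k'\<in>{1..3}. geo R (b k') \<and> (\<forall>x\<in>SG q. mser k l' (\<lambda>j. c j k) x = (\<Sum>k'\<in>{1..3}. mser k' l (b k') x))"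
    if k: "k \<in> {1..3}" for k
  proof -
    have "geo R (\<lambda>j. c j k)" using c(1) k by (auto simp: geo3_def)
    then obtain b where "\<And>k'. k' \<in> {1..3} \<Longrightarrow> geo R (b k')"
      "\<And>x. x \<in> SG q \<Longrightarrow> mser k l' (\<lambda>j. c j k) x = (\<Sum>k'\<in>{1..3}. mser k' l (b k') x)"
      by (rule mser_change_centre[OF _ R k, where l' = l' and l = l]) blast
    then show ?thesis by (intro exI[of _ b] ballI conjI)
  qed
  then have "\<exists>b. \<forall>k\<in>{1..3}. \<forall>k'\<in>{1..3}. geo R (b k k') \<and>
      (\<forall>x\<in>SG q. mser k l' (\<lambda>j. c j k) x = (\<Sum>k'\<in>{1..3}. mser k' l (b k k') x))"
    by (intro bchoice ballI)
  then obtain b where b: "\<And>k k'. k \<in> {1..3} \<Longrightarrow> k' \<in> {1..3} \<Longrightarrow> geo R (b k k')"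
    "\<And>k x. k \<in> {1..3} \<Longrightarrow> x \<in> SG q \<Longrightarrow> mser k l' (\<lambda>j. c j k) x = (\<Sum>k'\<in>{1..3}. mser k' l (b k k') x)"
    using i(1) by (elim exE) fast
  define d where "d j k' = b 1 k' j + b 2 k' j + b 3 k' j" for j k'
  have g: "geo R (\<lambda>j. b 1 k' j + b 2 k' j)" if "k' \<in> {1..3}" for k' using b(1) i that by (intro geo_add) auto
  have "geo3 R d" unfolding geo3_def d_def by (intro ballI geo_add b(1) i)
  moreover have "u x = ser l d x" if x: "x \<in> SG q" for x
  proof -
    have "u x = (\<Sum>k'\<in>{1..3}. mser k' l (b 1 k') x) + (\<Sum>k'\<in>{1..3}. mser k' l (b 2 k') x) + (\<Sum>k'\<in>{1..3}. mser k' l (b 3 k') x)"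
      unfolding c(2)[OF x] ser_expand b(2)[OF i(1) x] b(2)[OF i(2) x] b(2)[OF i(3) x] ..
    also have "\<dots> = ser l d x"
      unfolding ser_def sum.distrib[symmetric] d_def
    proof (intro sum.cong refl)
      fix k' :: nat assume k': "k' \<in> {1..3}"
      show "mser k' l (b 1 k') x + mser k' l (b 2 k') x + mser k' l (b 3 k') x = mser k' l (\<lambda>j. b 1 k' j + b 2 k' j + b 3 k' j) x"
        unfolding mser_add[OF g[OF k'] b(1)[OF i(3) k'] R k' x] mser_add[OF b(1)[OF i(1) k'] b(1)[OF i(2) k'] R k' x] ..
    qed
    finally show ?thesis .
  qed
  ultimately show ?thesis using that by blast
qed

lemma mono_F: "k \<in> {1..3} \<Longrightarrow> x \<in> SG q \<Longrightarrow> pmono k l j (F q l x) = kap k * (1/5) ^ j * pmono k l j x"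
proof -
  assume k: "k \<in> {1..3}" and x: "x \<in> SG q"
  have w: "pmono k l j (F q l (Fw q w (q i))) = kap k * (1/5) ^ j * pmono k l j (Fw q w (q i))" for w i
    using pmono(3)[OF k, of l j "l # w" i] pmono(3)[OF k, of l j w i] by (simp add: Pc_scale)
  have c: "continuous_on (SG q) (\<lambda>x. pmono k l j (F q l x))"
    by (rule continuous_on_compose2[OF pmono(2)[OF k] continuous_F]) (auto intro: F_in_SG)
  show ?thesis
    by (rule eq_on_SG[OF c continuous_on_mult[OF continuous_on_const pmono(2)[OF k]] w x])
qed

lemma ser_F:
  assumes x: "x \<in> SG q"
  shows "ser l c (F q l x) = ser l (\<lambda>j k. kap k * (1/5) ^ j * c j k) x"
  unfolding ser_def mser_def
  by (intro sum.cong refl arg_cong[where f = suminf] ext) (simp add: mono_F x)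

lemma kap_pos: "0 < (kap k :: real)" and kap_le: "(kap k :: real) \<le> 1" by (auto simp: kap_def)

lemma geo3_scale: "geo3 R c \<Longrightarrow> 0 < R \<Longrightarrow> geo3 (R / 5) (\<lambda>j k. kap k * (1/5) ^ j * c j k)"
proof -
  assume c: "geo3 R c" and R: "0 < R"
  have "geo (1/5 * R) (\<lambda>j. kap k * (1/5) ^ j * c j k)" if "k \<in> {1..3}" for k
    by (rule geo_weight[of R "\<lambda>j. c j k" _ "kap k"]) (use c R that kap_pos[of k] in \<open>auto simp: geo3_def abs_mult\<close>)
  then show ?thesis by (simp add: geo3_def)
qed

lemma An_F: assumes "An R u" "0 < R" "R < Lam" shows "An (R / 5) (\<lambda>x. u (F q i x))"
proof -
  obtain c where c: "geo3 R c" "\<And>x. x \<in> SG q \<Longrightarrow> u x = ser i c x" using An_centre[OF assms, of i] by blast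
  then have "u (F q i x) = ser i (\<lambda>j k. kap k * (1/5) ^ j * c j k) x" if "x \<in> SG q" for x
    using that F_in_SG ser_F by simp
  then show ?thesis unfolding An_def using geo3_scale[OF c(1) assms(2)] by blast
qed

lemma An_extend_F:
  assumes v: "An (R / 5) v" and R: "0 < R" "R < Lam"
  obtains U where "An R U" "\<And>x. x \<in> SG q \<Longrightarrow> U (F q i x) = v x"
proof -
  have R5: "0 < R / 5" "R / 5 < Lam" using R by auto
  obtain d where d: "geo3 (R/5) d" "\<And>x. x \<in> SG q \<Longrightarrow> v x = ser i d x" using An_centre[OF v R5, of i] by blast
  define c where "c j k = 5 ^ j / kap k * d j k" for j k
  have "geo (5 * (R/5)) (\<lambda>j. c j k)" if "k \<in> {1..3}" for k
    by (rule geo_weight[of "R/5" "\<lambda>j. d j k" _ "1 / kap k"])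
      (use d(1) R that kap_pos[of k] in \<open>auto simp: geo3_def c_def abs_mult\<close>)
  then have "geo3 R c" by (simp add: geo3_def)
  moreover have "ser i c (F q i x) = v x" if "x \<in> SG q" for x
  proof -
    have "kap k * (1/5) ^ j * c j k = d j k" for j k using kap_pos[of k] by (simp add: c_def power_divide)
    then show ?thesis using ser_F[OF that, of i c] d(2)[OF that] by simp
  qed
  ultimately show ?thesis using that[of "ser i c"] unfolding An_def by blast
qed

lemma mser_ray:
  assumes a: "geo R a" and R: "0 < R" "R < Lam" and k: "k \<in> {1..3}"
  shows "mser k l a ((F q l ^^ m) (q i)) = kap k ^ m * (\<Sum>j. (a j * Pc k l j [] i) * ((1/5) ^ m) ^ j)"
    "(\<lambda>m. \<Sum>j. (a j * Pc k l j [] i) * ((1/5) ^ m) ^ j) \<longlonglongrightarrow> a 0 * Pc k l 0 [] i"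
    "\<exists>K \<sigma>. 0 < \<sigma> \<and> \<sigma> < 1 \<and> (\<forall>j. \<bar>a j * Pc k l j [] i\<bar> \<le> K * \<sigma> ^ j)"
proof -
  obtain r C where r: "R < r" "r < Lam" "0 \<le> C" "\<And>j. \<bar>a j\<bar> \<le> C * R ^ j" "summable (\<lambda>j. (R / r) ^ j)"
    using mser_majorant[OF a R] by metis
  have r0: "0 < r" using r R by simp
  obtain M where M: "0 \<le> M" "\<And>k l j w i. k \<in> {1..3} \<Longrightarrow> \<bar>Pc k l j w i\<bar> \<le> M / r ^ j"
    using Pc_bound[OF r0 r(2)] by metis
  have b: "\<bar>a j * Pc k l j [] i\<bar> \<le> C * M * (R / r) ^ j" for j
  proof -
    have "\<bar>a j * Pc k l j [] i\<bar> \<le> (C * R ^ j) * (M / r ^ j)"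
      unfolding abs_mult using r M(1) M(2)[OF k] R by (intro mult_mono) auto
    then show ?thesis by (simp add: power_divide mult_ac)
  qed
  have s: "0 < R / r" "R / r < 1" using R r r0 by auto
  show "(\<lambda>m. \<Sum>j. (a j * Pc k l j [] i) * ((1/5) ^ m) ^ j) \<longlonglongrightarrow> a 0 * Pc k l 0 [] i"
    by (rule ray_limit(2)[OF b s])
  show "\<exists>K \<sigma>. 0 < \<sigma> \<and> \<sigma> < 1 \<and> (\<forall>j. \<bar>a j * Pc k l j [] i\<bar> \<le> K * \<sigma> ^ j)" using b s by blast
  have sm: "summable (\<lambda>j. (a j * Pc k l j [] i) * ((1/5) ^ m) ^ j)"
    by (rule ray_limit(1)[OF b s]) (simp add: power_le_one)
  have eq: "a j * pmono k l j ((F q l ^^ m) (q i)) = kap k ^ m * ((a j * Pc k l j [] i) * ((1/5) ^ m) ^ j)" for j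
    unfolding mono_replicate[OF k] power_mult_distrib by (simp add: power_mult[symmetric] mult_ac)
  show "mser k l a ((F q l ^^ m) (q i)) = kap k ^ m * (\<Sum>j. (a j * Pc k l j [] i) * ((1/5) ^ m) ^ j)"
    unfolding mser_def eq by (rule suminf_mult[OF sm])
qed

text \<open>On the ray into q_l the three series carry the factors 1, (3/5)^m and (1/5)^m. The value
  at q_l gives c 0 1 = 0, the antisymmetric part isolates k = 3, and since c 0 1 = 0 the k = 1 part
  is O(5^-m), negligible against (3/5)^m, so the limit yields c 0 2 = 0.\<close>

lemma ser_zero_0:
  assumes c: "geo3 R c" and R: "0 < R" "R < Lam" and z: "\<And>x. x \<in> SG q \<Longrightarrow> ser l c x = 0" and k: "k \<in> {1..3}"
  shows "c 0 k = 0"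
proof -
  have g: "geo R (\<lambda>j. c j 1)" "geo R (\<lambda>j. c j 2)" "geo R (\<lambda>j. c j 3)" using c by (auto simp: geo3_def)
  have i: "1 \<in> {1..3::nat}" "2 \<in> {1..3::nat}" "3 \<in> {1..3::nat}" by auto
  let ?A = "\<lambda>k i m. \<Sum>j. (c j k * Pc k l j [] i) * ((1/5) ^ m) ^ j"
  note r1 = mser_ray[OF g(1) R i(1), where l = l] and r2 = mser_ray[OF g(2) R i(2), where l = l] and r3 = mser_ray[OF g(3) R i(3), where l = l]
  have Z: "?A 1 i m + (3/5) ^ m * ?A 2 i m + (1/5) ^ m * ?A 3 i m = 0" for i m
    using z[OF funpow_in_SG, of m l i] unfolding ser_expand r1(1) r2(1) r3(1) by (simp add: kap_def)
  have P: "?A 1 (l - 1) m = ?A 1 (l + 1) m" "?A 2 (l - 1) m = ?A 2 (l + 1) m" for m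
    using Pc_vertex_sym[of 1 l] Pc_vertex_sym[of 2 l] by simp_all
  have P3: "?A 3 (l - 1) m = - ?A 3 (l + 1) m" for m
  proof -
    obtain K \<sigma> where "0 < \<sigma>" "\<sigma> < 1" "\<And>j. \<bar>c j 3 * Pc 3 l j [] (l + 1)\<bar> \<le> K * \<sigma> ^ j" using r3(3)[of "l + 1"] by blast
    then have "summable (\<lambda>j. (c j 3 * Pc 3 l j [] (l + 1)) * ((1/5) ^ m) ^ j)"
      by (intro ray_limit(1)) (auto simp: power_le_one)
    then show ?thesis using suminf_minus by (fastforce simp: Pc_vertex_antisym)
  qed
  have "c 0 1 = 0"
  proof -
    have h: "\<And>m. ?A 1 l m = c 0 1 \<and> ?A 2 l m = 0 \<and> ?A 3 l m = 0"
    proof -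
      fix m
      have "(\<lambda>j. (c j 1 * Pc 1 l j [] l) * ((1/5) ^ m) ^ j) = (\<lambda>j. if j = 0 then c 0 1 else 0)"
        by (auto simp: Pc_centre fun_eq_iff)
      moreover have "(\<lambda>j. if j = 0 then c 0 1 else 0) sums c 0 1" using sums_single[of 0 "\<lambda>_. c 0 1"] by simp
      ultimately show "?A 1 l m = c 0 1 \<and> ?A 2 l m = 0 \<and> ?A 3 l m = 0"
        by (simp add: Pc_centre sums_unique[symmetric])
    qed
    then show ?thesis using Z[of l 0] by (simp only: h)
  qed
  moreover have "c 0 3 = 0"
  proof -
    have "(1/5) ^ m * ?A 3 (l + 1) m = 0" for m using Z[of "l + 1" m] Z[of "l - 1" m] unfolding P P3 by simp
    then have "?A 3 (l + 1) m = 0" for m by simp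
    then have "(\<lambda>m. 0) \<longlonglongrightarrow> c 0 3 * Pc 3 l 0 [] (l + 1)" using r3(2)[of "l + 1"] by simp
    then show ?thesis by (simp add: LIMSEQ_const_iff Pc_vertex_0)
  qed
  moreover have "c 0 2 = 0"
  proof -
    \<comment> \<open>The k = 1 series with its vanishing constant term removed and a factor (1/5)^m
      split off.\<close>
    let ?B = "\<lambda>m. \<Sum>j. (c (Suc j) 1 * Pc 1 l (Suc j) [] (l + 1)) * ((1/5) ^ m) ^ j"
    obtain K \<sigma> where K: "0 < \<sigma>" "\<sigma> < 1" "\<And>j. \<bar>c j 1 * Pc 1 l j [] (l + 1)\<bar> \<le> K * \<sigma> ^ j" using r1(3)[of "l + 1"] by blast
    have K': "\<bar>c (Suc j) 1 * Pc 1 l (Suc j) [] (l + 1)\<bar> \<le> (K * \<sigma>) * \<sigma> ^ j" for j using K(3)[of "Suc j"] by (simp add: mult_ac)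
    have s: "summable (\<lambda>j. (c j 1 * Pc 1 l j [] (l + 1)) * ((1/5) ^ m) ^ j)"
      "summable (\<lambda>j. (c (Suc j) 1 * Pc 1 l (Suc j) [] (l + 1)) * ((1/5) ^ m) ^ j)" for m
      by (rule ray_limit(1)[OF K(3) K(1,2)], simp add: power_le_one, rule ray_limit(1)[OF K' K(1,2)], simp add: power_le_one)
    have A1: "?A 1 (l + 1) m = (1/5) ^ m * ?B m" for m
    proof -
      have "?A 1 (l + 1) m = (\<Sum>j. (c (Suc j) 1 * Pc 1 l (Suc j) [] (l + 1)) * ((1/5) ^ m) ^ Suc j)"
        using suminf_split_head[OF s(1)[of m]] \<open>c 0 1 = 0\<close> by simp
      also have "\<dots> = (\<Sum>j. (1/5) ^ m * ((c (Suc j) 1 * Pc 1 l (Suc j) [] (l + 1)) * ((1/5) ^ m) ^ j))"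
        by (simp add: mult_ac)
      also have "\<dots> = (1/5) ^ m * ?B m" by (rule suminf_mult[OF s(2)])
      finally show ?thesis .
    qed
    have e: "?A 2 (l + 1) m = - ((1/3) ^ m * ?B m)" for m
    proof -
      have "(1/5) ^ m * ?B m + (3/5) ^ m * ?A 2 (l + 1) m = 0"
        using Z[of "l + 1" m] Z[of "l - 1" m] unfolding P P3 A1[symmetric] by simp
      moreover have "(1/5 :: real) ^ m = (3/5) ^ m * (1/3) ^ m" by (simp flip: power_mult_distrib)
      ultimately have "(3/5) ^ m * ((1/3) ^ m * ?B m + ?A 2 (l + 1) m) = 0" by (simp only: distrib_left mult.assoc)
      then show ?thesis by (simp add: add_eq_0_iff)
    qed
    have "(\<lambda>m. - ((1/3) ^ m * ?B m)) \<longlonglongrightarrow> - (0 * (c (Suc 0) 1 * Pc 1 l (Suc 0) [] (l + 1)))"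
      by (intro tendsto_intros LIMSEQ_power_zero ray_limit(2)[OF K' K(1,2)]) auto
    then have "?A 2 (l + 1) \<longlonglongrightarrow> 0" unfolding e[symmetric] by simp
    then have "c 0 2 * Pc 2 l 0 [] (l + 1) = 0" using r2(2)[of "l + 1"] LIMSEQ_unique by blast
    then show ?thesis by (simp add: Pc_vertex_0)
  qed
  ultimately show ?thesis using k unfolding atLeastAtMost_1_3 by auto
qed

lemma ser_laplacian:
  assumes c: "geo3 R c" and R: "0 < R" "R < Lam"
  shows "has_laplacian q (ser l c) (ser l (\<lambda>j. c (Suc j)))"
proof -
  have g: "geo R (\<lambda>j. c j 1)" "geo R (\<lambda>j. c j 2)" "geo R (\<lambda>j. c j 3)" using c by (auto simp: geo3_def)
  show ?thesis unfolding ser_expand[abs_def]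
    by (intro has_laplacian_add mser_laplacian[OF _ R] g) auto
qed

text \<open>The Laplacian of a vanishing series is zero and is the series with shifted coefficients,
  so the order-zero case propagates to every j.\<close>

lemma ser_zero:
  assumes R: "0 < R" "R < Lam"
  shows "geo3 R c \<Longrightarrow> (\<And>x. x \<in> SG q \<Longrightarrow> ser l c x = 0) \<Longrightarrow> k \<in> {1..3} \<Longrightarrow> c j k = 0"
proof (induction j arbitrary: c)
  case 0
  then show ?case using ser_zero_0[OF 0(1) R] by blast
next
  case (Suc j)
  have g: "geo3 R (\<lambda>j. c (Suc j))" using Suc.prems(1) geo_Suc by (auto simp: geo3_def)
  have L: "has_laplacian q (ser l c) (ser l (\<lambda>j. c (Suc j)))" by (rule ser_laplacian[OF Suc.prems(1) R])
  have "has_laplacian q (ser l c) (\<lambda>_. 0)"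
    by (rule has_laplacian_cong[OF has_laplacian_cmult[OF L, of 0]]) (auto simp: Suc.prems(2))
  then have "ser l (\<lambda>j. c (Suc j)) x = 0" if "x \<in> SG q" for x
    using has_laplacian_unique[OF L _ that] by blast
  from Suc.IH[OF g this Suc.prems(3)] show ?case .
qed

lemma An_zero_F:
  assumes u: "An R u" and R: "0 < R" "R < Lam" and z: "\<And>x. x \<in> SG q \<Longrightarrow> u (F q i x) = 0" and x: "x \<in> SG q"
  shows "u x = 0"
proof -
  obtain c where c: "geo3 R c" "\<And>x. x \<in> SG q \<Longrightarrow> u x = ser i c x" using An_centre[OF u R, of i] by blast
  have R5: "0 < R / 5" "R / 5 < Lam" using R by auto
  have "ser i (\<lambda>j k. kap k * (1/5) ^ j * c j k) x = 0" if "x \<in> SG q" for x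
    using z[OF that] c(2)[OF F_in_SG[OF that]] ser_F[OF that] by simp
  from ser_zero[OF R5 geo3_scale[OF c(1) R(1)] this]
  have "kap k * (1/5) ^ j * c j k = 0" if "k \<in> {1..3}" for j k using that by blast
  then have "c j k = 0" if "k \<in> {1..3}" for j k using kap_pos[of k] that by (metis mult_eq_0_iff less_irrefl power_not_zero zero_neq_one divide_eq_0_iff zero_neq_numeral)
  then have "ser i c x = 0" by (simp add: ser_def mser_def)
  then show ?thesis using c(2)[OF x] by simp
qed

lemma div_5_power_bounds: "0 < R \<Longrightarrow> R < Lam \<Longrightarrow> 0 < R / 5 ^ m \<and> R / 5 ^ m < Lam"
proof -
  assume R: "0 < R" "R < Lam"
  have "R / 5 ^ m \<le> R / 1" using R by (intro divide_left_mono) auto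
  then show ?thesis using R by simp
qed

lemma An_Fw: "An R u \<Longrightarrow> 0 < R \<Longrightarrow> R < Lam \<Longrightarrow> An (R / 5 ^ length w) (\<lambda>x. u (Fw q w x))"
proof (induction w arbitrary: R u)
  case (Cons i w)
  have "An (R / 5) (\<lambda>x. u (F q i x))" by (rule An_F[OF Cons.prems])
  from Cons.IH[OF this] Cons.prems show ?case by (simp add: o_def)
qed simp

lemma An_extend_Fw:
  "An (R / 5 ^ length w) v \<Longrightarrow> 0 < R \<Longrightarrow> R < Lam \<Longrightarrow> \<exists>U. An R U \<and> (\<forall>x\<in>SG q. U (Fw q w x) = v x)"
proof (induction w arbitrary: R v)
  case (Cons i w)
  have "An ((R / 5) / 5 ^ length w) v" using Cons.prems by simp
  from Cons.IH[OF this] Cons.prems obtain U' where U': "An (R / 5) U'" "\<forall>x\<in>SG q. U' (Fw q w x) = v x" by auto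
  obtain U where U: "An R U" "\<And>x. x \<in> SG q \<Longrightarrow> U (F q i x) = U' x"
    using An_extend_F[OF U'(1) Cons.prems(2,3), of i] by blast
  then show ?case using U' Fw_in_SG by (intro exI[of _ U]) auto
qed auto

lemma An_zero_Fw:
  "An R u \<Longrightarrow> 0 < R \<Longrightarrow> R < Lam \<Longrightarrow> (\<And>x. x \<in> SG q \<Longrightarrow> u (Fw q w x) = 0) \<Longrightarrow> x \<in> SG q \<Longrightarrow> u x = 0"
proof (induction w arbitrary: R u x)
  case (Cons i w)
  have A: "An (R / 5) (\<lambda>x. u (F q i x))" by (rule An_F[OF Cons.prems(1-3)])
  have "u (F q i x) = 0" if "x \<in> SG q" for x
    by (rule Cons.IH[OF A]) (use Cons.prems that in auto)
  then show ?case using An_zero_F[OF Cons.prems(1-3)] Cons.prems(5) by blast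
qed auto

lemma An_diff:
  assumes "An R u" "An R v" "0 < R" "R < Lam" shows "An R (\<lambda>x. u x - v x)"
proof -
  obtain c d where c: "geo3 R c" "\<And>x. x \<in> SG q \<Longrightarrow> u x = ser 0 c x" and d: "geo3 R d" "\<And>x. x \<in> SG q \<Longrightarrow> v x = ser 0 d x"
    using An_centre[OF assms(1,3,4), of 0] An_centre[OF assms(2,3,4), of 0] by metis
  define e where "e j k = c j k + (-1) * d j k" for j k
  have g: "geo R (\<lambda>j. c j k)" "geo R (\<lambda>j. d j k)" "geo R (\<lambda>j. (-1) * d j k)" if "k \<in> {1..3}" for k
    using c d that by (auto simp: geo3_def geo_def)
  have "geo3 R e" unfolding geo3_def e_def using g by (intro ballI geo_add) auto
  moreover have "u x - v x = ser 0 e x" if x: "x \<in> SG q" for x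
    unfolding c(2)[OF x] d(2)[OF x] ser_def sum_subtractf[symmetric] e_def
  proof (intro sum.cong refl)
    fix k :: nat assume k: "k \<in> {1..3}"
    show "mser k 0 (\<lambda>j. c j k) x - mser k 0 (\<lambda>j. d j k) x = mser k 0 (\<lambda>j. c j k + (-1) * d j k) x"
      unfolding mser_add[OF g(1)[OF k] g(3)[OF k] assms(3,4) k x] mser_cmult[OF g(2)[OF k] assms(3,4) k x] by simp
  qed
  ultimately show ?thesis unfolding An_def by blast
qed

lemma An_mono: "An R u \<Longrightarrow> 0 < R \<Longrightarrow> R \<le> R' \<Longrightarrow> An R' u"
  unfolding An_def geo3_def using geo_mono by blast

lemma An_cong: "An R u \<Longrightarrow> (\<And>x. x \<in> SG q \<Longrightarrow> u x = v x) \<Longrightarrow> An R v"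
  unfolding An_def by auto

section \<open>Translation to entire functions and local expansions\<close>

lemma coeff_growth_iff: "coeff_growth q c \<longleftrightarrow> (\<exists>R. 0 < R \<and> R < Lam \<and> geo3 R c)"
  unfolding coeff_growth_def lambda2_eq geo3_def using geo_cong_bigo by blast

lemma entire_iff: "entire_analytic q u \<longleftrightarrow> (\<exists>R. 0 < R \<and> R < Lam \<and> An R u)"
proof
  assume "entire_analytic q u"
  then obtain l c where c: "coeff_growth q c" "\<And>x. x \<in> SG q \<Longrightarrow> u x = (\<Sum>k=1..3. \<Sum>j. c j k * monomial q l j k x)"
    unfolding entire_analytic_def by blast
  have "u x = ser l c x" if "x \<in> SG q" for x
    unfolding c(2)[OF that] ser_def mser_def by (intro sum.cong refl) (simp add: monomial_eq)
  then show "\<exists>R. 0 < R \<and> R < Lam \<and> An R u" using c(1) unfolding coeff_growth_iff An_def by blast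
next
  assume "\<exists>R. 0 < R \<and> R < Lam \<and> An R u"
  then obtain R l c where R: "0 < R" "R < Lam" and c: "geo3 R c" "\<And>x. x \<in> SG q \<Longrightarrow> u x = ser l c x"
    unfolding An_def by blast
  have "summable (\<lambda>j. c j k * monomial q l j k x)" if "x \<in> SG q" "k \<in> {1..3}" for x k
    unfolding monomial_eq[OF that(2)] by (rule mser_summable[OF _ R that(2,1)]) (use c that in \<open>auto simp: geo3_def\<close>)
  moreover have "u x = (\<Sum>k=1..3. \<Sum>j. c j k * monomial q l j k x)" if "x \<in> SG q" for x
    unfolding c(2)[OF that] ser_def mser_def by (intro sum.cong refl) (simp add: monomial_eq)
  moreover have "coeff_growth q c" unfolding coeff_growth_iff using R c(1) by blast
  ultimately show "entire_analytic q u" unfolding entire_analytic_def by blast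
qed

text \<open>A common form of the three factors in the local expansion; multiplying coefficients of
  rate R by them gives the coefficients of u after composition with F_w, of rate R / 5^m.\<close>

definition wt :: "nat \<Rightarrow> nat \<Rightarrow> nat \<Rightarrow> real" where "wt m j k = (kap k * (1/5) ^ j) ^ m"

lemma wt_pos: "0 < wt m j k" using kap_pos[of k] by (simp add: wt_def)

lemma geo3_wt: "geo3 R c \<Longrightarrow> 0 < R \<Longrightarrow> geo3 (R / 5 ^ m) (\<lambda>j k. wt m j k * c j k)"
proof -
  assume c: "geo3 R c" and R: "0 < R"
  have w: "wt m j k = kap k ^ m * (1 / 5 ^ m) ^ j" for j k
    unfolding wt_def power_mult_distrib by (simp add: power_divide power_mult[symmetric] mult.commute)
  have "geo (1 / 5 ^ m * R) (\<lambda>j. wt m j k * c j k)" if "k \<in> {1..3}" for k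
    by (rule geo_weight[of R "\<lambda>j. c j k" _ "kap k ^ m"])
      (use c R that kap_pos[of k] in \<open>auto simp: geo3_def abs_mult w\<close>)
  then show ?thesis by (simp add: geo3_def)
qed

lemma geo3_wt_inv: "geo3 (R / 5 ^ m) d \<Longrightarrow> 0 < R \<Longrightarrow> geo3 R (\<lambda>j k. d j k / wt m j k)"
proof -
  assume c: "geo3 (R / 5 ^ m) d" and R: "0 < R"
  have w: "wt m j k = kap k ^ m * (1 / 5 ^ m) ^ j" for j k
    unfolding wt_def power_mult_distrib by (simp add: power_divide power_mult[symmetric] mult.commute)
  have "geo (5 ^ m * (R / 5 ^ m)) (\<lambda>j. d j k / wt m j k)" if "k \<in> {1..3}" for k
    by (rule geo_weight[of "R / 5 ^ m" "\<lambda>j. d j k" _ "1 / kap k ^ m"])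
      (use c R that kap_pos[of k] in \<open>auto simp: geo3_def abs_mult w power_divide mult.commute\<close>)
  then show ?thesis by (simp add: geo3_def)
qed

lemma inv_Fw: "inv (Fw q w) (Fw q w y) = y"
  by (rule inv_f_f) (auto simp: inj_on_def Fw_inj)

lemma local_expansion_iff:
  assumes c: "geo3 R c" and R: "0 < R" "R < Lam"
  shows "local_expansion q w l c u \<longleftrightarrow> (\<forall>y\<in>SG q. u (Fw q w y) = ser l (\<lambda>j k. wt (length w) j k * c j k) y)"
proof -
  let ?m = "length w"
  let ?d = "\<lambda>j k. wt ?m j k * c j k"
  have i: "1 \<in> {1..3::nat}" "2 \<in> {1..3::nat}" "3 \<in> {1..3::nat}" by auto
  have R': "0 < R / 5 ^ ?m" "R / 5 ^ ?m < Lam" using div_5_power_bounds[OF R] by auto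
  have t: "(1/5)^(?m * j) * c j 1 * monomial q l j 1 (inv (Fw q w) (Fw q w y))
          + (3/5 * (1/5)^j)^?m * c j 2 * monomial q l j 2 (inv (Fw q w) (Fw q w y))
          + (1/5)^((j + 1) * ?m) * c j 3 * monomial q l j 3 (inv (Fw q w) (Fw q w y))
     = (\<Sum>k\<in>{1..3}. ?d j k * pmono k l j y)" for j y
  proof -
    have "(1/5 :: real)^(?m * j) = wt ?m j 1" by (simp add: wt_def kap_def power_mult[symmetric] mult.commute)
    moreover have "(3/5 * (1/5 :: real)^j)^?m = wt ?m j 2" by (simp add: wt_def kap_def)
    moreover have "(1/5 :: real)^((j + 1) * ?m) = wt ?m j 3" unfolding wt_def kap_def power_mult by simp
    ultimately show ?thesis unfolding inv_Fw monomial_eq[OF i(1)] monomial_eq[OF i(2)] monomial_eq[OF i(3)] atLeastAtMost_1_3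
      by simp
  qed
  have s: "(\<lambda>j. \<Sum>k\<in>{1..3}. ?d j k * pmono k l j y) sums ser l ?d y" if y: "y \<in> SG q" for y
    unfolding ser_def mser_def
    by (intro sums_sum summable_sums mser_summable[OF _ R' _ y]) (use geo3_wt[OF c R(1), of ?m] in \<open>auto simp: geo3_def\<close>)
  have "local_expansion q w l c u \<longleftrightarrow> (\<forall>y\<in>SG q. (\<lambda>j. \<Sum>k\<in>{1..3}. ?d j k * pmono k l j y) sums u (Fw q w y))"
    unfolding local_expansion_def Let_def cell_def ball_simps t ..
  also have "\<dots> \<longleftrightarrow> (\<forall>y\<in>SG q. u (Fw q w y) = ser l ?d y)"
    by (intro ball_cong refl) (auto dest: sums_unique2[OF s] s)
  finally show ?thesis .
qed

lemma entire_imp_local_expansion: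
  assumes "entire_analytic q u"
  shows "\<exists>c. local_expansion q w l c u \<and> coeff_growth q c"
proof -
  obtain R where R: "0 < R" "R < Lam" and u: "An R u" using assms entire_iff by blast
  let ?m = "length w"
  have R': "0 < R / 5 ^ ?m" "R / 5 ^ ?m < Lam" using div_5_power_bounds[OF R] by auto
  obtain d where d: "geo3 (R / 5 ^ ?m) d" "\<And>y. y \<in> SG q \<Longrightarrow> u (Fw q w y) = ser l d y"
    using An_centre[OF An_Fw[OF u R, of w] R', of l] by blast
  \<comment> \<open>Restriction to the cell has divided the rate by 5^m; dividing by the weights
    restores R.\<close>
  let ?c = "\<lambda>j k. d j k / wt ?m j k"
  have c: "geo3 R ?c" by (rule geo3_wt_inv[OF d(1) R(1)])
  have "wt ?m j k * ?c j k = d j k" for j k using wt_pos[of ?m j k] by simp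
  then have "local_expansion q w l ?c u" unfolding local_expansion_iff[OF c R] using d(2) by simp
  then show ?thesis unfolding coeff_growth_iff using c R by blast
qed

lemma local_expansion_extends:
  assumes "local_expansion q w l c u" "coeff_growth q c"
  shows "\<exists>!U. U \<in> extensional (SG q) \<and> entire_analytic q U \<and> (\<forall>x\<in>cell q w. U x = u x)"
proof -
  obtain R where R: "0 < R" "R < Lam" and c: "geo3 R c" using assms(2) coeff_growth_iff by blast
  have e: "u (Fw q w y) = ser l (\<lambda>j k. wt (length w) j k * c j k) y" if "y \<in> SG q" for y
    using assms(1) that unfolding local_expansion_iff[OF c R] by blast
  have "An (R / 5 ^ length w) (\<lambda>y. u (Fw q w y))"
    unfolding An_def using geo3_wt[OF c R(1)] e by blast
  from An_extend_Fw[OF this R] obtain U where U: "An R U" "\<forall>x\<in>SG q. U (Fw q w x) = u (Fw q w x)" by blast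
  show ?thesis
  proof (rule ex_ex1I)
    let ?U = "restrict U (SG q)"
    have "An R ?U" by (rule An_cong[OF U(1)]) simp
    then have "entire_analytic q ?U" unfolding entire_iff using R by blast
    moreover have "\<forall>x\<in>cell q w. ?U x = u x" using U(2) Fw_in_SG by (auto simp: cell_def)
    ultimately show "\<exists>U. U \<in> extensional (SG q) \<and> entire_analytic q U \<and> (\<forall>x\<in>cell q w. U x = u x)"
      by (intro exI[of _ ?U]) auto
  next
    fix U1 U2
    assume 1: "U1 \<in> extensional (SG q) \<and> entire_analytic q U1 \<and> (\<forall>x\<in>cell q w. U1 x = u x)"
      and 2: "U2 \<in> extensional (SG q) \<and> entire_analytic q U2 \<and> (\<forall>x\<in>cell q w. U2 x = u x)"
    obtain R1 R2 where R1: "0 < R1" "R1 < Lam" "An R1 U1" and R2: "0 < R2" "R2 < Lam" "An R2 U2"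
      using 1 2 entire_iff by blast
    \<comment> \<open>The two extensions may have different rates; the larger one serves both, so
      that their difference is again a series.\<close>
    let ?R = "max R1 R2"
    have R: "0 < ?R" "?R < Lam" using R1 R2 by auto
    have "An ?R (\<lambda>x. U1 x - U2 x)"
      by (intro An_diff R An_mono[OF R1(3,1)] An_mono[OF R2(3,1)]) auto
    from An_zero_Fw[OF this R, of w] have "U1 x - U2 x = 0" if "x \<in> SG q" for x
      using 1 2 that by (auto simp: cell_def)
    then show "U1 = U2" using 1 2 by (intro extensionalityI[of U1 "SG q" U2]) auto
  qed
qed

end

theorem theorem3p6:
  fixes q :: "3 \<Rightarrow> real^2"
  assumes "equilateral q"
  shows "(\<forall>u. entire_analytic q u \<longrightarrow>
            (\<forall>w l. \<exists>c. local_expansion q w l c u \<and> coeff_growth q c)) \<and>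
         (\<forall>w l c u. local_expansion q w l c u \<and> coeff_growth q c \<longrightarrow>
            (\<exists>!U. U \<in> extensional (SG q) \<and> entire_analytic q U \<and> (\<forall>x\<in>cell q w. U x = u x)))"
proof -
  interpret gasket q using assms by unfold_locales
  show ?thesis
    by (intro conjI allI impI; (elim conjE)?; rule entire_imp_local_expansion local_expansion_extends; assumption)
qed

end
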